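(* For every non-trivial $C=\sum_{\vec n\in\mathbb N_0^s}\beta_{\vec n}C_{\vec n}\in\mathcal C$ and every $(\omega,z)\in J(\tilde f)$, $$\mathrm{H\ddot ol}(C,z)=\liminf_{k\to\infty}\frac{S_k\tilde\psi(\omega,z)}{S_k\tilde\varphi(\omega,z)}.$$
   Context: Standing setup. $\hat{\mathbb C}$ is the Riemann sphere with spherical distance $d$; for a rational map $g$, $\|g'(z)\|$ is the norm of the derivative with respect to the spherical metric. For a semigroup $H$ of non-constant rational maps (under composition), $F(H)$ is the set of points having a neighbourhood on which $H$ is equicontinuous with respect to $d$, and $J(H)=\hat{\mathbb C}\setminus F(H)$. Let $s\ge1$, $I=\{1,\dots,s+1\}$, and $f_1,\dots,f_{s+1}$ rational maps with $\deg f_i\ge2$; $G=\langle f_1,\dots,f_{s+1}\rangle=\{f_{\omega_n}\circ\cdots\circ f_{\omega_1}:n\ge1,\omega_j\in I\}$. $P(G)$ is the closure of $\bigcup_{g\in G\cup\{\mathrm{id}\}}g(\{\text{critical values of the }f_i\})$. A minimal set of $G$ is a non-empty compact $K\subset\hat{\mathbb C}$ with $K=\overline{\{g(z):g\in G\}}$ for every $z\in K$. Assume (A1) $P(G)\subset F(G)$; (A2) $f_i^{-1}(J(G))\cap f_j^{-1}(J(G))=\emptyset$ for $i\ne j$; (A3) $G$ has at least two minimal sets. Fix a minimal set $L$ of $G$. Let $\vec p=(p_1,\dots,p_s)\in(0,1)^s$ with $\sum_{i\le s}p_i<1$ and $p_{s+1}=1-\sum_{i\le s}p_i$. For $\vec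 x\in(0,1)^s$ with $\sum x_i<1$ put $x_{s+1}=1-\sum_{i\le s}x_i$ and let $T_{\vec x}(z)$ be the measure, for the product measure $\bigotimes_{n\ge1}\sum_{i\in I}x_i\delta_i$ on $I^{\mathbb N}$, of the set of $\omega$ with $d(f_{\omega_n}\circ\cdots\circ f_{\omega_1}(z),L)\to0$. It is known that for some $a\in(0,1)$ the map $\vec x\mapsto T_{\vec x}\in C^a(\hat{\mathbb C})$ is real-analytic near $\vec p$; for $\vec n=(n_1,\dots,n_s)\in\mathbb N_0^s$ set $C_{\vec n}(z)=\frac{\partial^{|\vec n|}T_{\vec x}(z)}{\partial x_1^{n_1}\cdots\partial x_s^{n_s}}\big|_{\vec x=\vec p}$, $|\vec n|=\sum n_i$ (so $C_{\vec 0}=T_{\vec p}$). $\mathcal C$ is the set of finite complex linear combinations $C=\sum\beta_{\vec n}C_{\vec n}$; $C$ is called non-trivial if some $\beta_{\vec n}\ne0$. For a function $C$ on $\hat{\mathbb C}$, $\mathrm{H\ddot ol}(C,z)=\sup\{\alpha\ge0:\limsup_{y\to z,y\ne z}|C(y)-C(z)|/d(y,z)^\alpha<\infty\}$. Let $\sigma$ be the left shift on $I^{\mathbb N}$ and $\tilde f(\omega,z)=(\sigma\omega,f_{\omega_1}(z))$ on $I^{\mathbb N}\times\hat{\mathbb C}$. For $\omega\in I^{\mathbb N}$, $f_{\omega|_n}=f_{\omega_n}\circ\cdots\circ f_{\omega_1}$, $F_\omega$ is the set of points with a neighbourhood on which $\{f_{\omega|_n}\}_n$ is equicontinuous, $J_\omega=\hat{\mathbb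 C}\setminus F_\omega$, and $J(\tilde f)=\overline{\bigcup_\omega\{\omega\}\times J_\omega}$. Define $\tilde\varphi(\omega,z)=-\log\|f_{\omega_1}'(z)\|$, $\tilde\psi(\omega,z)=\log p_{\omega_1}$ on $J(\tilde f)$, and $S_k u=\sum_{j=0}^{k-1}u\circ\tilde f^j$. *)

theory Defs
  imports "HOL-Probability.Probability" "HOL-Computational_Algebra.Polynomial"
begin

text \<open>The Riemann sphere is realised as the unit sphere in complex x real (= R^3).\<close>

definition RS :: "(complex \<times> real) set" where
  "RS = {(w, h). (cmod w)^2 + h^2 = 1}"

text \<open>Spherical (great circle) distance on the unit sphere.\<close>
definition sdist :: "complex \<times> real \<Rightarrow> complex \<times> real \<Rightarrow> real" where
  "sdist u v = 2 * arcsin (dist u v / 2)"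

text \<open>Inverse stereographic projection from the extended plane (None = infinity) and back.\<close>
definition to_sph :: "complex option \<Rightarrow> complex \<times> real" where
  "to_sph zo = (case zo of None \<Rightarrow> (0, 1)
     | Some z \<Rightarrow> (2 * z / complex_of_real (1 + (cmod z)^2),
                 ((cmod z)^2 - 1) / ((cmod z)^2 + 1)))"

definition from_sph :: "complex \<times> real \<Rightarrow> complex option" where
  "from_sph u = (if snd u = 1 then None else Some (fst u / complex_of_real (1 - snd u)))"

definition rat_pair :: "complex poly \<Rightarrow> complex poly \<Rightarrow> bool" where
  "rat_pair p q \<longleftrightarrow> coprime p q"

definition rat_deg :: "complex poly \<Rightarrow> complex poly \<Rightarrow> nat" where
  "rat_deg p q = max (degree p) (degree q)"

definition rat_ext :: "complex poly \<Rightarrow> complex poly \<Rightarrow> complex option \<Rightarrow> complex option" where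
  "rat_ext p q zo = (case zo of
      None \<Rightarrow> (if degree p > degree q then None
               else if degree p < degree q then Some 0
               else Some (lead_coeff p / lead_coeff q))
    | Some z \<Rightarrow> (if poly q z = 0 then None else Some (poly p z / poly q z)))"

definition rat_sph :: "complex poly \<Rightarrow> complex poly \<Rightarrow> complex \<times> real \<Rightarrow> complex \<times> real" where
  "rat_sph p q u = to_sph (rat_ext p q (from_sph u))"

definition sph_dnorm :: "(complex \<times> real \<Rightarrow> complex \<times> real) \<Rightarrow> complex \<times> real \<Rightarrow> real" where
  "sph_dnorm g z = Lim (at z within RS) (\<lambda>y. sdist (g y) (g z) / sdist y z)"

fun wcomp :: "(nat \<Rightarrow> ('a \<Rightarrow> 'a)) \<Rightarrow> nat list \<Rightarrow> 'a \<Rightarrow> 'a" where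
  "wcomp f [] = id"
| "wcomp f (i # is) = wcomp f is \<circ> f i"

definition idx :: "nat \<Rightarrow> nat set" where
  "idx s = {1..s+1}"

definition semigrp :: "nat \<Rightarrow> (nat \<Rightarrow> ('a \<Rightarrow> 'a)) \<Rightarrow> ('a \<Rightarrow> 'a) set" where
  "semigrp s f = {wcomp f ws | ws. ws \<noteq> [] \<and> set ws \<subseteq> idx s}"

definition equicont_on :: "((complex \<times> real) \<Rightarrow> (complex \<times> real)) set \<Rightarrow> (complex \<times> real) set \<Rightarrow> bool" where
  "equicont_on H U \<longleftrightarrow> (\<forall>x\<in>U. \<forall>e>0. \<exists>\<delta>>0. \<forall>y\<in>U. sdist x y < \<delta> \<longrightarrow>
      (\<forall>h\<in>H. sdist (h x) (h y) < e))"

definition fatou :: "((complex \<times> real) \<Rightarrow> (complex \<times> real)) set \<Rightarrow> (complex \<times> real) set" where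
  "fatou H = {z \<in> RS. \<exists>U. open U \<and> z \<in> U \<and> equicont_on H (U \<inter> RS)}"

definition julia :: "((complex \<times> real) \<Rightarrow> (complex \<times> real)) set \<Rightarrow> (complex \<times> real) set" where
  "julia H = RS - fatou H"

definition crit_values :: "nat \<Rightarrow> (nat \<Rightarrow> (complex \<times> real \<Rightarrow> complex \<times> real)) \<Rightarrow> (complex \<times> real) set" where
  "crit_values s f = (\<Union>i\<in>idx s. f i ` {z \<in> RS. sph_dnorm (f i) z = 0})"

definition postcrit :: "nat \<Rightarrow> (nat \<Rightarrow> (complex \<times> real \<Rightarrow> complex \<times> real)) \<Rightarrow> (complex \<times> real) set" where
  "postcrit s f = closure (\<Union>g\<in>insert id (semigrp s f). g ` crit_values s f)"

definition minimal_set :: "nat \<Rightarrow> (nat \<Rightarrow> (complex \<times> real \<Rightarrow> complex \<times> real)) \<Rightarrow> (complex \<times> real) set \<Rightarrow> bool" where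
  "minimal_set s f K \<longleftrightarrow> K \<noteq> {} \<and> compact K \<and> K \<subseteq> RS \<and>
     (\<forall>z\<in>K. K = closure {g z | g. g \<in> semigrp s f})"

text \<open>Words omega : nat => nat, with omega 0 playing the role of omega_1.\<close>
definition fseq :: "(nat \<Rightarrow> ('a \<Rightarrow> 'a)) \<Rightarrow> (nat \<Rightarrow> nat) \<Rightarrow> nat \<Rightarrow> 'a \<Rightarrow> 'a" where
  "fseq f \<omega> n = wcomp f (map \<omega> [0..<n])"

definition fatou_seq :: "(nat \<Rightarrow> (complex \<times> real \<Rightarrow> complex \<times> real)) \<Rightarrow> (nat \<Rightarrow> nat) \<Rightarrow> (complex \<times> real) set" where
  "fatou_seq f \<omega> = {z \<in> RS. \<exists>U. open U \<and> z \<in> U \<and> equicont_on (range (fseq f \<omega>)) (U \<inter> RS)}"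

definition julia_seq :: "(nat \<Rightarrow> (complex \<times> real \<Rightarrow> complex \<times> real)) \<Rightarrow> (nat \<Rightarrow> nat) \<Rightarrow> (complex \<times> real) set" where
  "julia_seq f \<omega> = RS - fatou_seq f \<omega>"

definition julia_skew :: "nat \<Rightarrow> (nat \<Rightarrow> (complex \<times> real \<Rightarrow> complex \<times> real)) \<Rightarrow> ((nat \<Rightarrow> nat) \<times> (complex \<times> real)) set" where
  "julia_skew s f = closure {(\<omega>, z). (\<forall>n. \<omega> n \<in> idx s) \<and> z \<in> julia_seq f \<omega>}"

definition wt :: "nat \<Rightarrow> (nat \<Rightarrow> real) \<Rightarrow> nat \<Rightarrow> real" where
  "wt s x i = (if i \<in> {1..s} then x i else if i = s + 1 then 1 - (\<Sum>j=1..s. x j) else 0)"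

definition wpmf :: "nat \<Rightarrow> (nat \<Rightarrow> real) \<Rightarrow> nat pmf" where
  "wpmf s x = embed_pmf (wt s x)"

definition seq_measure :: "nat \<Rightarrow> (nat \<Rightarrow> real) \<Rightarrow> (nat \<Rightarrow> nat) measure" where
  "seq_measure s x = PiM UNIV (\<lambda>_. measure_pmf (wpmf s x))"

definition setdist :: "complex \<times> real \<Rightarrow> (complex \<times> real) set \<Rightarrow> real" where
  "setdist u L = Inf ((\<lambda>v. sdist u v) ` L)"

definition Tfun :: "nat \<Rightarrow> (nat \<Rightarrow> (complex \<times> real \<Rightarrow> complex \<times> real)) \<Rightarrow> (complex \<times> real) set
      \<Rightarrow> (nat \<Rightarrow> real) \<Rightarrow> complex \<times> real \<Rightarrow> real" where
  "Tfun s f L x z = measure (seq_measure s x)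
     {\<omega> \<in> space (seq_measure s x). (\<lambda>n. setdist (fseq f \<omega> n z) L) \<longlonglongrightarrow> 0}"

definition pdiff :: "((nat \<Rightarrow> real) \<Rightarrow> real) \<Rightarrow> nat \<Rightarrow> (nat \<Rightarrow> real) \<Rightarrow> real" where
  "pdiff F i x = deriv (\<lambda>t. F (x(i := t))) (x i)"

definition mpdiff :: "nat \<Rightarrow> (nat \<Rightarrow> nat) \<Rightarrow> ((nat \<Rightarrow> real) \<Rightarrow> real) \<Rightarrow> (nat \<Rightarrow> real) \<Rightarrow> real" where
  "mpdiff s n F = foldr (\<lambda>i G. ((\<lambda>H. pdiff H i) ^^ n i) G) [1..<s+1] F"

definition Ccoef :: "nat \<Rightarrow> (nat \<Rightarrow> (complex \<times> real \<Rightarrow> complex \<times> real)) \<Rightarrow> (complex \<times> real) set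
      \<Rightarrow> (nat \<Rightarrow> real) \<Rightarrow> (nat \<Rightarrow> nat) \<Rightarrow> complex \<times> real \<Rightarrow> real" where
  "Ccoef s f L p n z = mpdiff s n (\<lambda>x. Tfun s f L x z) p"

definition hoelder_exp :: "(complex \<times> real \<Rightarrow> complex) \<Rightarrow> complex \<times> real \<Rightarrow> ereal" where
  "hoelder_exp C z = Sup {ereal \<alpha> | \<alpha>. \<alpha> \<ge> 0 \<and>
      Limsup (at z within RS) (\<lambda>y. ereal (cmod (C y - C z) / (sdist y z) powr \<alpha>)) < \<infinity>}"

definition Sphi :: "(nat \<Rightarrow> (complex \<times> real \<Rightarrow> complex \<times> real)) \<Rightarrow> nat \<Rightarrow> (nat \<Rightarrow> nat) \<Rightarrow> complex \<times> real \<Rightarrow> real" where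
  "Sphi f k \<omega> z = (\<Sum>j<k. - ln (sph_dnorm (f (\<omega> j)) (fseq f \<omega> j z)))"

definition Spsi :: "nat \<Rightarrow> (nat \<Rightarrow> real) \<Rightarrow> nat \<Rightarrow> (nat \<Rightarrow> nat) \<Rightarrow> real" where
  "Spsi s p k \<omega> = (\<Sum>j<k. ln (wt s p (\<omega> j)))"

end

(* By (A2) the letters separate on the Julia set: near a point of f_i^{-1}(J) every other letter leads into
   the Fatou set, where all C_n are locally constant. Hence increments satisfy
     C_n(y) - C_n(z) = p_i (C_n(f_i y) - C_n(f_i z)) + (increments of derivatives of order |n| - 1),
   so along a word w an increment of a combination C at distance about 1 / ||f_w'(z)|| from z is p_w times an increment
   at unit scale of another combination with the same coefficients of top order. The lower order terms cost only
   a factor (1 + eps)^k, which gives the lower bound for the exponent. For the upper bound the C_n must be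
   linearly independent, uniformly, on every ball centred in J: in a relation of minimal order, transporting
   it along a recurrent backward orbit of a single letter changes a coefficient of submaximal order, and the
   difference of two such transports is a relation of smaller order; in order 0 it says that T is locally constant
   on the sphere, contradicting (A3).
   By (A1) inverse branches near J avoid an open set, form a normal family, and by (A2) contract uniformly
   (Bloch's theorem); this gives distortion bounds q^k with q close to 1. The C_n exist because the probability of
   absorption in the sets where convergence to L is certain or excluded tends to T geometrically fast,
   uniformly for complex weights close to p. *)
theory Submission
 imports Defs "HOL-Complex_Analysis.Complex_Analysis" "HOL-Computational_Algebra.Fundamental_Theorem_Algebra"
begin

section \<open>The Riemann sphere\<close>

text \<open>The estimates along a word of length k are not sharp: distances are known up to a factor
  q^k and increments up to (1 + \<epsilon>)^k, with q and 1 + \<epsilon> as close to 1 as desired.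
  Since derivatives grow at least like c * \<Lambda>^k, moving the exponent by an arbitrarily small
  t gains \<Lambda>^(t k), and q and \<epsilon> are chosen so that this gain covers the losses.
  Hence the two bounds are proved only for exponents separated from the liminf by a margin t, which
  the supremum in \<open>hoelder_exp\<close> does not see. \<open>Ccoef\<close> is built from
  \<open>deriv\<close>, which has some value even where no derivative exists, so its meaning has to
  be established: T is the restriction to real parameters of a uniform limit of polynomials in
  complex weights, and the complex derivatives of this limit are real there and agree with
  \<open>mpdiff\<close>. The Julia set of the skew product enters through a single consequence: the
  whole orbit of z along \<omega> lies in J(G).\<close>

lemma RS_sphere: "RS = sphere 0 1"
 by (auto simp: RS_def norm_Pair)

lemma compact_RS: "compact RS"
 by (simp add: RS_sphere)

lemma connected_RS: "connected RS"
 unfolding RS_sphere by (rule connected_sphere) simp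

lemma RS_islimpt: assumes "x \<in> RS" shows "x islimpt RS"
proof (rule connected_imp_perfect[OF connected_RS assms])
 fix a
 have "(0, 1) \<in> RS" "(0, -1) \<in> RS" by (auto simp: RS_def)
 moreover have "(0::complex, 1::real) \<noteq> (0, -1)" by simp
 ultimately show "RS \<noteq> {a}" by (metis singletonD)
qed

lemma dist_RS_le: assumes "u \<in> RS" "v \<in> RS" shows "dist u v \<le> 2"
 using assms norm_triangle_ineq4[of u v] by (auto simp: RS_sphere dist_norm)

section \<open>Spherical against chordal distance\<close>

definition arcsin_slope :: "real \<Rightarrow> real" where
 "arcsin_slope t = (if t = 0 then 1 else 2 * arcsin (t / 2) / t)"

lemma sdist_eq_slope: "sdist u v = arcsin_slope (dist u v) * dist u v"
 by (auto simp: sdist_def arcsin_slope_def)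

text \<open>With t = 2 sin a the slope is a / sin a. It is at least 1 because sin a \<le> a; the
  Taylor bound sin a \<ge> a - a^3 / 6 together with a \<le> 2 gives sin a \<ge> a / 3.\<close>

lemma arcsin_slope_bounds: assumes "0 \<le> t" "t \<le> 2"
 shows "1 \<le> arcsin_slope t" "arcsin_slope t \<le> 3"
proof -
 define a where "a = arcsin (t / 2)"
 have s: "sin a = t / 2" unfolding a_def using assms by (intro sin_arcsin) auto
 have a0: "0 \<le> a" unfolding a_def using assms arcsin_le_arcsin[of 0 "t/2"] by simp
 have "a \<le> pi / 2" unfolding a_def using assms by (intro arcsin_ubound) auto
 then have a2: "a \<le> 2" using pi_less_4 by linarith
 have "sin a \<le> a" using a0 by (simp add: sin_x_le_x)
 then have "t \<le> 2 * a" using s by simp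
 then show "1 \<le> arcsin_slope t" using assms by (auto simp: arcsin_slope_def a_def field_simps)
 have "\<bar>sin a - (\<Sum>m<3. sin_coeff m * a ^ m)\<bar> \<le> inverse (fact 3) * \<bar>a\<bar> ^ 3"
  by (rule Maclaurin_sin_bound)
 also have "(\<Sum>m<3. sin_coeff m * a ^ m) = a"
  by (simp add: eval_nat_numeral sin_coeff_def)
 finally have "\<bar>sin a - a\<bar> \<le> a ^ 3 / 6" using a0 by (simp add: eval_nat_numeral field_simps)
 then have "a - a ^ 3 / 6 \<le> sin a" by linarith
 moreover have "a ^ 3 \<le> 4 * a"
  using a0 a2 mult_mono[of a 2 a 2] mult_right_mono[of "a * a" 4 a] by (simp add: eval_nat_numeral)
 ultimately have "a \<le> 3 * (t / 2)" using s by linarith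
 then have "2 * a \<le> 3 * t" by simp
 then show "arcsin_slope t \<le> 3" using assms by (auto simp: arcsin_slope_def a_def field_simps)
qed

text \<open>The two distances agree to first order, so that \<open>sph_dnorm\<close>, a limit of
  spherical quotients, can be computed with \<open>dist\<close>.\<close>

lemma arcsin_slope_tendsto: "(arcsin_slope \<longlongrightarrow> 1) (nhds 0)"
proof -
 have "((\<lambda>t. 2 * arcsin (t / 2)) has_real_derivative 2 * (inverse (sqrt (1 - (0/2)\<^sup>2)) * (1 / 2))) (at 0)"
  by (rule derivative_eq_intros refl | simp)+
 then have "((\<lambda>t. 2 * arcsin (t / 2) / t) \<longlongrightarrow> 1) (at 0)"
  by (simp add: has_field_derivative_iff)
 moreover have "\<forall>\<^sub>F t in at 0. 2 * arcsin (t / 2) / t = arcsin_slope t"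
  by (auto simp: eventually_at_filter arcsin_slope_def)
 ultimately have "(arcsin_slope \<longlongrightarrow> arcsin_slope 0) (at 0)"
  using Lim_transform_eventually[of "\<lambda>t. 2 * arcsin (t / 2) / t" 1 "at 0" arcsin_slope]
  by (simp add: arcsin_slope_def)
 then have "isCont arcsin_slope 0" by (simp add: isCont_def)
 then show ?thesis by (simp add: isCont_def arcsin_slope_def tendsto_nhds_iff)
qed

text \<open>A factor 3 does not affect equicontinuity, convergence or Hoelder exponents. Everything
  except \<open>sph_dnorm\<close> is therefore done with the Euclidean distance of the surrounding
  space.\<close>

lemma sdist_bounds: assumes "u \<in> RS" "v \<in> RS"
 shows "dist u v \<le> sdist u v" "sdist u v \<le> 3 * dist u v"
 using arcsin_slope_bounds[of "dist u v"] dist_RS_le[OF assms]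
 by (auto simp: sdist_eq_slope intro: mult_right_mono order_trans[OF _ mult_right_mono[of 1]])

section \<open>Homogeneous coordinates [z : w] on the sphere\<close>

definition homsph :: "complex \<Rightarrow> complex \<Rightarrow> complex \<times> real" where
 "homsph z w = (2 * z * cnj w / complex_of_real ((cmod z)\<^sup>2 + (cmod w)\<^sup>2),
         ((cmod z)\<^sup>2 - (cmod w)\<^sup>2) / ((cmod z)\<^sup>2 + (cmod w)\<^sup>2))"

lemma cmod_sum_pos: "z \<noteq> 0 \<or> w \<noteq> 0 \<Longrightarrow> (cmod z)\<^sup>2 + (cmod w)\<^sup>2 > 0"
 by (metis add_nonneg_pos add_pos_nonneg zero_le_power2 zero_less_norm_iff zero_less_power)

text \<open>A form of the Lagrange identity for two vectors of C^2. Through it the chordal distance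
  depends only on the determinant z1 w2 - z2 w1 and on the norms of the two vectors.\<close>

lemma inner_homsph:
 assumes "z1 \<noteq> 0 \<or> z2 \<noteq> 0" "w1 \<noteq> 0 \<or> w2 \<noteq> 0"
 shows "inner (homsph z1 z2) (homsph w1 w2) =
  1 - 2 * (cmod (z1 * w2 - z2 * w1))\<^sup>2 / (((cmod z1)\<^sup>2 + (cmod z2)\<^sup>2) * ((cmod w1)\<^sup>2 + (cmod w2)\<^sup>2))"
proof -
 define A B where "A = (cmod z1)\<^sup>2 + (cmod z2)\<^sup>2" and "B = (cmod w1)\<^sup>2 + (cmod w2)\<^sup>2"
 have pos: "A > 0" "B > 0" unfolding A_def B_def using assms cmod_sum_pos by auto
 have "A * B * inner (homsph z1 z2) (homsph w1 w2) =
   4 * inner (z1 * cnj z2) (w1 * cnj w2) + ((cmod z1)\<^sup>2 - (cmod z2)\<^sup>2) * ((cmod w1)\<^sup>2 - (cmod w2)\<^sup>2)"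
  using pos unfolding homsph_def A_def[symmetric] B_def[symmetric]
  by (simp add: inner_complex_def field_simps)
 also have "\<dots> = A * B - 2 * (cmod (z1 * w2 - z2 * w1))\<^sup>2"
  unfolding A_def B_def cmod_power2 inner_complex_def
  by (simp add: algebra_simps power2_eq_square)
 finally show ?thesis using pos by (simp add: A_def[symmetric] B_def[symmetric] field_simps)
qed

lemma homsph_in_RS: assumes "z1 \<noteq> 0 \<or> z2 \<noteq> 0" shows "homsph z1 z2 \<in> RS"
 using inner_homsph[OF assms assms] by (simp add: RS_sphere norm_eq_sqrt_inner mult.commute)

lemma dist_homsph:
 assumes "z1 \<noteq> 0 \<or> z2 \<noteq> 0" "w1 \<noteq> 0 \<or> w2 \<noteq> 0"
 shows "dist (homsph z1 z2) (homsph w1 w2) = 2 * cmod (z1 * w2 - z2 * w1) /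
  (sqrt ((cmod z1)\<^sup>2 + (cmod z2)\<^sup>2) * sqrt ((cmod w1)\<^sup>2 + (cmod w2)\<^sup>2))"
proof (rule power2_eq_imp_eq)
 have 1: "inner (homsph z1 z2) (homsph z1 z2) = 1" "inner (homsph w1 w2) (homsph w1 w2) = 1"
  using inner_homsph[OF assms(1) assms(1)] inner_homsph[OF assms(2) assms(2)] by (simp_all add: mult.commute)
 have "(dist (homsph z1 z2) (homsph w1 w2))\<^sup>2 = 2 - 2 * inner (homsph z1 z2) (homsph w1 w2)"
  unfolding dist_norm power2_norm_eq_inner using 1 by (simp add: inner_diff inner_commute)
 also have "\<dots> = (2 * cmod (z1 * w2 - z2 * w1) /
  (sqrt ((cmod z1)\<^sup>2 + (cmod z2)\<^sup>2) * sqrt ((cmod w1)\<^sup>2 + (cmod w2)\<^sup>2)))\<^sup>2"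
  unfolding inner_homsph[OF assms] using cmod_sum_pos[OF assms(1)] cmod_sum_pos[OF assms(2)]
  by (simp add: power_divide power_mult_distrib)
 finally show "(dist (homsph z1 z2) (homsph w1 w2))\<^sup>2 = (2 * cmod (z1 * w2 - z2 * w1) /
  (sqrt ((cmod z1)\<^sup>2 + (cmod z2)\<^sup>2) * sqrt ((cmod w1)\<^sup>2 + (cmod w2)\<^sup>2)))\<^sup>2" .
qed auto

lemma homsph_scale: assumes "c \<noteq> 0" "z1 \<noteq> 0 \<or> z2 \<noteq> 0" shows "homsph (c * z1) (c * z2) = homsph z1 z2"
proof -
 have "dist (homsph (c * z1) (c * z2)) (homsph z1 z2) = 0"
  using assms by (subst dist_homsph) (auto simp: algebra_simps)
 then show ?thesis by simp
qed

lemma to_sph_Some: "to_sph (Some z) = homsph z 1"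
 by (simp add: to_sph_def homsph_def add.commute)

lemma to_sph_None: "to_sph None = homsph 1 0"
 by (simp add: to_sph_def homsph_def)

lemma to_sph_quotient: "w \<noteq> 0 \<Longrightarrow> to_sph (Some (z / w)) = homsph z w"
 using homsph_scale[of w "z / w" 1] by (simp add: to_sph_Some)

lemma to_sph_in_RS: "to_sph z \<in> RS"
 by (cases z) (auto simp: to_sph_Some to_sph_None intro: homsph_in_RS)

lemma from_to_sph: "from_sph (to_sph z) = z"
proof (cases z)
 case (Some w)
 have pos: "1 + (cmod w)\<^sup>2 > 0" by (simp add: add_pos_nonneg)
 then have n1: "((cmod w)\<^sup>2 - 1) / ((cmod w)\<^sup>2 + 1) \<noteq> 1" by (simp add: field_simps)
 have "1 - ((cmod w)\<^sup>2 - 1) / ((cmod w)\<^sup>2 + 1) = 2 / (1 + (cmod w)\<^sup>2)"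
  using pos by (simp add: field_simps)
 then show ?thesis using n1 pos Some
  by (simp add: to_sph_def from_sph_def) (metis add.right_neutral add_eq_0_iff of_real_0 of_real_1 of_real_add of_real_eq_iff of_real_power order_less_irrefl)
qed (simp add: to_sph_def from_sph_def)

lemma to_from_sph: assumes "u \<in> RS" shows "to_sph (from_sph u) = u"
proof -
 obtain w h where u: "u = (w, h)" by (cases u)
 have eq: "(cmod w)\<^sup>2 = (1 - h) * (1 + h)" using assms by (simp add: RS_def u algebra_simps power2_eq_square)
 show ?thesis
 proof (cases "h = 1")
  case True then show ?thesis using eq by (simp add: u from_sph_def to_sph_def)
 next
  case False
  have "h\<^sup>2 \<le> 1" using assms zero_le_power2[of "cmod w"] unfolding RS_def u mem_Collect_eq prod.case by linarith
  then have h: "1 - h > 0" using False by (simp add: abs_square_le_1 abs_le_iff)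
  then have c: "(cmod (w / complex_of_real (1 - h)))\<^sup>2 = (1 + h) / (1 - h)"
   using eq by (simp add: norm_divide power_divide power2_eq_square del: of_real_diff)
  have 2: "1 + (1 + h) / (1 - h) = 2 / (1 - h)" "(1 + h) / (1 - h) - 1 = 2 * h / (1 - h)"
   "(1 + h) / (1 - h) + 1 = 2 / (1 - h)"
   using h by (simp_all add: field_simps)
  have "complex_of_real (1 - h) \<noteq> 0" using h by (metis of_real_eq_0_iff order_less_irrefl)
  then show ?thesis using False h unfolding u from_sph_def to_sph_def fst_conv snd_conv
   by (simp add: c 2 del: of_real_diff)
 qed
qed

section \<open>Rational maps as pairs of homogeneous forms\<close>

definition hpoly :: "nat \<Rightarrow> complex poly \<Rightarrow> complex \<Rightarrow> complex \<Rightarrow> complex" where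
 "hpoly d p z w = (\<Sum>i\<le>d. coeff p i * z ^ i * w ^ (d - i))"

lemma hpoly_nonzero: assumes "w \<noteq> 0" "degree p \<le> d" shows "hpoly d p z w = w ^ d * poly p (z / w)"
proof -
 have "poly p (z / w) = (\<Sum>i\<le>d. coeff p i * (z / w) ^ i)"
  unfolding poly_altdef using assms(2)
  by (intro sum.mono_neutral_left) (auto simp: coeff_eq_0)
 then show ?thesis using assms(1)
  by (auto simp: hpoly_def sum_distrib_left power_divide power_diff intro!: sum.cong)
qed

lemma hpoly_0: "hpoly d p z 0 = coeff p d * z ^ d"
proof -
 have "hpoly d p z 0 = (\<Sum>i\<in>{d}. coeff p i * z ^ i * 0 ^ (d - i))"
  unfolding hpoly_def by (intro sum.mono_neutral_right) auto
 then show ?thesis by simp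
qed

lemma rat_pair_no_common_root: assumes "rat_pair p q" shows "poly p z \<noteq> 0 \<or> poly q z \<noteq> 0"
 using assms coprime_poly_0[of p q z] by (auto simp: rat_pair_def)

lemma rat_pair_coeff: assumes "rat_pair p q" shows "coeff p (rat_deg p q) \<noteq> 0 \<or> coeff q (rat_deg p q) \<noteq> 0"
proof -
 have "p \<noteq> 0 \<or> q \<noteq> 0" using rat_pair_no_common_root[OF assms, of 0] by auto
 then show ?thesis unfolding rat_deg_def max_def
  by (metis degree_0 le_zero_eq leading_coeff_0_iff nat_le_linear)
qed

lemma hpoly_not_both_zero:
 assumes "rat_pair p q" "z \<noteq> 0 \<or> w \<noteq> 0"
 shows "hpoly (rat_deg p q) p z w \<noteq> 0 \<or> hpoly (rat_deg p q) q z w \<noteq> 0"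
proof (cases "w = 0")
 case True then show ?thesis using assms rat_pair_coeff[OF assms(1)] by (auto simp: hpoly_0)
next
 case False
 then show ?thesis using rat_pair_no_common_root[OF assms(1), of "z / w"]
  by (auto simp: hpoly_nonzero rat_deg_def)
qed

text \<open>In homogeneous coordinates the case distinctions of \<open>rat_ext\<close> at poles and
  at infinity become one formula: a pair of forms of degree \<open>rat_deg p q\<close> without
  common zero.\<close>

lemma rat_sph_homsph:
 assumes "rat_pair p q" "z \<noteq> 0 \<or> w \<noteq> 0" and deg: "rat_deg p q \<ge> 1"
 shows "rat_sph p q (homsph z w) = homsph (hpoly (rat_deg p q) p z w) (hpoly (rat_deg p q) q z w)"
proof (cases "w = 0")
 case True
 define d where "d = rat_deg p q"
 have z: "z \<noteq> 0" using True assms by auto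
 have "homsph z w = to_sph None" using homsph_scale[of z 1 0] z by (simp add: True to_sph_None)
 then have L: "rat_sph p q (homsph z w) = to_sph (rat_ext p q None)" by (simp add: rat_sph_def from_to_sph)
 have "homsph (hpoly d p z w) (hpoly d q z w) = homsph (z ^ d * coeff p d) (z ^ d * coeff q d)"
  by (simp add: True hpoly_0 mult.commute)
 also have "\<dots> = homsph (coeff p d) (coeff q d)"
  using rat_pair_coeff[OF assms(1)] z by (intro homsph_scale) (auto simp: d_def)
 also have "\<dots> = to_sph (rat_ext p q None)"
 proof -
  consider "degree p > degree q" | "degree p < degree q" | "degree p = degree q" by linarith
  then show ?thesis
  proof cases
   case 1
   then have "coeff q d = 0" "coeff p d \<noteq> 0" using rat_pair_coeff[OF assms(1)]
    by (auto simp: d_def rat_deg_def coeff_eq_0)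
   then show ?thesis using 1 homsph_scale[of "coeff p d" 1 0] by (simp add: rat_ext_def to_sph_None)
  next
   case 2
   then have "coeff p d = 0" "coeff q d \<noteq> 0" using rat_pair_coeff[OF assms(1)]
    by (auto simp: d_def rat_deg_def coeff_eq_0)
   then show ?thesis using 2 homsph_scale[of "coeff q d" 0 1] by (simp add: rat_ext_def to_sph_Some)
  next
   case 3
   then have "d = degree p" by (simp add: d_def rat_deg_def)
   moreover have "lead_coeff q \<noteq> 0" using deg 3
    by (auto simp: rat_deg_def)
   ultimately show ?thesis using 3 by (simp add: rat_ext_def to_sph_quotient)
  qed
 qed
 finally show ?thesis using L by (simp add: d_def)
next
 case False
 define d where "d = rat_deg p q"
 define t where "t = z / w"
 have "homsph z w = to_sph (Some t)" by (simp add: to_sph_quotient False t_def)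
 then have L: "rat_sph p q (homsph z w) = to_sph (rat_ext p q (Some t))" by (simp add: rat_sph_def from_to_sph)
 have "homsph (hpoly d p z w) (hpoly d q z w) = homsph (w ^ d * poly p t) (w ^ d * poly q t)"
  by (simp add: hpoly_nonzero False t_def d_def rat_deg_def)
 also have "\<dots> = homsph (poly p t) (poly q t)"
  using rat_pair_no_common_root[OF assms(1)] False by (intro homsph_scale) auto
 also have "\<dots> = to_sph (rat_ext p q (Some t))"
 proof (cases "poly q t = 0")
  case True
  then have "poly p t \<noteq> 0" using rat_pair_no_common_root[OF assms(1), of t] by auto
  then show ?thesis using True homsph_scale[of "poly p t" 1 0] by (simp add: rat_ext_def to_sph_None)
 qed (simp add: rat_ext_def to_sph_quotient)
 finally show ?thesis using L by (simp add: d_def)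
qed

lemma rat_sph_in_RS: "rat_sph p q x \<in> RS"
 by (simp add: rat_sph_def to_sph_in_RS)

text \<open>Apart from infinity the fibre consists of roots of q or of p - e q. Neither polynomial
  vanishes identically, since p and q are coprime and not both constant.\<close>

lemma rat_sph_fiber_finite:
 assumes "rat_pair p q" "rat_deg p q \<ge> 1" shows "finite {x \<in> RS. rat_sph p q x = v}"
proof -
 have nz: "\<not> (degree p = 0 \<and> degree q = 0)" using assms(2) by (auto simp: rat_deg_def)
 have nosm: "p \<noteq> smult c q" for c
 proof
  assume "p = smult c q"
  then have "q dvd p" by (simp add: dvd_smult)
  then have "is_unit q" using assms(1) by (metis coprime_absorb_right rat_pair_def)
  then have "degree q = 0" by (rule is_unit_polyE) auto
  then show False using nz degree_smult_le[of c q] \<open>p = smult c q\<close> by simp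
 qed
 have q0: "q \<noteq> 0"
 proof
  assume q: "q = 0"
  then have "is_unit p" using assms(1) by (simp add: rat_pair_def)
  then have "degree p = 0" by (rule is_unit_polyE) auto
  then show False using nz q by simp
 qed
 have "{t. rat_ext p q (Some t) = e} \<subseteq> {t. poly q t = 0} \<union> {t. poly (p - smult (the e) q) t = 0}" for e
  by (auto simp: rat_ext_def)
 moreover have "finite ({t. poly q t = 0} \<union> {t. poly (p - smult (the e) q) t = 0})" for e
  using poly_roots_finite[OF q0] poly_roots_finite[of "p - smult (the e) q"] nosm[of "the e"] by auto
 ultimately have fin: "finite {t. rat_ext p q (Some t) = e}" for e using finite_subset by blast
 have "{x \<in> RS. rat_sph p q x = v} \<subseteq> insert (to_sph None) ((\<lambda>t. to_sph (Some t)) ` {t. rat_ext p q (Some t) = from_sph v})"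
 proof
  fix x assume x: "x \<in> {x \<in> RS. rat_sph p q x = v}"
  then have "rat_ext p q (from_sph x) = from_sph v" by (auto simp: rat_sph_def from_to_sph)
  moreover have "x = to_sph (from_sph x)" using x by (simp add: to_from_sph)
  ultimately show "x \<in> insert (to_sph None) ((\<lambda>t. to_sph (Some t)) ` {t. rat_ext p q (Some t) = from_sph v})"
   by (cases "from_sph x") (metis insertI1, metis (mono_tags, lifting) image_eqI insertI2 mem_Collect_eq)
 qed
 then show ?thesis using fin finite_subset by blast
qed

section \<open>Charts with a movable point at infinity\<close>

definition pole :: "complex \<Rightarrow> complex \<times> real" where
 "pole a = homsph a 1"

text \<open>The chart u = 1 / (z - a), in which the point a of the plane is at infinity.\<close>
definition emb :: "complex \<Rightarrow> complex \<Rightarrow> complex \<times> real" where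
 "emb a u = homsph (1 + a * u) u"

text \<open>The norm of the homogeneous vector (1 + a u, u). In this chart the spherical metric is 2
  |du| / \<open>emb_wt a u\<close>^2.\<close>

definition emb_wt :: "complex \<Rightarrow> complex \<Rightarrow> real" where
 "emb_wt a u = sqrt ((cmod (1 + a * u))\<^sup>2 + (cmod u)\<^sup>2)"

lemma emb_nonzero: "1 + a * (u :: complex) \<noteq> 0 \<or> u \<noteq> 0"
 by (cases "u = 0") auto

lemma emb_wt_pos: "emb_wt a u > 0"
 unfolding emb_wt_def by (metis cmod_sum_pos emb_nonzero real_sqrt_gt_zero)

lemma isCont_emb_wt [continuous_intros]: "isCont f u \<Longrightarrow> isCont (\<lambda>u. emb_wt a (f u)) u"
 unfolding emb_wt_def by (intro continuous_intros)

lemma norm_le_emb_wt: "cmod u \<le> emb_wt a u"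
 unfolding emb_wt_def by (rule real_le_rsqrt) simp

lemma pole_in_RS: "pole a \<in> RS"
 by (simp add: pole_def homsph_in_RS)

lemma emb_in_RS: "emb a u \<in> RS"
 unfolding emb_def using emb_nonzero by (rule homsph_in_RS)

lemma dist_emb: "dist (emb a u) (emb a v) = 2 * cmod (u - v) / (emb_wt a u * emb_wt a v)"
proof -
 have "(1 + a * u) * v - u * (1 + a * v) = v - u" by (simp add: algebra_simps)
 then show ?thesis unfolding emb_def emb_wt_def dist_homsph[OF emb_nonzero emb_nonzero]
  by (simp only: norm_minus_commute[of v u])
qed

lemma dist_emb_pole: "dist (emb a u) (pole a) = 2 / (emb_wt a u * sqrt ((cmod a)\<^sup>2 + 1))"
proof -
 have "dist (emb a u) (pole a) = 2 * cmod ((1 + a * u) * 1 - u * a) /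
  (sqrt ((cmod (1 + a * u))\<^sup>2 + (cmod u)\<^sup>2) * sqrt ((cmod a)\<^sup>2 + (cmod 1)\<^sup>2))"
  unfolding emb_def pole_def by (rule dist_homsph) auto
 then show ?thesis by (simp add: emb_wt_def mult.commute)
qed

lemma sqrt_ge_1: "sqrt ((cmod a)\<^sup>2 + 1) \<ge> 1"
 by simp

lemma emb_neq_pole: "emb a u \<noteq> pole a"
proof
 assume "emb a u = pole a"
 moreover have "emb_wt a u * sqrt ((cmod a)\<^sup>2 + 1) > 0"
  using sqrt_ge_1[of a] emb_wt_pos[of a u] by (intro mult_pos_pos) linarith+
 ultimately show False using dist_emb_pole[of a u] by (metis dist_self divide_eq_0_iff less_irrefl zero_neq_numeral)
qed

lemma emb_wt_le: assumes "\<delta> > 0" "dist (emb a u) (pole a) \<ge> \<delta>" shows "emb_wt a u \<le> 2 / \<delta>"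
proof -
 have "\<delta> \<le> 2 / (emb_wt a u * sqrt ((cmod a)\<^sup>2 + 1))" using assms by (simp add: dist_emb_pole)
 also have "\<dots> \<le> 2 / (emb_wt a u * 1)"
  using sqrt_ge_1 emb_wt_pos[of a u] by (intro divide_left_mono mult_left_mono) (auto simp: add_nonneg_pos)
 finally show ?thesis using assms(1) emb_wt_pos[of a u] by (simp add: field_simps)
qed

lemma emb_wt_ge: "emb_wt a u \<ge> 1 / sqrt ((cmod a)\<^sup>2 + 1)"
proof -
 have "2 / (emb_wt a u * sqrt ((cmod a)\<^sup>2 + 1)) \<le> 2"
  unfolding dist_emb_pole[symmetric] by (intro dist_RS_le emb_in_RS pole_in_RS)
 moreover have "sqrt ((cmod a)\<^sup>2 + 1) > 0" using sqrt_ge_1[of a] by linarith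
 ultimately show ?thesis using emb_wt_pos[of a u] by (simp add: field_simps)
qed

lemma emb_lipschitz: "dist (emb a u) (emb a v) \<le> 2 * ((cmod a)\<^sup>2 + 1) * dist u v"
proof -
 define c where "c = sqrt ((cmod a)\<^sup>2 + 1)"
 have c: "c > 0" "c * c = (cmod a)\<^sup>2 + 1" unfolding c_def using sqrt_ge_1[of a] by (auto simp: add_nonneg_pos)
 have "1 \<le> emb_wt a u * c" "1 \<le> emb_wt a v * c"
  using emb_wt_ge[of a u] emb_wt_ge[of a v] c(1) unfolding c_def[symmetric] by (simp_all add: divide_le_eq)
 then have "1 * 1 \<le> (emb_wt a u * c) * (emb_wt a v * c)" by (intro mult_mono) auto
 then have "1 / (emb_wt a u * emb_wt a v) \<le> c * c"
  using emb_wt_pos[of a u] emb_wt_pos[of a v] by (simp add: field_simps)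
 then have "2 * dist u v * (1 / (emb_wt a u * emb_wt a v)) \<le> 2 * dist u v * (c * c)"
  by (intro mult_left_mono) auto
 then show ?thesis by (simp add: dist_emb dist_norm[of u v] c(2) algebra_simps)
qed

text \<open>Away from the pole the weights are at most 2 / \<delta>, so there the chart is
  bi-Lipschitz; the other inequality, \<open>emb_lipschitz\<close>, holds everywhere.\<close>

lemma emb_inverse_lipschitz:
 assumes "\<delta> > 0" "dist (emb a u) (pole a) \<ge> \<delta>" "dist (emb a v) (pole a) \<ge> \<delta>"
 shows "dist u v \<le> 2 / \<delta>\<^sup>2 * dist (emb a u) (emb a v)"
proof -
 have "dist u v = dist (emb a u) (emb a v) * (emb_wt a u * emb_wt a v) / 2"
  using emb_wt_pos[of a u] emb_wt_pos[of a v] by (simp add: dist_emb dist_norm[of u v])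
 also have "\<dots> \<le> dist (emb a u) (emb a v) * ((2 / \<delta>) * (2 / \<delta>)) / 2"
  using emb_wt_le[OF assms(1,2)] emb_wt_le[OF assms(1,3)] emb_wt_pos[of a u] emb_wt_pos[of a v] assms(1)
  by (intro divide_right_mono mult_left_mono mult_mono) auto
 finally show ?thesis by (simp add: power2_eq_square field_simps)
qed

lemma emb_norm_le: assumes "\<delta> > 0" "dist (emb a u) (pole a) \<ge> \<delta>" shows "cmod u \<le> 2 / \<delta>"
 using emb_wt_le[OF assms] norm_le_emb_wt[of u a] by linarith

lemma inj_emb: "inj (emb a)"
proof (rule injI)
 fix u v assume "emb a u = emb a v"
 then have "dist (emb a u) (emb a v) = 0" by simp
 then have "2 * cmod (u - v) / (emb_wt a u * emb_wt a v) = 0" unfolding dist_emb .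
 then show "u = v" using emb_wt_pos[of a u] emb_wt_pos[of a v] by auto
qed

lemma continuous_emb: "continuous_on S (emb a)"
proof (rule continuous_on_subset[OF _ subset_UNIV])
 show "continuous_on UNIV (emb a)"
 proof (rule lipschitz_on_continuous_on)
  show "(2 * ((cmod a)\<^sup>2 + 1))-lipschitz_on UNIV (emb a)"
   using emb_lipschitz[of a] by (auto simp: lipschitz_on_def)
 qed
qed

lemma open_emb_vimage: "open V \<Longrightarrow> open (emb a -` V)"
 using continuous_emb[of UNIV a] by (simp add: continuous_on_open_vimage)

lemma emb_surj: assumes "x \<in> RS" "x \<noteq> pole a" shows "\<exists>u. x = emb a u"
proof (cases "from_sph x")
 case None
 then have "x = homsph 1 0" using to_from_sph[OF assms(1)] by (simp add: to_sph_None)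
 then show ?thesis by (intro exI[of _ 0]) (simp add: emb_def)
next
 case (Some z)
 then have x: "x = homsph z 1" using to_from_sph[OF assms(1)] by (simp add: to_sph_Some)
 then have za: "z \<noteq> a" using assms(2) by (auto simp: pole_def)
 then have "1 + a * (1 / (z - a)) = 1 / (z - a) * z" by (simp add: field_simps)
 then have "emb a (1 / (z - a)) = homsph (1 / (z - a) * z) (1 / (z - a) * 1)" by (simp add: emb_def)
 also have "\<dots> = x" unfolding x using za by (intro homsph_scale) auto
 finally show ?thesis by metis
qed

lemma emb_finite: assumes "u \<noteq> 0" shows "emb a u = to_sph (Some (a + 1 / u))"
proof -
 have "a + 1 / u = (1 + a * u) / u" using assms by (simp add: field_simps)
 then show ?thesis using assms by (simp add: to_sph_quotient emb_def)
qed

lemma emb_local_inverse: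
 assumes "\<delta> > 0"
 shows "\<exists>\<eta>>0. \<forall>y\<in>RS. dist (emb a u) y < \<eta> \<longrightarrow> (\<exists>v. y = emb a v \<and> dist u v < \<delta>)"
proof -
 \<comment> \<open>Points closer than D to \<open>emb a u\<close> are still at distance at least D
   from the pole, where the chart is bi-Lipschitz.\<close>
 define D where "D = dist (emb a u) (pole a) / 2"
 have D: "D > 0" using emb_neq_pole[of a u] by (simp add: D_def)
 define \<eta> where "\<eta> = min D (\<delta> * D\<^sup>2 / 2)"
 have "\<exists>v. y = emb a v \<and> dist u v < \<delta>" if y: "y \<in> RS" "dist (emb a u) y < \<eta>" for y
 proof -
  have "dist (emb a u) (pole a) \<le> dist (emb a u) y + dist y (pole a)" by (rule dist_triangle)
  then have Dy: "dist y (pole a) \<ge> D" using y(2) by (simp add: D_def \<eta>_def)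
  then have "y \<noteq> pole a" using D by auto
  then obtain v where v: "y = emb a v" using emb_surj[OF y(1)] by auto
  have "dist u v \<le> 2 / D\<^sup>2 * dist (emb a u) (emb a v)"
   using D Dy by (intro emb_inverse_lipschitz) (auto simp: v D_def)
  also have "\<dots> < 2 / D\<^sup>2 * (\<delta> * D\<^sup>2 / 2)"
   using y(2) D unfolding v \<eta>_def by (intro mult_strict_left_mono) auto
  also have "\<dots> = \<delta>" using D by simp
  finally show ?thesis using v by auto
 qed
 moreover have "\<eta> > 0" using D assms by (simp add: \<eta>_def)
 ultimately show ?thesis by blast
qed

lemma openin_emb_image: assumes "open U" shows "openin (top_of_set RS) (emb a ` U)"
proof (subst openin_euclidean_subtopology_iff, intro conjI ballI)
 show "emb a ` U \<subseteq> RS" using emb_in_RS by auto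
 fix x assume "x \<in> emb a ` U"
 then obtain u where u: "u \<in> U" "x = emb a u" by auto
 obtain \<delta> where \<delta>: "\<delta> > 0" "ball u \<delta> \<subseteq> U" using assms u by (meson open_contains_ball)
 obtain \<eta> where \<eta>: "\<eta> > 0" "\<forall>y\<in>RS. dist (emb a u) y < \<eta> \<longrightarrow> (\<exists>v. y = emb a v \<and> dist u v < \<delta>)"
  using emb_local_inverse[OF \<delta>(1)] by blast
 have "y \<in> emb a ` U" if y: "y \<in> RS" "dist y x < \<eta>" for y
 proof -
  have "dist (emb a u) y < \<eta>" using y(2) u(2) by (simp add: dist_commute)
  then obtain v where "y = emb a v" "dist u v < \<delta>" using \<eta>(2) y(1) by blast
  then show ?thesis using \<delta>(2) by auto
 qed
 then show "\<exists>e>0. \<forall>x'\<in>RS. dist x' x < e \<longrightarrow> x' \<in> emb a ` U" using \<eta>(1) by blast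
qed

lemma pole_avoid: assumes "finite A" shows "\<exists>a. pole a \<notin> A"
proof -
 have "inj pole"
 proof (rule injI)
  fix a b :: complex assume "pole a = pole b"
  then have "to_sph (Some a) = to_sph (Some b)" by (simp add: pole_def to_sph_Some)
  then show "a = b" by (metis from_to_sph option.inject)
 qed
 then have "infinite (range pole)" using finite_imageD infinite_UNIV_char_0 by blast
 then show ?thesis using assms by (metis finite_subset image_subset_iff)
qed

text \<open>Lets a point of a prescribed open set be put at infinity: maps that omit the open set
  become bounded in the chart.\<close>

lemma pole_dense: assumes "open V" "x \<in> RS" "x \<in> V" shows "\<exists>a. pole a \<in> V \<and> pole a \<noteq> y"
proof -
 have "infinite (RS \<inter> V)"
  using RS_islimpt[OF assms(2)] assms(1,3) unfolding islimpt_eq_acc_point by (metis Int_commute)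
 then have "infinite (RS \<inter> V - {y, to_sph None})" by simp
 then have "RS \<inter> V - {y, to_sph None} \<noteq> {}" by (metis finite.emptyI)
 then obtain w where w: "w \<in> RS" "w \<in> V" "w \<noteq> y" "w \<noteq> to_sph None" by blast
 then obtain z where "from_sph w = Some z" using to_from_sph[OF w(1)] by (cases "from_sph w") auto
 then have "w = pole z" using to_from_sph[OF w(1)] by (simp add: to_sph_Some pole_def)
 then show ?thesis using w by auto
qed

text \<open>Strict differentiability stated with distances only: near x, f multiplies distances by
  \<kappa> up to a small relative error. Letting both points vary, instead of fixing one at x, is
  what yields local injectivity for \<kappa> > 0 and continuity of the derivative.\<close>

definition metric_deriv :: "('a::metric_space \<Rightarrow> 'a) \<Rightarrow> 'a set \<Rightarrow> 'a \<Rightarrow> real \<Rightarrow> bool" where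
 "metric_deriv f S x \<kappa> \<longleftrightarrow> (\<forall>\<epsilon>>0. \<exists>\<delta>>0. \<forall>y\<in>S. \<forall>y'\<in>S. dist x y < \<delta> \<longrightarrow> dist x y' < \<delta> \<longrightarrow>
   \<bar>dist (f y) (f y') - \<kappa> * dist y y'\<bar> \<le> \<epsilon> * dist y y')"

text \<open>The mean value inequality for v \<mapsto> h v - h'(u) v, whose derivative is small near
  u because \<open>deriv h\<close> is continuous.\<close>

lemma holomorphic_strict_derivative:
 assumes "h holomorphic_on U" "open U" "u \<in> U" "\<epsilon> > 0"
 shows "\<exists>\<delta>>0. ball u \<delta> \<subseteq> U \<and> (\<forall>v\<in>ball u \<delta>. \<forall>w\<in>ball u \<delta>. \<bar>cmod (h v - h w) - cmod (deriv h u) * cmod (v - w)\<bar> \<le> \<epsilon> * cmod (v - w))"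
proof -
 have "isCont (deriv h) u"
  using holomorphic_deriv[OF assms(1,2)] assms(2,3) holomorphic_on_imp_continuous_on continuous_on_eq_continuous_at by blast
 then obtain \<delta>1 where \<delta>1: "\<delta>1 > 0" "\<And>v. dist v u < \<delta>1 \<Longrightarrow> dist (deriv h v) (deriv h u) < \<epsilon>"
  using assms(4) unfolding continuous_at_eps_delta by blast
 obtain \<delta>2 where \<delta>2: "\<delta>2 > 0" "ball u \<delta>2 \<subseteq> U" using assms(2,3) by (meson open_contains_ball)
 define \<delta> where "\<delta> = min \<delta>1 \<delta>2"
 have sub: "ball u \<delta> \<subseteq> U" using \<delta>2 by (auto simp: \<delta>_def)
 have "\<bar>cmod (h v - h w) - cmod (deriv h u) * cmod (v - w)\<bar> \<le> \<epsilon> * cmod (v - w)"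
  if vw: "v \<in> ball u \<delta>" "w \<in> ball u \<delta>" for v w
 proof -
  have "cmod ((h v - deriv h u * v) - (h w - deriv h u * w)) \<le> \<epsilon> * cmod (v - w)"
  proof (rule field_differentiable_bound[OF convex_ball _ _ vw(1,2)])
   fix z assume z: "z \<in> ball u \<delta>"
   then have "(h has_field_derivative deriv h z) (at z)"
    using sub assms(1,2) holomorphic_derivI by blast
   then have "((\<lambda>v. h v - deriv h u * v) has_field_derivative deriv h z - deriv h u) (at z)"
    by (auto intro!: derivative_eq_intros)
   then show "((\<lambda>v. h v - deriv h u * v) has_field_derivative deriv h z - deriv h u) (at z within ball u \<delta>)"
    by (rule has_field_derivative_at_within)
   have "dist (deriv h z) (deriv h u) < \<epsilon>" using \<delta>1(2)[of z] z by (simp add: \<delta>_def dist_commute)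
   then show "cmod (deriv h z - deriv h u) \<le> \<epsilon>" by (simp add: dist_norm)
  qed
  moreover have "(h v - deriv h u * v) - (h w - deriv h u * w) = (h v - h w) - deriv h u * (v - w)"
   by (simp add: algebra_simps)
  moreover have "\<bar>cmod (h v - h w) - cmod (deriv h u * (v - w))\<bar> \<le> cmod ((h v - h w) - deriv h u * (v - w))"
   by (rule norm_triangle_ineq3)
  ultimately show ?thesis by (simp add: norm_mult)
 qed
 then show ?thesis using \<delta>1 \<delta>2 sub by (intro exI[of _ \<delta>]) (auto simp: \<delta>_def)
qed

lemma metric_deriv_emb:
 assumes hol: "h holomorphic_on U" and U: "open U" "u \<in> U"
  and f: "\<And>v. v \<in> U \<Longrightarrow> f (emb a v) = emb a (h v)"
 shows "metric_deriv f RS (emb a u) (cmod (deriv h u) * (emb_wt a u)\<^sup>2 / (emb_wt a (h u))\<^sup>2)"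
 unfolding metric_deriv_def
proof (intro allI impI)
 fix \<epsilon> :: real assume \<epsilon>: "\<epsilon> > 0"
 define m0 where "m0 = cmod (deriv h u)"
 \<comment> \<open>The ratio of the chart weights for a pair of points. Since both points move, it
   is its joint continuity at (u, u) that matters.\<close>
 define r where "r = (\<lambda>p. emb_wt a (fst p) * emb_wt a (snd p) / (emb_wt a (h (fst p)) * emb_wt a (h (snd p))))"
 define r0 where "r0 = r (u, u)"
 have r0: "r0 \<ge> 0" using emb_wt_pos[of a] by (simp add: r0_def r_def less_imp_le)
 \<comment> \<open>Chosen for the final estimate (m0 + 1) * e + r0 * e \<le> \<epsilon>, where e
   \<le> 1 bounds the Euclidean quotient of h by m0 + 1.\<close>
 define e where "e = min 1 (\<epsilon> / (m0 + 1 + r0))"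
 have m0: "m0 \<ge> 0" by (simp add: m0_def)
 have e: "e > 0" "e \<le> 1" using \<epsilon> r0 m0 by (auto simp: e_def)
 have e\<epsilon>: "(m0 + 1) * e + r0 * e \<le> \<epsilon>"
 proof -
  have "(m0 + 1 + r0) * e \<le> (m0 + 1 + r0) * (\<epsilon> / (m0 + 1 + r0))"
   using r0 m0 by (intro mult_left_mono) (auto simp: e_def)
  also have "\<dots> = \<epsilon>" using r0 m0 by simp
  finally show ?thesis by (simp add: algebra_simps)
 qed
 have ch: "isCont h u" using hol U holomorphic_on_imp_continuous_on continuous_on_eq_continuous_at by blast
 have fs: "isCont fst (u, u)" "isCont snd (u, u)" by (intro continuous_fst continuous_snd continuous_ident)+
 have hf: "isCont (\<lambda>p. h (fst p)) (u, u)" using isCont_o2[OF fs(1), of h] ch by simp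
 have hs: "isCont (\<lambda>p. h (snd p)) (u, u)" using isCont_o2[OF fs(2), of h] ch by simp
 have "isCont (\<lambda>p. emb_wt a (h (fst p)) * emb_wt a (h (snd p))) (u, u)"
  by (intro isCont_mult isCont_emb_wt hf hs)
 moreover have "isCont (\<lambda>p. emb_wt a (fst p) * emb_wt a (snd p)) (u, u)"
  by (intro isCont_mult isCont_emb_wt fs)
 moreover have "emb_wt a (h (fst (u, u))) * emb_wt a (h (snd (u, u))) \<noteq> 0" using emb_wt_pos[of a "h u"] by simp
 ultimately have "isCont r (u, u)" unfolding r_def by (intro isCont_divide)
 then obtain \<delta>1 where \<delta>1: "\<delta>1 > 0" "\<And>p. dist p (u, u) < \<delta>1 \<Longrightarrow> dist (r p) r0 < e"
  using e(1) unfolding continuous_at_eps_delta r0_def by blast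
 obtain \<delta>2 where \<delta>2: "\<delta>2 > 0" "ball u \<delta>2 \<subseteq> U"
   "\<And>v w. v \<in> ball u \<delta>2 \<Longrightarrow> w \<in> ball u \<delta>2 \<Longrightarrow> \<bar>cmod (h v - h w) - m0 * cmod (v - w)\<bar> \<le> e * cmod (v - w)"
  using holomorphic_strict_derivative[OF hol U e(1)] unfolding m0_def by blast
 define \<delta> where "\<delta> = min (\<delta>1 / 2) \<delta>2"
 have "\<delta> > 0" using \<delta>1 \<delta>2 by (simp add: \<delta>_def)
 then obtain \<eta> where \<eta>: "\<eta> > 0" "\<forall>y\<in>RS. dist (emb a u) y < \<eta> \<longrightarrow> (\<exists>v. y = emb a v \<and> dist u v < \<delta>)"
  using emb_local_inverse by blast
 have k: "cmod (deriv h u) * (emb_wt a u)\<^sup>2 / (emb_wt a (h u))\<^sup>2 = m0 * r0"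
  by (simp add: m0_def r0_def r_def power2_eq_square)
 have "\<bar>dist (f y) (f y') - m0 * r0 * dist y y'\<bar> \<le> \<epsilon> * dist y y'"
  if y: "y \<in> RS" "y' \<in> RS" "dist (emb a u) y < \<eta>" "dist (emb a u) y' < \<eta>" for y y'
 proof -
  obtain v w where v: "y = emb a v" "dist u v < \<delta>" and w: "y' = emb a w" "dist u w < \<delta>"
   using \<eta>(2) y by metis
  have vw: "v \<in> ball u \<delta>2" "w \<in> ball u \<delta>2" using v w by (auto simp: \<delta>_def)
  have "dist (v, w) (u, u) \<le> dist v u + dist w u"
   unfolding dist_Pair_Pair by (rule sqrt_sum_squares_le_sum) auto
  then have rr: "\<bar>r (v, w) - r0\<bar> < e" using \<delta>1(2)[of "(v, w)"] v w by (auto simp: \<delta>_def dist_commute dist_real_def)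
  define n where "n = cmod (v - w)"
  define R where "R = r (v, w)"
  define g where "g = emb_wt a v * emb_wt a w"
  have g: "g > 0" using emb_wt_pos by (simp add: g_def)
  have d1: "dist y y' = 2 * n / g" by (simp add: v w dist_emb n_def g_def)
  have d2: "dist (f y) (f y') = 2 * cmod (h v - h w) / g * R"
   using f vw \<delta>2(2) emb_wt_pos[of a v] emb_wt_pos[of a w]
   by (simp add: subset_eq v w dist_emb R_def r_def g_def)
  have "\<bar>cmod (h v - h w) * R - m0 * r0 * n\<bar> \<le> \<epsilon> * n"
  proof -
   have A: "\<bar>cmod (h v - h w) - m0 * n\<bar> \<le> e * n" using \<delta>2(3)[OF vw] by (simp add: n_def)
   have n0: "n \<ge> 0" by (simp add: n_def)
   have "cmod (h v - h w) \<le> (m0 + e) * n" using A by (simp add: algebra_simps abs_le_iff)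
   also have "\<dots> \<le> (m0 + 1) * n" using e n0 by (intro mult_right_mono) auto
   finally have B: "cmod (h v - h w) \<le> (m0 + 1) * n" .
   have "cmod (h v - h w) * R - m0 * r0 * n = cmod (h v - h w) * (R - r0) + r0 * (cmod (h v - h w) - m0 * n)"
    by (simp add: algebra_simps)
   also have "\<bar>\<dots>\<bar> \<le> cmod (h v - h w) * \<bar>R - r0\<bar> + r0 * \<bar>cmod (h v - h w) - m0 * n\<bar>"
    by (rule order_trans[OF abs_triangle_ineq]) (simp add: abs_mult r0)
   also have "\<dots> \<le> ((m0 + 1) * n) * e + r0 * (e * n)"
    using A B rr r0 m0 n0 e unfolding R_def by (intro add_mono mult_mono) auto
   also have "\<dots> = ((m0 + 1) * e + r0 * e) * n" by (simp add: algebra_simps)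
   also have "\<dots> \<le> \<epsilon> * n" using e\<epsilon> n0 by (rule mult_right_mono)
   finally show ?thesis .
  qed
  moreover define X where "X = cmod (h v - h w) * R - m0 * r0 * n"
  ultimately have "2 / g * \<bar>X\<bar> \<le> 2 / g * (\<epsilon> * n)"
   using g by (intro mult_left_mono) auto
  moreover have "dist (f y) (f y') - m0 * r0 * dist y y' = 2 / g * X"
   by (simp add: d1 d2 X_def algebra_simps diff_divide_distrib)
  ultimately show ?thesis using g by (simp add: d1 abs_mult mult_ac)
 qed
 then show "\<exists>\<delta>>0. \<forall>y\<in>RS. \<forall>y'\<in>RS. dist (emb a u) y < \<delta> \<longrightarrow> dist (emb a u) y' < \<delta> \<longrightarrow>
   \<bar>dist (f y) (f y') - cmod (deriv h u) * (emb_wt a u)\<^sup>2 / (emb_wt a (h u))\<^sup>2 * dist y y'\<bar> \<le> \<epsilon> * dist y y'"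
  unfolding k using \<eta>(1) by blast
qed

lemma metric_deriv_continuous:
 assumes "metric_deriv f S x \<kappa>" "x \<in> S" shows "continuous (at x within S) f"
 unfolding continuous_within_eps_delta
proof (intro allI impI)
 fix e :: real assume e: "e > 0"
 obtain \<delta> where \<delta>: "\<delta> > 0" "\<forall>y\<in>S. \<forall>y'\<in>S. dist x y < \<delta> \<longrightarrow> dist x y' < \<delta> \<longrightarrow>
   \<bar>dist (f y) (f y') - \<kappa> * dist y y'\<bar> \<le> 1 * dist y y'"
  using assms(1) unfolding metric_deriv_def by (meson zero_less_one)
 have "dist (f y) (f x) < e" if y: "y \<in> S" "dist y x < min \<delta> (e / (\<bar>\<kappa>\<bar> + 1))" for y
 proof -
  have "\<bar>dist (f y) (f x) - \<kappa> * dist y x\<bar> \<le> dist y x"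
   using \<delta>(2)[rule_format, of y x] y assms(2) \<delta>(1) by (simp add: dist_commute)
  moreover have "\<kappa> * dist y x \<le> \<bar>\<kappa>\<bar> * dist y x" by (intro mult_right_mono) auto
  ultimately have "dist (f y) (f x) \<le> (\<bar>\<kappa>\<bar> + 1) * dist y x" by (simp add: algebra_simps)
  also have "\<dots> < e" using y(2) by (simp add: field_simps)
  finally show ?thesis .
 qed
 moreover have "min \<delta> (e / (\<bar>\<kappa>\<bar> + 1)) > 0" using \<delta>(1) e by simp
 ultimately show "\<exists>d>0. \<forall>x'\<in>S. dist x' x < d \<longrightarrow> dist (f x') (f x) < e" by blast
qed

text \<open>The slopes in numerator and denominator both tend to 1, so spherical and chordal
  quotients have the same limit. \<open>Lim\<close> returns it because x is a limit point of the
  sphere.\<close>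

lemma metric_deriv_sph_dnorm:
 assumes md: "metric_deriv f RS x \<kappa>" and x: "x \<in> RS" and fRS: "\<And>y. y \<in> RS \<Longrightarrow> f y \<in> RS"
 shows "sph_dnorm f x = \<kappa>"
proof -
 have cont: "(f \<longlongrightarrow> f x) (at x within RS)" using metric_deriv_continuous[OF md x] by (simp add: continuous_within)
 have d0: "((\<lambda>y. dist (f y) (f x)) \<longlongrightarrow> 0) (at x within RS)" using cont by (rule tendsto_dist_iff[THEN iffD1])
 have d1: "((\<lambda>y. dist y x) \<longlongrightarrow> 0) (at x within RS)" using tendsto_ident_at by (rule tendsto_dist_iff[THEN iffD1])
 have s0: "((\<lambda>y. arcsin_slope (dist (f y) (f x))) \<longlongrightarrow> 1) (at x within RS)"
  using filterlim_compose[OF arcsin_slope_tendsto d0] .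
 have s1: "((\<lambda>y. arcsin_slope (dist y x)) \<longlongrightarrow> 1) (at x within RS)"
  using filterlim_compose[OF arcsin_slope_tendsto d1] .
 have q: "((\<lambda>y. dist (f y) (f x) / dist y x) \<longlongrightarrow> \<kappa>) (at x within RS)"
  unfolding tendsto_iff eventually_at
 proof (intro allI impI)
  fix e :: real assume e: "e > 0"
  obtain \<delta> where \<delta>: "\<delta> > 0" "\<forall>y\<in>RS. \<forall>y'\<in>RS. dist x y < \<delta> \<longrightarrow> dist x y' < \<delta> \<longrightarrow>
   \<bar>dist (f y) (f y') - \<kappa> * dist y y'\<bar> \<le> e / 2 * dist y y'"
   using md e unfolding metric_deriv_def by (meson half_gt_zero)
  have "dist (dist (f y) (f x) / dist y x) \<kappa> < e" if y: "y \<in> RS" "y \<noteq> x" "dist y x < \<delta>" for y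
  proof -
   have p: "dist y x > 0" using y by simp
   have "\<bar>dist (f y) (f x) - \<kappa> * dist y x\<bar> \<le> e / 2 * dist y x"
    using \<delta>(2)[rule_format, of y x] y x \<delta>(1) by (simp add: dist_commute)
   then have "\<bar>dist (f y) (f x) - \<kappa> * dist y x\<bar> / dist y x \<le> e / 2" using p by (simp add: field_simps)
   moreover have "dist (f y) (f x) / dist y x - \<kappa> = (dist (f y) (f x) - \<kappa> * dist y x) / dist y x"
    using p by (simp add: field_simps)
   ultimately have "\<bar>dist (f y) (f x) / dist y x - \<kappa>\<bar> \<le> e / 2" using p by (simp only: abs_divide abs_of_pos)
   then show ?thesis using e unfolding dist_real_def by linarith
  qed
  then show "\<exists>d>0. \<forall>y\<in>RS. y \<noteq> x \<and> dist y x < d \<longrightarrow> dist (dist (f y) (f x) / dist y x) \<kappa> < e"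
   using \<delta>(1) by blast
 qed
 have "((\<lambda>y. arcsin_slope (dist (f y) (f x)) * (dist (f y) (f x) / dist y x) / arcsin_slope (dist y x)) \<longlongrightarrow> 1 * \<kappa> / 1) (at x within RS)"
  by (intro tendsto_intros s0 s1 q) simp
 then have "((\<lambda>y. sdist (f y) (f x) / sdist y x) \<longlongrightarrow> \<kappa>) (at x within RS)"
  by (simp add: sdist_eq_slope mult.commute)
 then show ?thesis unfolding sph_dnorm_def
  using RS_islimpt[OF x] by (intro tendsto_Lim) (auto simp: trivial_limit_within)
qed

section \<open>Rational maps on the sphere\<close>

text \<open>In the chart u = 1 / (z - a) the map with homogeneous components P and N reads N / (P -
  a N). This is the denominator; it vanishes exactly where the image is the point a.\<close>

definition rchart_den :: "complex poly \<Rightarrow> complex poly \<Rightarrow> complex \<Rightarrow> complex \<Rightarrow> complex" where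
 "rchart_den p q a u = hpoly (rat_deg p q) p (1 + a * u) u - a * hpoly (rat_deg p q) q (1 + a * u) u"

definition rchart :: "complex poly \<Rightarrow> complex poly \<Rightarrow> complex \<Rightarrow> complex \<Rightarrow> complex" where
 "rchart p q a u = hpoly (rat_deg p q) q (1 + a * u) u / rchart_den p q a u"

lemma rat_sph_emb:
 assumes "rat_pair p q" "rat_deg p q \<ge> 1"
 shows "rat_sph p q (emb a u) = (if rchart_den p q a u = 0 then pole a else emb a (rchart p q a u))"
proof -
 define N D where "N = hpoly (rat_deg p q) q (1 + a * u) u" and "D = rchart_den p q a u"
 have "hpoly (rat_deg p q) p (1 + a * u) u = D + a * N" by (simp add: N_def D_def rchart_den_def)
 then have eq: "rat_sph p q (emb a u) = homsph (D + a * N) N" and nz: "D + a * N \<noteq> 0 \<or> N \<noteq> 0"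
  using rat_sph_homsph[OF assms(1) emb_nonzero assms(2), of a u] hpoly_not_both_zero[OF assms(1) emb_nonzero, of a u]
  by (simp_all add: N_def emb_def)
 show ?thesis
 proof (cases "D = 0")
  case True
  then have "N \<noteq> 0" using nz by auto
  then show ?thesis using True eq homsph_scale[of N a 1] by (simp add: D_def pole_def mult.commute)
 next
  case False
  have "homsph (D * (1 + a * (N / D))) (D * (N / D)) = homsph (1 + a * (N / D)) (N / D)"
   using False emb_nonzero[of a "N / D"] by (intro homsph_scale) auto
  moreover have "D * (1 + a * (N / D)) = D + a * N" "D * (N / D) = N" using False by (simp_all add: field_simps)
  ultimately have "homsph (D + a * N) N = emb a (N / D)" by (simp add: emb_def)
  then show ?thesis using eq False by (simp add: D_def N_def rchart_def)
 qed
qed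

lemma rchart_den_eq_0_iff:
 assumes "rat_pair p q" "rat_deg p q \<ge> 1"
 shows "rchart_den p q a u = 0 \<longleftrightarrow> rat_sph p q (emb a u) = pole a"
 using rat_sph_emb[OF assms, of a u] emb_neq_pole by auto

lemma holomorphic_hpoly: "(\<lambda>u. hpoly d p (1 + a * u) u) holomorphic_on S"
 unfolding hpoly_def by (intro holomorphic_intros)

lemma holomorphic_rchart_den: "rchart_den p q a holomorphic_on S"
 unfolding rchart_den_def by (intro holomorphic_intros holomorphic_hpoly)

lemma open_rchart_domain:
 assumes "rat_pair p q" "rat_deg p q \<ge> 1"
 shows "open {u. rat_sph p q (emb a u) \<noteq> pole a}"
proof -
 have "open (rchart_den p q a -` (- {0}))"
  using holomorphic_on_imp_continuous_on[OF holomorphic_rchart_den] by (intro open_vimage) auto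
 moreover have "rchart_den p q a -` (- {0}) = {u. rat_sph p q (emb a u) \<noteq> pole a}"
  using rchart_den_eq_0_iff[OF assms] by auto
 ultimately show ?thesis by simp
qed

lemma holomorphic_rchart:
 assumes "rat_pair p q" "rat_deg p q \<ge> 1" "\<And>u. u \<in> S \<Longrightarrow> rat_sph p q (emb a u) \<noteq> pole a"
 shows "rchart p q a holomorphic_on S"
 unfolding rchart_def using assms(3) rchart_den_eq_0_iff[OF assms(1,2)]
 by (intro holomorphic_on_divide holomorphic_hpoly holomorphic_rchart_den) auto

lemma rat_sph_emb_eq:
 assumes "rat_pair p q" "rat_deg p q \<ge> 1" "rat_sph p q (emb a u) \<noteq> pole a"
 shows "rat_sph p q (emb a u) = emb a (rchart p q a u)"
 using rat_sph_emb[OF assms(1,2), of a u] assms(3) by (auto split: if_splits)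

lemma rat_sph_metric_deriv_emb:
 assumes "rat_pair p q" "rat_deg p q \<ge> 1" "rat_sph p q (emb a u) \<noteq> pole a"
 shows "metric_deriv (rat_sph p q) RS (emb a u)
  (cmod (deriv (rchart p q a) u) * (emb_wt a u)\<^sup>2 / (emb_wt a (rchart p q a u))\<^sup>2)"
 using assms(3) by (intro metric_deriv_emb[OF holomorphic_rchart[OF assms(1,2)] open_rchart_domain[OF assms(1,2)]]
  rat_sph_emb_eq[OF assms(1,2)]) auto

text \<open>A pole different from x and from its image makes one chart usable at both
  points.\<close>

lemma rat_sph_metric_deriv:
 assumes "rat_pair p q" "rat_deg p q \<ge> 1" "x \<in> RS"
 shows "metric_deriv (rat_sph p q) RS x (sph_dnorm (rat_sph p q) x)"
proof -
 obtain a where a: "pole a \<notin> {x, rat_sph p q x}" using pole_avoid[of "{x, rat_sph p q x}"] by auto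
 then have "x \<noteq> pole a" by auto
 then obtain u where u: "x = emb a u" using emb_surj[OF assms(3)] by blast
 have "metric_deriv (rat_sph p q) RS x (cmod (deriv (rchart p q a) u) * (emb_wt a u)\<^sup>2 / (emb_wt a (rchart p q a u))\<^sup>2)"
  using rat_sph_metric_deriv_emb[OF assms(1,2)] a u by auto
 moreover from this have "sph_dnorm (rat_sph p q) x = cmod (deriv (rchart p q a) u) * (emb_wt a u)\<^sup>2 / (emb_wt a (rchart p q a u))\<^sup>2"
  by (rule metric_deriv_sph_dnorm[OF _ assms(3) rat_sph_in_RS])
 ultimately show ?thesis by simp
qed

lemma deriv_rchart_eq_0_iff:
 assumes "rat_pair p q" "rat_deg p q \<ge> 1" "rat_sph p q (emb a u) \<noteq> pole a"
 shows "deriv (rchart p q a) u = 0 \<longleftrightarrow> sph_dnorm (rat_sph p q) (emb a u) = 0"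
 using metric_deriv_sph_dnorm[OF rat_sph_metric_deriv_emb[OF assms] emb_in_RS rat_sph_in_RS]
  emb_wt_pos[of a u] emb_wt_pos[of a "rchart p q a u"] by auto

lemma continuous_rat_sph:
 assumes "rat_pair p q" "rat_deg p q \<ge> 1" shows "continuous_on RS (rat_sph p q)"
 using metric_deriv_continuous[OF rat_sph_metric_deriv[OF assms]] by (auto simp: continuous_on_eq_continuous_within)

lemma metric_derivE:
 assumes "metric_deriv f S x k" "e > 0"
 obtains d where "d > 0" "\<And>y y'. y \<in> S \<Longrightarrow> y' \<in> S \<Longrightarrow> dist x y < d \<Longrightarrow> dist x y' < d \<Longrightarrow>
   \<bar>dist (f y) (f y') - k * dist y y'\<bar> \<le> e * dist y y'"
 using assms unfolding metric_deriv_def by blast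

text \<open>The derivatives at x and at y both describe the distance quotient of the same pair of
  points close to y, so they differ by at most e. This is the continuity of the derivative
  norm.\<close>

lemma metric_deriv_close:
 assumes "metric_deriv f RS x k" "\<And>y. y \<in> RS \<Longrightarrow> metric_deriv f RS y (g y)" "x \<in> RS" "e > 0"
 shows "\<exists>d>0. \<forall>y\<in>RS. dist x y < d \<longrightarrow> \<bar>g y - k\<bar> \<le> e"
proof -
 have e2: "e / 2 > 0" using assms(4) by simp
 obtain d where d: "d > 0" "\<And>y y'. y \<in> RS \<Longrightarrow> y' \<in> RS \<Longrightarrow> dist x y < d \<Longrightarrow> dist x y' < d \<Longrightarrow>
   \<bar>dist (f y) (f y') - k * dist y y'\<bar> \<le> e / 2 * dist y y'"
  using metric_derivE[OF assms(1) e2] by blast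
 have "\<bar>g y - k\<bar> \<le> e" if y: "y \<in> RS" "dist x y < d" for y
 proof -
  obtain d' where d': "d' > 0" "\<And>z z'. z \<in> RS \<Longrightarrow> z' \<in> RS \<Longrightarrow> dist y z < d' \<Longrightarrow> dist y z' < d' \<Longrightarrow>
   \<bar>dist (f z) (f z') - g y * dist z z'\<bar> \<le> e / 2 * dist z z'"
   using metric_derivE[OF assms(2)[OF y(1)] e2] by blast
  define d'' where "d'' = min d' (d - dist x y)"
  have "d'' > 0" using d' y by (simp add: d''_def)
  then obtain z where z: "z \<in> RS" "z \<noteq> y" "dist z y < d''"
   using RS_islimpt[OF y(1)] unfolding islimpt_approachable by blast
  have p: "dist y z > 0" using z by simp
  have "dist x z \<le> dist x y + dist z y" using dist_triangle[of x z y] by (simp add: dist_commute)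
  then have "dist x z < d" using z(3) by (simp add: d''_def)
  then have 1: "\<bar>dist (f y) (f z) - k * dist y z\<bar> \<le> e / 2 * dist y z"
   using d(2)[OF y(1) z(1) y(2)] by simp
  have 2: "\<bar>dist (f y) (f z) - g y * dist y z\<bar> \<le> e / 2 * dist y z"
   using d'(2)[of y z] y(1) z d'(1) by (simp add: d''_def dist_commute)
  have "(dist (f y) (f z) - k * dist y z) - (dist (f y) (f z) - g y * dist y z) = (g y - k) * dist y z"
   by (simp add: algebra_simps)
  then have "\<bar>g y - k\<bar> * dist y z = \<bar>(dist (f y) (f z) - k * dist y z) - (dist (f y) (f z) - g y * dist y z)\<bar>"
   using p by (simp add: abs_mult)
  also have "\<dots> \<le> e * dist y z" using 1 2 by linarith
  finally show ?thesis using p by simp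
 qed
 then show ?thesis using d(1) by blast
qed

lemma continuous_sph_dnorm:
 assumes "rat_pair p q" "rat_deg p q \<ge> 1" shows "continuous_on RS (sph_dnorm (rat_sph p q))"
 unfolding continuous_on_iff
proof (intro ballI allI impI)
 fix x and e :: real assume "x \<in> RS" "e > 0"
 then obtain d where d: "d > 0" "\<forall>y\<in>RS. dist x y < d \<longrightarrow> \<bar>sph_dnorm (rat_sph p q) y - sph_dnorm (rat_sph p q) x\<bar> \<le> e / 2"
  using metric_deriv_close[OF rat_sph_metric_deriv[OF assms] rat_sph_metric_deriv[OF assms], of x "e / 2"] by auto
 then have "\<forall>y\<in>RS. dist y x < d \<longrightarrow> dist (sph_dnorm (rat_sph p q) y) (sph_dnorm (rat_sph p q) x) < e"
  unfolding dist_real_def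
 proof (intro ballI impI)
  fix y assume "y \<in> RS" "dist y x < d"
  then have "\<bar>sph_dnorm (rat_sph p q) y - sph_dnorm (rat_sph p q) x\<bar> \<le> e / 2"
   using d(2) by (simp add: dist_commute)
  then show "\<bar>sph_dnorm (rat_sph p q) y - sph_dnorm (rat_sph p q) x\<bar> < e" using \<open>e > 0\<close> by linarith
 qed
 then show "\<exists>d>0. \<forall>y\<in>RS. dist y x < d \<longrightarrow> dist (sph_dnorm (rat_sph p q) y) (sph_dnorm (rat_sph p q) x) < e"
  using d(1) by blast
qed

lemma sph_dnorm_nonneg:
 assumes "rat_pair p q" "rat_deg p q \<ge> 1" "x \<in> RS" shows "sph_dnorm (rat_sph p q) x \<ge> 0"
proof -
 obtain a where a: "pole a \<notin> {x, rat_sph p q x}" using pole_avoid[of "{x, rat_sph p q x}"] by auto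
 then have "x \<noteq> pole a" by auto
 then obtain u where u: "x = emb a u" using emb_surj[OF assms(3)] by blast
 show ?thesis using metric_deriv_sph_dnorm[OF rat_sph_metric_deriv_emb[OF assms(1,2)] emb_in_RS rat_sph_in_RS, of a u] a u by auto
qed

text \<open>The open mapping theorem in a chart around x and its image; the map is not constant
  there because its fibres are finite.\<close>

lemma rat_sph_open:
 assumes "rat_pair p q" "rat_deg p q \<ge> 1" "openin (top_of_set RS) V"
 shows "openin (top_of_set RS) (rat_sph p q ` V)"
proof (subst openin_subopen, intro ballI)
 define f where "f = rat_sph p q"
 fix y assume "y \<in> rat_sph p q ` V"
 then obtain x where x: "x \<in> V" "y = f x" by (auto simp: f_def)
 obtain V' where V': "open V'" "V = RS \<inter> V'" using assms(3) by (auto simp: openin_open)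
 obtain a where a: "pole a \<notin> {x, f x}" using pole_avoid[of "{x, f x}"] by auto
 have "x \<in> RS" using x V' by auto
 moreover have "x \<noteq> pole a" using a by auto
 ultimately obtain u where u: "x = emb a u" using emb_surj by blast
 define U where "U = {u. f (emb a u) \<noteq> pole a} \<inter> emb a -` V'"
 have "open U" unfolding U_def f_def by (intro open_Int open_rchart_domain[OF assms(1,2)] open_emb_vimage V'(1))
 moreover have "u \<in> U" using a u x V' by (auto simp: U_def)
 ultimately obtain r where r: "r > 0" "ball u r \<subseteq> U" by (meson open_contains_ball)
 define h where "h = rchart p q a"
 have h: "f (emb a v) = emb a (h v)" if "v \<in> ball u r" for v
  using rat_sph_emb_eq[OF assms(1,2)] that r by (auto simp: f_def h_def U_def)
 have hol: "h holomorphic_on ball u r" unfolding h_def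
  by (rule holomorphic_rchart[OF assms(1,2)]) (use r in \<open>auto simp: U_def f_def\<close>)
 have "\<not> h constant_on ball u r"
 proof
  assume "h constant_on ball u r"
  then obtain c where "\<And>v. v \<in> ball u r \<Longrightarrow> h v = c" by (auto simp: constant_on_def)
  then have "emb a ` ball u r \<subseteq> {x \<in> RS. f x = emb a c}" using h emb_in_RS by auto
  then have "finite (emb a ` ball u r)"
   unfolding f_def by (rule finite_subset) (rule rat_sph_fiber_finite[OF assms(1,2)])
  then have "finite (ball u r)" using inj_emb by (metis finite_imageD inj_on_subset subset_UNIV)
  then show False using r(1) finite_imp_not_open[of "ball u r"] by auto
 qed
 then have "open (h ` ball u r)" by (intro open_mapping_thm[OF hol]) auto
 then have "openin (top_of_set RS) (emb a ` h ` ball u r)" by (rule openin_emb_image)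
 moreover have "y \<in> emb a ` h ` ball u r" using r(1) h[of u] x u by (auto simp: image_iff intro!: bexI[of _ u])
 moreover have "emb a ` h ` ball u r \<subseteq> rat_sph p q ` V"
 proof
  fix w assume "w \<in> emb a ` h ` ball u r"
  then obtain v where v: "v \<in> ball u r" "w = emb a (h v)" by auto
  then have "w = f (emb a v)" using h by simp
  moreover have "emb a v \<in> V" using v(1) r(2) V'(2) emb_in_RS by (auto simp: U_def)
  ultimately show "w \<in> rat_sph p q ` V" by (auto simp: f_def)
 qed
 ultimately show "\<exists>T. openin (top_of_set RS) T \<and> y \<in> T \<and> T \<subseteq> rat_sph p q ` V" by blast
qed

text \<open>The image is open by \<open>rat_sph_open\<close>, closed by compactness, and the sphere
  is connected.\<close>

lemma rat_sph_onto:
 assumes "rat_pair p q" "rat_deg p q \<ge> 1" shows "rat_sph p q ` RS = RS"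
proof -
 have "openin (top_of_set RS) (rat_sph p q ` RS)" using rat_sph_open[OF assms, of RS] by auto
 moreover have "compact (rat_sph p q ` RS)"
  by (intro compact_continuous_image continuous_rat_sph[OF assms] compact_RS)
 then have "closedin (top_of_set RS) (rat_sph p q ` RS)"
  using rat_sph_in_RS by (intro closed_subset compact_imp_closed) auto
 moreover have "rat_sph p q ` RS \<noteq> {}" using pole_in_RS by auto
 ultimately show ?thesis using connected_RS unfolding connected_clopen by blast
qed

section \<open>Critical points and coverings\<close>

lemma is_unit_poly_degree: "is_unit (p :: complex poly) \<Longrightarrow> degree p = 0"
 by (erule is_unit_polyE) auto

text \<open>The coefficient of p' q - p q' in degree deg p + deg q - 1 is (deg p - deg q) times the
  product of the leading coefficients. It is non-zero for different degrees, so the Wronskian is a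
  non-constant polynomial.\<close>

lemma wronskian_root_aux:
 fixes p q :: "complex poly"
 assumes "p \<noteq> 0" "q \<noteq> 0" "degree p \<noteq> degree q" "max (degree p) (degree q) \<ge> 2"
 shows "\<exists>z. poly (pderiv p * q - p * pderiv q) z = 0"
proof -
 define n where "n = degree p + degree q - 1"
 have c1: "coeff (pderiv p * q) n = of_nat (degree p) * lead_coeff p * lead_coeff q"
 proof (cases "degree p = 0")
  case True then show ?thesis by (simp add: pderiv_eq_0_iff[THEN iffD2])
 next
  case False
  then have "n = degree (pderiv p) + degree q" by (simp add: n_def degree_pderiv)
  then have "coeff (pderiv p * q) n = lead_coeff (pderiv p) * lead_coeff q" by (simp add: coeff_mult_degree_sum)
  then show ?thesis using False by (simp add: degree_pderiv coeff_pderiv)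
 qed
 have c2: "coeff (p * pderiv q) n = of_nat (degree q) * lead_coeff p * lead_coeff q"
 proof (cases "degree q = 0")
  case True then show ?thesis by (simp add: pderiv_eq_0_iff[THEN iffD2])
 next
  case False
  then have "n = degree p + degree (pderiv q)" by (simp add: n_def degree_pderiv)
  then have "coeff (p * pderiv q) n = lead_coeff p * lead_coeff (pderiv q)" by (simp add: coeff_mult_degree_sum)
  then show ?thesis using False by (simp add: degree_pderiv coeff_pderiv)
 qed
 have "coeff (pderiv p * q - p * pderiv q) n = (of_nat (degree p) - of_nat (degree q)) * (lead_coeff p * lead_coeff q)"
  unfolding coeff_diff c1 c2 by (simp add: algebra_simps)
 also have "\<dots> \<noteq> 0" using assms by simp
 finally have "degree (pderiv p * q - p * pderiv q) \<ge> n" by (rule le_degree)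
 moreover have "n \<ge> 1" using assms(4) by (auto simp: n_def max_def split: if_splits)
 ultimately have "degree (pderiv p * q - p * pderiv q) \<noteq> 0" by linarith
 then have "\<not> constant (poly (pderiv p * q - p * pderiv q))" by (simp add: constant_degree)
 then show ?thesis by (rule fundamental_theorem_of_algebra)
qed

lemma wronskian_root:
 fixes p q :: "complex poly"
 assumes "coprime p q" "max (degree p) (degree q) \<ge> 2"
 shows "\<exists>z. poly (pderiv p * q - p * pderiv q) z = 0"
proof (cases "degree p = degree q")
 case False
 have "p \<noteq> 0" "q \<noteq> 0"
  using assms is_unit_poly_degree[of p] is_unit_poly_degree[of q] by auto
 then show ?thesis using wronskian_root_aux False assms(2) by blast
next
 case True
 define c where "c = lead_coeff p / lead_coeff q"
 \<comment> \<open>For equal degrees the top coefficient cancels. Subtracting c q from p lowers the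
   degree and does not change the Wronskian.\<close>
 define r where "r = p - smult c q"
 have d: "degree q \<ge> 2" using True assms(2) by simp
 then have q0: "q \<noteq> 0" by auto
 then have "coeff r (degree q) = 0" using True by (simp add: r_def c_def)
 moreover have "degree r \<le> degree q" unfolding r_def using True degree_smult_le[of c q] by (intro degree_diff_le) auto
 ultimately have dr: "degree r < degree q \<or> r = 0" by (metis eq_zero_or_degree_less le_neq_implies_less leading_coeff_0_iff)
 have r0: "r \<noteq> 0"
 proof
  assume "r = 0"
  then have "p = smult c q" by (simp add: r_def)
  then have "q dvd p" by (simp add: dvd_smult)
  then have "is_unit q" using assms(1) by (metis coprime_absorb_right)
  then show False using d by (auto dest: is_unit_poly_degree)
 qed
 have "pderiv p * q - p * pderiv q = pderiv r * q - r * pderiv q"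
  by (simp add: r_def pderiv_diff pderiv_smult algebra_simps)
 then show ?thesis using wronskian_root_aux[OF r0 q0] dr r0 d by auto
qed

text \<open>At a root of p' q - p q' the derivative of q / (p - a q) vanishes, whatever a is; for a
  different from the point and from its image this quotient is the map in a chart. The critical
  value obtained here supplies the open set that inverse branches avoid.\<close>

lemma exists_critical_point:
 assumes "rat_pair p q" "rat_deg p q \<ge> 2"
 shows "\<exists>x\<in>RS. sph_dnorm (rat_sph p q) x = 0"
proof -
 define f where "f = rat_sph p q"
 obtain z where z: "poly (pderiv p * q - p * pderiv q) z = 0"
  using wronskian_root assms by (auto simp: rat_pair_def rat_deg_def)
 define x where "x = to_sph (Some z)"
 have x: "x = pole z" "x \<in> RS" by (simp_all add: x_def pole_def to_sph_Some pole_in_RS[unfolded pole_def])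
 obtain a where a: "pole a \<notin> {x, f x}" using pole_avoid[of "{x, f x}"] by auto
 have za: "z \<noteq> a" using a x by auto
 define u where "u = 1 / (z - a)"
 have u0: "u \<noteq> 0" and zu: "a + 1 / u = z" using za by (auto simp: u_def)
 then have xu: "x = emb a u" by (simp add: emb_finite x_def)
 define N D where "N = (\<lambda>v. poly q (a + 1 / v))" and "D = (\<lambda>v. poly (p - smult a q) (a + 1 / v))"
 have fe: "f (emb a v) = homsph (D v + a * N v) (N v)" if "v \<noteq> 0" for v
 proof -
  define t where "t = a + 1 / v"
  have "emb a v = homsph t 1" using that by (simp add: emb_finite to_sph_Some t_def)
  then have "f (emb a v) = homsph (poly p t) (poly q t)"
   using rat_sph_homsph[OF assms(1), of t 1] assms(2) by (simp add: f_def hpoly_nonzero rat_deg_def)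
  then show ?thesis by (simp add: D_def N_def t_def)
 qed
 have nz: "D v + a * N v \<noteq> 0 \<or> N v \<noteq> 0" for v
  using rat_pair_no_common_root[OF assms(1), of "a + 1 / v"] by (auto simp: D_def N_def)
 have Du: "D u \<noteq> 0"
 proof
  assume 0: "D u = 0"
  then have "f x = homsph (N u * a) (N u * 1)" using fe[OF u0] xu by (simp add: mult.commute)
  also have "\<dots> = pole a" using nz[of u] 0 unfolding pole_def by (intro homsph_scale) auto
  finally show False using a by auto
 qed
 have cD: "continuous_on (- {0}) D" unfolding D_def by (intro continuous_intros) auto
 define U where "U = {v \<in> - {0}. D v \<in> - {0}}"
 have "open U" unfolding U_def using continuous_open_preimage[OF cD, of "- {0}"]
  by (auto simp: open_Compl Int_def vimage_def)
 have uU: "u \<in> U" using u0 Du by (simp add: U_def)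
 define h where "h = (\<lambda>v. N v / D v)"
 have hol: "h holomorphic_on U" unfolding h_def N_def D_def
  by (intro holomorphic_intros) (auto simp: U_def D_def)
 have fh: "f (emb a v) = emb a (h v)" if "v \<in> U" for v
 proof -
  have v: "v \<noteq> 0" "D v \<noteq> 0" using that by (auto simp: U_def)
  have "homsph (D v * (1 + a * h v)) (D v * h v) = homsph (1 + a * h v) (h v)"
   using v emb_nonzero[of a "h v"] by (intro homsph_scale) auto
  moreover have "D v * (1 + a * h v) = D v + a * N v" "D v * h v = N v" using v by (simp_all add: h_def field_simps)
  ultimately show ?thesis using fe[OF v(1)] by (simp add: emb_def)
 qed
 have md: "metric_deriv f RS x (cmod (deriv h u) * (emb_wt a u)\<^sup>2 / (emb_wt a (h u))\<^sup>2)"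
  unfolding xu by (rule metric_deriv_emb[OF hol \<open>open U\<close> uU fh])
 define g where "g = (\<lambda>t. poly q t / poly (p - smult a q) t)"
 have Dz: "poly (p - smult a q) z \<noteq> 0" using Du zu by (simp add: D_def)
 have "(g has_field_derivative (poly (pderiv q) z * poly (p - smult a q) z - poly q z * poly (pderiv (p - smult a q)) z)
   / (poly (p - smult a q) z * poly (p - smult a q) z)) (at z)"
  unfolding g_def by (intro DERIV_divide poly_DERIV Dz)
 moreover have "poly (pderiv q) z * poly (p - smult a q) z - poly q z * poly (pderiv (p - smult a q)) z = 0"
  using z by (simp add: pderiv_diff pderiv_smult algebra_simps)
 ultimately have "(g has_field_derivative 0) (at (a + 1 / u))" using zu by simp
 moreover have "((\<lambda>v. a + 1 / v) has_field_derivative - 1 / u\<^sup>2) (at u)"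
  using u0 by (auto intro!: derivative_eq_intros simp: power2_eq_square)
 ultimately have "((\<lambda>v. g (a + 1 / v)) has_field_derivative 0 * (- 1 / u\<^sup>2)) (at u)" by (rule DERIV_chain2)
 then have "(h has_field_derivative 0) (at u)" by (simp add: h_def N_def D_def g_def)
 then have "deriv h u = 0" by (rule DERIV_imp_deriv)
 then have "metric_deriv f RS x 0" using md by simp
 then have "sph_dnorm f x = 0" using x(2) by (rule metric_deriv_sph_dnorm) (simp add: f_def rat_sph_in_RS)
 then show ?thesis using x by (auto simp: f_def)
qed

text \<open>A proper local homeomorphism is a covering. Disjoint balls around the finitely many
  points of a fibre serve as sheets, and compactness of the rest R of X keeps a neighbourhood of y
  free of further preimages.\<close>

lemma covering_space_finite_fibres:
 fixes f :: "'a::metric_space \<Rightarrow> 'a"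
 assumes X: "compact X" and contf: "continuous_on X f" and onto: "f ` X = X"
  and opn: "\<And>V. openin (top_of_set X) V \<Longrightarrow> openin (top_of_set X) (f ` V)"
  and fin: "\<And>y. finite {x \<in> X. f x = y}"
  and E: "closed E"
  and inj: "\<And>x. x \<in> X \<Longrightarrow> f x \<notin> E \<Longrightarrow> \<exists>\<delta>>0. inj_on f (ball x \<delta> \<inter> X)"
 shows "covering_space {x \<in> X. f x \<notin> E} f (X - E)"
 unfolding covering_space_def
proof (intro conjI ballI)
 let ?C = "{x \<in> X. f x \<notin> E}" and ?S = "X - E"
 show "continuous_on ?C f" by (rule continuous_on_subset[OF contf]) auto
 show img: "f ` ?C = ?S" using onto by auto
 fix y assume y: "y \<in> ?S"
 define \<Phi> where "\<Phi> = {x \<in> X. f x = y}"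
 have fin\<Phi>: "finite \<Phi>" unfolding \<Phi>_def by (rule fin)
 have "y \<in> f ` X" using y onto by simp
 then have ne: "\<Phi> \<noteq> {}" by (auto simp: \<Phi>_def)
 have "\<exists>\<delta>. \<forall>x\<in>\<Phi>. \<delta> x > 0 \<and> inj_on f (ball x (\<delta> x) \<inter> X)"
  by (rule bchoice) (use inj y in \<open>auto simp: \<Phi>_def\<close>)
 then obtain \<delta> where \<delta>: "\<And>x. x \<in> \<Phi> \<Longrightarrow> \<delta> x > 0" "\<And>x. x \<in> \<Phi> \<Longrightarrow> inj_on f (ball x (\<delta> x) \<inter> X)" by blast
 obtain r where r: "r > 0" "\<And>x x'. x \<in> \<Phi> \<Longrightarrow> x' \<in> \<Phi> \<Longrightarrow> x \<noteq> x' \<Longrightarrow> 2 * r \<le> dist x x'" "\<And>x. x \<in> \<Phi> \<Longrightarrow> r \<le> \<delta> x"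
 proof -
  define A where "A = insert 1 ((\<lambda>(x,x'). dist x x' / 2) ` {(x,x') \<in> \<Phi> \<times> \<Phi>. x \<noteq> x'} \<union> \<delta> ` \<Phi>)"
  have finP: "finite {(x,x') \<in> \<Phi> \<times> \<Phi>. x \<noteq> x'}" using fin\<Phi> by (intro finite_subset[OF _ finite_cartesian_product[OF fin\<Phi> fin\<Phi>]]) auto
  have finA: "finite A" unfolding A_def using finP fin\<Phi> by auto
  have pos: "\<forall>a\<in>A. a > 0" using \<delta>(1) by (auto simp: A_def)
  have "Min A > 0" using finA pos by (simp add: A_def)
  moreover have "2 * Min A \<le> dist x x'" if "x \<in> \<Phi>" "x' \<in> \<Phi>" "x \<noteq> x'" for x x'
  proof -
   have "dist x x' / 2 \<in> A" using that by (force simp: A_def)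
   then have "Min A \<le> dist x x' / 2" by (rule Min_le[OF finA])
   then show ?thesis by simp
  qed
  moreover have "Min A \<le> \<delta> x" if "x \<in> \<Phi>" for x
   using that finA by (intro Min_le) (auto simp: A_def)
  ultimately show ?thesis by (rule that)
 qed
 define N where "N x = ball x r \<inter> X" for x
 have Nop: "openin (top_of_set X) (N x)" for x by (auto simp: N_def openin_open)
 have Ninj: "inj_on f (N x)" if "x \<in> \<Phi>" for x
  using \<delta>(2)[OF that] r(3)[OF that] by (rule_tac inj_on_subset) (auto simp: N_def)
 define R where "R = X - (\<Union>x\<in>\<Phi>. ball x r)"
 have "compact R" unfolding R_def using X by (intro compact_diff) auto
 then have "compact (f ` R)" by (rule compact_continuous_image[rotated]) (rule continuous_on_subset[OF contf], auto simp: R_def)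
 then have clR: "closed (f ` R)" by (rule compact_imp_closed)
 define T where "T = (\<Inter>x\<in>\<Phi>. f ` N x) - f ` R - E"
 have opT: "openin (top_of_set X) T"
 proof -
  have "openin (top_of_set X) (\<Inter>x\<in>\<Phi>. f ` N x)"
   using fin\<Phi> ne opn[OF Nop] by (intro openin_Inter) auto
  moreover have "T = (\<Inter>x\<in>\<Phi>. f ` N x) \<inter> - (f ` R \<union> E)" by (auto simp: T_def)
  ultimately show ?thesis using clR E by (auto intro!: openin_Int_open)
 qed
 have TS: "T \<subseteq> ?S"
 proof -
  have "T \<subseteq> X" using opT by (auto simp: openin_open)
  then show ?thesis by (auto simp: T_def)
 qed
 have yT: "y \<in> T"
 proof -
  have "y \<in> f ` N x" if "x \<in> \<Phi>" for x
   using that r(1) by (auto simp: N_def \<Phi>_def intro!: image_eqI[of y f x])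
  moreover have "y \<notin> f ` R"
  proof
   assume "y \<in> f ` R"
   then obtain x where "x \<in> R" "f x = y" by auto
   then have "x \<in> \<Phi>" by (auto simp: R_def \<Phi>_def)
   then show False using \<open>x \<in> R\<close> r(1) by (auto simp: R_def)
  qed
  ultimately show ?thesis using y by (auto simp: T_def)
 qed
 define M where "M x = N x \<inter> f -` T" for x
 have MC: "M x \<subseteq> ?C" for x using TS by (auto simp: M_def N_def)
 have MopX: "openin (top_of_set X) (M x)" for x
 proof -
  have "openin (top_of_set X) (X \<inter> f -` T)"
   using continuous_openin_preimage[OF contf _ opT] onto by auto
  then have "openin (top_of_set X) (N x \<inter> (X \<inter> f -` T))" using Nop by blast
  moreover have "N x \<inter> (X \<inter> f -` T) = M x" by (auto simp: M_def N_def)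
  ultimately show ?thesis by simp
 qed
 have un: "\<Union> (M ` \<Phi>) = ?C \<inter> f -` T"
 proof
  show "\<Union> (M ` \<Phi>) \<subseteq> ?C \<inter> f -` T" using MC by (auto simp: M_def)
  show "?C \<inter> f -` T \<subseteq> \<Union> (M ` \<Phi>)"
  proof
   fix x assume x: "x \<in> ?C \<inter> f -` T"
   then have "x \<notin> R" by (auto simp: T_def)
   then obtain c where "c \<in> \<Phi>" "x \<in> ball c r" using x by (auto simp: R_def)
   then show "x \<in> \<Union> (M ` \<Phi>)" using x by (auto simp: M_def N_def)
  qed
 qed
 have dj: "disjoint (M ` \<Phi>)"
 proof (rule disjointI)
  fix A B assume AB: "A \<in> M ` \<Phi>" "B \<in> M ` \<Phi>" "A \<noteq> B"
  then obtain c d where cd: "c \<in> \<Phi>" "d \<in> \<Phi>" "A = M c" "B = M d" "c \<noteq> d" by auto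
  have False if "x \<in> A" "x \<in> B" for x
  proof -
   have "dist c x < r" "dist d x < r" using that cd by (auto simp: M_def N_def)
   moreover have "dist c d \<le> dist c x + dist d x" using dist_triangle[of c d x] by (simp add: dist_commute)
   ultimately show False using r(2)[OF cd(1,2,5)] by linarith
  qed
  then show "A \<inter> B = {}" by auto
 qed
 have homeo: "\<exists>q. homeomorphism (M x) T f q" if x: "x \<in> \<Phi>" for x
 proof -
  have c: "continuous_on (M x) f" by (rule continuous_on_subset[OF contf]) (auto simp: M_def N_def)
  have "T \<subseteq> f ` N x" using x by (auto simp: T_def)
  then have i: "f ` M x = T" unfolding M_def by blast
  have "inj_on f (M x)" using Ninj[OF x] by (rule inj_on_subset) (auto simp: M_def)
  moreover have "openin (top_of_set T) (f ` U)" if U: "openin (top_of_set (M x)) U" for U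
  proof -
   have "openin (top_of_set X) U" using openin_trans[OF U MopX] .
   then have "openin (top_of_set X) (f ` U)" by (rule opn)
   moreover have "f ` U \<subseteq> T" using U i openin_imp_subset by blast
   moreover have "T \<subseteq> X" using TS by auto
   ultimately show ?thesis using openin_subset_trans by blast
  qed
  ultimately show ?thesis using homeomorphism_injective_open_map[OF c i] by metis
 qed
 show "\<exists>T. y \<in> T \<and> openin (top_of_set ?S) T \<and>
      (\<exists>v. \<Union> v = ?C \<inter> f -` T \<and> (\<forall>u\<in>v. openin (top_of_set ?C) u) \<and>
        disjoint v \<and> (\<forall>u\<in>v. \<exists>q. homeomorphism u T f q))"
 proof (intro exI[of _ T] conjI exI[of _ "M ` \<Phi>"])
  show "openin (top_of_set ?S) T" using opT TS by (rule openin_subset_trans) auto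
  show "\<forall>u\<in>M ` \<Phi>. openin (top_of_set ?C) u"
  proof
   fix u assume "u \<in> M ` \<Phi>"
   then show "openin (top_of_set ?C) u" using MopX MC by (auto intro!: openin_subset_trans[OF MopX MC])
  qed
 qed (use yT un dj homeo in auto)
qed

text \<open>Off the critical values the derivative k is positive, and the distance estimate with
  relative error k / 2 excludes that two different points near x have the same image.\<close>

lemma covering_space_rat_sph:
 assumes "rat_pair p q" "rat_deg p q \<ge> 1"
  and E: "closed E" "\<And>x. x \<in> RS \<Longrightarrow> sph_dnorm (rat_sph p q) x = 0 \<Longrightarrow> rat_sph p q x \<in> E"
 shows "covering_space {x \<in> RS. rat_sph p q x \<notin> E} (rat_sph p q) (RS - E)"
proof (rule covering_space_finite_fibres[OF compact_RS continuous_rat_sph[OF assms(1,2)] rat_sph_onto[OF assms(1,2)]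
   rat_sph_open[OF assms(1,2)] rat_sph_fiber_finite[OF assms(1,2)] E(1)])
 fix x assume x: "x \<in> RS" "rat_sph p q x \<notin> E"
 define k where "k = sph_dnorm (rat_sph p q) x"
 have k: "k > 0" using E(2)[OF x(1)] x(2) sph_dnorm_nonneg[OF assms(1,2) x(1)] by (force simp: k_def)
 have k2: "k / 2 > 0" using k by simp
 obtain d where d: "d > 0" "\<And>y y'. y \<in> RS \<Longrightarrow> y' \<in> RS \<Longrightarrow> dist x y < d \<Longrightarrow> dist x y' < d \<Longrightarrow>
   \<bar>dist (rat_sph p q y) (rat_sph p q y') - k * dist y y'\<bar> \<le> k / 2 * dist y y'"
  using metric_derivE[OF rat_sph_metric_deriv[OF assms(1,2) x(1)] k2] unfolding k_def by blast
 have "inj_on (rat_sph p q) (ball x d \<inter> RS)"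
 proof (rule inj_onI)
  fix y y' assume y: "y \<in> ball x d \<inter> RS" "y' \<in> ball x d \<inter> RS" "rat_sph p q y = rat_sph p q y'"
  then have "\<bar>0 - k * dist y y'\<bar> \<le> k / 2 * dist y y'" using d(2)[of y y'] by auto
  then have "k * dist y y' \<le> 0" using k by (simp add: abs_mult)
  then show "y = y'" using k by (simp add: mult_le_0_iff)
 qed
 then show "\<exists>\<delta>>0. inj_on (rat_sph p q) (ball x \<delta> \<inter> RS)" using d(1) by blast
qed

section \<open>Fatou and Julia sets\<close>

definition equi :: "('a::metric_space \<Rightarrow> 'a) set \<Rightarrow> 'a set \<Rightarrow> 'a \<Rightarrow> bool" where
 "equi H S x \<longleftrightarrow> (\<forall>e>0. \<exists>\<delta>>0. \<forall>y\<in>S. dist x y < \<delta> \<longrightarrow> (\<forall>h\<in>H. dist (h x) (h y) < e))"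

text \<open>In \<open>fatou\<close> equicontinuity is tested inside the neighbourhood and with
  \<open>sdist\<close>. Testing against the whole sphere and with \<open>dist\<close> is equivalent
  because the neighbourhood is open; this form is the one used from here on.\<close>

lemma fatou_iff_equi:
 assumes H: "\<And>h x. h \<in> H \<Longrightarrow> x \<in> RS \<Longrightarrow> h x \<in> RS"
 shows "z \<in> fatou H \<longleftrightarrow> z \<in> RS \<and> (\<exists>r>0. \<forall>x\<in>RS. dist z x < r \<longrightarrow> equi H RS x)"
proof
 assume "z \<in> fatou H"
 then obtain U where U: "z \<in> RS" "open U" "z \<in> U" "equicont_on H (U \<inter> RS)" by (auto simp: fatou_def)
 have "equi H RS x" if x: "x \<in> U \<inter> RS" for x
  unfolding equi_def
 proof (intro allI impI)
  fix e :: real assume "e > 0"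
  then obtain d where d: "d > 0" "\<And>y h. y \<in> U \<inter> RS \<Longrightarrow> sdist x y < d \<Longrightarrow> h \<in> H \<Longrightarrow> sdist (h x) (h y) < e"
   using U(4) x unfolding equicont_on_def by meson
  obtain r where r: "r > 0" "ball x r \<subseteq> U" using U(2) x by (meson IntD1 open_contains_ball)
  have "dist (h x) (h y) < e" if "y \<in> RS" "dist x y < min r (d / 3)" "h \<in> H" for y h
  proof -
   have "sdist x y \<le> 3 * dist x y" using sdist_bounds x that by auto
   then have "sdist (h x) (h y) < e" using d(2)[of y h] that r by auto
   moreover have "h x \<in> RS" "h y \<in> RS" using H that x by auto
   ultimately show ?thesis using sdist_bounds(1)[of "h x" "h y"] by simp
  qed
  then show "\<exists>\<delta>>0. \<forall>y\<in>RS. dist x y < \<delta> \<longrightarrow> (\<forall>h\<in>H. dist (h x) (h y) < e)"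
   using d(1) r(1) by (intro exI[of _ "min r (d / 3)"]) auto
 qed
 moreover obtain r where "r > 0" "ball z r \<subseteq> U" using U by (meson open_contains_ball)
 ultimately show "z \<in> RS \<and> (\<exists>r>0. \<forall>x\<in>RS. dist z x < r \<longrightarrow> equi H RS x)"
  using U(1) by (intro conjI exI[of _ r]) auto
next
 assume "z \<in> RS \<and> (\<exists>r>0. \<forall>x\<in>RS. dist z x < r \<longrightarrow> equi H RS x)"
 then obtain r where z: "z \<in> RS" and r: "r > 0" "\<And>x. x \<in> RS \<Longrightarrow> dist z x < r \<Longrightarrow> equi H RS x" by blast
 have "equicont_on H (ball z r \<inter> RS)"
  unfolding equicont_on_def
 proof (intro ballI allI impI)
  fix x and e :: real assume x: "x \<in> ball z r \<inter> RS" and e: "e > 0"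
  then have "equi H RS x" using r(2) by auto
  moreover have "e / 3 > 0" using e by simp
  ultimately obtain d where d: "d > 0" "\<And>y h. y \<in> RS \<Longrightarrow> dist x y < d \<Longrightarrow> h \<in> H \<Longrightarrow> dist (h x) (h y) < e / 3"
   unfolding equi_def by meson
  have "sdist (h x) (h y) < e" if "y \<in> ball z r \<inter> RS" "sdist x y < d" "h \<in> H" for y h
  proof -
   have "dist x y < d" using sdist_bounds(1)[of x y] that x by auto
   then have "dist (h x) (h y) < e / 3" using d that by auto
   moreover have "sdist (h x) (h y) \<le> 3 * dist (h x) (h y)" using sdist_bounds H x that by auto
   ultimately show ?thesis by linarith
  qed
  then show "\<exists>\<delta>>0. \<forall>y\<in>ball z r \<inter> RS. sdist x y < \<delta> \<longrightarrow> (\<forall>h\<in>H. sdist (h x) (h y) < e)"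
   using d(1) by blast
 qed
 then show "z \<in> fatou H" unfolding fatou_def using z r(1) by (auto intro!: exI[of _ "ball z r"])
qed

section \<open>Words, Cauchy estimates and lifts\<close>

lemma wcomp_append: "wcomp f (u @ v) x = wcomp f v (wcomp f u x)"
 by (induction u arbitrary: x) auto

lemma wcomp_take_drop: "wcomp f (drop j w) (wcomp f (take j w) x) = wcomp f w x"
 by (metis append_take_drop_id wcomp_append)

text \<open>Cauchy's inequality on circles of radius r / 4 about points of the half ball, then the
  mean value inequality.\<close>

lemma holomorphic_bounded_lipschitz:
 assumes "h holomorphic_on ball u r" "\<And>v. v \<in> ball u r \<Longrightarrow> cmod (h v) \<le> R" "r > 0"
 shows "\<And>v. v \<in> ball u (r / 2) \<Longrightarrow> cmod (deriv h v) \<le> 4 * R / r"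
  and "\<And>v w. v \<in> ball u (r / 2) \<Longrightarrow> w \<in> ball u (r / 2) \<Longrightarrow> dist (h v) (h w) \<le> 4 * R / r * dist v w"
proof -
 show d: "cmod (deriv h v) \<le> 4 * R / r" if v: "v \<in> ball u (r / 2)" for v
 proof -
  have sub: "cball v (r / 4) \<subseteq> ball u r"
  proof
   fix w assume "w \<in> cball v (r / 4)"
   then have "dist u w < r / 2 + r / 2" using v assms(3) dist_triangle[of u w v] by (auto simp: dist_commute)
   then show "w \<in> ball u r" by simp
  qed
  have "cmod ((deriv ^^ 1) h v) \<le> fact 1 * R / (r / 4) ^ 1"
  proof (rule Cauchy_inequality)
   show "h holomorphic_on ball v (r / 4)" "continuous_on (cball v (r / 4)) h"
    using assms(1) sub ball_subset_cball holomorphic_on_subset holomorphic_on_imp_continuous_on by blast+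
   show "cmod (h x) \<le> R" if "cmod (v - x) = r / 4" for x
    using that sub by (intro assms(2)) (auto simp: dist_norm subset_eq)
  qed (use assms(3) in auto)
  then show ?thesis by (simp add: field_simps)
 qed
 show "dist (h v) (h w) \<le> 4 * R / r * dist v w" if v: "v \<in> ball u (r / 2)" "w \<in> ball u (r / 2)" for v w
  unfolding dist_norm
 proof (rule field_differentiable_bound[OF convex_ball _ d v])
  fix z assume "z \<in> ball u (r / 2)"
  then have "z \<in> ball u r" using assms(3) by auto
  then have "(h has_field_derivative deriv h z) (at z)" using assms(1) holomorphic_derivI by blast
  then show "(h has_field_derivative deriv h z) (at z within ball u (r / 2))"
   by (rule has_field_derivative_at_within)
 qed
qed

text \<open>In Caratheodory's form, F z - F (g t) = A z * (z - g t) with A continuous at g t. Hence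
  the difference quotients of g are those of h divided by A (g z), and A does not vanish near the
  limit.\<close>

lemma holomorphic_lift:
 assumes "open U" "continuous_on U g" "h holomorphic_on U" "open V" "F holomorphic_on V"
  and g: "\<And>t. t \<in> U \<Longrightarrow> g t \<in> V" "\<And>t. t \<in> U \<Longrightarrow> F (g t) = h t" "\<And>t. t \<in> U \<Longrightarrow> deriv F (g t) \<noteq> 0"
 shows "g holomorphic_on U"
 unfolding holomorphic_on_open[OF assms(1)]
proof
 fix t assume t: "t \<in> U"
 have "(F has_field_derivative deriv F (g t)) (at (g t))" using assms(4,5) g(1)[OF t] holomorphic_derivI by blast
 then obtain A where A: "\<And>z. F z - F (g t) = A z * (z - g t)" "isCont A (g t)" "A (g t) = deriv F (g t)"
  unfolding CARAT_DERIV by blast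
 have "(h has_field_derivative deriv h t) (at t)" using assms(1,3) t holomorphic_derivI by blast
 have gt: "isCont g t" using assms(1,2) t continuous_on_eq_continuous_at by blast
 then have cA: "isCont (\<lambda>z. A (g z)) t" using A(2) isCont_o2 by blast
 have "A (g t) \<noteq> 0" using A(3) g(3)[OF t] by simp
 then have ev: "\<forall>\<^sub>F z in at t. A (g z) \<noteq> 0"
  using cA by (metis isCont_def tendsto_imp_eventually_ne)
 have evU: "\<forall>\<^sub>F z in at t. z \<in> U" using assms(1) t eventually_at_in_open' by blast
 have "((\<lambda>z. (h z - h t) / (z - t)) \<longlongrightarrow> deriv h t) (at t)"
  using \<open>(h has_field_derivative deriv h t) (at t)\<close> by (simp add: has_field_derivative_iff)
 then have "((\<lambda>z. (h z - h t) / (z - t) / A (g z)) \<longlongrightarrow> deriv h t / A (g t)) (at t)"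
  using cA \<open>A (g t) \<noteq> 0\<close> by (intro tendsto_divide) (auto simp: isCont_def)
 moreover have "\<forall>\<^sub>F z in at t. (h z - h t) / (z - t) / A (g z) = (g z - g t) / (z - t)"
  using ev evU
 proof eventually_elim
  case (elim z)
  have "h z - h t = A (g z) * (g z - g t)" using A(1)[of "g z"] g(2)[OF elim(2)] g(2)[OF t] by simp
  then show ?case using elim(1) by simp
 qed
 ultimately have "((\<lambda>z. (g z - g t) / (z - t)) \<longlongrightarrow> deriv h t / A (g t)) (at t)"
  by (rule Lim_transform_eventually)
 then show "\<exists>f'. (g has_field_derivative f') (at t)" by (auto simp: has_field_derivative_iff)
qed

text \<open>The dichotomy behind \<open>equi_near_limit\<close>: an initial segment of w is
  controlled by the inverse branch of w, and a word that deviates from w is controlled after its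
  first deviation by the Fatou set.\<close>

lemma common_prefix_cases:
 assumes "length u \<le> length w"
 obtains "u = take (length u) w" | j where "j < length u" "take j u = take j w" "u ! j \<noteq> w ! j"
proof (cases "\<exists>j<length u. u ! j \<noteq> w ! j")
 case False
 then have "u = take (length u) w" using assms by (intro nth_equalityI) auto
 then show ?thesis by (rule that(1))
next
 case True
 define j where "j = (LEAST j. j < length u \<and> u ! j \<noteq> w ! j)"
 have j: "j < length u \<and> u ! j \<noteq> w ! j" unfolding j_def by (rule LeastI_ex) (use True in blast)
 have "u ! i = w ! i" if "i < j" for i
  using not_less_Least[of i "\<lambda>j. j < length u \<and> u ! j \<noteq> w ! j"] that j by (auto simp: j_def)
 then have "take j u = take j w" using j assms by (intro nth_equalityI) auto
 then show ?thesis using that(2) j by blast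
qed

section \<open>The Fatou and Julia sets of the semigroup\<close>

locale rational_system =
 fixes s :: nat and f :: "nat \<Rightarrow> complex \<times> real \<Rightarrow> complex \<times> real"
 assumes s_pos: "s \<ge> 1"
  and rat: "\<And>i. i \<in> idx s \<Longrightarrow> \<exists>p q. rat_pair p q \<and> rat_deg p q \<ge> 2 \<and> f i = rat_sph p q"
begin

abbreviation "J \<equiv> julia (semigrp s f)"
abbreviation "F \<equiv> fatou (semigrp s f)"
abbreviation word :: "nat list \<Rightarrow> bool" where "word w \<equiv> set w \<subseteq> idx s"
abbreviation odist where "odist j w x y \<equiv> dist (wcomp f (take j w) x) (wcomp f (take j w) y)"
text \<open>Orbit segments ending at y and at y' are paired so that they stay close at every time
  and converge backwards in time. Both directions are needed: the first moves away from a given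
  orbit in J, the second finds an orbit in J next to a given one.\<close>

abbreviation shadow where
 "shadow C \<theta> w y y' \<equiv> (\<forall>x\<in>RS. wcomp f w x = y \<longrightarrow> (\<exists>x'\<in>RS. wcomp f w x' = y' \<and>
   (\<forall>j\<le>length w. odist j w x x' \<le> C * \<theta> ^ (length w - j) * dist y y'))) \<and>
  (\<forall>x'\<in>RS. wcomp f w x' = y' \<longrightarrow> (\<exists>x\<in>RS. wcomp f w x = y \<and>
   (\<forall>j\<le>length w. odist j w x x' \<le> C * \<theta> ^ (length w - j) * dist y y')))"
text \<open>The version without contraction, which comes directly from Cauchy estimates; the
  contraction is bootstrapped from it in \<open>preimages_contract\<close>.\<close>

abbreviation weak_shadow where
 "weak_shadow K w y y' \<equiv> (\<forall>x\<in>RS. wcomp f w x = y \<longrightarrow> (\<exists>x'\<in>RS. wcomp f w x' = y' \<and>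
   (\<forall>j. odist j w x x' \<le> K * dist y y'))) \<and>
  (\<forall>x'\<in>RS. wcomp f w x' = y' \<longrightarrow> (\<exists>x\<in>RS. wcomp f w x = y \<and>
   (\<forall>j. odist j w x x' \<le> K * dist y y')))"

lemma ratE: assumes "i \<in> idx s"
 obtains p q where "rat_pair p q" "rat_deg p q \<ge> 2" "rat_deg p q \<ge> 1" "f i = rat_sph p q"
 using rat[OF assms] by (metis one_le_numeral order_trans)

lemma f_RS: "i \<in> idx s \<Longrightarrow> f i x \<in> RS"
 by (metis ratE rat_sph_in_RS)

lemma continuous_f: "i \<in> idx s \<Longrightarrow> continuous_on RS (f i)"
 by (metis ratE continuous_rat_sph)

lemma open_f: "i \<in> idx s \<Longrightarrow> openin (top_of_set RS) V \<Longrightarrow> openin (top_of_set RS) (f i ` V)"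
 by (metis ratE rat_sph_open)

lemma onto_f: "i \<in> idx s \<Longrightarrow> f i ` RS = RS"
 by (metis ratE rat_sph_onto)

lemma metric_deriv_f: "i \<in> idx s \<Longrightarrow> x \<in> RS \<Longrightarrow> metric_deriv (f i) RS x (sph_dnorm (f i) x)"
 by (metis ratE rat_sph_metric_deriv)

lemma finite_idx: "finite (idx s)"
 by (simp add: idx_def)

lemma idx_nonempty: "1 \<in> idx s"
 by (simp add: idx_def)

lemma wcomp_RS: "word w \<Longrightarrow> x \<in> RS \<Longrightarrow> wcomp f w x \<in> RS"
 by (induction w arbitrary: x) (auto simp: f_RS)

lemma continuous_wcomp: "word w \<Longrightarrow> continuous_on RS (wcomp f w)"
proof (induction w)
 case (Cons i w)
 then have "continuous_on RS (f i)" "continuous_on (f i ` RS) (wcomp f w)"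
  using continuous_f onto_f by auto
 then show ?case unfolding wcomp.simps by (rule continuous_on_compose)
qed (simp add: continuous_on_id')

lemma semigrp_RS: "h \<in> semigrp s f \<Longrightarrow> x \<in> RS \<Longrightarrow> h x \<in> RS"
 by (auto simp: semigrp_def wcomp_RS)

lemma semigrpI: "w \<noteq> [] \<Longrightarrow> word w \<Longrightarrow> wcomp f w \<in> semigrp s f"
 by (auto simp: semigrp_def)

lemma F_iff: "z \<in> F \<longleftrightarrow> z \<in> RS \<and> (\<exists>r>0. \<forall>x\<in>RS. dist z x < r \<longrightarrow> equi (semigrp s f) RS x)"
 by (rule fatou_iff_equi) (rule semigrp_RS)

lemma equi_of_F: "x \<in> F \<Longrightarrow> equi (semigrp s f) RS x"
 unfolding F_iff by auto

lemma F_RS: "F \<subseteq> RS" by (auto simp: fatou_def)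

lemma J_RS: "J \<subseteq> RS" by (auto simp: julia_def)

lemma J_iff: "x \<in> RS \<Longrightarrow> x \<in> J \<longleftrightarrow> x \<notin> F" by (auto simp: julia_def)

lemma openin_F: "openin (top_of_set RS) F"
proof (subst openin_euclidean_subtopology_iff, intro conjI ballI F_RS)
 fix x assume "x \<in> F"
 then obtain r where r: "r > 0" "\<And>y. y \<in> RS \<Longrightarrow> dist x y < r \<Longrightarrow> equi (semigrp s f) RS y" unfolding F_iff by blast
 have "x' \<in> F" if x': "x' \<in> RS" "dist x' x < r / 2" for x'
  unfolding F_iff
 proof (intro conjI exI[of _ "r / 2"] ballI impI x'(1))
  fix y assume "y \<in> RS" "dist x' y < r / 2"
  moreover have "dist x y \<le> dist x' x + dist x' y" using dist_triangle[of x y x'] by (simp add: dist_commute)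
  ultimately show "equi (semigrp s f) RS y" using r(2) x' by simp
 qed (use r in simp)
 then show "\<exists>e>0. \<forall>x'\<in>RS. dist x' x < e \<longrightarrow> x' \<in> F" using r(1) by (intro exI[of _ "r / 2"]) auto
qed

lemma compact_J: "compact J"
proof -
 have "closedin (top_of_set RS) (RS - F)" using openin_F by (metis closedin_diff closedin_topspace topspace_euclidean_subtopology)
 then show ?thesis unfolding julia_def using compact_RS closedin_compact by blast
qed

text \<open>Because f i is open, the points near f i x are images of points near x, and a map of the
  semigroup composed with f i is again in the semigroup.\<close>

lemma F_forward: assumes "x \<in> F" "i \<in> idx s" shows "f i x \<in> F"
proof -
 obtain r where r: "r > 0" "x \<in> RS" "\<And>y. y \<in> RS \<Longrightarrow> dist x y < r \<Longrightarrow> equi (semigrp s f) RS y"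
  using assms(1) unfolding F_iff by blast
 have opb: "\<exists>r'>0. \<forall>z\<in>RS. dist (f i y) z < r' \<longrightarrow> (\<exists>y'\<in>RS. dist y y' < r \<and> z = f i y')"
  if "y \<in> RS" "r > 0" for y r
 proof -
  have "openin (top_of_set RS) (f i ` (RS \<inter> ball y r))" by (intro open_f assms(2)) (auto simp: openin_open)
  moreover have "f i y \<in> f i ` (RS \<inter> ball y r)" using that by auto
  ultimately obtain e where e: "e > 0" "\<forall>z\<in>RS. dist z (f i y) < e \<longrightarrow> z \<in> f i ` (RS \<inter> ball y r)"
   unfolding openin_euclidean_subtopology_iff by blast
  have "\<exists>y'\<in>RS. dist y y' < r \<and> z = f i y'" if z: "z \<in> RS" "dist (f i y) z < e" for z
  proof -
   have "z \<in> f i ` (RS \<inter> ball y r)" using e(2) z by (simp add: dist_commute)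
   then obtain y' where "y' \<in> RS" "y' \<in> ball y r" "z = f i y'" by blast
   then show ?thesis by (intro bexI[of _ y']) auto
  qed
  then show ?thesis using e(1) by blast
 qed
 have eq: "equi (semigrp s f) RS (f i y)" if y: "y \<in> RS" "dist x y < r" for y
  unfolding equi_def
 proof (intro allI impI)
  fix e :: real assume "e > 0"
  then obtain d where d: "d > 0" "\<And>z h. z \<in> RS \<Longrightarrow> dist y z < d \<Longrightarrow> h \<in> semigrp s f \<Longrightarrow> dist (h y) (h z) < e"
   using r(3)[OF y] unfolding equi_def by meson
  obtain r' where r': "r' > 0" "\<And>z. z \<in> RS \<Longrightarrow> dist (f i y) z < r' \<Longrightarrow> \<exists>y'\<in>RS. dist y y' < d \<and> z = f i y'"
   using opb[OF y(1) d(1)] by blast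
  have "dist (h (f i y)) (h z) < e" if z: "z \<in> RS" "dist (f i y) z < r'" and h: "h \<in> semigrp s f" for z h
  proof -
   obtain y' where y': "y' \<in> RS" "dist y y' < d" "z = f i y'" using r'(2)[OF z] by blast
   obtain w where w: "w \<noteq> []" "word w" "h = wcomp f w" using h by (auto simp: semigrp_def)
   have "wcomp f (i # w) \<in> semigrp s f" using w assms(2) by (intro semigrpI) auto
   then have "dist (wcomp f (i # w) y) (wcomp f (i # w) y') < e" using d(2) y' by blast
   then show ?thesis by (simp add: w y')
  qed
  then show "\<exists>\<delta>>0. \<forall>z\<in>RS. dist (f i y) z < \<delta> \<longrightarrow> (\<forall>h\<in>semigrp s f. dist (h (f i y)) (h z) < e)"
   using r'(1) by blast
 qed
 obtain r' where r': "r' > 0" "\<And>z. z \<in> RS \<Longrightarrow> dist (f i x) z < r' \<Longrightarrow> \<exists>y'\<in>RS. dist x y' < r \<and> z = f i y'"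
  using opb[OF r(2,1)] by blast
 show ?thesis unfolding F_iff
 proof (intro conjI exI[of _ r'] ballI impI f_RS[OF assms(2)] r'(1))
  fix z assume "z \<in> RS" "dist (f i x) z < r'"
  then obtain y' where "y' \<in> RS" "dist x y' < r" "z = f i y'" using r'(2) by blast
  then show "equi (semigrp s f) RS z" using eq by simp
 qed
qed

lemma F_forward_word: "x \<in> F \<Longrightarrow> word w \<Longrightarrow> wcomp f w x \<in> F"
 by (induction w arbitrary: x) (auto simp: F_forward)

lemma J_backward: assumes "x \<in> RS" "word w" "wcomp f w x \<in> J" shows "x \<in> J"
 using F_forward_word[of x w] assms J_iff[of x] by (auto simp: julia_def)

text \<open>A Lebesgue number of K for the neighbourhoods of equicontinuity. The empty word, which
  gives no element of the semigroup, is included.\<close>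

lemma uniform_equi:
 assumes K: "compact K" "K \<subseteq> F" and e: "e > 0"
 shows "\<exists>\<delta>>0. \<forall>x\<in>K. \<forall>y\<in>RS. dist x y < \<delta> \<longrightarrow> (\<forall>w. word w \<longrightarrow> dist (wcomp f w x) (wcomp f w y) < e)"
proof -
 have "\<exists>d. d > 0 \<and> (\<forall>y\<in>RS. dist x y < d \<longrightarrow> (\<forall>w. word w \<longrightarrow> dist (wcomp f w x) (wcomp f w y) < e / 2))"
  if x: "x \<in> K" for x
 proof -
  have "equi (semigrp s f) RS x" using x K(2) equi_of_F by blast
  moreover have e2: "e / 2 > 0" using e by simp
  ultimately obtain d where d: "d > 0" "\<And>z h. z \<in> RS \<Longrightarrow> dist x z < d \<Longrightarrow> h \<in> semigrp s f \<Longrightarrow> dist (h x) (h z) < e / 2"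
   unfolding equi_def by meson
  have "dist (wcomp f w x) (wcomp f w y) < e / 2" if "y \<in> RS" "dist x y < min d (e / 2)" "word w" for y w
   using that d(2)[of y "wcomp f w"] by (cases "w = []") (auto intro: semigrpI)
  then show ?thesis using d(1) e2 by (intro exI[of _ "min d (e / 2)"]) auto
 qed
 then obtain D where D: "\<And>x. x \<in> K \<Longrightarrow> D x > 0"
  "\<And>x y w. x \<in> K \<Longrightarrow> y \<in> RS \<Longrightarrow> dist x y < D x \<Longrightarrow> word w \<Longrightarrow> dist (wcomp f w x) (wcomp f w y) < e / 2"
  by metis
 have "K \<subseteq> \<Union> ((\<lambda>x. ball x (D x)) ` K)" using D(1) by auto
 moreover have "\<And>B. B \<in> (\<lambda>x. ball x (D x)) ` K \<Longrightarrow> open B" by auto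
 ultimately obtain d where d: "d > 0" "\<And>x. x \<in> K \<Longrightarrow> \<exists>B\<in>(\<lambda>x. ball x (D x)) ` K. ball x d \<subseteq> B"
  using Heine_Borel_lemma[OF K(1), of "(\<lambda>x. ball x (D x)) ` K"] by blast
 have "dist (wcomp f w x) (wcomp f w y) < e" if x: "x \<in> K" and y: "y \<in> RS" "dist x y < d" and w: "word w" for x y w
 proof -
  obtain c where c: "c \<in> K" "ball x d \<subseteq> ball c (D c)" using d(2)[OF x] by auto
  have "x \<in> ball x d" "y \<in> ball x d" using d(1) y(2) by auto
  then have "x \<in> ball c (D c)" "y \<in> ball c (D c)" using c(2) by blast+
  moreover have "x \<in> RS" using x K(2) F_RS by auto
  ultimately have "dist (wcomp f w c) (wcomp f w x) < e / 2" "dist (wcomp f w c) (wcomp f w y) < e / 2"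
   using D(2) c(1) y(1) w by auto
  then show ?thesis by (rule dist_triangle_half_r)
 qed
 then show ?thesis using d(1) by blast
qed

lemma uniform_continuity:
 assumes "e > 0" shows "\<exists>d>0. \<forall>i\<in>idx s. \<forall>x\<in>RS. \<forall>y\<in>RS. dist x y < d \<longrightarrow> dist (f i x) (f i y) < e"
proof -
 have "\<forall>i\<in>idx s. \<exists>d>0. \<forall>x\<in>RS. \<forall>y\<in>RS. dist x y < d \<longrightarrow> dist (f i x) (f i y) < e"
  using compact_uniformly_continuous[OF continuous_f compact_RS] assms
  unfolding uniformly_continuous_on_def by (metis dist_commute)
 then obtain D where D: "\<forall>i\<in>idx s. D i > 0 \<and> (\<forall>x\<in>RS. \<forall>y\<in>RS. dist x y < D i \<longrightarrow> dist (f i x) (f i y) < e)"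
  by (auto simp: bchoice_iff)
 have "Min (D ` idx s) > 0" using D finite_idx idx_nonempty by (subst Min_gr_iff) auto
 moreover have "Min (D ` idx s) \<le> D i" if "i \<in> idx s" for i using that finite_idx by (intro Min_le) auto
 ultimately show ?thesis using D by (intro exI[of _ "Min (D ` idx s)"]) (meson less_le_trans)
qed

lemma holomorphic_wcomp:
 assumes "word w"
  "\<And>v j. v \<in> V \<Longrightarrow> j \<le> length w \<Longrightarrow> wcomp f (take j w) (emb a v) \<noteq> pole a"
 shows "\<exists>h. h holomorphic_on V \<and> (\<forall>v\<in>V. wcomp f w (emb a v) = emb a (h v))"
 using assms
proof (induction w rule: rev_induct)
 case Nil
 show ?case by (intro exI[of _ "\<lambda>v. v"]) (auto intro: holomorphic_intros)
next
 case (snoc i w)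
 have "wcomp f (take j w) (emb a v) \<noteq> pole a" if "v \<in> V" "j \<le> length w" for v j
  using snoc.prems(2)[of v j] that by simp
 then obtain h where h: "h holomorphic_on V" "\<And>v. v \<in> V \<Longrightarrow> wcomp f w (emb a v) = emb a (h v)"
  using snoc.IH snoc.prems(1) by auto
 have "i \<in> idx s" using snoc.prems(1) by simp
 then obtain p q where pq: "rat_pair p q" "rat_deg p q \<ge> 1" "f i = rat_sph p q" by (metis ratE)
 have ne: "rat_sph p q (emb a (h v)) \<noteq> pole a" if "v \<in> V" for v
  using snoc.prems(2)[OF that, of "Suc (length w)"] h(2)[OF that] pq(3) by (simp add: wcomp_append)
 have "rchart p q a holomorphic_on h ` V" using ne by (intro holomorphic_rchart[OF pq(1,2)]) auto
 then have "(rchart p q a \<circ> h) holomorphic_on V" using h(1) holomorphic_on_compose by blast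
 moreover have "wcomp f (w @ [i]) (emb a v) = emb a ((rchart p q a \<circ> h) v)" if "v \<in> V" for v
  using rat_sph_emb_eq[OF pq(1,2) ne[OF that]] h(2)[OF that] pq(3) by (simp add: wcomp_append)
 ultimately show ?case by blast
qed

text \<open>A quantitative form of Montel's theorem: if all initial segments of w avoid the
  \<delta>-ball about the pole, then the map is bounded by 2 / \<delta> in the chart, and Cauchy's
  inequality gives a Lipschitz constant independent of w.\<close>

lemma wcomp_lipschitz:
 assumes "word w" "\<delta> > 0" "r > 0"
  and avoid: "\<And>v j. v \<in> ball u r \<Longrightarrow> j \<le> length w \<Longrightarrow> \<delta> \<le> dist (wcomp f (take j w) (emb a v)) (pole a)"
  and v: "v \<in> ball u (r / 2)" "v' \<in> ball u (r / 2)"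
 shows "dist (wcomp f w (emb a v)) (wcomp f w (emb a v')) \<le> 2 * ((cmod a)\<^sup>2 + 1) * (8 / (\<delta> * r)) * dist v v'"
proof -
 have "wcomp f (take j w) (emb a v) \<noteq> pole a" if "v \<in> ball u r" "j \<le> length w" for v j
  using avoid[OF that] assms(2) by auto
 then obtain h where h: "h holomorphic_on ball u r" "\<And>v. v \<in> ball u r \<Longrightarrow> wcomp f w (emb a v) = emb a (h v)"
  using holomorphic_wcomp[OF assms(1), of "ball u r" a] by blast
 have "cmod (h v) \<le> 2 / \<delta>" if "v \<in> ball u r" for v
  using avoid[OF that, of "length w"] h(2)[OF that] by (intro emb_norm_le[OF assms(2)]) auto
 then have "dist (h v) (h v') \<le> 4 * (2 / \<delta>) / r * dist v v'"
  by (intro holomorphic_bounded_lipschitz(2)[OF h(1) _ assms(3) v]) auto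
 moreover define C where "C = 2 * ((cmod a)\<^sup>2 + 1)"
 ultimately have "C * dist (h v) (h v') \<le> C * (8 / (\<delta> * r) * dist v v')"
  by (intro mult_left_mono) (auto simp: field_simps)
 moreover have "dist (emb a (h v)) (emb a (h v')) \<le> C * dist (h v) (h v')" unfolding C_def by (rule emb_lipschitz)
 moreover have "v \<in> ball u r" "v' \<in> ball u r" using v assms(3) by auto
 ultimately show ?thesis unfolding C_def[symmetric] by (simp add: h(2) mult.assoc)
qed

text \<open>If all images of a neighbourhood of z omitted V, a point of V could be put at infinity;
  \<open>wcomp_lipschitz\<close> would then make the semigroup equicontinuous near z.\<close>

lemma J_dense_images:
 assumes z: "z \<in> J" and r: "r > 0" and V: "open V" "x0 \<in> V" "x0 \<in> RS"
 shows "\<exists>w x. w \<noteq> [] \<and> word w \<and> x \<in> RS \<and> dist z x < r \<and> wcomp f w x \<in> V"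
proof (rule ccontr)
 assume neg: "\<not> ?thesis"
 have zRS: "z \<in> RS" using z J_RS by auto
 obtain a where a: "pole a \<in> V" "pole a \<noteq> z" using pole_dense[OF V(1,3,2)] by metis
 obtain u where u: "z = emb a u" using emb_surj[OF zRS] a(2) by metis
 obtain \<delta>1 where \<delta>1: "\<delta>1 > 0" "ball (pole a) \<delta>1 \<subseteq> V" using V(1) a(1) by (meson open_contains_ball)
 define D where "D = dist z (pole a)"
 have D: "D > 0" using a(2) by (simp add: D_def)
 \<comment> \<open>The first entry serves the non-empty words, which omit V, the second the empty
   word, since points near z stay off the pole.\<close>
 define \<delta> where "\<delta> = min \<delta>1 (D / 2)"
 have \<delta>: "\<delta> > 0" using \<delta>1 D by (simp add: \<delta>_def)
 define L where "L = 2 * ((cmod a)\<^sup>2 + 1)"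
 have L: "L > 0" by (simp add: L_def add_nonneg_pos)
 define \<rho> where "\<rho> = min r (D / 2) / L"
 have \<rho>: "\<rho> > 0" using r D L by (simp add: \<rho>_def)
 have emb\<rho>: "dist z (emb a v) < min r (D / 2)" if "v \<in> ball u \<rho>" for v
 proof -
  have "dist z (emb a v) \<le> L * dist u v" unfolding u L_def by (rule emb_lipschitz)
  also have "\<dots> < L * \<rho>" using that L by simp
  also have "\<dots> = min r (D / 2)" using L by (simp add: \<rho>_def)
  finally show ?thesis .
 qed
 have av: "\<delta> \<le> dist (wcomp f w (emb a v)) (pole a)" if "v \<in> ball u \<rho>" "word w" for v w
 proof (cases "w = []")
  case True
  have "D \<le> dist z (emb a v) + dist (emb a v) (pole a)" unfolding D_def by (rule dist_triangle)
  then have "D / 2 \<le> dist (emb a v) (pole a)" using emb\<rho>[OF that(1)] by simp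
  then show ?thesis by (simp add: True \<delta>_def min.coboundedI2)
 next
  case False
  moreover have "dist z (emb a v) < r" using emb\<rho>[OF that(1)] by simp
  ultimately have "wcomp f w (emb a v) \<notin> V" using neg that(2) emb_in_RS by blast
  then have "wcomp f w (emb a v) \<notin> ball (pole a) \<delta>1" using \<delta>1 by auto
  then show ?thesis by (simp add: \<delta>_def dist_commute)
 qed
 define M where "M = 2 * ((cmod a)\<^sup>2 + 1) * (8 / (\<delta> * \<rho>))"
 have "M = L * (8 / (\<delta> * \<rho>))" by (simp add: M_def L_def)
 then have M: "M > 0" using L \<delta> \<rho> by simp
 have lip: "dist (wcomp f w (emb a v)) (wcomp f w (emb a v')) \<le> M * dist v v'"
  if "word w" "v \<in> ball u (\<rho> / 2)" "v' \<in> ball u (\<rho> / 2)" for w v v'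
  unfolding M_def using that by (intro wcomp_lipschitz \<delta> \<rho> av) (auto dest: in_set_takeD)
 obtain \<eta> where \<eta>: "\<eta> > 0" "\<And>y. y \<in> RS \<Longrightarrow> dist z y < \<eta> \<Longrightarrow> \<exists>v. y = emb a v \<and> dist u v < \<rho> / 2"
  using emb_local_inverse[OF half_gt_zero[OF \<rho>], of a u] unfolding u[symmetric] by blast
 have "equi (semigrp s f) RS y" if y: "y \<in> RS" "dist z y < \<eta>" for y
  unfolding equi_def
 proof (intro allI impI)
  fix e :: real assume e: "e > 0"
  obtain v where v: "y = emb a v" "dist u v < \<rho> / 2" using \<eta>(2)[OF y] by blast
  define d where "d = min (\<rho> / 2 - dist u v) (e / M)"
  have d: "d > 0" using v e M by (simp add: d_def)
  obtain \<zeta> where \<zeta>: "\<zeta> > 0" "\<And>y'. y' \<in> RS \<Longrightarrow> dist y y' < \<zeta> \<Longrightarrow> \<exists>v'. y' = emb a v' \<and> dist v v' < d"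
   using emb_local_inverse[OF d, of a v] unfolding v(1)[symmetric] by blast
  have "dist (h y) (h y') < e" if y': "y' \<in> RS" "dist y y' < \<zeta>" and h: "h \<in> semigrp s f" for y' h
  proof -
   obtain v' where v': "y' = emb a v'" "dist v v' < d" using \<zeta>(2)[OF y'] by blast
   obtain w where w: "word w" "h = wcomp f w" using h by (auto simp: semigrp_def)
   have "dist u v' \<le> dist u v + dist v v'" by (rule dist_triangle)
   then have "v' \<in> ball u (\<rho> / 2)" using v'(2) by (simp add: d_def)
   then have "dist (h y) (h y') \<le> M * dist v v'" using lip[OF w(1)] v by (simp add: w v')
   also have "\<dots> < M * (e / M)" using v'(2) M by (intro mult_strict_left_mono) (auto simp: d_def)
   finally show ?thesis using M by simp
  qed
  then show "\<exists>\<delta>>0. \<forall>y'\<in>RS. dist y y' < \<delta> \<longrightarrow> (\<forall>h\<in>semigrp s f. dist (h y) (h y') < e)"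
   using \<zeta>(1) by blast
 qed
 then have "z \<in> F" unfolding F_iff using zRS \<eta>(1) by blast
 then show False using z by (simp add: julia_def)
qed

end

section \<open>Inverse branches near the Julia set\<close>

lemma wcomp_split:
 assumes "j < length w" shows "wcomp f w x = wcomp f (drop (Suc j) w) (f (w ! j) (wcomp f (take j w) x))"
proof -
 have "wcomp f w x = wcomp f (take j w @ w ! j # drop (Suc j) w) x" using id_take_nth_drop[OF assms] by simp
 then show ?thesis by (simp add: wcomp_append)
qed

text \<open>\<open>A2\<close> is stated pointwise. That J is non-empty is assumed here; in the
  theorem it follows from the given point of the Julia set of the skew product.\<close>

locale hyperbolic_system = rational_system +
 assumes A1: "postcrit s f \<subseteq> fatou (semigrp s f)"
  and A2: "\<And>i j x. i \<in> idx s \<Longrightarrow> j \<in> idx s \<Longrightarrow> x \<in> RS \<Longrightarrow> f i x \<in> julia (semigrp s f) \<Longrightarrow> f j x \<in> julia (semigrp s f) \<Longrightarrow> i = j"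
  and J_nonempty: "julia (semigrp s f) \<noteq> {}"
begin

lemma set_take_idx: "word w \<Longrightarrow> word (take j w)"
 by (rule order_trans[OF set_take_subset])

lemma set_drop_idx: "word w \<Longrightarrow> word (drop j w)"
 by (rule order_trans[OF set_drop_subset])

lemma crit_in_postcrit:
 assumes "word w" "i \<in> idx s" "x \<in> RS" "sph_dnorm (f i) x = 0"
 shows "wcomp f w (f i x) \<in> postcrit s f"
proof -
 have "f i x \<in> crit_values s f" using assms by (auto simp: crit_values_def)
 moreover have "wcomp f w \<in> insert id (semigrp s f)"
  using assms(1) semigrpI[of w] by (cases "w = []") auto
 ultimately have "wcomp f w (f i x) \<in> (\<Union>g\<in>insert id (semigrp s f). g ` crit_values s f)" by blast
 then show ?thesis unfolding postcrit_def by (rule subsetD[OF closure_subset])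
qed

lemma compact_postcrit: "compact (postcrit s f)"
proof -
 have "closed (postcrit s f)" unfolding postcrit_def by (rule closed_closure)
 moreover have "postcrit s f \<subseteq> RS" using A1 F_RS by auto
 ultimately show ?thesis using compact_RS by (metis compact_Int_closed inf.absorb_iff2)
qed

text \<open>By equicontinuity a whole ball about a critical value has its orbit away from the Julia set.
 A point of that ball is put at infinity.\<close>
lemma omitted_ball:
 "\<exists>a \<delta> e. \<delta> > 0 \<and> e > 0 \<and>
   (\<forall>w y x. word w \<longrightarrow> y \<in> RS \<longrightarrow> dist y (pole a) < \<delta> \<longrightarrow> x \<in> J \<longrightarrow> e \<le> dist (wcomp f w y) x) \<and>
   (\<forall>w i y x. word w \<longrightarrow> i \<in> idx s \<longrightarrow> y \<in> RS \<longrightarrow> sph_dnorm (f i) y = 0 \<longrightarrow> x \<in> J \<longrightarrow> e \<le> dist (wcomp f w (f i y)) x)"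
proof -
 obtain p q where pq: "rat_pair p q" "rat_deg p q \<ge> 2" "f 1 = rat_sph p q" using ratE[OF idx_nonempty] by metis
 obtain x0 where x0: "x0 \<in> RS" "sph_dnorm (f 1) x0 = 0" using exists_critical_point[OF pq(1,2)] pq(3) by auto
 define c where "c = f 1 x0"
 have cP: "wcomp f w c \<in> postcrit s f" if "word w" for w
  unfolding c_def using crit_in_postcrit[OF that idx_nonempty x0] .
 have "postcrit s f \<inter> J = {}" using A1 by (auto simp: julia_def)
 then obtain e where e: "e > 0" "\<And>x y. x \<in> postcrit s f \<Longrightarrow> y \<in> J \<Longrightarrow> e \<le> dist x y"
  using separate_compact_closed[OF compact_postcrit compact_imp_closed[OF compact_J]] by blast
 have "c \<in> F" using cP[of "[]"] A1 by auto
 moreover have "e / 2 > 0" using e(1) by simp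
 ultimately obtain d where d: "d > 0" "\<And>y w. y \<in> RS \<Longrightarrow> dist c y < d \<Longrightarrow> word w \<Longrightarrow> dist (wcomp f w c) (wcomp f w y) < e / 2"
  using uniform_equi[of "{c}" "e / 2"] by auto
 have "c \<in> RS" using \<open>c \<in> F\<close> F_RS by auto
 then obtain a where a: "pole a \<in> ball c (d / 2)" using pole_dense[of "ball c (d / 2)" c] d(1) by auto
 have 1: "e / 2 \<le> dist (wcomp f w y) x" if "word w" "y \<in> RS" "dist y (pole a) < d / 2" "x \<in> J" for w y x
 proof -
  have "dist c y \<le> dist c (pole a) + dist y (pole a)" by (rule dist_triangle2)
  then have "dist c y < d" using that a by simp
  then have "dist (wcomp f w c) (wcomp f w y) < e / 2" using d(2) that by simp
  moreover have "e \<le> dist (wcomp f w c) x" using e(2) cP that by auto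
  moreover have "dist (wcomp f w c) x \<le> dist (wcomp f w c) (wcomp f w y) + dist (wcomp f w y) x" by (rule dist_triangle)
  ultimately show ?thesis by linarith
 qed
 have 2: "e / 2 \<le> dist (wcomp f w (f i y)) x" if "word w" "i \<in> idx s" "y \<in> RS" "sph_dnorm (f i) y = 0" "x \<in> J" for w i y x
  using e(2)[OF crit_in_postcrit[OF that(1-4)] that(5)] e(1) by linarith
 have "d / 2 > 0" "e / 2 > 0" using d(1) e(1) by auto
 then show ?thesis using 1 2
  by - (rule exI[of _ a], rule exI[of _ "d / 2"], rule exI[of _ "e / 2"], blast)
qed

lemma compact_preimage_J: assumes i: "i \<in> idx s" shows "compact {y \<in> RS. f i y \<in> J}"
proof -
 have "closed (RS \<inter> f i -` J)"
  using continuous_closed_preimage[OF continuous_f[OF i] compact_imp_closed[OF compact_RS] compact_imp_closed[OF compact_J]] .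
 then have "compact (RS \<inter> (RS \<inter> f i -` J))" using compact_RS compact_Int_closed by blast
 moreover have "RS \<inter> (RS \<inter> f i -` J) = {y \<in> RS. f i y \<in> J}" by auto
 ultimately show ?thesis by simp
qed

text \<open>The set of points reached with a letter i from a place where another letter leads into
  J. By (A2) it is a compact part of the Fatou set: whoever departs from an orbit inside J lands in
  it and is controlled from then on.\<close>

lemma compact_departures:
 "compact (\<Union>i\<in>idx s. f i ` {y \<in> RS. \<exists>i'\<in>idx s. i' \<noteq> i \<and> f i' y \<in> J})" (is "compact ?K")
 and departures_F: "(\<Union>i\<in>idx s. f i ` {y \<in> RS. \<exists>i'\<in>idx s. i' \<noteq> i \<and> f i' y \<in> J}) \<subseteq> F"
 and departures_nonempty: "(\<Union>i\<in>idx s. f i ` {y \<in> RS. \<exists>i'\<in>idx s. i' \<noteq> i \<and> f i' y \<in> J}) \<noteq> {}"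
proof -
 have "compact {y \<in> RS. \<exists>i'\<in>idx s. i' \<noteq> i \<and> f i' y \<in> J}" for i
 proof -
  have "{y \<in> RS. \<exists>i'\<in>idx s. i' \<noteq> i \<and> f i' y \<in> J} = (\<Union>i'\<in>idx s - {i}. {y \<in> RS. f i' y \<in> J})" by auto
  then show ?thesis using finite_idx compact_preimage_J by (auto intro!: compact_UN)
 qed
 then show "compact ?K" using finite_idx continuous_f
  by (intro compact_UN compact_continuous_image) (auto intro: continuous_on_subset)
 show "?K \<subseteq> F"
 proof
  fix x assume "x \<in> ?K"
  then obtain i i' y where y: "i \<in> idx s" "i' \<in> idx s" "i' \<noteq> i" "y \<in> RS" "f i' y \<in> J" "x = f i y" by blast
  then have "f i y \<notin> J" using A2 by metis
  then show "x \<in> F" using y f_RS by (simp add: J_iff)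
 qed
 obtain x where x: "x \<in> J" using J_nonempty by auto
 then have "x \<in> f 1 ` RS" using onto_f[OF idx_nonempty] J_RS by auto
 then obtain y where y: "y \<in> RS" "x = f 1 y" by auto
 have "y \<in> {y \<in> RS. \<exists>i'\<in>idx s. i' \<noteq> 2 \<and> f i' y \<in> J}"
  using y x idx_nonempty by (intro CollectI conjI bexI[of _ 1]) auto
 moreover have "2 \<in> idx s" using s_pos by (simp add: idx_def)
 ultimately show "?K \<noteq> {}" by blast
qed

end

text \<open>The data provided by \<open>omitted_ball\<close>: the pole is the centre of a hole of
  radius \<delta>, and the orbits of the hole and of the critical values keep distance e from
  J.\<close>

locale hyperbolic_chart = hyperbolic_system +
 fixes a :: complex and \<delta> e :: real
 assumes \<delta>: "\<delta> > 0" and e: "e > 0"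
  and avoid_hole: "\<And>w y x. set w \<subseteq> idx s \<Longrightarrow> y \<in> RS \<Longrightarrow> dist y (pole a) < \<delta> \<Longrightarrow> x \<in> J \<Longrightarrow> e \<le> dist (wcomp f w y) x"
  and avoid_crit: "\<And>w i y x. set w \<subseteq> idx s \<Longrightarrow> i \<in> idx s \<Longrightarrow> y \<in> RS \<Longrightarrow> sph_dnorm (f i) y = 0 \<Longrightarrow> x \<in> J \<Longrightarrow> e \<le> dist (wcomp f w (f i y)) x"
begin

text \<open>L is the Lipschitz constant of the chart. On a chart ball of radius r1 about a point of
  J one stays within e of J, hence off the orbits of the hole and of the critical values. R bounds
  everything outside the hole in the chart.\<close>

definition "L = 2 * ((cmod a)\<^sup>2 + 1)"
definition "r1 = e / L"
definition "R = 2 / \<delta>"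

lemma L_pos: "L > 0" by (simp add: L_def add_nonneg_pos)
lemma r1_pos: "r1 > 0" using e L_pos by (simp add: r1_def)
lemma R_pos: "R > 0" using \<delta> by (simp add: R_def)

lemma emb_L: "dist (emb a u) (emb a v) \<le> L * dist u v"
 unfolding L_def by (rule emb_lipschitz)

lemma emb_close: "t \<in> ball u r1 \<Longrightarrow> dist (emb a t) (emb a u) < e"
 using emb_L[of t u] L_pos by (auto simp: r1_def field_simps dist_commute)

lemma J_off_pole: assumes "x \<in> J" shows "\<delta> \<le> dist x (pole a)"
 using avoid_hole[of "[]" x x] assms J_RS e by (force simp: not_le)

lemma preimage_off_pole:
 assumes "word w" "y \<in> RS" "wcomp f w y = emb a t" "t \<in> ball u r1" "emb a u \<in> J"
 shows "\<delta> \<le> dist y (pole a)"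
 using avoid_hole[of w y "emb a u"] assms emb_close[OF assms(4)] by force

lemma chart_point: assumes "x \<in> J" obtains u where "x = emb a u" "cmod u \<le> R"
proof -
 have "x \<noteq> pole a" using J_off_pole[OF assms] \<delta> by auto
 then obtain u where u: "x = emb a u" using emb_surj J_RS assms by blast
 then show ?thesis using that emb_norm_le[OF \<delta>, of a u] J_off_pole[OF assms] by (simp add: R_def)
qed

text \<open>Inverse branch of f_w on a ball of the fixed radius r1, in the same chart at both
  ends.\<close>

definition branch :: "nat list \<Rightarrow> complex \<Rightarrow> (complex \<Rightarrow> complex) \<Rightarrow> bool" where
 "branch w u g \<longleftrightarrow> g holomorphic_on ball u r1 \<and> (\<forall>t\<in>ball u r1. wcomp f w (emb a (g t)) = emb a t)"

text \<open>Induction on the word: the branch of the remaining word avoids the critical values of f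
  i by \<open>avoid_crit\<close>, and the ball is simply connected, so this branch lifts through the
  covering f i. By \<open>avoid_hole\<close> the lift stays off the pole and can be read in the
  chart, where \<open>holomorphic_lift\<close> applies. That x may lie over any v in the ball gives
  the second half of shadowing.\<close>

lemma branch_exists:
 assumes u: "emb a u \<in> J" and v: "v \<in> ball u r1"
 shows "word w \<Longrightarrow> x \<in> RS \<Longrightarrow> wcomp f w x = emb a v \<Longrightarrow> \<exists>g. branch w u g \<and> emb a (g v) = x"
proof (induction w arbitrary: x)
 case Nil
 then show ?case by (intro exI[of _ "\<lambda>t. t"]) (auto simp: branch_def intro!: holomorphic_intros)
next
 case (Cons i w)
 define U where "U = ball u r1"
 have i: "i \<in> idx s" and w: "word w" using Cons.prems by auto
 have "wcomp f w (f i x) = emb a v" using Cons.prems(3) by simp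
 then obtain g1 where g1: "branch w u g1" "emb a (g1 v) = f i x"
  using Cons.IH[OF w f_RS[OF i]] by blast
 obtain p q where pq: "rat_pair p q" "rat_deg p q \<ge> 1" "f i = rat_sph p q" by (metis ratE[OF i])
 define E where "E = f i ` {y \<in> RS. sph_dnorm (f i) y = 0}"
 have "closed {y \<in> RS. sph_dnorm (f i) y = 0}"
  unfolding pq(3) by (intro continuous_closed_preimage_constant continuous_sph_dnorm[OF pq(1,2)] compact_imp_closed[OF compact_RS])
 then have "compact (RS \<inter> {y \<in> RS. sph_dnorm (f i) y = 0})" using compact_RS compact_Int_closed by blast
 moreover have "RS \<inter> {y \<in> RS. sph_dnorm (f i) y = 0} = {y \<in> RS. sph_dnorm (f i) y = 0}" by auto
 ultimately have "compact {y \<in> RS. sph_dnorm (f i) y = 0}" by simp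
 then have "compact E" unfolding E_def using continuous_f[OF i]
  by (intro compact_continuous_image) (auto intro: continuous_on_subset)
 then have clE: "closed E" by (rule compact_imp_closed)
 have cov: "covering_space {y \<in> RS. f i y \<notin> E} (f i) (RS - E)"
  unfolding pq(3) by (rule covering_space_rat_sph[OF pq(1,2) clE]) (auto simp: E_def pq(3))
 define G1 where "G1 = (\<lambda>t. emb a (g1 t))"
 have w1: "wcomp f w (G1 t) = emb a t" if "t \<in> U" for t
  using g1(1) that by (simp add: branch_def U_def G1_def)
 have G1E: "G1 t \<notin> E" if "t \<in> U" for t
 proof
  assume "G1 t \<in> E"
  then obtain y where y: "y \<in> RS" "sph_dnorm (f i) y = 0" "G1 t = f i y" by (auto simp: E_def)
  have "e \<le> dist (wcomp f w (f i y)) (emb a u)" using avoid_crit[OF w i y(1,2) u] .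
  moreover have "wcomp f w (f i y) = emb a t" using w1[OF that] y(3) by simp
  ultimately show False using emb_close[of t u] that by (simp add: U_def)
 qed
 have cG1: "continuous_on U G1" unfolding G1_def
  using g1(1) holomorphic_on_imp_continuous_on
  by (intro continuous_on_compose2[OF continuous_emb[of UNIV]]) (auto simp: branch_def U_def)
 have vU: "v \<in> U" using v by (simp add: U_def)
 have sc: "simply_connected U" unfolding U_def by (intro convex_imp_simply_connected) simp
 have lpc: "locally path_connected U" unfolding U_def by (intro convex_imp_locally_path_connected) simp
 obtain G where G: "continuous_on U G" "G \<in> U \<rightarrow> {y \<in> RS. f i y \<notin> E}" "G v = x" "\<And>t. t \<in> U \<Longrightarrow> f i (G t) = G1 t"
 proof (rule covering_space_lift_strong[OF cov _ vU sc lpc cG1])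
  show "x \<in> {y \<in> RS. f i y \<notin> E}" using Cons.prems(2) G1E[OF vU] g1(2) by (simp add: G1_def)
  show "G1 \<in> U \<rightarrow> RS - E" using G1E emb_in_RS by (auto simp: G1_def)
  show "G1 v = f i x" using g1(2) by (simp add: G1_def)
 qed blast
 have GRS: "G t \<in> RS" if "t \<in> U" for t using G(2) that by auto
 have Gw: "wcomp f (i # w) (G t) = emb a t" if "t \<in> U" for t using G(4) w1 that by simp
 have Goff: "\<delta> \<le> dist (G t) (pole a)" if "t \<in> U" for t
  using preimage_off_pole[OF Cons.prems(1) GRS[OF that] Gw[OF that] _ u] that by (simp add: U_def)
 have "\<exists>z. G t = emb a z" if "t \<in> U" for t
 proof -
  have "G t \<noteq> pole a" using Goff[OF that] \<delta> by (metis dist_self not_le)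
  then show ?thesis using emb_surj[OF GRS[OF that]] by blast
 qed
 then obtain g where g: "\<And>t. t \<in> U \<Longrightarrow> G t = emb a (g t)" by metis
 have cg: "continuous_on U g"
  unfolding continuous_on_iff
 proof (intro ballI allI impI)
  fix t and \<epsilon> :: real assume t: "t \<in> U" and \<epsilon>: "\<epsilon> > 0"
  have "\<epsilon> * \<delta>\<^sup>2 / 2 > 0" using \<epsilon> \<delta> by simp
  then obtain d where d: "d > 0" "\<And>t'. t' \<in> U \<Longrightarrow> dist t' t < d \<Longrightarrow> dist (G t') (G t) < \<epsilon> * \<delta>\<^sup>2 / 2"
   using G(1) t unfolding continuous_on_iff by blast
  have "dist (g t') (g t) < \<epsilon>" if t': "t' \<in> U" "dist t' t < d" for t'
  proof -
   have "dist (g t') (g t) \<le> 2 / \<delta>\<^sup>2 * dist (emb a (g t')) (emb a (g t))"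
    using Goff g t t' by (intro emb_inverse_lipschitz[OF \<delta>]) auto
   also have "\<dots> < 2 / \<delta>\<^sup>2 * (\<epsilon> * \<delta>\<^sup>2 / 2)"
    using d(2)[OF t'] g t t' \<delta> by (intro mult_strict_left_mono) auto
   also have "\<dots> = \<epsilon>" using \<delta> by simp
   finally show ?thesis .
  qed
  then show "\<exists>d>0. \<forall>t'\<in>U. dist t' t < d \<longrightarrow> dist (g t') (g t) < \<epsilon>" using d(1) by blast
 qed
 define V where "V = {z. rat_sph p q (emb a z) \<noteq> pole a}"
 have fg: "rat_sph p q (emb a (g t)) = emb a (g1 t)" if "t \<in> U" for t
  using G(4)[OF that] g[OF that] by (simp add: pq(3) G1_def)
 have gV: "g t \<in> V" if "t \<in> U" for t using fg[OF that] emb_neq_pole by (simp add: V_def)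
 have "g holomorphic_on U"
 proof (rule holomorphic_lift[OF _ cg _ _ _ gV])
  show "open U" by (simp add: U_def)
  show "g1 holomorphic_on U" using g1(1) by (simp add: branch_def U_def)
  show "open V" unfolding V_def by (rule open_rchart_domain[OF pq(1,2)])
  show "rchart p q a holomorphic_on V" by (rule holomorphic_rchart[OF pq(1,2)]) (simp add: V_def)
  fix t assume t: "t \<in> U"
  have "emb a (rchart p q a (g t)) = emb a (g1 t)"
   using rat_sph_emb_eq[OF pq(1,2), of a "g t"] gV[OF t] fg[OF t] by (simp add: V_def)
  then show "rchart p q a (g t) = g1 t" using inj_emb[of a] by (simp add: inj_def)
  have "f i (G t) \<notin> E" using G(2) t by auto
  then have "sph_dnorm (f i) (G t) \<noteq> 0" using GRS[OF t] by (auto simp: E_def)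
  then show "deriv (rchart p q a) (g t) \<noteq> 0"
   using deriv_rchart_eq_0_iff[OF pq(1,2), of a "g t"] gV[OF t] g[OF t] by (simp add: V_def pq(3))
 qed
 then have "branch (i # w) u g" using Gw g by (simp add: branch_def U_def)
 moreover have "emb a (g v) = x" using G(3) g[OF vU] by simp
 ultimately show ?case by blast
qed

lemma branch_norm_le:
 assumes "branch w u g" "word w" "emb a u \<in> J" "t \<in> ball u r1" shows "cmod (g t) \<le> R"
 unfolding R_def
proof (rule emb_norm_le[OF \<delta>])
 show "\<delta> \<le> dist (emb a (g t)) (pole a)"
  using preimage_off_pole[OF assms(2) emb_in_RS _ assms(4,3)] assms(1,4) by (auto simp: branch_def)
qed

lemma branch_lipschitz:
 assumes "branch w u g" "word w" "emb a u \<in> J"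
 shows "\<And>v. v \<in> ball u (r1 / 2) \<Longrightarrow> cmod (deriv g v) \<le> 4 * R / r1"
  "\<And>v v'. v \<in> ball u (r1 / 2) \<Longrightarrow> v' \<in> ball u (r1 / 2) \<Longrightarrow> dist (g v) (g v') \<le> 4 * R / r1 * dist v v'"
 using holomorphic_bounded_lipschitz[of g u r1 R] branch_norm_le[OF assms] assms(1) r1_pos
 by (auto simp: branch_def)

lemma branch_take_off_pole:
 assumes "branch w u g" "word w" "emb a u \<in> J" "t \<in> ball u r1"
 shows "\<delta> \<le> dist (wcomp f (take j w) (emb a (g t))) (pole a)"
proof (rule preimage_off_pole[OF _ _ _ assms(4,3)])
 show "word (drop j w)" using assms(2) by (rule set_drop_idx)
 have "word (take j w)" using assms(2) by (rule set_take_idx)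
 then show "wcomp f (take j w) (emb a (g t)) \<in> RS" by (rule wcomp_RS[OF _ emb_in_RS])
 show "wcomp f (drop j w) (wcomp f (take j w) (emb a (g t))) = emb a t"
  unfolding wcomp_take_drop using assms(1,4) by (simp add: branch_def)
qed

text \<open>If a branch had derivative bounded below, its image would contain a ball of definite size on which
 the initial segments of the word avoid the hole, hence are equicontinuous; any other word leaves the
 Julia set on the way. So the centre would be a Fatou point.\<close>
lemma equi_near_limit:
 assumes c: "c > 0"
  and words: "\<And>\<rho> m. \<rho> > 0 \<Longrightarrow> \<exists>w x'. m \<le> length w \<and> word w \<and> dist x x' < \<rho> \<and> wcomp f w (emb a x') \<in> J \<and>
   (\<forall>v\<in>ball x c. \<forall>j\<le>length w. \<delta> \<le> dist (wcomp f (take j w) (emb a v)) (pole a))"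
 shows "emb a x \<in> F"
proof -
 define K where "K = (\<Union>i\<in>idx s. f i ` {y \<in> RS. \<exists>i'\<in>idx s. i' \<noteq> i \<and> f i' y \<in> J})"
 have K: "compact K" "K \<subseteq> F" "K \<noteq> {}"
  unfolding K_def using compact_departures departures_F departures_nonempty by blast+
 have "K \<inter> J = {}" using K(2) by (auto simp: julia_def)
 then obtain d0 where d0: "d0 > 0" "\<And>x y. x \<in> K \<Longrightarrow> y \<in> J \<Longrightarrow> d0 \<le> dist x y"
  using separate_compact_closed[OF K(1) compact_imp_closed[OF compact_J]] by blast
 \<comment> \<open>Half the distance between K and J, so that the closed \<eta>-neighbourhood Kp of
   K is still a compact part of the Fatou set.\<close>
 define \<eta> where "\<eta> = d0 / 2"
 define Kp where "Kp = RS \<inter> {y. infdist y K \<le> \<eta>}"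
 have "closed {y. infdist y K \<le> \<eta>}" by (intro closed_Collect_le continuous_intros)
 then have cKp: "compact Kp" unfolding Kp_def using compact_RS by (rule compact_Int_closed[rotated])
 have KpF: "Kp \<subseteq> F"
 proof
  fix y assume y: "y \<in> Kp"
  show "y \<in> F"
  proof (rule ccontr)
   assume "y \<notin> F"
   then have yJ: "y \<in> J" using y by (simp add: Kp_def julia_def)
   have "d0 \<le> infdist y K" unfolding infdist_notempty[OF K(3)]
    using K(3) d0(2) yJ by (intro cINF_greatest) (auto simp: dist_commute)
   then show False using y d0(1) by (simp add: Kp_def \<eta>_def)
  qed
 qed
 have \<eta>: "\<eta> > 0" using d0 by (simp add: \<eta>_def)
 obtain \<zeta> where \<zeta>: "\<zeta> > 0" "\<And>i x y. i \<in> idx s \<Longrightarrow> x \<in> RS \<Longrightarrow> y \<in> RS \<Longrightarrow> dist x y < \<zeta> \<Longrightarrow> dist (f i x) (f i y) < \<eta>"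
  using uniform_continuity[OF \<eta>] by blast
 define M where "M = 2 * ((cmod a)\<^sup>2 + 1) * (8 / (\<delta> * c))"
 have "M = L * (8 / (\<delta> * c))" by (simp add: M_def L_def)
 then have M: "M > 0" using \<delta> c L_pos by simp
 \<comment> \<open>Two points within \<tau> of x are less than 2 \<tau> apart, so initial segments
   of w keep them closer than \<zeta>, and one more letter keeps them closer than \<eta>.\<close>
 define \<tau> where "\<tau> = min (c / 2) (\<zeta> / (2 * M))"
 have \<tau>: "\<tau> > 0" using c \<zeta> M by (simp add: \<tau>_def)
 obtain r where r: "r > 0" "\<And>y. y \<in> RS \<Longrightarrow> dist (emb a x) y < r \<Longrightarrow> \<exists>v. y = emb a v \<and> dist x v < \<tau>"
  using emb_local_inverse[OF \<tau>] by blast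
 have "equi (semigrp s f) RS y" if y: "y \<in> RS" "dist (emb a x) y < r" for y
  unfolding equi_def
 proof (intro allI impI)
  fix \<epsilon> :: real assume \<epsilon>: "\<epsilon> > 0"
  obtain v where v: "y = emb a v" "dist x v < \<tau>" using r(2)[OF y] by blast
  obtain d1 where d1: "d1 > 0" "\<And>y y' w. y \<in> Kp \<Longrightarrow> y' \<in> RS \<Longrightarrow> dist y y' < d1 \<Longrightarrow> word w \<Longrightarrow>
    dist (wcomp f w y) (wcomp f w y') < \<epsilon>"
   using uniform_equi[OF cKp KpF \<epsilon>] by blast
  obtain d2 where d2: "d2 > 0" "\<And>i x y. i \<in> idx s \<Longrightarrow> x \<in> RS \<Longrightarrow> y \<in> RS \<Longrightarrow> dist x y < d2 \<Longrightarrow> dist (f i x) (f i y) < d1"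
   using uniform_continuity[OF d1(1)] by blast
  define d where "d = min (\<tau> - dist x v) (min (\<epsilon> / M) (d2 / M))"
  have d: "d > 0" using v \<epsilon> d2 M by (simp add: d_def)
  obtain \<kappa> where \<kappa>: "\<kappa> > 0" "\<And>y'. y' \<in> RS \<Longrightarrow> dist y y' < \<kappa> \<Longrightarrow> \<exists>v'. y' = emb a v' \<and> dist v v' < d"
   using emb_local_inverse[OF d, of a v] unfolding v(1)[symmetric] by blast
  have "dist (h y) (h y') < \<epsilon>" if y': "y' \<in> RS" "dist y y' < \<kappa>" and h: "h \<in> semigrp s f" for y' h
  proof -
   obtain v' where v': "y' = emb a v'" "dist v v' < d" using \<kappa>(2)[OF y'] by blast
   obtain u where u: "word u" "h = wcomp f u" using h by (auto simp: semigrp_def)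
   obtain w x' where w: "length u \<le> length w" "word w" "dist x x' < \<tau>" "wcomp f w (emb a x') \<in> J"
    and off: "\<And>v j. v \<in> ball x c \<Longrightarrow> j \<le> length w \<Longrightarrow> \<delta> \<le> dist (wcomp f (take j w) (emb a v)) (pole a)"
    using words[OF \<tau>] by metis
   have lip: "dist (wcomp f (take j w) (emb a t)) (wcomp f (take j w) (emb a t')) \<le> M * dist t t'"
    if "dist x t < \<tau>" "dist x t' < \<tau>" for j t t'
    unfolding M_def
   proof (rule wcomp_lipschitz[OF _ \<delta> c])
    show "word (take j w)" using w(2) by (rule set_take_idx)
    show "t \<in> ball x (c / 2)" "t' \<in> ball x (c / 2)" using that by (auto simp: \<tau>_def)
    fix v k assume "v \<in> ball x c" "k \<le> length (take j w)"
    then show "\<delta> \<le> dist (wcomp f (take k (take j w)) (emb a v)) (pole a)" using off[of v k] by (simp add: min_absorb1)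
   qed
   have "dist x v' \<le> dist x v + dist v v'" by (rule dist_triangle)
   then have xv': "dist x v' < \<tau>" using v'(2) by (simp add: d_def)
   have Mv: "M * dist v v' < \<epsilon>" "M * dist v v' < d2"
    using v'(2) M by (simp_all add: d_def pos_less_divide_eq mult.commute)
   show ?thesis
   proof (rule common_prefix_cases[OF w(1)])
    assume "u = take (length u) w"
    then have "dist (h y) (h y') \<le> M * dist v v'" using lip[OF v(2) xv', of "length u"] by (simp add: u v v')
    then show ?thesis using Mv by linarith
   next
    fix j assume j: "j < length u" "take j u = take j w" "u ! j \<noteq> w ! j"
    define i where "i = u ! j"
    have i: "i \<in> idx s" using u(1) j(1) by (auto simp: i_def)
    have wj: "w ! j \<in> idx s" using w(1,2) j(1) by (meson nth_mem order_less_le_trans subsetD)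
    have tj: "word (take j w)" using w(2) by (rule set_take_idx)
    have du: "set (drop (Suc j) u) \<subseteq> idx s" using u(1) by (rule set_drop_idx)
    define b where "b t = wcomp f (take j w) (emb a t)" for t
    have bRS: "b t \<in> RS" for t unfolding b_def by (rule wcomp_RS[OF tj emb_in_RS])
    have "j < length w" using w(1) j(1) by simp
    then have "wcomp f w (emb a x') = wcomp f (drop (Suc j) w) (f (w ! j) (b x'))"
     unfolding b_def by (rule wcomp_split)
    moreover have "set (drop (Suc j) w) \<subseteq> idx s" using w(2) by (rule set_drop_idx)
    \<comment> \<open>At the first deviation the letter of w still leads b x' into J. Hence the
      deviating letter i sends b x' into K and the nearby b v into Kp, where all words are
      equicontinuous.\<close>
    ultimately have "f (w ! j) (b x') \<in> J" using J_backward[OF f_RS[OF wj]] w(4) by metis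
    then have "b x' \<in> {y \<in> RS. \<exists>i'\<in>idx s. i' \<noteq> i \<and> f i' y \<in> J}"
     using wj j(3) bRS by (intro CollectI conjI bexI[of _ "w ! j"]) (auto simp: i_def)
    then have bK: "f i (b x') \<in> K" unfolding K_def using i by blast
    have "dist (b v) (b x') \<le> M * dist v x'" unfolding b_def by (rule lip[OF v(2) w(3)])
    also have "\<dots> < M * (2 * \<tau>)"
     using dist_triangle[of v x' x] v(2) w(3) M by (intro mult_strict_left_mono) (auto simp: dist_commute)
    also have "\<dots> \<le> \<zeta>"
    proof -
     have "\<tau> \<le> \<zeta> / (2 * M)" by (simp add: \<tau>_def)
     then show ?thesis using M by (simp add: field_simps)
    qed
    finally have "dist (f i (b v)) (f i (b x')) < \<eta>" by (intro \<zeta>(2)[OF i bRS bRS])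
    then have "infdist (f i (b v)) K \<le> \<eta>" using infdist_le[OF bK, of "f i (b v)"] by linarith
    then have Kp1: "f i (b v) \<in> Kp" using f_RS[OF i] by (simp add: Kp_def)
    have "dist (b v) (b v') < d2" using lip[OF v(2) xv', of j] Mv by (simp add: b_def)
    then have "dist (f i (b v)) (f i (b v')) < d1" by (intro d2(2)[OF i bRS bRS])
    then have "dist (wcomp f (drop (Suc j) u) (f i (b v))) (wcomp f (drop (Suc j) u) (f i (b v'))) < \<epsilon>"
     using d1(2)[OF Kp1 f_RS[OF i] _ du] by blast
    moreover have "wcomp f u (emb a t) = wcomp f (drop (Suc j) u) (f i (b t))" for t
     unfolding b_def i_def j(2)[symmetric] by (rule wcomp_split[OF j(1)])
    ultimately show ?thesis by (simp add: u v v')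
   qed
  qed
  then show "\<exists>\<delta>>0. \<forall>y'\<in>RS. dist y y' < \<delta> \<longrightarrow> (\<forall>h\<in>semigrp s f. dist (h y) (h y') < \<epsilon>)"
   using \<kappa>(1) by blast
 qed
 then show ?thesis unfolding F_iff using emb_in_RS r(1) by blast
qed

text \<open>Otherwise branches of arbitrarily long words have derivative at least c at the centre,
  and by Bloch's lemma their images contain balls of a common radius c'. The centres of these balls
  lie in J and accumulate at a point l of J, which \<open>equi_near_limit\<close> shows to be a
  Fatou point.\<close>

lemma branch_contracts:
 assumes c: "c > 0"
 shows "\<exists>n. \<forall>w u g. word w \<longrightarrow> n \<le> length w \<longrightarrow> emb a u \<in> J \<longrightarrow> branch w u g \<longrightarrow> cmod (deriv g u) < c"
proof (rule ccontr)
 assume "\<not> ?thesis"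
 then have "\<forall>n. \<exists>w u g. word w \<and> n \<le> length w \<and> emb a u \<in> J \<and> branch w u g \<and> c \<le> cmod (deriv g u)"
  by (meson not_le)
 then obtain w u g where w: "\<And>n. word (w n)" "\<And>n. n \<le> length (w n)" and u: "\<And>n. emb a (u n) \<in> J"
  and g: "\<And>n. branch (w n) (u n) (g n)" and big: "\<And>n. c \<le> cmod (deriv (g n) (u n))" by metis
 define M where "M = 4 * (4 * R / r1) / (r1 / 2)"
 have M: "M > 0" using R_pos r1_pos by (simp add: M_def)
 \<comment> \<open>M is the Lipschitz constant of the derivative, so on a ball of radius c / M it
   changes by at most c and hence at most doubles, as Bloch's lemma requires.\<close>
 define \<rho> where "\<rho> = min (r1 / 8) (c / M)"
 have \<rho>: "\<rho> > 0" using r1_pos c M by (simp add: \<rho>_def)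
 \<comment> \<open>The radius in \<open>Bloch_lemma\<close>, with the derivative replaced by its
   lower bound c.\<close>
 define c' where "c' = (3 - 2 * sqrt 2) * \<rho> * c"
 have "sqrt 2 < 3 / 2" by (rule real_less_lsqrt) (auto simp: power2_eq_square)
 then have c': "c' > 0" using \<rho> c by (simp add: c'_def)
 define x where "x n = g n (u n)" for n
 have fx: "wcomp f (w n) (emb a (x n)) = emb a (u n)" for n
  using g[of n] r1_pos by (simp add: branch_def x_def)
 have xJ: "emb a (x n) \<in> J" for n using J_backward[OF emb_in_RS w(1)] fx u by metis
 have img: "ball (x n) c' \<subseteq> g n ` ball (u n) r1" for n
 proof -
  have hol: "g n holomorphic_on ball (u n) r1" using g[of n] by (simp add: branch_def)
  have hol': "deriv (g n) holomorphic_on ball (u n) (r1 / 2)"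
   using holomorphic_deriv[OF hol] r1_pos by (auto intro: holomorphic_on_subset)
  have bd: "cmod (deriv (g n) v) \<le> 4 * R / r1" if "v \<in> ball (u n) (r1 / 2)" for v
   using branch_lipschitz(1)[OF g w(1) u that] .
  have "cmod (deriv (g n) t) \<le> 2 * cmod (deriv (g n) (u n))" if t: "t \<in> ball (u n) \<rho>" for t
  proof -
   have "t \<in> ball (u n) (r1 / 2 / 2)" "u n \<in> ball (u n) (r1 / 2 / 2)" using t r1_pos by (auto simp: \<rho>_def)
   then have "dist (deriv (g n) t) (deriv (g n) (u n)) \<le> M * dist t (u n)"
    unfolding M_def
    using holomorphic_bounded_lipschitz(2)[OF hol' bd half_gt_zero[OF r1_pos]] by blast
   also have "\<dots> \<le> M * (c / M)" using t M by (intro mult_left_mono) (auto simp: \<rho>_def dist_commute)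
   also have "\<dots> = c" using M by simp
   finally have "dist (deriv (g n) t) (deriv (g n) (u n)) \<le> cmod (deriv (g n) (u n))" using big[of n] by linarith
   then show ?thesis using norm_triangle_ineq2[of "deriv (g n) t" "deriv (g n) (u n)"] by (simp add: dist_norm)
  qed
  moreover have "g n holomorphic_on cball (u n) \<rho>"
   using r1_pos by (intro holomorphic_on_subset[OF hol]) (auto simp: \<rho>_def)
  ultimately have "ball (g n (u n)) ((3 - 2 * sqrt 2) * \<rho> * cmod (deriv (g n) (u n))) \<subseteq> g n ` ball (u n) \<rho>"
   using \<rho> by (intro Bloch_lemma) auto
  moreover have "c' \<le> (3 - 2 * sqrt 2) * \<rho> * cmod (deriv (g n) (u n))"
   unfolding c'_def using \<open>sqrt 2 < 3 / 2\<close> \<rho> big[of n] by (intro mult_left_mono) auto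
  moreover have "g n ` ball (u n) \<rho> \<subseteq> g n ` ball (u n) r1" using r1_pos by (intro image_mono) (auto simp: \<rho>_def)
  ultimately show ?thesis unfolding x_def by (meson order_trans subset_ball)
 qed
 have "x n \<in> cball 0 R" for n
  using branch_norm_le[OF g w(1) u, where t = "u n"] r1_pos by (simp add: x_def)
 then obtain l k where l: "strict_mono k" "(x \<circ> k) \<longlonglongrightarrow> l"
  using compact_cball[of "0::complex" R] unfolding compact_def by metis
 have "isCont (emb a) l" using continuous_emb[of UNIV a] by (simp add: continuous_on_eq_continuous_at)
 then have lim: "(\<lambda>n. emb a ((x \<circ> k) n)) \<longlonglongrightarrow> emb a l" by (rule isCont_tendsto_compose[OF _ l(2)])
 have "emb a ((x \<circ> k) n) \<in> J" for n using xJ by simp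
 then have lJ: "emb a l \<in> J" by (rule closed_sequentially[OF compact_imp_closed[OF compact_J] _ lim])
 have "emb a l \<in> F"
 proof (rule equi_near_limit[of "c' / 2"])
  fix \<rho>' :: real and m :: nat assume "\<rho>' > 0"
  then have "min \<rho>' (c' / 2) > 0" using c' by simp
  then obtain N where N: "\<And>n. n \<ge> N \<Longrightarrow> dist ((x \<circ> k) n) l < min \<rho>' (c' / 2)"
   using l(2) unfolding lim_sequentially by blast
  define n where "n = k (max N m)"
  have d: "dist (x n) l < min \<rho>' (c' / 2)" using N[of "max N m"] by (simp add: n_def)
  have "m \<le> length (w n)" using seq_suble[OF l(1), of "max N m"] w(2)[of n] by (simp add: n_def)
  moreover have "\<delta> \<le> dist (wcomp f (take j (w n)) (emb a v)) (pole a)" if v: "v \<in> ball l (c' / 2)" for v j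
  proof -
   have "dist (x n) v \<le> dist (x n) l + dist l v" by (rule dist_triangle)
   then have "v \<in> ball (x n) c'" using v d by simp
   then obtain t where "t \<in> ball (u n) r1" "v = g n t" using img by blast
   then show ?thesis using branch_take_off_pole[OF g w(1) u] by simp
  qed
  moreover have "dist l (x n) < \<rho>'" using d by (simp add: dist_commute)
  ultimately show "\<exists>w x'. m \<le> length w \<and> word w \<and> dist l x' < \<rho>' \<and> wcomp f w (emb a x') \<in> J \<and>
   (\<forall>v\<in>ball l (c' / 2). \<forall>j\<le>length w. \<delta> \<le> dist (wcomp f (take j w) (emb a v)) (pole a))"
   using w(1) fx u by (intro exI[of _ "w n"] exI[of _ "x n"]) auto
 qed (use c' in simp)
 then show False using lJ by (simp add: julia_def)
qed

end

section \<open>Contraction and distortion\<close>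

lemma metric_deriv_compose:
 assumes f: "metric_deriv f S x k" and g: "metric_deriv g S (f x) l" and S: "x \<in> S" "\<And>y. y \<in> S \<Longrightarrow> f y \<in> S"
 shows "metric_deriv (\<lambda>y. g (f y)) S x (k * l)"
 unfolding metric_deriv_def
proof (intro allI impI)
 fix \<epsilon> :: real assume \<epsilon>: "\<epsilon> > 0"
 define e where "e = min 1 (\<epsilon> / (\<bar>k\<bar> + 1 + \<bar>l\<bar>))"
 have e: "e > 0" "e \<le> 1" using \<epsilon> by (auto simp: e_def)
 have e\<epsilon>: "(\<bar>k\<bar> + 1 + \<bar>l\<bar>) * e \<le> \<epsilon>"
 proof -
  have "(\<bar>k\<bar> + 1 + \<bar>l\<bar>) * e \<le> (\<bar>k\<bar> + 1 + \<bar>l\<bar>) * (\<epsilon> / (\<bar>k\<bar> + 1 + \<bar>l\<bar>))" by (intro mult_left_mono) (auto simp: e_def)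
  then show ?thesis by simp
 qed
 obtain d1 where d1: "d1 > 0" "\<And>y y'. y \<in> S \<Longrightarrow> y' \<in> S \<Longrightarrow> dist x y < d1 \<Longrightarrow> dist x y' < d1 \<Longrightarrow> \<bar>dist (f y) (f y') - k * dist y y'\<bar> \<le> e * dist y y'"
  using metric_derivE[OF f e(1)] by blast
 obtain d2 where d2: "d2 > 0" "\<And>y y'. y \<in> S \<Longrightarrow> y' \<in> S \<Longrightarrow> dist (f x) y < d2 \<Longrightarrow> dist (f x) y' < d2 \<Longrightarrow> \<bar>dist (g y) (g y') - l * dist y y'\<bar> \<le> e * dist y y'"
  using metric_derivE[OF g e(1)] by blast
 obtain d3 where d3: "d3 > 0" "\<And>y. y \<in> S \<Longrightarrow> dist y x < d3 \<Longrightarrow> dist (f y) (f x) < d2"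
  using metric_deriv_continuous[OF f S(1)] d2(1) unfolding continuous_within_eps_delta by blast
 have "\<bar>dist (g (f y)) (g (f y')) - k * l * dist y y'\<bar> \<le> \<epsilon> * dist y y'"
  if y: "y \<in> S" "y' \<in> S" "dist x y < min d1 d3" "dist x y' < min d1 d3" for y y'
 proof -
  have A: "\<bar>dist (f y) (f y') - k * dist y y'\<bar> \<le> e * dist y y'" using d1(2) y by simp
  have B: "\<bar>dist (g (f y)) (g (f y')) - l * dist (f y) (f y')\<bar> \<le> e * dist (f y) (f y')"
   using d2(2)[OF S(2)[OF y(1)] S(2)[OF y(2)]] d3(2)[OF y(1)] d3(2)[OF y(2)] y(3,4) by (simp add: dist_commute)
  have "dist (f y) (f y') \<le> (k + e) * dist y y'" using A by (simp add: algebra_simps abs_le_iff)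
  also have "\<dots> \<le> (\<bar>k\<bar> + 1) * dist y y'" using e by (intro mult_right_mono) auto
  finally have C: "dist (f y) (f y') \<le> (\<bar>k\<bar> + 1) * dist y y'" .
  have "dist (g (f y)) (g (f y')) - k * l * dist y y' =
    (dist (g (f y)) (g (f y')) - l * dist (f y) (f y')) + l * (dist (f y) (f y') - k * dist y y')"
   by (simp add: algebra_simps)
  also have "\<bar>\<dots>\<bar> \<le> \<bar>dist (g (f y)) (g (f y')) - l * dist (f y) (f y')\<bar> + \<bar>l\<bar> * \<bar>dist (f y) (f y') - k * dist y y'\<bar>"
   by (rule order_trans[OF abs_triangle_ineq]) (simp add: abs_mult)
  also have "\<dots> \<le> e * ((\<bar>k\<bar> + 1) * dist y y') + \<bar>l\<bar> * (e * dist y y')"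
   using A order_trans[OF B mult_left_mono[OF C]] e by (intro add_mono mult_left_mono) auto
  also have "\<dots> = ((\<bar>k\<bar> + 1 + \<bar>l\<bar>) * e) * dist y y'" by (simp add: algebra_simps)
  also have "\<dots> \<le> \<epsilon> * dist y y'" using e\<epsilon> by (rule mult_right_mono) simp
  finally show ?thesis .
 qed
 then show "\<exists>\<delta>>0. \<forall>y\<in>S. \<forall>y'\<in>S. dist x y < \<delta> \<longrightarrow> dist x y' < \<delta> \<longrightarrow> \<bar>dist (g (f y)) (g (f y')) - k * l * dist y y'\<bar> \<le> \<epsilon> * dist y y'"
  using d1(1) d3(1) by (intro exI[of _ "min d1 d3"]) auto
qed

text \<open>Replacing each map h by h + t (h - h(x)) keeps the image inside the domain and multiplies the
 derivative of the composition at x by a power of 1 + t (Earle-Hamilton).\<close>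
lemma earle_hamilton:
 fixes h H :: "nat \<Rightarrow> complex \<Rightarrow> complex"
 assumes N: "open N" "N \<subseteq> cball 0 R"
  and hol: "\<And>i. h i holomorphic_on N"
  and deep: "\<And>i v z. v \<in> N \<Longrightarrow> dist (h i v) z < \<tau> \<Longrightarrow> z \<in> N"
  and t: "t > 0" "t * (2 * R) < \<tau>"
  and H: "\<And>v. H 0 v = v" "\<And>m v. H (Suc m) v = h m (H m v)"
  and x: "r > 0" "ball x r \<subseteq> N"
 shows "cmod (deriv (H m) x) \<le> 4 * R / r / (1 + t) ^ m" "H m holomorphic_on N" "H m ` N \<subseteq> N"
proof -
 have xN: "x \<in> N" using x by auto
 then have "R \<ge> 0" using N(2) norm_ge_zero[of x] by (metis mem_cball_0 order_trans subsetD)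
 then have \<tau>: "\<tau> > 0" using t by (smt (verit) mult_nonneg_nonneg)
 have hN: "h i v \<in> N" if "v \<in> N" for i v using deep[OF that, of i "h i v"] \<tau> by simp
 have main: "H m holomorphic_on N \<and> H m ` N \<subseteq> N \<and> (\<exists>G. G holomorphic_on N \<and> G ` N \<subseteq> N \<and> G x = H m x \<and>
   deriv G x = (1 + complex_of_real t) ^ m * deriv (H m) x)" for m
 proof (induction m)
  case 0
  have "H 0 = (\<lambda>v. v)" using H(1) by auto
  then show ?case by (auto intro!: exI[of _ "\<lambda>v. v"] holomorphic_intros)
 next
  case (Suc m)
  then obtain G where G: "G holomorphic_on N" "G ` N \<subseteq> N" "G x = H m x"
   "deriv G x = (1 + complex_of_real t) ^ m * deriv (H m) x" by blast
  have Hm: "H m holomorphic_on N" "H m ` N \<subseteq> N" using Suc by blast+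
  have HS: "H (Suc m) = h m \<circ> H m" using H(2) by auto
  have 1: "(h m \<circ> H m) holomorphic_on N"
   using Hm hol[of m] holomorphic_on_compose holomorphic_on_subset by blast
  have hG: "(h m \<circ> G) holomorphic_on N"
   using G(1,2) hol[of m] holomorphic_on_compose holomorphic_on_subset by blast
  define G' where "G' = (\<lambda>v. (h m \<circ> G) v + complex_of_real t * ((h m \<circ> G) v - h m (G x)))"
  have g1: "G' holomorphic_on N" unfolding G'_def by (intro holomorphic_intros hG)
  have g2: "G' v \<in> N" if v: "v \<in> N" for v
  proof (rule deep)
   show Gv: "G v \<in> N" using G(2) v by auto
   have Gx: "G x \<in> N" using G(2) xN by auto
   have "h m (G v) \<in> cball 0 R" "h m (G x) \<in> cball 0 R"
    using subsetD[OF N(2) hN[OF Gv]] subsetD[OF N(2) hN[OF Gx]] by auto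
   then have "cmod (h m (G v) - h m (G x)) \<le> 2 * R"
    using norm_triangle_ineq4[of "h m (G v)" "h m (G x)"] by simp
   then have A: "t * cmod (h m (G v) - h m (G x)) \<le> t * (2 * R)" using t by (intro mult_left_mono) auto
   have e: "dist (h m (G v)) (G' v) = t * cmod (h m (G v) - h m (G x))" using t by (simp add: G'_def dist_norm norm_mult)
   show "dist (h m (G v)) (G' v) < \<tau>" unfolding e using A t(2) by linarith
  qed
  have dG: "(G has_field_derivative deriv G x) (at x)" using G(1) N(1) xN holomorphic_derivI by blast
  have dH: "(H m has_field_derivative deriv (H m) x) (at x)" using Hm(1) N(1) xN holomorphic_derivI by blast
  have dh: "(h m has_field_derivative deriv (h m) (G x)) (at (G x))"
   using hol[of m] N(1) G(2) xN holomorphic_derivI by blast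
  have c: "((h m \<circ> G) has_field_derivative deriv (h m) (G x) * deriv G x) (at x)"
   using DERIV_chain[OF dh dG] .
  have "((h m \<circ> H m) has_field_derivative deriv (h m) (G x) * deriv (H m) x) (at x)"
   using DERIV_chain[OF dh[unfolded G(3)] dH] G(3) by simp
  then have d1: "deriv (H (Suc m)) x = deriv (h m) (G x) * deriv (H m) x"
   unfolding HS by (rule DERIV_imp_deriv)
  have "(G' has_field_derivative deriv (h m) (G x) * deriv G x + complex_of_real t * (deriv (h m) (G x) * deriv G x - 0)) (at x)"
   unfolding G'_def by (rule DERIV_add[OF c DERIV_cmult[OF DERIV_diff[OF c DERIV_const]]])
  then have "deriv G' x = deriv (h m) (G x) * deriv G x + complex_of_real t * (deriv (h m) (G x) * deriv G x - 0)"
   by (rule DERIV_imp_deriv)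
  then have d2: "deriv G' x = (1 + complex_of_real t) ^ Suc m * deriv (H (Suc m)) x"
   by (simp add: d1 G(4) algebra_simps)
  have "G' x = H (Suc m) x" by (simp add: G'_def HS G(3))
  moreover have "H (Suc m) holomorphic_on N" using 1 HS by simp
  moreover have "H (Suc m) ` N \<subseteq> N" using hN Hm(2) by (auto simp: H(2))
  moreover have "G' ` N \<subseteq> N" using g2 by auto
  ultimately show ?case using g1 d2 by blast
 qed
 then show "H m holomorphic_on N" "H m ` N \<subseteq> N" by blast+
 obtain G where G: "G holomorphic_on N" "G ` N \<subseteq> N" "deriv G x = (1 + complex_of_real t) ^ m * deriv (H m) x"
  using main by blast
 \<comment> \<open>The modified composition G is still bounded by R, so Cauchy's inequality bounds
   (1 + t)^m times the derivative of H m.\<close>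
 have "cmod (deriv G x) \<le> 4 * R / r"
 proof (rule holomorphic_bounded_lipschitz(1)[of G x r R])
  show "G holomorphic_on ball x r" using G(1) x(2) by (rule holomorphic_on_subset)
  show "cmod (G v) \<le> R" if "v \<in> ball x r" for v using that G(2) x(2) N(2) by (meson image_subset_iff mem_cball_0 subsetD)
 qed (use x in auto)
 moreover have "cmod (1 + complex_of_real t) = 1 + t"
  using t by (metis norm_of_real of_real_1 of_real_add abs_of_nonneg add_nonneg_nonneg less_imp_le zero_le_one)
 ultimately have "(1 + t) ^ m * cmod (deriv (H m) x) \<le> 4 * R / r" by (simp add: G(3) norm_mult norm_power)
 then have A: "cmod (deriv (H m) x) * (1 + t) ^ m \<le> 4 * R / r" by (simp only: mult.commute)
 have p: "(1 + t) ^ m > 0" using t by simp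
 show "cmod (deriv (H m) x) \<le> 4 * R / r / (1 + t) ^ m" unfolding pos_le_divide_eq[OF p] by (rule A)
qed

section \<open>Derivatives along words\<close>

context rational_system
begin

text \<open>The norm of the derivative of f_w at x, kept as the product from the chain rule;
  \<open>metric_deriv_wcomp\<close> justifies this reading.\<close>

primrec wder :: "nat list \<Rightarrow> complex \<times> real \<Rightarrow> real" where
 "wder [] x = 1"
| "wder (i # w) x = sph_dnorm (f i) x * wder w (f i x)"

lemma wder_append: "wder (u @ v) x = wder u x * wder v (wcomp f u x)"
 by (induction u arbitrary: x) auto

lemma metric_deriv_wcomp: "word w \<Longrightarrow> x \<in> RS \<Longrightarrow> metric_deriv (wcomp f w) RS x (wder w x)"
proof (induction w arbitrary: x)
 case Nil
 then show ?case by (auto simp: metric_deriv_def intro: exI[of _ 1])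
next
 case (Cons i w)
 then have "metric_deriv (\<lambda>y. wcomp f w (f i y)) RS x (sph_dnorm (f i) x * wder w (f i x))"
  using metric_deriv_f[of i x] f_RS by (intro metric_deriv_compose) auto
 then show ?case by (simp add: o_def)
qed

lemma fseq_add: "fseq f \<omega> (m + n) x = wcomp f (map \<omega> [m..<m + n]) (fseq f \<omega> m x)"
proof -
 have "[0..<m + n] = [0..<m] @ [m..<m + n]" using upt_add_eq_append[of 0 m n] by simp
 then show ?thesis by (simp add: fseq_def wcomp_append)
qed

end

section \<open>From inverse branches to expansion\<close>

context hyperbolic_chart
begin

text \<open>Carrying a branch of w forward by j letters gives a branch of the remaining word. In
  this way bounds for branches become bounds at every intermediate time of an orbit segment.\<close>

lemma branch_suffix:
 assumes "branch w u g" "word w" "emb a u \<in> J"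
 shows "\<exists>g'. branch (drop j w) u g' \<and> (\<forall>t\<in>ball u r1. wcomp f (take j w) (emb a (g t)) = emb a (g' t))"
proof -
 have ne: "wcomp f (take k (take j w)) (emb a v) \<noteq> pole a" if v: "v \<in> g ` ball u r1" "k \<le> length (take j w)" for v k
 proof -
  obtain t where t: "t \<in> ball u r1" "v = g t" using v(1) by blast
  have "\<delta> \<le> dist (wcomp f (take (min k j) w) (emb a v)) (pole a)" unfolding t(2) by (rule branch_take_off_pole[OF assms t(1)])
  then show ?thesis using \<delta> by (metis dist_self not_le take_take)
 qed
 obtain h where h: "h holomorphic_on g ` ball u r1" "\<And>v. v \<in> g ` ball u r1 \<Longrightarrow> wcomp f (take j w) (emb a v) = emb a (h v)"
  using holomorphic_wcomp[OF set_take_idx[OF assms(2)] ne] by blast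
 have "(h \<circ> g) holomorphic_on ball u r1" using assms(1) h(1) holomorphic_on_compose by (simp add: branch_def)
 moreover have "wcomp f (drop j w) (emb a ((h \<circ> g) t)) = emb a t" if "t \<in> ball u r1" for t
 proof -
  have "emb a ((h \<circ> g) t) = wcomp f (take j w) (emb a (g t))" using h(2) that by simp
  then show ?thesis using wcomp_take_drop[where f = f and j = j and w = w] assms(1) that by (simp add: branch_def)
 qed
 ultimately show ?thesis using h(2) by (intro exI[of _ "h \<circ> g"]) (auto simp: branch_def)
qed

lemma chart_near_J:
 assumes "emb a u \<in> J" "y \<in> RS" "dist (emb a u) y < \<delta> / 2"
 shows "\<exists>v. y = emb a v \<and> dist u v \<le> 8 / \<delta>\<^sup>2 * dist (emb a u) y"
proof -
 have "\<delta> \<le> dist (emb a u) y + dist y (pole a)"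
  using J_off_pole[OF assms(1)] dist_triangle[of "emb a u" "pole a" y] by linarith
 then have d: "\<delta> / 2 \<le> dist y (pole a)" using assms(3) by simp
 then have "y \<noteq> pole a" using \<delta> by (metis dist_self half_gt_zero not_le)
 then obtain v where v: "y = emb a v" using emb_surj[OF assms(2)] by blast
 have "dist u v \<le> 2 / (\<delta> / 2)\<^sup>2 * dist (emb a u) (emb a v)"
  using d J_off_pole[OF assms(1)] \<delta> v by (intro emb_inverse_lipschitz) auto
 then show ?thesis using v by (auto simp: power_divide)
qed

text \<open>Within distance r2 of a point of J one is within r1 / 2 of it in the chart. K2 is the
  product of the Lipschitz constants of the chart, of a branch, and of the inverse chart near
  J.\<close>

definition "r2 = min (\<delta> / 2) (r1 / 2 * \<delta>\<^sup>2 / 8)"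
definition "K2 = L * (4 * R / r1) * (8 / \<delta>\<^sup>2)"

lemma r2_pos: "r2 > 0" using \<delta> r1_pos by (simp add: r2_def)
lemma K2_pos: "K2 > 0" using \<delta> r1_pos L_pos R_pos by (simp add: K2_def)

lemma branch_image_close:
 assumes "branch w u g" "word w" "emb a u \<in> J" "dist u v \<le> 8 / \<delta>\<^sup>2 * d" "v \<in> ball u (r1 / 2)"
 shows "dist (wcomp f (take j w) (emb a (g u))) (wcomp f (take j w) (emb a (g v))) \<le> K2 * d"
proof -
 obtain g' where g': "branch (drop j w) u g'" "\<And>t. t \<in> ball u r1 \<Longrightarrow> wcomp f (take j w) (emb a (g t)) = emb a (g' t)"
  using branch_suffix[OF assms(1-3)] by blast
 have uv: "u \<in> ball u r1" "v \<in> ball u r1" "u \<in> ball u (r1 / 2)" using assms(5) r1_pos by auto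
 have "dist (emb a (g' u)) (emb a (g' v)) \<le> L * dist (g' u) (g' v)" by (rule emb_L)
 also have "\<dots> \<le> L * (4 * R / r1 * dist u v)"
  using branch_lipschitz(2)[OF g'(1) set_drop_idx[OF assms(2)] assms(3) uv(3) assms(5)] L_pos by (intro mult_left_mono) auto
 also have "\<dots> \<le> L * (4 * R / r1 * (8 / \<delta>\<^sup>2 * d))"
  using L_pos R_pos r1_pos assms(4) by (intro mult_left_mono) auto
 finally show ?thesis using g'(2)[OF uv(1)] g'(2)[OF uv(2)] by (simp add: K2_def mult.assoc)
qed

lemma equicontinuous_preimages:
 assumes w: "word w" and y: "y \<in> J" "y' \<in> RS" "dist y y' < r2"
 shows "\<And>x. x \<in> RS \<Longrightarrow> wcomp f w x = y \<Longrightarrow> \<exists>x'\<in>RS. wcomp f w x' = y' \<and>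
   (\<forall>j. odist j w x x' \<le> K2 * dist y y')"
  and "\<And>x'. x' \<in> RS \<Longrightarrow> wcomp f w x' = y' \<Longrightarrow> \<exists>x\<in>RS. wcomp f w x = y \<and>
   (\<forall>j. odist j w x x' \<le> K2 * dist y y')"
proof -
 obtain u where u: "y = emb a u" using chart_point[OF y(1)] by blast
 have uJ: "emb a u \<in> J" using y(1) u by simp
 obtain v where v: "y' = emb a v" "dist u v \<le> 8 / \<delta>\<^sup>2 * dist y y'"
  using chart_near_J[OF uJ y(2)] y(3) u by (auto simp: r2_def)
 have "8 / \<delta>\<^sup>2 * dist y y' < 8 / \<delta>\<^sup>2 * (r1 / 2 * \<delta>\<^sup>2 / 8)"
  using y(3) \<delta> by (intro mult_strict_left_mono) (auto simp: r2_def)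
 also have "\<dots> = r1 / 2" using \<delta> by simp
 finally have vb: "v \<in> ball u (r1 / 2)" using v(2) by simp
 then have vb1: "v \<in> ball u r1" "u \<in> ball u r1" using r1_pos by auto
 show "\<exists>x'\<in>RS. wcomp f w x' = y' \<and> (\<forall>j. odist j w x x' \<le> K2 * dist y y')"
  if x: "x \<in> RS" "wcomp f w x = y" for x
 proof -
  obtain g where g: "branch w u g" "emb a (g u) = x" using branch_exists[OF uJ vb1(2) w x(1)] x(2) u by auto
  have "wcomp f w (emb a (g v)) = y'" using g(1) vb1 v by (simp add: branch_def)
  then show ?thesis using branch_image_close[OF g(1) w uJ v(2) vb] g(2) emb_in_RS by blast
 qed
 show "\<exists>x\<in>RS. wcomp f w x = y \<and> (\<forall>j. odist j w x x' \<le> K2 * dist y y')"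
  if x: "x' \<in> RS" "wcomp f w x' = y'" for x'
 proof -
  obtain g where g: "branch w u g" "emb a (g v) = x'" using branch_exists[OF uJ vb1(1) w x(1)] x(2) v by auto
  have "wcomp f w (emb a (g u)) = y" using g(1) vb1 u by (simp add: branch_def)
  then show ?thesis using branch_image_close[OF g(1) w uJ v(2) vb] g(2) emb_in_RS by blast
 qed
qed

text \<open>The branch through x inverts f_w and has derivative below c, so f_w expands by an amount
  of order 1 / c. Chart and chordal distances are compared at a single test point t near u, with c
  such that \<open>wder w x < C\<close> would give dist u t \<le> dist u t / 2.\<close>

lemma wder_large: "\<exists>n. \<forall>w x. word w \<longrightarrow> n \<le> length w \<longrightarrow> x \<in> RS \<longrightarrow> wcomp f w x \<in> J \<longrightarrow> C \<le> wder w x"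
proof -
 define K where "K = L * (8 / \<delta>\<^sup>2)"
 have K: "K > 0" using L_pos \<delta> by (simp add: K_def)
 define c where "c = 1 / (4 * K * (\<bar>C\<bar> + 1))"
 have c: "c > 0" using K by (simp add: c_def)
 obtain n where n: "\<And>w u g. word w \<Longrightarrow> n \<le> length w \<Longrightarrow> emb a u \<in> J \<Longrightarrow> branch w u g \<Longrightarrow> cmod (deriv g u) < c"
  using branch_contracts[OF c] by blast
 have "C \<le> wder w x" if w: "word w" "n \<le> length w" and x: "x \<in> RS" "wcomp f w x \<in> J" for w x
 proof (rule ccontr)
  assume "\<not> C \<le> wder w x"
  then have less: "wder w x < \<bar>C\<bar>" by simp
  obtain u where u: "wcomp f w x = emb a u" using chart_point[OF x(2)] by blast
  have uJ: "emb a u \<in> J" using x(2) u by simp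
  have ub: "u \<in> ball u r1" using r1_pos by simp
  obtain g where g: "branch w u g" "emb a (g u) = x" using branch_exists[OF uJ ub w(1) x(1) u] by blast
  have hol: "g holomorphic_on ball u r1" using g(1) by (simp add: branch_def)
  obtain d1 where d1: "d1 > 0" "ball u d1 \<subseteq> ball u r1"
    "\<And>v v'. v \<in> ball u d1 \<Longrightarrow> v' \<in> ball u d1 \<Longrightarrow> \<bar>cmod (g v - g v') - cmod (deriv g u) * cmod (v - v')\<bar> \<le> c * cmod (v - v')"
   using holomorphic_strict_derivative[OF hol open_ball ub c] by blast
  obtain d2 where d2: "d2 > 0" "\<And>y y'. y \<in> RS \<Longrightarrow> y' \<in> RS \<Longrightarrow> dist x y < d2 \<Longrightarrow> dist x y' < d2 \<Longrightarrow>
    \<bar>dist (wcomp f w y) (wcomp f w y') - wder w x * dist y y'\<bar> \<le> 1 * dist y y'"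
   using metric_derivE[OF metric_deriv_wcomp[OF w(1) x(1)] zero_less_one] by blast
  \<comment> \<open>The entries make the derivative estimate of the branch valid at t, keep the
    branch defined, bring its value within d2 of x on the sphere, and let emb a t be read back in
    the chart.\<close>
  define \<rho> where "\<rho> = min (min d1 r1) (min (d2 / (L * (2 * c))) (\<delta> / (2 * L)))"
  have \<rho>: "\<rho> > 0" using d1(1) d2(1) L_pos c r1_pos \<delta> by (simp add: \<rho>_def)
  define t where "t = u + complex_of_real (\<rho> / 2)"
  have ut: "dist u t = \<rho> / 2" using \<rho> by (simp add: t_def dist_norm)
  then have tb: "t \<in> ball u d1" "u \<in> ball u d1" "t \<in> ball u r1" using \<rho> d1(1) by (auto simp: \<rho>_def)
  have "\<bar>dist (g u) (g t) - cmod (deriv g u) * dist u t\<bar> \<le> c * dist u t" using d1(3)[OF tb(2,1)] by (simp add: dist_norm)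
  moreover have "cmod (deriv g u) * dist u t \<le> c * dist u t" using n[OF w uJ g(1)] by (intro mult_right_mono) auto
  ultimately have gut: "dist (g u) (g t) \<le> 2 * c * dist u t" by linarith
  have xt: "dist x (emb a (g t)) \<le> L * (2 * c * dist u t)"
   using order_trans[OF emb_L[of "g u" "g t"] mult_left_mono[OF gut less_imp_le[OF L_pos]]] unfolding g(2) .
  also have "\<dots> < L * (2 * c) * (d2 / (L * (2 * c)))"
   using L_pos c ut \<rho> by (subst mult.assoc[symmetric], intro mult_strict_left_mono) (auto simp: \<rho>_def mult.assoc[symmetric])
  also have "\<dots> = d2" using L_pos c by simp
  finally have "\<bar>dist (wcomp f w x) (wcomp f w (emb a (g t))) - wder w x * dist x (emb a (g t))\<bar> \<le> 1 * dist x (emb a (g t))"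
   using d2(1) x(1) emb_in_RS by (intro d2(2)) auto
  then have "dist (wcomp f w x) (wcomp f w (emb a (g t))) \<le> (wder w x + 1) * dist x (emb a (g t))"
   by (simp add: algebra_simps abs_le_iff)
  moreover have "wcomp f w (emb a (g t)) = emb a t" using g(1) tb(3) by (simp add: branch_def)
  ultimately have A: "dist (emb a u) (emb a t) \<le> (wder w x + 1) * dist x (emb a (g t))" using u by simp
  have "dist (emb a u) (emb a t) \<le> L * dist u t" by (rule emb_L)
  also have "\<dots> \<le> L * (\<delta> / (2 * L) / 2)" using ut L_pos \<rho> by (intro mult_left_mono) (auto simp: \<rho>_def)
  also have "\<dots> < \<delta> / 2" using L_pos \<delta> by simp
  finally obtain t' where t': "emb a t = emb a t'" "dist u t' \<le> 8 / \<delta>\<^sup>2 * dist (emb a u) (emb a t)"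
   using chart_near_J[OF uJ emb_in_RS] by blast
  then have "t = t'" using inj_emb[of a] by (simp add: inj_def)
  then have "dist u t \<le> 8 / \<delta>\<^sup>2 * dist (emb a u) (emb a t)" using t' by simp
  also have "\<dots> \<le> 8 / \<delta>\<^sup>2 * ((wder w x + 1) * dist x (emb a (g t)))" using A \<delta> by (intro mult_left_mono) auto
  also have "\<dots> \<le> 8 / \<delta>\<^sup>2 * ((\<bar>C\<bar> + 1) * dist x (emb a (g t)))"
   using less \<delta> by (intro mult_left_mono mult_right_mono) auto
  also have "\<dots> \<le> 8 / \<delta>\<^sup>2 * ((\<bar>C\<bar> + 1) * (L * (2 * c * dist u t)))"
   using xt \<delta> by (intro mult_left_mono) auto
  also have "\<dots> = (2 * K * (\<bar>C\<bar> + 1)) * c * dist u t" by (simp add: K_def)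
  also have "(2 * K * (\<bar>C\<bar> + 1)) * c = 1 / 2"
  proof -
   have "4 * K * (\<bar>C\<bar> + 1) \<noteq> 0" using K by auto
   then show ?thesis by (simp add: c_def)
  qed
  finally show False using ut \<rho> by simp
 qed
 then show ?thesis by blast
qed

end

text \<open>Gives one constant for finitely many letters. The premise covers all smaller d' so that
  a minimum can be taken.\<close>

lemma finite_uniform_bound:
 assumes "finite A" "\<And>i. i \<in> A \<Longrightarrow> \<exists>d>0::real. \<forall>d'. 0 < d' \<longrightarrow> d' \<le> d \<longrightarrow> P i d'"
 shows "\<exists>d>0. \<forall>i\<in>A. P i d"
proof -
 have "\<exists>d>0. \<forall>d'. 0 < d' \<longrightarrow> d' \<le> d \<longrightarrow> (\<forall>i\<in>A. P i d')" using assms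
 proof (induction A rule: finite_induct)
  case empty
  show ?case by (rule exI[of _ 1]) simp
 next
  case (insert i A)
  obtain d1 where "d1 > 0" "\<forall>d'. 0 < d' \<longrightarrow> d' \<le> d1 \<longrightarrow> (\<forall>i\<in>A. P i d')"
   using insert.IH insert.prems by blast
  moreover obtain d2 where "d2 > 0" "\<forall>d'. 0 < d' \<longrightarrow> d' \<le> d2 \<longrightarrow> P i d'" using insert.prems[of i] by blast
  ultimately show ?case by (intro exI[of _ "min d1 d2"]) auto
 qed
 then show ?thesis by blast
qed

section \<open>Distortion, uniform expansion and contraction on the Fatou set\<close>

context hyperbolic_system
begin

lemma hyperbolic_chart_exists: "\<exists>a \<delta> e. hyperbolic_chart s f a \<delta> e"
proof -
 obtain a \<delta> e where "\<delta> > 0" "e > 0"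
   "\<forall>w y x. word w \<longrightarrow> y \<in> RS \<longrightarrow> dist y (pole a) < \<delta> \<longrightarrow> x \<in> J \<longrightarrow> e \<le> dist (wcomp f w y) x"
   "\<forall>w i y x. word w \<longrightarrow> i \<in> idx s \<longrightarrow> y \<in> RS \<longrightarrow> sph_dnorm (f i) y = 0 \<longrightarrow> x \<in> J \<longrightarrow> e \<le> dist (wcomp f w (f i y)) x"
  using omitted_ball by blast
 then have "hyperbolic_chart s f a \<delta> e"
  by (intro hyperbolic_chart.intro hyperbolic_system_axioms hyperbolic_chart_axioms.intro) blast+
 then show ?thesis by blast
qed

lemma preimages_equicontinuous:
 "\<exists>r>0. \<exists>K>0. \<forall>w y y'. word w \<longrightarrow> y \<in> J \<longrightarrow> y' \<in> RS \<longrightarrow> dist y y' < r \<longrightarrow>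
  weak_shadow K w y y'"
proof -
 obtain a \<delta> e where "hyperbolic_chart s f a \<delta> e" using hyperbolic_chart_exists by blast
 then interpret hyperbolic_chart s f a \<delta> e .
 show ?thesis
  by (rule exI[of _ r2], rule conjI[OF r2_pos], rule exI[of _ K2], rule conjI[OF K2_pos])
   (intro allI impI conjI ballI equicontinuous_preimages)
qed

lemma wder_large: "\<exists>n. \<forall>w x. word w \<longrightarrow> n \<le> length w \<longrightarrow> x \<in> RS \<longrightarrow> wcomp f w x \<in> J \<longrightarrow> C \<le> wder w x"
proof -
 obtain a \<delta> e where "hyperbolic_chart s f a \<delta> e" using hyperbolic_chart_exists by blast
 then interpret hyperbolic_chart s f a \<delta> e .
 show ?thesis by (rule wder_large)
qed

lemma sph_dnorm_pos: assumes "i \<in> idx s" "x \<in> RS" "f i x \<in> J" shows "sph_dnorm (f i) x > 0"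
proof -
 have "sph_dnorm (f i) x \<noteq> 0"
 proof
  assume "sph_dnorm (f i) x = 0"
  then have "f i x \<in> postcrit s f" using crit_in_postcrit[of "[]" i x] assms by simp
  then show False using A1 assms(3) by (auto simp: julia_def)
 qed
 moreover have "sph_dnorm (f i) x \<ge> 0" using assms by (metis ratE sph_dnorm_nonneg)
 ultimately show ?thesis by simp
qed

text \<open>Multiplicative error of one step, uniform over the preimages of J. Iteration in
  \<open>track\<close> turns q into q^k.\<close>

definition distortion :: "real \<Rightarrow> real \<Rightarrow> bool" where
 "distortion q \<delta> \<longleftrightarrow> (\<forall>i\<in>idx s. \<forall>x\<in>RS. \<forall>y\<in>RS. f i x \<in> J \<longrightarrow> dist x y < \<delta> \<longrightarrow>
   sph_dnorm (f i) x / q * dist x y \<le> dist (f i x) (f i y) \<and> dist (f i x) (f i y) \<le> sph_dnorm (f i) x * q * dist x y)"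

lemma distortion_exists: assumes q: "q > 1" shows "\<exists>\<delta>>0. distortion q \<delta>"
 unfolding distortion_def
proof (rule finite_uniform_bound[OF finite_idx])
 fix i assume i: "i \<in> idx s"
 let ?K = "{x \<in> RS. f i x \<in> J}"
 let ?P = "\<lambda>x y. sph_dnorm (f i) x / q * dist x y \<le> dist (f i x) (f i y) \<and> dist (f i x) (f i y) \<le> sph_dnorm (f i) x * q * dist x y"
 have "\<forall>x0\<in>?K. \<exists>d. d > 0 \<and> (\<forall>x\<in>RS. \<forall>y\<in>RS. dist x0 x < d \<longrightarrow> dist x0 y < d \<longrightarrow> ?P x y)"
 proof
  fix x0 assume x0: "x0 \<in> ?K"
  define k where "k = sph_dnorm (f i) x0"
  have k: "k > 0" unfolding k_def using sph_dnorm_pos i x0 by auto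
  \<comment> \<open>The relative error for which (1 + a) / (1 - a) = q: the derivative at x and the
    distance quotient both lie between (1 - a) k and (1 + a) k.\<close>
  define a where "a = (q - 1) / (q + 1)"
  have a: "a > 0" "1 + a = q * (1 - a)" using q by (auto simp: a_def field_simps)
  have ak: "a * k > 0" using a k by simp
  have x0R: "x0 \<in> RS" using x0 by simp
  obtain d1 where d1: "d1 > 0" "\<And>y y'. y \<in> RS \<Longrightarrow> y' \<in> RS \<Longrightarrow> dist x0 y < d1 \<Longrightarrow> dist x0 y' < d1 \<Longrightarrow>
    \<bar>dist (f i y) (f i y') - k * dist y y'\<bar> \<le> a * k * dist y y'"
   using metric_derivE[OF metric_deriv_f[OF i x0R] ak] unfolding k_def by blast
  obtain d2 where d2: "d2 > 0" "\<And>y. y \<in> RS \<Longrightarrow> dist x0 y < d2 \<Longrightarrow> \<bar>sph_dnorm (f i) y - k\<bar> \<le> a * k"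
   using metric_deriv_close[OF metric_deriv_f[OF i x0R] metric_deriv_f[OF i] x0R ak] unfolding k_def by blast
  have "?P x y" if xy: "x \<in> RS" "y \<in> RS" "dist x0 x < min d1 d2" "dist x0 y < min d1 d2" for x y
  proof -
   define D where "D = dist (f i x) (f i y)"
   define t where "t = dist x y"
   define l where "l = sph_dnorm (f i) x"
   have t: "t \<ge> 0" by (simp add: t_def)
   have A: "\<bar>D - k * t\<bar> \<le> a * k * t" unfolding D_def t_def using d1(2) xy by simp
   have B: "\<bar>l - k\<bar> \<le> a * k" unfolding l_def using d2(2) xy by simp
   have l1: "(1 - a) * k \<le> l" and l2: "l \<le> (1 + a) * k" using B by (simp_all add: algebra_simps abs_le_iff)
   have "D \<le> (1 + a) * k * t" using A by (simp add: algebra_simps abs_le_iff)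
   also have "\<dots> = q * ((1 - a) * k) * t" by (simp add: a(2))
   also have "\<dots> \<le> q * l * t" using l1 q t by (intro mult_right_mono mult_left_mono) auto
   finally have up: "D \<le> l * q * t" by (simp add: mult_ac)
   have "l / q * t \<le> (1 + a) * k / q * t" using l2 q t by (intro mult_right_mono divide_right_mono) auto
   also have "\<dots> = (1 - a) * k * t" using q by (simp add: a(2))
   also have "\<dots> \<le> D" using A by (simp add: algebra_simps abs_le_iff)
   finally show ?thesis using up by (simp add: D_def t_def l_def)
  qed
  moreover have "min d1 d2 > 0" using d1(1) d2(1) by simp
  ultimately show "\<exists>d. d > 0 \<and> (\<forall>x\<in>RS. \<forall>y\<in>RS. dist x0 x < d \<longrightarrow> dist x0 y < d \<longrightarrow> ?P x y)" by blast
 qed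
 from bchoice[OF this] obtain D where D0: "\<forall>x0\<in>?K. D x0 > 0 \<and> (\<forall>x\<in>RS. \<forall>y\<in>RS. dist x0 x < D x0 \<longrightarrow> dist x0 y < D x0 \<longrightarrow> ?P x y)" ..
 then have D: "\<And>x0. x0 \<in> ?K \<Longrightarrow> D x0 > 0"
  "\<And>x0 x y. x0 \<in> ?K \<Longrightarrow> x \<in> RS \<Longrightarrow> y \<in> RS \<Longrightarrow> dist x0 x < D x0 \<Longrightarrow> dist x0 y < D x0 \<Longrightarrow> ?P x y" by blast+
 have "?K \<subseteq> \<Union> ((\<lambda>x. ball x (D x)) ` ?K)" using D(1) by auto
 moreover have "\<And>B. B \<in> (\<lambda>x. ball x (D x)) ` ?K \<Longrightarrow> open B" by auto
 ultimately obtain d where d: "d > 0" "\<And>x. x \<in> ?K \<Longrightarrow> \<exists>B\<in>(\<lambda>x. ball x (D x)) ` ?K. ball x d \<subseteq> B"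
  using Heine_Borel_lemma[OF compact_preimage_J[OF i], of "(\<lambda>x. ball x (D x)) ` ?K"] by blast
 have "?P x y" if xy: "x \<in> RS" "y \<in> RS" "f i x \<in> J" "dist x y < d" for x y
 proof -
  have "x \<in> ?K" using xy by simp
  then obtain c where c: "c \<in> ?K" "ball x d \<subseteq> ball c (D c)" using d(2) by blast
  have "x \<in> ball x d" "y \<in> ball x d" using d(1) xy by auto
  then have "dist c x < D c" "dist c y < D c" using c(2) by (metis mem_ball subsetD)+
  then show ?thesis using D(2)[OF c(1) xy(1,2)] by blast
 qed
 then show "\<exists>d>0. \<forall>d'. 0 < d' \<longrightarrow> d' \<le> d \<longrightarrow> (\<forall>x\<in>RS. \<forall>y\<in>RS. f i x \<in> J \<longrightarrow> dist x y < d' \<longrightarrow> ?P x y)"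
  using d(1) by (meson less_le_trans)
qed

lemma wder_pos: "word w \<Longrightarrow> x \<in> RS \<Longrightarrow> wcomp f w x \<in> J \<Longrightarrow> wder w x > 0"
proof (induction w arbitrary: x)
 case (Cons i w)
 then have iw: "i \<in> idx s" "word w" "wcomp f w (f i x) \<in> J" by auto
 then have "f i x \<in> J" using J_backward f_RS by metis
 then show ?case using sph_dnorm_pos[OF iw(1) Cons.prems(2)] Cons.IH[OF iw(2) f_RS[OF iw(1)] iw(3)] by simp
qed simp

lemma track:
 assumes D: "distortion q \<delta>" and q: "q > 1"
 shows "word w \<Longrightarrow> x \<in> RS \<Longrightarrow> y \<in> RS \<Longrightarrow> wcomp f w x \<in> J \<Longrightarrow>
  (\<And>j. j < length w \<Longrightarrow> odist j w x y < \<delta>) \<Longrightarrow>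
  wder w x / q ^ length w * dist x y \<le> dist (wcomp f w x) (wcomp f w y) \<and>
  dist (wcomp f w x) (wcomp f w y) \<le> wder w x * q ^ length w * dist x y"
proof (induction w arbitrary: x y)
 case (Cons i w)
 have iw: "i \<in> idx s" "word w" "wcomp f w (f i x) \<in> J" using Cons.prems by auto
 have fJ: "f i x \<in> J" using J_backward[OF f_RS[OF iw(1)] iw(2,3)] .
 define l k d0 d1 d2 where "l = sph_dnorm (f i) x" and "k = wder w (f i x)" and "d0 = dist x y"
  and "d1 = dist (f i x) (f i y)" and "d2 = dist (wcomp f w (f i x)) (wcomp f w (f i y))"
 have pos: "l > 0" "k > 0" unfolding l_def k_def
  using sph_dnorm_pos[OF iw(1) Cons.prems(2) fJ] wder_pos[OF iw(2) f_RS[OF iw(1)] iw(3)] by auto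
 have "dist x y < \<delta>" using Cons.prems(5)[of 0] by simp
 then have 1: "l / q * d0 \<le> d1" "d1 \<le> l * q * d0"
  using D iw(1) Cons.prems(2,3) fJ unfolding distortion_def l_def d0_def d1_def by blast+
 have "dist (wcomp f (take j w) (f i x)) (wcomp f (take j w) (f i y)) < \<delta>" if "j < length w" for j
  using Cons.prems(5)[of "Suc j"] that by simp
 then have 2: "k / q ^ length w * d1 \<le> d2" "d2 \<le> k * q ^ length w * d1"
  using Cons.IH[OF iw(2) f_RS[OF iw(1)] f_RS[OF iw(1)] iw(3)] unfolding k_def d1_def d2_def by blast+
 have "k / q ^ length w * (l / q * d0) \<le> k / q ^ length w * d1" using 1 pos q by (intro mult_left_mono) auto
 then have A: "l * k / q ^ Suc (length w) * d0 \<le> d2" using 2 by (simp add: field_simps)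
 have "k * q ^ length w * d1 \<le> k * q ^ length w * (l * q * d0)" using 1 pos q by (intro mult_left_mono) auto
 then have "d2 \<le> l * k * q ^ Suc (length w) * d0" using 2 by (simp add: mult_ac)
 then show ?case using A by (simp add: l_def k_def d0_def d2_def)
qed simp

text \<open>By \<open>wder_large\<close> a block of n0 letters expands by at least 4 = \<Lambda>^n0.
  A remaining shorter piece contributes at least m^n0, and c makes up for it and for the missing
  factor 4.\<close>

lemma wder_growth:
 "\<exists>c>0. \<exists>\<Lambda>>1. \<forall>w x. word w \<longrightarrow> x \<in> RS \<longrightarrow> wcomp f w x \<in> J \<longrightarrow> c * \<Lambda> ^ length w \<le> wder w x"
proof -
 obtain n where n: "\<And>w x. word w \<Longrightarrow> n \<le> length w \<Longrightarrow> x \<in> RS \<Longrightarrow> wcomp f w x \<in> J \<Longrightarrow> 4 \<le> wder w x"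
  using wder_large[of 4] by blast
 define n0 where "n0 = max n 1"
 define \<Lambda> where "\<Lambda> = root n0 4"
 have n0: "n0 > 0" "n \<le> n0" by (auto simp: n0_def)
 have \<Lambda>: "\<Lambda> > 1" "\<Lambda> ^ n0 = 4" unfolding \<Lambda>_def using n0 by (auto intro: real_root_gt_1_iff[THEN iffD2])
 have "\<exists>m>0. \<forall>i\<in>idx s. \<forall>x\<in>RS. f i x \<in> J \<longrightarrow> m \<le> sph_dnorm (f i) x"
 proof (rule finite_uniform_bound[OF finite_idx])
  fix i assume i: "i \<in> idx s"
  obtain p q where pq: "rat_pair p q" "rat_deg p q \<ge> 1" "f i = rat_sph p q" by (metis ratE[OF i])
  have cont: "continuous_on {y \<in> RS. f i y \<in> J} (sph_dnorm (f i))"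
   using continuous_on_subset[OF continuous_sph_dnorm[OF pq(1,2)]] pq(3) by simp
  show "\<exists>d>0. \<forall>d'. 0 < d' \<longrightarrow> d' \<le> d \<longrightarrow> (\<forall>x\<in>RS. f i x \<in> J \<longrightarrow> d' \<le> sph_dnorm (f i) x)"
  proof (cases "{y \<in> RS. f i y \<in> J} = {}")
   case True
   then show ?thesis by (intro exI[of _ 1]) auto
  next
   case False
   then obtain x0 where x0: "x0 \<in> RS" "f i x0 \<in> J" "\<And>y. y \<in> RS \<Longrightarrow> f i y \<in> J \<Longrightarrow> sph_dnorm (f i) x0 \<le> sph_dnorm (f i) y"
    using continuous_attains_inf[OF compact_preimage_J[OF i] False cont] by blast
   show ?thesis using sph_dnorm_pos[OF i x0(1,2)] x0(3) by (intro exI[of _ "sph_dnorm (f i) x0"]) (meson order_trans)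
  qed
 qed
 then obtain m' where m': "m' > 0" "\<And>i x. i \<in> idx s \<Longrightarrow> x \<in> RS \<Longrightarrow> f i x \<in> J \<Longrightarrow> m' \<le> sph_dnorm (f i) x" by blast
 define m where "m = min m' 1"
 have m: "m > 0" "m \<le> 1" using m' by (auto simp: m_def)
 have low: "m ^ length w \<le> wder w x" if "word w" "x \<in> RS" "wcomp f w x \<in> J" for w x
  using that
 proof (induction w arbitrary: x)
  case (Cons i w)
  then have iw: "i \<in> idx s" "word w" "wcomp f w (f i x) \<in> J" by auto
  then have "f i x \<in> J" using J_backward f_RS by metis
  then have "m \<le> sph_dnorm (f i) x" using m'(2)[OF iw(1) Cons.prems(2)] by (simp add: m_def)
  then have "m * m ^ length w \<le> sph_dnorm (f i) x * wder w (f i x)"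
   using Cons.IH[OF iw(2) f_RS[OF iw(1)] iw(3)] m by (intro mult_mono) auto
  then show ?case by simp
 qed simp
 define c where "c = m ^ n0 / 4"
 have c: "c > 0" using m by (simp add: c_def)
 have "c * \<Lambda> ^ length w \<le> wder w x" if "word w" "x \<in> RS" "wcomp f w x \<in> J" for w x
  using that
 proof (induction "length w" arbitrary: w x rule: less_induct)
  case less
  show ?case
  proof (cases "length w < n0")
   case True
   have "\<Lambda> ^ length w \<le> \<Lambda> ^ n0" using \<Lambda>(1) True by (intro power_increasing) auto
   then have "c * \<Lambda> ^ length w \<le> c * 4" using c \<Lambda>(2) by (intro mult_left_mono) auto
   also have "\<dots> = m ^ n0" by (simp add: c_def)
   also have "\<dots> \<le> m ^ length w" using m True by (intro power_decreasing) auto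
   also have "\<dots> \<le> wder w x" using low less.prems by blast
   finally show ?thesis .
  next
   case False
   define u v where "u = take n0 w" and "v = drop n0 w"
   have uv: "word u" "word v" unfolding u_def v_def using less.prems(1) set_take_idx set_drop_idx by auto
   have xu: "wcomp f u x \<in> RS" using wcomp_RS[OF uv(1) less.prems(2)] .
   have vJ: "wcomp f v (wcomp f u x) \<in> J" unfolding u_def v_def wcomp_take_drop by (rule less.prems(3))
   have "wcomp f u x \<in> J" using J_backward[OF xu uv(2) vJ] .
   then have 4: "4 \<le> wder u x" using n[OF uv(1) _ less.prems(2)] False n0 by (simp add: u_def)
   have "length v < length w" using False n0 by (simp add: v_def)
   then have "c * \<Lambda> ^ length v \<le> wder v (wcomp f u x)" using less.hyps uv(2) xu vJ by blast
   then have "4 * (c * \<Lambda> ^ length v) \<le> wder u x * wder v (wcomp f u x)"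
    using 4 c \<Lambda> by (intro mult_mono) auto
   moreover have "wder w x = wder u x * wder v (wcomp f u x)"
    using wder_append[of u v x] by (simp add: u_def v_def)
   moreover have "4 * (c * \<Lambda> ^ length v) = c * \<Lambda> ^ length w"
   proof -
    have "length w = n0 + length v" using False by (simp add: v_def)
    then show ?thesis by (simp add: power_add \<Lambda>(2))
   qed
   ultimately show ?thesis by simp
  qed
 qed
 then show ?thesis using c \<Lambda>(1) by blast
qed

lemma wcomp_take_add: "wcomp f (take i (drop j w)) (wcomp f (take j w) x) = wcomp f (take (j + i) w) x"
 by (simp add: take_add wcomp_append)

text \<open>Bootstrapping: \<open>preimages_equicontinuous\<close> keeps the two orbits within
  \<delta>, where \<open>track\<close> applies. With q = sqrt \<Lambda> the loss q^k leaves a net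
  expansion c * q^k, which read backwards is a contraction by \<theta> = 1 / q.\<close>

lemma preimages_contract:
 "\<exists>r>0. \<exists>C>0. \<exists>\<theta>. 0 < \<theta> \<and> \<theta> < 1 \<and> (\<forall>w y y'. word w \<longrightarrow> y \<in> J \<longrightarrow> y' \<in> RS \<longrightarrow> dist y y' < r \<longrightarrow>
  shadow C \<theta> w y y')"
proof -
 obtain c \<Lambda> where c: "c > 0" and \<Lambda>: "\<Lambda> > 1"
  and gr: "\<And>w x. word w \<Longrightarrow> x \<in> RS \<Longrightarrow> wcomp f w x \<in> J \<Longrightarrow> c * \<Lambda> ^ length w \<le> wder w x"
  using wder_growth by blast
 define q where "q = sqrt \<Lambda>"
 have q: "q > 1" "q * q = \<Lambda>" using \<Lambda> by (auto simp: q_def)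
 obtain \<delta> where \<delta>: "\<delta> > 0" "distortion q \<delta>" using distortion_exists[OF q(1)] by blast
 obtain r K where r: "r > 0" and K: "K > 0" and pre: "\<And>w y y'. word w \<Longrightarrow> y \<in> J \<Longrightarrow> y' \<in> RS \<Longrightarrow> dist y y' < r \<Longrightarrow>
  weak_shadow K w y y'"
  using preimages_equicontinuous by metis
 define r' where "r' = min r (\<delta> / K)"
 have r': "r' > 0" using r \<delta> K by (simp add: r'_def)
 define \<theta> where "\<theta> = 1 / q"
 have \<theta>: "0 < \<theta>" "\<theta> < 1" using q by (auto simp: \<theta>_def)
 have key: "odist j w x x' \<le> 1 / c * \<theta> ^ (length w - j) * dist y y'"
  if w: "word w" and y: "y \<in> J" "y' \<in> RS" "dist y y' < r'" and x: "x \<in> RS" "x' \<in> RS" "wcomp f w x = y" "wcomp f w x' = y'"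
   and cl: "\<And>j. odist j w x x' \<le> K * dist y y'" and j: "j \<le> length w"
  for w y y' x x' j
 proof -
  define v z z' where "v = drop j w" and "z = wcomp f (take j w) x" and "z' = wcomp f (take j w) x'"
  have v: "word v" unfolding v_def by (rule set_drop_idx[OF w])
  have z: "z \<in> RS" "z' \<in> RS" unfolding z_def z'_def using wcomp_RS[OF set_take_idx[OF w]] x by auto
  have vz: "wcomp f v z = y" "wcomp f v z' = y'" unfolding v_def z_def z'_def wcomp_take_drop using x by auto
  have Kd: "K * dist y y' < \<delta>" using y(3) K by (simp add: r'_def pos_less_divide_eq mult.commute)
  have "wder v z / q ^ length v * dist z z' \<le> dist (wcomp f v z) (wcomp f v z')"
  proof (rule track[OF \<delta>(2) q(1) v z, THEN conjunct1])
   show "wcomp f v z \<in> J" using vz y by simp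
   show "odist i v z z' < \<delta>" for i
    unfolding v_def z_def z'_def wcomp_take_add using cl[of "j + i"] Kd by linarith
  qed
  then have A: "wder v z / q ^ length v * dist z z' \<le> dist y y'" by (simp add: vz)
  have "c * q ^ length v = c * \<Lambda> ^ length v / q ^ length v" using q by (simp add: q(2)[symmetric] power_mult_distrib)
  also have "\<dots> \<le> wder v z / q ^ length v" using gr[OF v z(1)] vz y(1) q by (intro divide_right_mono) auto
  finally have "c * q ^ length v * dist z z' \<le> dist y y'" using A by (meson mult_right_mono order_trans zero_le_dist)
  then have "dist z z' \<le> 1 / c * (1 / q ^ length v) * dist y y'" using c q by (simp add: field_simps)
  then show ?thesis unfolding \<theta>_def by (simp add: power_one_over z_def z'_def v_def)
 qed
 show ?thesis
 proof (rule exI[of _ r'], rule conjI[OF r'], rule exI[of _ "1 / c"], rule conjI, use c in simp,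
   rule exI[of _ \<theta>], intro conjI \<theta> allI impI ballI)
  fix w y y' x assume a: "word w" "y \<in> J" "y' \<in> RS" "dist y y' < r'" "x \<in> RS" "wcomp f w x = y"
  then have "dist y y' < r" by (simp add: r'_def)
  then obtain x' where "x' \<in> RS" "wcomp f w x' = y'" "\<And>j. odist j w x x' \<le> K * dist y y'"
   using pre[OF a(1-3)] a(5,6) by blast
  then show "\<exists>x'\<in>RS. wcomp f w x' = y' \<and>
   (\<forall>j\<le>length w. odist j w x x' \<le> 1 / c * \<theta> ^ (length w - j) * dist y y')"
   using key[OF a(1-5) _ a(6)] by blast
 next
  fix w y y' x' assume a: "word w" "y \<in> J" "y' \<in> RS" "dist y y' < r'" "x' \<in> RS" "wcomp f w x' = y'"
  then have "dist y y' < r" by (simp add: r'_def)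
  then obtain x where "x \<in> RS" "wcomp f w x = y" "\<And>j. odist j w x x' \<le> K * dist y y'"
   using pre[OF a(1-3)] a(5,6) by blast
  then show "\<exists>x\<in>RS. wcomp f w x = y \<and>
   (\<forall>j\<le>length w. odist j w x x' \<le> 1 / c * \<theta> ^ (length w - j) * dist y y')"
   using key[OF a(1-4) _ a(5) _ a(6)] by blast
 qed
qed

lemma compact_far_from_J: assumes "\<eta> > 0" shows "compact {x \<in> RS. \<eta> \<le> infdist x J}" "{x \<in> RS. \<eta> \<le> infdist x J} \<subseteq> F"
proof -
 have "closed {x. \<eta> \<le> infdist x J}" by (intro closed_Collect_le continuous_intros)
 then have "compact (RS \<inter> {x. \<eta> \<le> infdist x J})" using compact_RS compact_Int_closed by blast
 then show "compact {x \<in> RS. \<eta> \<le> infdist x J}" by (simp add: Collect_conj_eq)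
 show "{x \<in> RS. \<eta> \<le> infdist x J} \<subseteq> F"
 proof
  fix x assume "x \<in> {x \<in> RS. \<eta> \<le> infdist x J}"
  then have x: "x \<in> RS" "\<eta> \<le> infdist x J" by auto
  then have "x \<notin> J" using assms by (metis in_closure_iff_infdist_zero closure_subset J_nonempty not_le subsetD)
  then show "x \<in> F" using x(1) by (simp add: julia_def)
 qed
qed

text \<open>Contraction of preimages towards J means repulsion from J in forward time: n0 letters
  map the set at distance more than \<eta> / 2 from J into the set at distance more than \<eta>. In
  a chart with pole next to J every block of n0 letters thus maps N well inside itself, and
  \<open>earle_hamilton\<close> makes the derivatives decay geometrically along every word.
  Consequently convergence to L is locally constant on F for each \<omega>.\<close>

lemma fatou_contraction:
 assumes y0: "y0 \<in> F"
 shows "\<exists>d>0. \<forall>y\<in>RS. dist y0 y < d \<longrightarrow> (\<forall>\<omega>. (\<forall>n. \<omega> n \<in> idx s) \<longrightarrow> (\<lambda>n. dist (fseq f \<omega> n y0) (fseq f \<omega> n y)) \<longlonglongrightarrow> 0)"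
proof -
 define D where "D x = infdist x J" for x
 have clJ: "closed J" by (rule compact_imp_closed[OF compact_J])
 obtain r C \<theta> where r: "r > 0" and C: "C > 0" and \<theta>: "0 < \<theta>" "\<theta> < 1"
  and pre: "\<And>w y y' x'. word w \<Longrightarrow> y \<in> J \<Longrightarrow> y' \<in> RS \<Longrightarrow> dist y y' < r \<Longrightarrow> x' \<in> RS \<Longrightarrow> wcomp f w x' = y' \<Longrightarrow>
   \<exists>x\<in>RS. wcomp f w x = y \<and> dist x x' \<le> C * \<theta> ^ length w * dist y y'"
 proof -
  obtain r C \<theta> where 1: "r > 0" "C > 0" "0 < \<theta>" "\<theta> < 1" and 2: "\<forall>w y y'. word w \<longrightarrow> y \<in> J \<longrightarrow> y' \<in> RS \<longrightarrow> dist y y' < r \<longrightarrow>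
   shadow C \<theta> w y y'"
   using preimages_contract by (elim exE conjE)
  have 3: "\<exists>x\<in>RS. wcomp f w x = y \<and> dist x x' \<le> C * \<theta> ^ length w * dist y y'"
   if a: "word w" "y \<in> J" "y' \<in> RS" "dist y y' < r" "x' \<in> RS" "wcomp f w x' = y'" for w y y' x'
  proof -
   obtain x where x: "x \<in> RS" "wcomp f w x = y"
    "\<forall>j\<le>length w. odist j w x x' \<le> C * \<theta> ^ (length w - j) * dist y y'"
    using 2[rule_format, OF a(1-4), THEN conjunct2, rule_format, OF a(5,6)] by blast
   then show ?thesis using x(3)[rule_format, of 0] by auto
  qed
  show ?thesis by (rule that[OF 1 3])
 qed
 have y0R: "y0 \<in> RS" using y0 F_RS by blast
 have "y0 \<notin> J" using y0 by (simp add: julia_def)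
 then have D0: "D y0 > 0" unfolding D_def by (rule infdist_pos_not_in_closed[OF clJ J_nonempty])
 define \<eta> where "\<eta> = min (D y0 / 2) (r / 2)"
 have \<eta>: "\<eta> > 0" "\<eta> < r" "\<eta> < D y0" using D0 r by (auto simp: \<eta>_def)
 \<comment> \<open>If the image comes within \<rho> of J, its nearest point in J is pulled back to a
   point of J next to x.\<close>
 have pull: "D x \<le> C * \<theta> ^ length w * \<rho>"
  if x: "x \<in> RS" and w: "word w" and \<rho>: "D (wcomp f w x) \<le> \<rho>" "\<rho> < r" for x w \<rho>
 proof -
  obtain y where y: "y \<in> J" "D (wcomp f w x) = dist (wcomp f w x) y"
   unfolding D_def using infdist_attains_inf[OF clJ J_nonempty] by blast
  then have d: "dist y (wcomp f w x) \<le> \<rho>" using \<rho> by (simp add: dist_commute)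
  then obtain x1 where x1: "x1 \<in> RS" "wcomp f w x1 = y" "dist x1 x \<le> C * \<theta> ^ length w * dist y (wcomp f w x)"
   using pre[OF w y(1) wcomp_RS[OF w x] _ x] \<rho>(2) by auto
  have "x1 \<in> J" using J_backward[OF x1(1) w] x1(2) y(1) by simp
  then have "D x \<le> dist x x1" unfolding D_def by (rule infdist_le)
  also have "\<dots> \<le> C * \<theta> ^ length w * dist y (wcomp f w x)" using x1(3) by (simp add: dist_commute)
  also have "\<dots> \<le> C * \<theta> ^ length w * \<rho>" using d C \<theta> by (intro mult_left_mono) auto
  finally show ?thesis .
 qed
 obtain n0 where n0: "\<theta> ^ n0 < 1 / (2 * C)" using real_arch_pow_inv[of "1 / (2 * C)" \<theta>] C \<theta> by auto
 \<comment> \<open>The barrier for times inside a block: orbits that start at distance more than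
   \<eta> / 2 from J never come within \<eta>2 of it.\<close>
 define \<eta>2 where "\<eta>2 = \<eta> / (2 * (C + 1))"
 have \<eta>2: "\<eta>2 > 0" "C * \<eta>2 \<le> \<eta> / 2" "\<eta>2 \<le> \<eta> / 2" using \<eta> C by (auto simp: \<eta>2_def field_simps)
 have claim1: "\<eta> < D (wcomp f w x)" if "x \<in> RS" "word w" "length w = n0" "\<eta> / 2 < D x" for x w
 proof (rule ccontr)
  assume "\<not> \<eta> < D (wcomp f w x)"
  then have "D x \<le> C * \<theta> ^ n0 * \<eta>" using pull[OF that(1,2), of \<eta>] \<eta> that(3) by simp
  also have "\<dots> \<le> C * (1 / (2 * C)) * \<eta>" using n0 C \<eta> by (intro mult_right_mono mult_left_mono) auto
  also have "\<dots> = \<eta> / 2" using C by simp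
  finally show False using that(4) by simp
 qed
 have claim2: "\<eta>2 < D (wcomp f w x)" if "x \<in> RS" "word w" "\<eta> / 2 < D x" for x w
 proof (rule ccontr)
  assume "\<not> \<eta>2 < D (wcomp f w x)"
  then have "D x \<le> C * \<theta> ^ length w * \<eta>2" using pull[OF that(1,2), of \<eta>2] \<eta> \<eta>2 by simp
  also have "\<dots> \<le> C * 1 * \<eta>2" using C \<theta> \<eta>2 by (intro mult_right_mono mult_left_mono power_le_one) auto
  also have "\<dots> \<le> \<eta> / 2" using \<eta>2 by simp
  finally show False using that(3) by simp
 qed
 obtain z0 where z0: "z0 \<in> J" using J_nonempty by blast
 define \<delta> where "\<delta> = \<eta>2 / 2"
 have \<delta>: "\<delta> > 0" using \<eta>2 by (simp add: \<delta>_def)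
 \<comment> \<open>With the pole this close to a point of J, all points at distance more than
   \<eta>2 from J stay off the pole by \<delta>.\<close>
 obtain a where a: "pole a \<in> ball z0 \<delta>"
  using pole_dense[OF open_ball, of z0 z0 \<delta> z0] z0 J_RS \<delta> by auto
 have off: "\<delta> \<le> dist x (pole a)" if "\<eta>2 < D x" for x
 proof -
  have "D x \<le> dist x z0" unfolding D_def using z0 by (rule infdist_le)
  also have "\<dots> \<le> dist x (pole a) + dist z0 (pole a)" by (rule dist_triangle2)
  finally show ?thesis using that a by (simp add: \<delta>_def)
 qed
 define N where "N = {v. \<eta> / 2 < D (emb a v)}"
 have "open {x. \<eta> / 2 < D x}" unfolding D_def by (intro open_Collect_less continuous_intros)
 then have "open (emb a -` {x. \<eta> / 2 < D x})" by (rule open_emb_vimage)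
 then have openN: "open N" by (simp add: N_def vimage_def)
 define R where "R = 2 / \<delta>"
 have R: "R > 0" using \<delta> by (simp add: R_def)
 have NR: "N \<subseteq> cball 0 R"
 proof
  fix v assume "v \<in> N"
  then have "\<eta>2 < D (emb a v)" using \<eta>2 by (simp add: N_def)
  then have "cmod v \<le> R" unfolding R_def by (intro emb_norm_le[OF \<delta> off])
  then show "v \<in> cball 0 R" by simp
 qed
 define L where "L = 2 * ((cmod a)\<^sup>2 + 1)"
 have L: "L > 0" by (simp add: L_def add_nonneg_pos)
 define \<tau> where "\<tau> = \<eta> / (2 * L)"
 have \<tau>: "\<tau> > 0" using \<eta> L by (simp add: \<tau>_def)
 have deepN: "z \<in> N" if "\<eta> < D (emb a v)" "dist v z < \<tau>" for v z
 proof -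
  have "D (emb a v) \<le> D (emb a z) + dist (emb a v) (emb a z)" unfolding D_def by (rule infdist_triangle)
  moreover have "dist (emb a v) (emb a z) \<le> L * dist v z" unfolding L_def by (rule emb_lipschitz)
  moreover have "L * dist v z < L * \<tau>" using that(2) L by simp
  moreover have "L * \<tau> = \<eta> / 2" using L by (simp add: \<tau>_def)
  ultimately show ?thesis using that(1) by (simp add: N_def)
 qed
 have "y0 \<noteq> pole a"
 proof -
  have "\<delta> \<le> dist y0 (pole a)" using off[of y0] \<eta> \<eta>2 by simp
  then show ?thesis using \<delta> by auto
 qed
 then obtain u0 where u0: "y0 = emb a u0" using emb_surj[OF y0R] by blast
 have ballN: "ball u0 \<tau> \<subseteq> N" using deepN[of u0] \<eta>(3) by (auto simp: u0)
 \<comment> \<open>Then t * 2 R = \<tau> / 2: the displacement in \<open>earle_hamilton\<close>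
   stays below the depth \<tau>, and t is independent of the word.\<close>
 define t where "t = \<tau> / (4 * R)"
 have t: "t > 0" "t * (2 * R) < \<tau>" using \<tau> R by (auto simp: t_def)
 define B where "B = 4 * R / (\<tau> / 2)"
 have B: "B > 0" using R \<tau> by (simp add: B_def)
 obtain d where d: "d > 0" "\<And>y. y \<in> RS \<Longrightarrow> dist y0 y < d \<Longrightarrow> \<exists>v. y = emb a v \<and> dist u0 v < \<tau> / 2"
  using emb_local_inverse[OF half_gt_zero[OF \<tau>], of a u0] unfolding u0[symmetric] by blast
 have "(\<lambda>n. dist (fseq f \<omega> n y0) (fseq f \<omega> n y)) \<longlonglongrightarrow> 0" if y: "y \<in> RS" "dist y0 y < d" and \<omega>: "\<forall>n. \<omega> n \<in> idx s" for y \<omega>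
 proof -
  have wid: "word (map \<omega> [i..<k])" for i k using \<omega> by auto
  define w where "w m = map \<omega> [m * n0..<m * n0 + n0]" for m
  have wm: "word (w m)" "length (w m) = n0" for m using wid by (simp_all add: w_def)
  have "\<exists>h. h holomorphic_on N \<and> (\<forall>v\<in>N. wcomp f (w m) (emb a v) = emb a (h v))" for m
  proof (rule holomorphic_wcomp[OF wm(1)])
   fix v j assume "v \<in> N"
   then have "\<eta>2 < D (wcomp f (take j (w m)) (emb a v))"
    using claim2[OF emb_in_RS set_take_idx[OF wm(1)]] by (simp add: N_def)
   then show "wcomp f (take j (w m)) (emb a v) \<noteq> pole a" using off \<delta> by (metis dist_self not_le)
  qed
  then obtain h where h: "\<And>m. h m holomorphic_on N" "\<And>m v. v \<in> N \<Longrightarrow> wcomp f (w m) (emb a v) = emb a (h m v)" by metis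
  have hN: "\<eta> < D (emb a (h m v))" if "v \<in> N" for m v
   using claim1[OF emb_in_RS wm(1) wm(2), of a v m] h(2)[OF that] that by (simp add: N_def)
  define H where "H = (\<lambda>m v. rec_nat v (\<lambda>m. h m) m)"
  have H: "\<And>v. H 0 v = v" "\<And>m v. H (Suc m) v = h m (H m v)" by (simp_all add: H_def)
  have deep: "\<And>i v z. v \<in> N \<Longrightarrow> dist (h i v) z < \<tau> \<Longrightarrow> z \<in> N" using hN deepN by blast
  have sub: "ball x (\<tau> / 2) \<subseteq> N" if "x \<in> ball u0 (\<tau> / 2)" for x
  proof
   fix z assume "z \<in> ball x (\<tau> / 2)"
   then have "dist u0 z < \<tau> / 2 + \<tau> / 2" using that dist_triangle[of u0 z x] by simp
   then show "z \<in> N" using ballN by auto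
  qed
  have EH: "cmod (deriv (H m) x) \<le> 4 * R / (\<tau> / 2) / (1 + t) ^ m" "H m holomorphic_on N" "H m ` N \<subseteq> N"
   if x: "x \<in> ball u0 (\<tau> / 2)" for m x
   by (rule earle_hamilton[where N = N and h = h and H = H and R = R and \<tau> = \<tau> and t = t and r = "\<tau> / 2" and x = x];
    use openN NR h(1) deep t H half_gt_zero[OF \<tau>] sub[OF x] in blast)+
  have u0b: "u0 \<in> ball u0 (\<tau> / 2)" using \<tau> by simp
  have HN: "H m v \<in> N" if "v \<in> N" for m v using EH(3)[OF u0b] that by auto
  have lip: "dist (H m u0) (H m v) \<le> B / (1 + t) ^ m * dist u0 v" if v: "v \<in> ball u0 (\<tau> / 2)" for m v
   unfolding dist_norm
  proof (rule field_differentiable_bound[OF convex_ball _ _ u0b v])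
   fix z assume z: "z \<in> ball u0 (\<tau> / 2)"
   then have "z \<in> N" using sub[OF z] \<tau> by auto
   then have "(H m has_field_derivative deriv (H m) z) (at z)"
    using EH(2)[OF u0b] openN holomorphic_derivI by blast
   then show "(H m has_field_derivative deriv (H m) z) (at z within ball u0 (\<tau> / 2))" by (rule has_field_derivative_at_within)
   show "cmod (deriv (H m) z) \<le> B / (1 + t) ^ m" using EH(1)[OF z] by (simp add: B_def)
  qed
  have fH: "fseq f \<omega> (m * n0) (emb a v) = emb a (H m v)" if "v \<in> N" for m v
  proof (induction m)
   case 0
   show ?case by (simp add: fseq_def H(1))
  next
   case (Suc m)
   have "fseq f \<omega> (m * n0 + n0) (emb a v) = wcomp f (w m) (emb a (H m v))"
    unfolding fseq_add w_def Suc ..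
   then show ?case using h(2)[OF HN[OF that]] by (simp add: H(2) add.commute)
  qed
  obtain v where v: "y = emb a v" "dist u0 v < \<tau> / 2" using d(2)[OF y] by blast
  have vN: "v \<in> ball u0 (\<tau> / 2)" "v \<in> N" "u0 \<in> N" using v(2) \<tau> sub[OF u0b] by auto
  define K where "K = {x \<in> RS. \<eta> / 2 \<le> infdist x J}"
  have K: "compact K" "K \<subseteq> F" unfolding K_def using compact_far_from_J[OF half_gt_zero[OF \<eta>(1)]] by auto
  show ?thesis
  \<comment> \<open>After m blocks the two orbits are \<zeta>-close in the compact set K; uniform
    equicontinuity there takes care of all later times, including those inside a block.\<close>
  proof (rule LIMSEQ_I)
   fix \<epsilon> :: real assume "\<epsilon> > 0"
   then obtain \<zeta> where \<zeta>: "\<zeta> > 0" "\<And>x y w. x \<in> K \<Longrightarrow> y \<in> RS \<Longrightarrow> dist x y < \<zeta> \<Longrightarrow> word w \<Longrightarrow> dist (wcomp f w x) (wcomp f w y) < \<epsilon>"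
    using uniform_equi[OF K] by metis
   obtain m where m: "L * B * \<tau> / \<zeta> < (1 + t) ^ m" using real_arch_pow[of "1 + t"] t by auto
   have p: "(1 + t) ^ m > 0" using t by simp
   have "dist (emb a (H m u0)) (emb a (H m v)) \<le> L * dist (H m u0) (H m v)" unfolding L_def by (rule emb_lipschitz)
   also have "\<dots> \<le> L * (B / (1 + t) ^ m * dist u0 v)" using lip[OF vN(1)] L by (intro mult_left_mono) auto
   also have "\<dots> \<le> L * (B / (1 + t) ^ m * \<tau>)" using v(2) L B p \<tau> by (intro mult_left_mono) auto
   also have "\<dots> < \<zeta>" using m p \<zeta>(1) by (simp add: field_simps)
   finally have cl: "dist (emb a (H m u0)) (emb a (H m v)) < \<zeta>" .
   have HK: "emb a (H m u0) \<in> K" using HN[OF vN(3), of m] emb_in_RS by (simp add: K_def N_def D_def)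
   have "norm (dist (fseq f \<omega> n y0) (fseq f \<omega> n y) - 0) < \<epsilon>" if n: "n \<ge> m * n0" for n
   proof -
    obtain k where k: "n = m * n0 + k" using n le_Suc_ex by blast
    have "fseq f \<omega> n y0 = wcomp f (map \<omega> [m * n0..<n]) (emb a (H m u0))"
     "fseq f \<omega> n y = wcomp f (map \<omega> [m * n0..<n]) (emb a (H m v))"
     unfolding k fseq_add u0 v(1) fH[OF vN(3)] fH[OF vN(2)] by simp_all
    then show ?thesis using \<zeta>(2)[OF HK emb_in_RS cl wid] by simp
   qed
   then show "\<exists>no. \<forall>n\<ge>no. norm (dist (fseq f \<omega> n y0) (fseq f \<omega> n y) - 0) < \<epsilon>" by blast
  qed
 qed
 then show ?thesis using d(1) by blast
qed

end

type_synonym germ = "(nat \<Rightarrow> complex) \<Rightarrow> complex"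

section \<open>Separately holomorphic functions\<close>

definition pdisc :: "nat \<Rightarrow> (nat \<Rightarrow> complex) \<Rightarrow> real \<Rightarrow> (nat \<Rightarrow> complex) set" where
 "pdisc s c \<rho> = {\<xi>. \<forall>j\<in>{1..s}. dist (c j) (\<xi> j) < \<rho>}"

text \<open>Bounded, with a common bound, and holomorphic in each of the variables 1..s separately.
  This stands in for holomorphy in several variables, and is stable under \<open>cpd\<close> with
  explicit loss of radius and bound.\<close>

definition sep_hol :: "nat \<Rightarrow> (nat \<Rightarrow> complex) \<Rightarrow> real \<Rightarrow> real \<Rightarrow> germ \<Rightarrow> bool" where
 "sep_hol s c \<rho> M H \<longleftrightarrow> (\<forall>\<xi>\<in>pdisc s c \<rho>. cmod (H \<xi>) \<le> M \<and>
   (\<forall>j\<in>{1..s}. (\<lambda>t. H (\<xi>(j := t))) holomorphic_on ball (c j) \<rho>))"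

definition cpd :: "nat \<Rightarrow> germ \<Rightarrow> germ" where
 "cpd j H \<xi> = deriv (\<lambda>t. H (\<xi>(j := t))) (\<xi> j)"

lemma pdisc_upd: "\<xi> \<in> pdisc s c \<rho> \<Longrightarrow> t \<in> ball (c j) \<rho> \<Longrightarrow> \<xi>(j := t) \<in> pdisc s c \<rho>"
 by (auto simp: pdisc_def)

lemma pdisc_mono: "\<rho>' \<le> \<rho> \<Longrightarrow> pdisc s c \<rho>' \<subseteq> pdisc s c \<rho>"
 by (force simp: pdisc_def)

lemma pdisc_centre: "\<rho> > 0 \<Longrightarrow> c \<in> pdisc s c \<rho>"
 by (simp add: pdisc_def)

lemma sep_hol_mono: "sep_hol s c \<rho> M H \<Longrightarrow> \<rho>' \<le> \<rho> \<Longrightarrow> M \<le> M' \<Longrightarrow> sep_hol s c \<rho>' M' H"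
 unfolding sep_hol_def using pdisc_mono[of \<rho>' \<rho> s c]
 by (meson holomorphic_on_subset order_trans subsetD subset_ball)

text \<open>The constant depends only on the bound and the radius, which is what makes the
  difference quotients in \<open>sep_hol_cpd\<close> converge uniformly.\<close>

lemma holomorphic_taylor1:
 assumes h: "h holomorphic_on ball w r" "\<And>v. v \<in> ball w r \<Longrightarrow> cmod (h v) \<le> M" "r > 0" and d: "cmod d < r / 4"
 shows "cmod (h (w + d) - h w - deriv h w * d) \<le> 32 * M / r\<^sup>2 * (cmod d)\<^sup>2"
proof -
 have hol': "deriv h holomorphic_on ball w (r / 2)"
  using holomorphic_deriv[OF h(1)] h(3) by (auto intro: holomorphic_on_subset)
 have b: "cmod (deriv h v) \<le> 4 * M / r" if "v \<in> ball w (r / 2)" for v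
  using holomorphic_bounded_lipschitz(1)[OF h(1,2,3) that] by blast
 have K: "4 * (4 * M / r) / (r / 2) = 32 * M / r\<^sup>2" by (simp add: power2_eq_square)
 have l: "cmod (deriv h v - deriv h w) \<le> 32 * M / r\<^sup>2 * cmod (v - w)" if "v \<in> ball w (r / 4)" for v
 proof -
  have "v \<in> ball w (r / 2 / 2)" "w \<in> ball w (r / 2 / 2)" using that h(3) by auto
  then have "dist (deriv h v) (deriv h w) \<le> 4 * (4 * M / r) / (r / 2) * dist v w"
   using holomorphic_bounded_lipschitz(2)[OF hol' b half_gt_zero[OF h(3)]] by blast
  then show ?thesis unfolding K by (simp add: dist_norm)
 qed
 have "cmod (h w) \<le> M" using h(2)[of w] h(3) by simp
 then have "M \<ge> 0" using norm_ge_zero[of "h w"] by linarith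
 then have M: "0 \<le> 32 * M / r\<^sup>2" by simp
 have "cmod ((h (w + d) - deriv h w * (w + d)) - (h w - deriv h w * w)) \<le> 32 * M / r\<^sup>2 * cmod d * cmod ((w + d) - w)"
 proof (rule field_differentiable_bound[OF convex_cball[of w "cmod d"]])
  fix z assume z: "z \<in> cball w (cmod d)"
  then have zb: "z \<in> ball w (r / 4)" using d by auto
  then have "z \<in> ball w r" using h(3) by auto
  then have "(h has_field_derivative deriv h z) (at z)" using h(1) holomorphic_derivI by blast
  then have "((\<lambda>v. h v - deriv h w * v) has_field_derivative deriv h z - deriv h w) (at z)"
   by (auto intro!: derivative_eq_intros)
  then show "((\<lambda>v. h v - deriv h w * v) has_field_derivative deriv h z - deriv h w) (at z within cball w (cmod d))"
   by (rule has_field_derivative_at_within)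
  have "cmod (z - w) \<le> cmod d" using z by (simp add: dist_norm norm_minus_commute)
  then have "32 * M / r\<^sup>2 * cmod (z - w) \<le> 32 * M / r\<^sup>2 * cmod d" using M by (rule mult_left_mono)
  then show "cmod (deriv h z - deriv h w) \<le> 32 * M / r\<^sup>2 * cmod d" using l[OF zb] by linarith
 qed (auto simp: dist_norm)
 then show ?thesis by (simp add: algebra_simps power2_eq_square)
qed

text \<open>The derivative in one variable is a locally uniform limit of difference quotients, hence
 holomorphic in the other variables.\<close>
lemma sep_hol_cpd:
 assumes H: "sep_hol s c \<rho> M H" and \<rho>: "\<rho> > 0" and j: "j \<in> {1..s}"
 shows "sep_hol s c (\<rho> / 2) (4 * M / \<rho>) (cpd j H)"
 unfolding sep_hol_def
proof (intro ballI conjI)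
 fix \<xi> assume \<xi>: "\<xi> \<in> pdisc s c (\<rho> / 2)"
 then have \<xi>\<rho>: "\<xi> \<in> pdisc s c \<rho>" using pdisc_mono[of "\<rho> / 2" \<rho> s c] \<rho> by auto
 have hol: "(\<lambda>t. H (\<xi>(i := t))) holomorphic_on ball (c i) \<rho>" if "\<xi> \<in> pdisc s c \<rho>" "i \<in> {1..s}" for i \<xi>
  using H that by (auto simp: sep_hol_def)
 have bd: "cmod (H (\<xi>(i := t))) \<le> M" if "\<xi> \<in> pdisc s c \<rho>" "i \<in> {1..s}" "t \<in> ball (c i) \<rho>" for i \<xi> t
  using H pdisc_upd[OF that(1,3)] by (auto simp: sep_hol_def)
 have \<xi>j: "\<xi> j \<in> ball (c j) (\<rho> / 2)" using \<xi> j by (auto simp: pdisc_def)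
 show "cmod (cpd j H \<xi>) \<le> 4 * M / \<rho>"
  unfolding cpd_def using holomorphic_bounded_lipschitz(1)[OF hol[OF \<xi>\<rho> j] bd[OF \<xi>\<rho> j] \<rho> \<xi>j] by blast
 fix i assume i: "i \<in> {1..s}"
 show "(\<lambda>t. cpd j H (\<xi>(i := t))) holomorphic_on ball (c i) (\<rho> / 2)"
 proof (cases "i = j")
  case True
  have "deriv (\<lambda>t. H (\<xi>(j := t))) holomorphic_on ball (c j) \<rho>" by (rule holomorphic_deriv[OF hol[OF \<xi>\<rho> j]]) simp
  then have "deriv (\<lambda>t. H (\<xi>(j := t))) holomorphic_on ball (c j) (\<rho> / 2)"
   using \<rho> by (auto intro: holomorphic_on_subset)
  then show ?thesis by (simp add: True cpd_def)
 next
  case False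
  \<comment> \<open>The 9 makes the steps smaller than \<rho> / 8 from n = 0 on, the range of
    \<open>holomorphic_taylor1\<close> for the radius \<rho> / 2.\<close>
  define d :: "nat \<Rightarrow> complex" where "d n = complex_of_real (\<rho> / (9 * real (Suc n)))" for n
  have dn: "cmod (d n) = \<rho> / (9 * real (Suc n))" for n
   unfolding d_def norm_of_real using \<rho> by simp
  have d: "d n \<noteq> 0" "cmod (d n) < \<rho> / 2 / 4" for n
  proof -
   show "d n \<noteq> 0" using dn[of n] \<rho> by (metis divide_pos_pos mult_pos_pos norm_zero of_nat_0_less_iff order_less_irrefl zero_less_Suc zero_less_numeral)
   have "\<rho> * 8 < 9 * (\<rho> * real (Suc n))" using \<rho> by (simp add: algebra_simps add_strict_increasing)
   then show "cmod (d n) < \<rho> / 2 / 4" unfolding dn using \<rho> by (simp add: field_simps)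
  qed
  define q where "q n t = (H (\<xi>(i := t, j := \<xi> j + d n)) - H (\<xi>(i := t, j := \<xi> j))) / d n" for n t
  have \<xi>d: "\<xi> j + d n \<in> ball (c j) \<rho>" for n
  proof -
   have "dist (c j) (\<xi> j + d n) \<le> dist (c j) (\<xi> j) + cmod (d n)" using norm_triangle_ineq4[of "c j - \<xi> j" "d n"]
    by (simp add: dist_norm algebra_simps)
   then show ?thesis using \<xi>j d(2)[of n] \<rho> by simp
  qed
  have qhol: "q n holomorphic_on ball (c i) (\<rho> / 2)" for n
  proof -
   have 1: "(\<lambda>t. H ((\<xi>(j := z))(i := t))) holomorphic_on ball (c i) (\<rho> / 2)" if "z \<in> ball (c j) \<rho>" for z
    using hol[OF pdisc_upd[OF \<xi>\<rho> that] i] \<rho> by (auto intro: holomorphic_on_subset)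
   have "\<xi> j \<in> ball (c j) \<rho>" using \<xi>j \<rho> by simp
   then have "(\<lambda>t. (H ((\<xi>(j := \<xi> j + d n))(i := t)) - H ((\<xi>(j := \<xi> j))(i := t))) / d n) holomorphic_on ball (c i) (\<rho> / 2)"
    using d(1)[of n] by (intro holomorphic_on_divide holomorphic_on_diff holomorphic_on_const 1 \<xi>d) auto
   moreover have "\<xi>(i := t, j := \<xi> j) = \<xi>(i := t)" for t using False by auto
   ultimately show ?thesis unfolding q_def using False by (simp add: fun_upd_twist)
  qed
  have ul: "uniform_limit (ball (c i) (\<rho> / 2)) q (\<lambda>t. cpd j H (\<xi>(i := t))) sequentially"
  proof (rule uniform_limitI)
   fix e :: real assume e: "e > 0"
   define K where "K = 32 * M / (\<rho> / 2)\<^sup>2"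
   have "cmod (H \<xi>) \<le> M" using H \<xi>\<rho> by (auto simp: sep_hol_def)
   then have "M \<ge> 0" using norm_ge_zero[of "H \<xi>"] by linarith
   then have K: "K \<ge> 0" by (simp add: K_def)
   obtain N where N: "(K + 1) * \<rho> / e < real N" using reals_Archimedean2 by blast
   have est: "cmod (q n t - cpd j H (\<xi>(i := t))) \<le> K * cmod (d n)" if t: "t \<in> ball (c i) (\<rho> / 2)" for n t
   proof -
    define h where "h = (\<lambda>z. H ((\<xi>(i := t))(j := z)))"
    have t\<rho>: "\<xi>(i := t) \<in> pdisc s c \<rho>" using pdisc_upd[OF \<xi>\<rho>, of t i] t \<rho> by auto
    have sub: "ball (\<xi> j) (\<rho> / 2) \<subseteq> ball (c j) \<rho>"
    proof
     fix z assume "z \<in> ball (\<xi> j) (\<rho> / 2)"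
     then have "dist (c j) z < \<rho> / 2 + \<rho> / 2" using \<xi>j dist_triangle[of "c j" z "\<xi> j"] by simp
     then show "z \<in> ball (c j) \<rho>" by simp
    qed
    have "cmod (h (\<xi> j + d n) - h (\<xi> j) - deriv h (\<xi> j) * d n) \<le> K * (cmod (d n))\<^sup>2"
     unfolding K_def
    proof (rule holomorphic_taylor1[OF _ _ half_gt_zero[OF \<rho>] d(2)])
     show "h holomorphic_on ball (\<xi> j) (\<rho> / 2)" unfolding h_def
      by (rule holomorphic_on_subset[OF hol[OF t\<rho> j] sub])
     show "cmod (h v) \<le> M" if "v \<in> ball (\<xi> j) (\<rho> / 2)" for v
      unfolding h_def using bd[OF t\<rho> j] sub that by blast
    qed
    moreover have "cpd j H (\<xi>(i := t)) = deriv h (\<xi> j)" using False by (simp add: cpd_def h_def)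
    moreover have "q n t - deriv h (\<xi> j) = (h (\<xi> j + d n) - h (\<xi> j) - deriv h (\<xi> j) * d n) / d n"
     using d(1)[of n] by (simp add: q_def h_def field_simps)
    ultimately have "cmod (q n t - cpd j H (\<xi>(i := t))) \<le> K * (cmod (d n))\<^sup>2 / cmod (d n)"
     by (simp add: norm_divide divide_right_mono)
    also have "\<dots> = K * cmod (d n)" using d(1)[of n] by (simp add: power2_eq_square)
    finally show ?thesis .
   qed
   show "\<forall>\<^sub>F n in sequentially. \<forall>t\<in>ball (c i) (\<rho> / 2). dist (q n t) (cpd j H (\<xi>(i := t))) < e"
   proof (rule eventually_sequentiallyI[of N], rule ballI)
    fix n t assume n: "n \<ge> N" and t: "t \<in> ball (c i) (\<rho> / 2)"
    have "(K + 1) * \<rho> / e < real n" using N n by (meson less_le_trans of_nat_le_iff)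
    then have "(K + 1) * \<rho> < e * real n" using e by (simp add: field_simps)
    also have "\<dots> \<le> e * (9 * real (Suc n))" using e by (intro mult_left_mono) auto
    finally have "(K + 1) * cmod (d n) < e" unfolding dn using \<rho> by (simp add: field_simps)
    moreover have "K * cmod (d n) \<le> (K + 1) * cmod (d n)" by (intro mult_right_mono) auto
    ultimately show "dist (q n t) (cpd j H (\<xi>(i := t))) < e" using est[OF t, of n] by (simp add: dist_norm)
   qed
  qed
  show ?thesis
  proof (rule holomorphic_uniform_sequence[OF open_ball qhol])
   fix t assume "t \<in> ball (c i) (\<rho> / 2)"
   then obtain e where e: "e > 0" "cball t e \<subseteq> ball (c i) (\<rho> / 2)" using open_contains_cball_eq[OF open_ball] by blast
   then show "\<exists>e>0. cball t e \<subseteq> ball (c i) (\<rho> / 2) \<and> uniform_limit (cball t e) q (\<lambda>t. cpd j H (\<xi>(i := t))) sequentially"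
    using uniform_limit_on_subset[OF ul] by blast
  qed
 qed
qed

section \<open>Equality near a point and linear operators\<close>

definition reg :: "nat \<Rightarrow> (nat \<Rightarrow> complex) \<Rightarrow> germ \<Rightarrow> bool" where
 "reg s c H \<longleftrightarrow> (\<exists>\<rho>>0. \<exists>M. sep_hol s c \<rho> M H)"

text \<open>Identities for derivatives hold only near c, where the functions are holomorphic, so
  they are stated as equality on some polydisc. \<open>cpd\<close> respects this relation.\<close>

definition germ_eq :: "nat \<Rightarrow> (nat \<Rightarrow> complex) \<Rightarrow> germ \<Rightarrow> germ \<Rightarrow> bool" where
 "germ_eq s c H H' \<longleftrightarrow> (\<exists>\<rho>>0. \<forall>\<xi>\<in>pdisc s c \<rho>. H \<xi> = H' \<xi>)"

lemma germ_eq_refl [simp]: "germ_eq s c H H"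
 unfolding germ_eq_def by (intro exI[of _ 1]) simp

lemma germ_eq_trans [trans]: assumes "germ_eq s c H H'" "germ_eq s c H' H''" shows "germ_eq s c H H''"
proof -
 obtain r r' where "r > 0" "r' > 0" "\<forall>\<xi>\<in>pdisc s c r. H \<xi> = H' \<xi>" "\<forall>\<xi>\<in>pdisc s c r'. H' \<xi> = H'' \<xi>"
  using assms unfolding germ_eq_def by blast
 then show ?thesis unfolding germ_eq_def using pdisc_mono[of "min r r'" r s c] pdisc_mono[of "min r r'" r' s c]
  by (intro exI[of _ "min r r'"]) (auto simp: subset_eq)
qed

lemma germ_eq_at: "germ_eq s c H H' \<Longrightarrow> H c = H' c"
 unfolding germ_eq_def using pdisc_centre by blast

lemma germ_eq_lin:
 assumes "germ_eq s c H H'" "germ_eq s c G G'"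
 shows "germ_eq s c (\<lambda>\<xi>. a \<xi> * H \<xi> + b \<xi> * G \<xi>) (\<lambda>\<xi>. a \<xi> * H' \<xi> + b \<xi> * G' \<xi>)"
proof -
 obtain r r' where "r > 0" "r' > 0" "\<forall>\<xi>\<in>pdisc s c r. H \<xi> = H' \<xi>" "\<forall>\<xi>\<in>pdisc s c r'. G \<xi> = G' \<xi>"
  using assms unfolding germ_eq_def by blast
 then show ?thesis unfolding germ_eq_def using pdisc_mono[of "min r r'" r s c] pdisc_mono[of "min r r'" r' s c]
  by (intro exI[of _ "min r r'"]) (auto simp: subset_eq)
qed

lemma reg_mult: assumes "reg s c A" "reg s c H" shows "reg s c (\<lambda>\<xi>. A \<xi> * H \<xi>)"
proof -
 obtain r M r' M' where r: "r > 0" "sep_hol s c r M A" "r' > 0" "sep_hol s c r' M' H"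
  using assms unfolding reg_def by blast
 define \<rho> where "\<rho> = min r r'"
 have 1: "sep_hol s c \<rho> M A" "sep_hol s c \<rho> M' H" using r sep_hol_mono[of s c] by (auto simp: \<rho>_def)
 have "sep_hol s c \<rho> (M * M') (\<lambda>\<xi>. A \<xi> * H \<xi>)"
  unfolding sep_hol_def
 proof (intro ballI conjI)
  fix \<xi> assume \<xi>: "\<xi> \<in> pdisc s c \<rho>"
  then have "cmod (A \<xi>) \<le> M" "cmod (H \<xi>) \<le> M'" using 1 by (auto simp: sep_hol_def)
  moreover from this have "0 \<le> M" using norm_ge_zero[of "A \<xi>"] by linarith
  ultimately show "cmod (A \<xi> * H \<xi>) \<le> M * M'" unfolding norm_mult by (intro mult_mono) auto
  fix j assume "j \<in> {1..s}"
  then show "(\<lambda>t. A (\<xi>(j := t)) * H (\<xi>(j := t))) holomorphic_on ball (c j) \<rho>"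
   using 1 \<xi> by (intro holomorphic_on_mult) (auto simp: sep_hol_def)
 qed
 moreover have "\<rho> > 0" using r by (simp add: \<rho>_def)
 ultimately show ?thesis unfolding reg_def by blast
qed

lemma reg_add: assumes "reg s c A" "reg s c H" shows "reg s c (\<lambda>\<xi>. A \<xi> + H \<xi>)"
proof -
 obtain r M r' M' where r: "r > 0" "sep_hol s c r M A" "r' > 0" "sep_hol s c r' M' H"
  using assms unfolding reg_def by blast
 define \<rho> where "\<rho> = min r r'"
 have 1: "sep_hol s c \<rho> M A" "sep_hol s c \<rho> M' H" using r sep_hol_mono[of s c] by (auto simp: \<rho>_def)
 have "sep_hol s c \<rho> (M + M') (\<lambda>\<xi>. A \<xi> + H \<xi>)"
  unfolding sep_hol_def
 proof (intro ballI conjI)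
  fix \<xi> assume \<xi>: "\<xi> \<in> pdisc s c \<rho>"
  then have "cmod (A \<xi>) \<le> M" "cmod (H \<xi>) \<le> M'" using 1 by (auto simp: sep_hol_def)
  then show "cmod (A \<xi> + H \<xi>) \<le> M + M'" using norm_triangle_ineq[of "A \<xi>" "H \<xi>"] by linarith
  fix j assume "j \<in> {1..s}"
  then show "(\<lambda>t. A (\<xi>(j := t)) + H (\<xi>(j := t))) holomorphic_on ball (c j) \<rho>"
   using 1 \<xi> by (intro holomorphic_on_add) (auto simp: sep_hol_def)
 qed
 moreover have "\<rho> > 0" using r by (simp add: \<rho>_def)
 ultimately show ?thesis unfolding reg_def by blast
qed

lemma reg_const: "reg s c (\<lambda>\<xi>. a)"
 unfolding reg_def sep_hol_def by (rule exI[of _ 1], intro exI[of _ "cmod a"] conjI) (auto intro: holomorphic_intros)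

lemma reg_var: assumes "j \<in> {1..s}" shows "reg s c (\<lambda>\<xi>. \<xi> j)"
 unfolding reg_def sep_hol_def
proof (rule exI[of _ 1], intro exI[of _ "cmod (c j) + 1"] conjI ballI)
 fix \<xi> assume "\<xi> \<in> pdisc s c 1"
 then have "dist (c j) (\<xi> j) < 1" using assms by (auto simp: pdisc_def)
 then show "cmod (\<xi> j) \<le> cmod (c j) + 1" using norm_triangle_ineq2[of "\<xi> j" "c j"] by (simp add: dist_norm norm_minus_commute)
 fix i show "(\<lambda>t. (\<xi>(i := t)) j) holomorphic_on ball (c i) 1"
  by (cases "i = j") (auto intro: holomorphic_intros)
qed simp

lemma reg_sum: "finite S \<Longrightarrow> (\<And>l. l \<in> S \<Longrightarrow> reg s c (G l)) \<Longrightarrow> reg s c (\<lambda>\<xi>. \<Sum>l\<in>S. a l * G l \<xi>)"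
proof (induction S rule: finite_induct)
 case empty
 then show ?case by (simp add: reg_const)
next
 case (insert l S)
 have "reg s c (\<lambda>\<xi>. a l * G l \<xi>)" using insert.prems by (intro reg_mult reg_const) auto
 then show ?case using reg_add[of s c "\<lambda>\<xi>. a l * G l \<xi>" "\<lambda>\<xi>. \<Sum>l\<in>S. a l * G l \<xi>"] insert by simp
qed

text \<open>Linearity is asked only of regular functions and only near c, because
  \<open>deriv\<close> is additive only where the derivatives exist.\<close>

definition linop :: "nat \<Rightarrow> (nat \<Rightarrow> complex) \<Rightarrow> (germ \<Rightarrow> germ) \<Rightarrow> bool" where
 "linop s c D \<longleftrightarrow> (\<forall>H. reg s c H \<longrightarrow> reg s c (D H)) \<and> (\<forall>H H'. germ_eq s c H H' \<longrightarrow> germ_eq s c (D H) (D H')) \<and>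
   (\<forall>H G a b. reg s c H \<longrightarrow> reg s c G \<longrightarrow> germ_eq s c (D (\<lambda>\<xi>. a * H \<xi> + b * G \<xi>)) (\<lambda>\<xi>. a * D H \<xi> + b * D G \<xi>))"

lemma linop_reg: "linop s c D \<Longrightarrow> reg s c H \<Longrightarrow> reg s c (D H)"
 and linop_germ: "linop s c D \<Longrightarrow> germ_eq s c H H' \<Longrightarrow> germ_eq s c (D H) (D H')"
 and linop_lin: "linop s c D \<Longrightarrow> reg s c H \<Longrightarrow> reg s c G \<Longrightarrow>
  germ_eq s c (D (\<lambda>\<xi>. a * H \<xi> + b * G \<xi>)) (\<lambda>\<xi>. a * D H \<xi> + b * D G \<xi>)"
 by (simp_all add: linop_def)

lemma linop_id: "linop s c (\<lambda>H. H)"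
 by (simp add: linop_def)

lemma linop_compose: assumes D: "linop s c D" and E: "linop s c E" shows "linop s c (\<lambda>H. D (E H))"
proof -
 have "germ_eq s c (D (E (\<lambda>\<xi>. a * H \<xi> + b * G \<xi>))) (\<lambda>\<xi>. a * D (E H) \<xi> + b * D (E G) \<xi>)"
  if "reg s c H" "reg s c G" for H G a b
 proof -
  have "germ_eq s c (D (E (\<lambda>\<xi>. a * H \<xi> + b * G \<xi>))) (D (\<lambda>\<xi>. a * E H \<xi> + b * E G \<xi>))"
   by (rule linop_germ[OF D linop_lin[OF E that]])
  also have "germ_eq s c \<dots> (\<lambda>\<xi>. a * D (E H) \<xi> + b * D (E G) \<xi>)"
   by (rule linop_lin[OF D linop_reg[OF E that(1)] linop_reg[OF E that(2)]])
  finally show ?thesis .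
 qed
 then show ?thesis unfolding linop_def[of s c "\<lambda>H. D (E H)"]
  by (intro conjI allI impI linop_reg[OF D] linop_reg[OF E] linop_germ[OF D] linop_germ[OF E])
qed

lemma linop_funpow: "linop s c D \<Longrightarrow> linop s c (\<lambda>H. (D ^^ k) H)"
proof (induction k)
 case 0
 then show ?case by (simp add: linop_id)
next
 case (Suc k)
 then show ?case using linop_compose[of s c D "\<lambda>H. (D ^^ k) H"] by simp
qed

lemma linop_sum:
 assumes D: "linop s c D" and "finite S" "\<And>l. l \<in> S \<Longrightarrow> reg s c (G l)"
 shows "germ_eq s c (D (\<lambda>\<xi>. \<Sum>l\<in>S. a l * G l \<xi>)) (\<lambda>\<xi>. \<Sum>l\<in>S. a l * D (G l) \<xi>)"
 using assms(2,3)
proof (induction S rule: finite_induct)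
 case empty
 have "germ_eq s c (D (\<lambda>\<xi>. 0 * 0 + 0 * 0)) (\<lambda>\<xi>. 0 * D (\<lambda>\<xi>. 0) \<xi> + 0 * D (\<lambda>\<xi>. 0) \<xi>)"
  by (rule linop_lin[OF D reg_const reg_const])
 then show ?case by simp
next
 case (insert l S)
 have r: "reg s c (G l)" "reg s c (\<lambda>\<xi>. \<Sum>l\<in>S. a l * G l \<xi>)" using insert reg_sum[of S s c G a] by auto
 have "germ_eq s c (D (\<lambda>\<xi>. a l * G l \<xi> + 1 * (\<Sum>l\<in>S. a l * G l \<xi>))) (\<lambda>\<xi>. a l * D (G l) \<xi> + 1 * D (\<lambda>\<xi>. \<Sum>l\<in>S. a l * G l \<xi>) \<xi>)"
  by (rule linop_lin[OF D r])
 also have "germ_eq s c \<dots> (\<lambda>\<xi>. a l * D (G l) \<xi> + 1 * (\<Sum>l\<in>S. a l * D (G l) \<xi>))"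
  using insert by (intro germ_eq_lin) auto
 finally show ?case using insert by simp
qed

lemma cpd_has_derivative:
 assumes "sep_hol s c \<rho> M H" "\<xi> \<in> pdisc s c \<rho>" "j \<in> {1..s}"
 shows "((\<lambda>t. H (\<xi>(j := t))) has_field_derivative cpd j H \<xi>) (at (\<xi> j))"
proof -
 have "(\<lambda>t. H (\<xi>(j := t))) holomorphic_on ball (c j) \<rho>" "\<xi> j \<in> ball (c j) \<rho>"
  using assms by (auto simp: sep_hol_def pdisc_def)
 then show ?thesis unfolding cpd_def using holomorphic_derivI[OF _ open_ball] by blast
qed

lemma cpd_cong:
 assumes "\<And>\<xi>. \<xi> \<in> pdisc s c \<rho> \<Longrightarrow> H \<xi> = H' \<xi>" "\<xi> \<in> pdisc s c \<rho>" "j \<in> {1..s}"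
 shows "cpd j H \<xi> = cpd j H' \<xi>"
 unfolding cpd_def
proof (rule deriv_cong_ev)
 have "\<xi> j \<in> ball (c j) \<rho>" using assms(2,3) by (auto simp: pdisc_def)
 then have "\<forall>\<^sub>F t in nhds (\<xi> j). t \<in> ball (c j) \<rho>" using open_ball by (rule eventually_nhds_in_open[rotated])
 then show "\<forall>\<^sub>F t in nhds (\<xi> j). H (\<xi>(j := t)) = H' (\<xi>(j := t))"
  by eventually_elim (use assms(1) pdisc_upd[OF assms(2)] in blast)
qed simp

lemma linop_cpd: assumes j: "j \<in> {1..s}" shows "linop s c (cpd j)"
 unfolding linop_def
proof (intro conjI allI impI)
 fix H assume "reg s c H"
 then show "reg s c (cpd j H)" unfolding reg_def using sep_hol_cpd[OF _ _ j] half_gt_zero by blast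
next
 fix H H' assume "germ_eq s c H H'"
 then show "germ_eq s c (cpd j H) (cpd j H')" unfolding germ_eq_def using cpd_cong[OF _ _ j] by metis
next
 fix H G :: "germ" and a b assume "reg s c H" "reg s c G"
 then obtain r M r' M' where r: "r > 0" "sep_hol s c r M H" "r' > 0" "sep_hol s c r' M' G" unfolding reg_def by blast
 define \<rho> where "\<rho> = min r r'"
 have 1: "sep_hol s c \<rho> M H" "sep_hol s c \<rho> M' G" using r sep_hol_mono[of s c] by (auto simp: \<rho>_def)
 have "cpd j (\<lambda>\<xi>. a * H \<xi> + b * G \<xi>) \<xi> = a * cpd j H \<xi> + b * cpd j G \<xi>" if \<xi>: "\<xi> \<in> pdisc s c \<rho>" for \<xi>
  unfolding cpd_def[of j "\<lambda>\<xi>. a * H \<xi> + b * G \<xi>"]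
  by (intro DERIV_imp_deriv DERIV_add DERIV_cmult cpd_has_derivative[OF 1(1) \<xi> j] cpd_has_derivative[OF 1(2) \<xi> j])
 then show "germ_eq s c (cpd j (\<lambda>\<xi>. a * H \<xi> + b * G \<xi>)) (\<lambda>\<xi>. a * cpd j H \<xi> + b * cpd j G \<xi>)"
  unfolding germ_eq_def using r by (intro exI[of _ \<rho>]) (auto simp: \<rho>_def)
qed

definition cmpd :: "nat list \<Rightarrow> (nat \<Rightarrow> nat) \<Rightarrow> germ \<Rightarrow> germ" where
 "cmpd js n H = foldr (\<lambda>i G. ((cpd i) ^^ n i) G) js H"

lemma cmpd_Nil [simp]: "cmpd [] n H = H" by (simp add: cmpd_def)

lemma cmpd_Cons [simp]: "cmpd (j # js) n H = ((cpd j) ^^ n j) (cmpd js n H)" by (simp add: cmpd_def)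

lemma linop_cmpd: "set js \<subseteq> {1..s} \<Longrightarrow> linop s c (cmpd js n)"
proof (induction js)
 case Nil
 then show ?case using linop_id by (simp add: cmpd_def)
next
 case (Cons j js)
 have "linop s c (\<lambda>H. ((cpd j) ^^ n j) (cmpd js n H))"
  using linop_compose[OF linop_funpow[OF linop_cpd]] Cons by auto
 then show ?case by (simp add: cmpd_def)
qed

text \<open>v j is the constant partial derivative of A in direction j. The weights of the letters,
  as functions of the parameters, have this form.\<close>

definition affine_fun :: "nat \<Rightarrow> (nat \<Rightarrow> complex) \<Rightarrow> (nat \<Rightarrow> complex) \<Rightarrow> germ \<Rightarrow> bool" where
 "affine_fun s c v A \<longleftrightarrow> reg s c A \<and> (\<forall>j\<in>{1..s}. \<forall>\<xi> t. A (\<xi>(j := t)) = A \<xi> + v j * (t - \<xi> j))"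

lemma cpd_affine_mult:
 assumes A: "affine_fun s c v A" and H: "reg s c H" and j: "j \<in> {1..s}"
 shows "germ_eq s c (cpd j (\<lambda>\<xi>. A \<xi> * H \<xi>)) (\<lambda>\<xi>. A \<xi> * cpd j H \<xi> + v j * H \<xi>)"
proof -
 obtain r M where r: "r > 0" "sep_hol s c r M H" using H unfolding reg_def by blast
 have "cpd j (\<lambda>\<xi>. A \<xi> * H \<xi>) \<xi> = A \<xi> * cpd j H \<xi> + v j * H \<xi>" if \<xi>: "\<xi> \<in> pdisc s c r" for \<xi>
 proof -
  have "((\<lambda>t. A \<xi> + v j * (t - \<xi> j)) has_field_derivative v j) (at (\<xi> j))"
   by (auto intro!: derivative_eq_intros)
  from DERIV_mult[OF this cpd_has_derivative[OF r(2) \<xi> j]]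
  have "((\<lambda>t. (A \<xi> + v j * (t - \<xi> j)) * H (\<xi>(j := t))) has_field_derivative A \<xi> * cpd j H \<xi> + v j * H \<xi>) (at (\<xi> j))"
   by (simp add: algebra_simps)
  moreover have "(\<lambda>t. (A \<xi> + v j * (t - \<xi> j)) * H (\<xi>(j := t))) = (\<lambda>t. A (\<xi>(j := t)) * H (\<xi>(j := t)))"
   using A j by (auto simp: affine_fun_def)
  ultimately show ?thesis unfolding cpd_def[of j "\<lambda>\<xi>. A \<xi> * H \<xi>"] by (metis DERIV_imp_deriv)
 qed
 then show ?thesis unfolding germ_eq_def using r(1) by blast
qed

text \<open>Since A has constant derivative, the Leibniz rule stops after two terms. For k = 0 the
  truncated exponent k - 1 is harmless because of the factor k.\<close>

lemma cpd_pow_affine_mult: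
 assumes A: "affine_fun s c v A" and H: "reg s c H" and j: "j \<in> {1..s}"
 shows "germ_eq s c ((cpd j ^^ k) (\<lambda>\<xi>. A \<xi> * H \<xi>)) (\<lambda>\<xi>. A \<xi> * (cpd j ^^ k) H \<xi> + (of_nat k * v j) * (cpd j ^^ (k - 1)) H \<xi>)"
proof (induction k)
 case (Suc k)
 have D: "linop s c (cpd j)" by (rule linop_cpd[OF j])
 have rk: "reg s c ((cpd j ^^ k) H)" for k by (rule linop_reg[OF linop_funpow[OF D] H])
 have rA: "reg s c (\<lambda>\<xi>. A \<xi> * (cpd j ^^ k) H \<xi>)" using A rk reg_mult by (auto simp: affine_fun_def)
 have "germ_eq s c (cpd j ((cpd j ^^ k) (\<lambda>\<xi>. A \<xi> * H \<xi>)))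
   (cpd j (\<lambda>\<xi>. 1 * (A \<xi> * (cpd j ^^ k) H \<xi>) + (of_nat k * v j) * (cpd j ^^ (k - 1)) H \<xi>))"
  using linop_germ[OF D Suc] by simp
 also have "germ_eq s c \<dots> (\<lambda>\<xi>. 1 * cpd j (\<lambda>\<xi>. A \<xi> * (cpd j ^^ k) H \<xi>) \<xi> + (of_nat k * v j) * cpd j ((cpd j ^^ (k - 1)) H) \<xi>)"
  by (rule linop_lin[OF D rA rk])
 also have "germ_eq s c \<dots> (\<lambda>\<xi>. 1 * (A \<xi> * cpd j ((cpd j ^^ k) H) \<xi> + v j * (cpd j ^^ k) H \<xi>) + (of_nat k * v j) * cpd j ((cpd j ^^ (k - 1)) H) \<xi>)"
  by (intro germ_eq_lin cpd_affine_mult[OF A rk j] germ_eq_refl)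
 also have "(\<lambda>\<xi>. 1 * (A \<xi> * cpd j ((cpd j ^^ k) H) \<xi> + v j * (cpd j ^^ k) H \<xi>) + (of_nat k * v j) * cpd j ((cpd j ^^ (k - 1)) H) \<xi>)
   = (\<lambda>\<xi>. A \<xi> * (cpd j ^^ Suc k) H \<xi> + (of_nat (Suc k) * v j) * (cpd j ^^ k) H \<xi>)"
  by (cases k) (auto simp: algebra_simps)
 finally show ?case by simp
qed simp

lemma cmpd_exponent_cong: "(\<And>i. i \<in> set js \<Longrightarrow> n i = n' i) \<Longrightarrow> cmpd js n H = cmpd js n' H"
 by (induction js) auto

text \<open>Mixed second derivatives of A vanish as well, so each extra term lowers a single
  exponent by one. This is the source of the terms of order |n| - 1 in the recursion for the
  C_n.\<close>

lemma leibniz_affine: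
 assumes A: "affine_fun s c v A" and H: "reg s c H" and js: "distinct js" "set js \<subseteq> {1..s}"
 shows "germ_eq s c (cmpd js n (\<lambda>\<xi>. A \<xi> * H \<xi>))
  (\<lambda>\<xi>. A \<xi> * cmpd js n H \<xi> + (\<Sum>l\<in>set js. (of_nat (n l) * v l) * cmpd js (n(l := n l - 1)) H \<xi>))"
 using js
proof (induction js)
 case (Cons j js)
 have j: "j \<in> {1..s}" and js: "distinct js" "set js \<subseteq> {1..s}" "j \<notin> set js" using Cons.prems by auto
 define D where "D = (\<lambda>H. (cpd j ^^ n j) H)"
 have D: "linop s c D" unfolding D_def by (rule linop_funpow[OF linop_cpd[OF j]])
 define G where "G = cmpd js n H"
 define G' where "G' l = cmpd js (n(l := n l - 1)) H" for l
 have rG: "reg s c G" "reg s c (G' l)" for l unfolding G_def G'_def by (rule linop_reg[OF linop_cmpd[OF js(2)] H])+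
 have rA: "reg s c (\<lambda>\<xi>. A \<xi> * G \<xi>)" using A rG reg_mult by (auto simp: affine_fun_def)
 define a where "a l = of_nat (n l) * v l" for l
 have "germ_eq s c (cmpd js n (\<lambda>\<xi>. A \<xi> * H \<xi>)) (\<lambda>\<xi>. 1 * (A \<xi> * G \<xi>) + 1 * (\<Sum>l\<in>set js. a l * G' l \<xi>))"
  using Cons.IH[OF js(1,2)] unfolding G_def G'_def a_def mult_1 .
 then have "germ_eq s c (D (cmpd js n (\<lambda>\<xi>. A \<xi> * H \<xi>))) (D (\<lambda>\<xi>. 1 * (A \<xi> * G \<xi>) + 1 * (\<Sum>l\<in>set js. a l * G' l \<xi>)))"
  by (rule linop_germ[OF D])
 also have "germ_eq s c \<dots> (\<lambda>\<xi>. 1 * D (\<lambda>\<xi>. A \<xi> * G \<xi>) \<xi> + 1 * D (\<lambda>\<xi>. \<Sum>l\<in>set js. a l * G' l \<xi>) \<xi>)"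
  by (rule linop_lin[OF D rA reg_sum]) (auto intro: rG)
 also have "germ_eq s c \<dots> (\<lambda>\<xi>. 1 * (A \<xi> * D G \<xi> + a j * (cpd j ^^ (n j - 1)) G \<xi>) + 1 * (\<Sum>l\<in>set js. a l * D (G' l) \<xi>))"
  using cpd_pow_affine_mult[OF A rG(1) j, of "n j"] linop_sum[OF D, of "set js" G' a] rG unfolding D_def a_def
  by (intro germ_eq_lin) auto
 also have "(\<lambda>\<xi>. 1 * (A \<xi> * D G \<xi> + a j * (cpd j ^^ (n j - 1)) G \<xi>) + 1 * (\<Sum>l\<in>set js. a l * D (G' l) \<xi>))
  = (\<lambda>\<xi>. A \<xi> * cmpd (j # js) n H \<xi> + (\<Sum>l\<in>set (j # js). a l * cmpd (j # js) (n(l := n l - 1)) H \<xi>))"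
 proof
  fix \<xi>
  have 1: "cmpd (j # js) (n(j := n j - 1)) H = (cpd j ^^ (n j - 1)) G"
  proof -
   have "cmpd js (n(j := n j - 1)) H = cmpd js n H" by (rule cmpd_exponent_cong) (use js(3) in auto)
   then show ?thesis by (simp add: G_def)
  qed
  have 2: "cmpd (j # js) (n(l := n l - 1)) H = D (G' l)" if "l \<in> set js" for l
  proof -
   have "l \<noteq> j" using that js(3) by auto
   then show ?thesis by (simp add: D_def G'_def)
  qed
  have "(\<Sum>l\<in>set js. a l * cmpd (j # js) (n(l := n l - 1)) H \<xi>) = (\<Sum>l\<in>set js. a l * D (G' l) \<xi>)"
   by (intro sum.cong refl) (simp only: 2)
  then show "1 * (A \<xi> * D G \<xi> + a j * (cpd j ^^ (n j - 1)) G \<xi>) + 1 * (\<Sum>l\<in>set js. a l * D (G' l) \<xi>)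
   = A \<xi> * cmpd (j # js) n H \<xi> + (\<Sum>l\<in>set (j # js). a l * cmpd (j # js) (n(l := n l - 1)) H \<xi>)"
   using js(3) unfolding set_simps(2) by (subst sum.insert) (auto simp only: 1 finite_set, simp add: D_def G_def)
 qed
 finally show ?case by (simp only: D_def a_def cmpd_Cons)
qed simp

section \<open>Agreement with the real derivatives\<close>

definition real_agree :: "nat \<Rightarrow> (nat \<Rightarrow> complex) \<Rightarrow> real \<Rightarrow> germ \<Rightarrow> ((nat \<Rightarrow> real) \<Rightarrow> real) \<Rightarrow> bool" where
 "real_agree s c \<rho> H h \<longleftrightarrow> (\<forall>x. (\<lambda>i. complex_of_real (x i)) \<in> pdisc s c \<rho> \<longrightarrow> H (\<lambda>i. complex_of_real (x i)) = complex_of_real (h x))"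

text \<open>Along the real axis the imaginary part of H vanishes, so the complex derivative is real
  and is the derivative of h, which therefore exists. This gives \<open>pdiff\<close> its intended
  meaning.\<close>

lemma real_agree_cpd:
 assumes H: "sep_hol s c \<rho> M H" and h: "real_agree s c \<rho> H h" and \<rho>: "\<rho> > 0" and j: "j \<in> {1..s}"
 shows "real_agree s c (\<rho> / 2) (cpd j H) (pdiff h j)"
 unfolding real_agree_def
proof (intro allI impI)
 fix x :: "nat \<Rightarrow> real" assume "(\<lambda>i. complex_of_real (x i)) \<in> pdisc s c (\<rho> / 2)"
 then have x: "(\<lambda>i. complex_of_real (x i)) \<in> pdisc s c \<rho>" using pdisc_mono[of "\<rho> / 2" \<rho> s c] \<rho> by auto
 define D where "D = cpd j H (\<lambda>i. complex_of_real (x i))"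
 define \<phi> where "\<phi> = (\<lambda>t. H ((\<lambda>i. complex_of_real (x i))(j := t)))"
 have d: "(\<phi> has_field_derivative D) (at (complex_of_real (x j)))"
  unfolding \<phi>_def D_def using cpd_has_derivative[OF H x j] .
 have "((\<lambda>t. \<phi> (complex_of_real t)) has_vector_derivative D) (at (x j))"
  using has_vector_derivative_real_field[of \<phi> D "x j" UNIV] d by simp
 then have dR: "((\<lambda>t. Re (\<phi> (complex_of_real t))) has_vector_derivative Re D) (at (x j))"
  and dI: "((\<lambda>t. Im (\<phi> (complex_of_real t))) has_vector_derivative Im D) (at (x j))"
  by (auto intro: bounded_linear.has_vector_derivative[OF bounded_linear_Re] bounded_linear.has_vector_derivative[OF bounded_linear_Im])
 have "complex_of_real (x j) \<in> ball (c j) \<rho>" using x j by (auto simp: pdisc_def)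
 then have "open (complex_of_real -` ball (c j) \<rho>)" "x j \<in> complex_of_real -` ball (c j) \<rho>"
  by (auto intro!: open_vimage continuous_intros)
 then have ev: "\<forall>\<^sub>F t in nhds (x j). complex_of_real t \<in> ball (c j) \<rho>"
  using eventually_nhds_in_open[of "complex_of_real -` ball (c j) \<rho>" "x j"] by simp
 have eq: "\<phi> (complex_of_real t) = complex_of_real (h (x(j := t)))" if "complex_of_real t \<in> ball (c j) \<rho>" for t
 proof -
  have e: "(\<lambda>i. complex_of_real (x i))(j := complex_of_real t) = (\<lambda>i. complex_of_real ((x(j := t)) i))" by auto
  have "(\<lambda>i. complex_of_real ((x(j := t)) i)) \<in> pdisc s c \<rho>" using pdisc_upd[OF x that] unfolding e .
  then show ?thesis using h unfolding real_agree_def \<phi>_def e by blast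
 qed
 have "\<forall>\<^sub>F t in nhds (x j). Re (\<phi> (complex_of_real t)) = h (x(j := t))"
  using ev by eventually_elim (simp add: eq)
 from DERIV_cong_ev[OF refl this refl, THEN iffD1, OF dR[folded has_real_derivative_iff_has_vector_derivative]]
 have "((\<lambda>t. h (x(j := t))) has_real_derivative Re D) (at (x j))" .
 then have p: "pdiff h j x = Re D" unfolding pdiff_def by (rule DERIV_imp_deriv)
 have "\<forall>\<^sub>F t in nhds (x j). Im (\<phi> (complex_of_real t)) = 0"
  using ev by eventually_elim (simp add: eq)
 from DERIV_cong_ev[OF refl this refl, THEN iffD1, OF dI[folded has_real_derivative_iff_has_vector_derivative]]
 have "((\<lambda>t. 0 :: real) has_real_derivative Im D) (at (x j))" .
 then have "Im D = 0" using DERIV_unique DERIV_const by blast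
 then show "cpd j H (\<lambda>i. complex_of_real (x i)) = complex_of_real (pdiff h j x)"
  unfolding p by (simp add: D_def complex_eq_iff)
qed

text \<open>The new radius and bound are chosen before H and h. One polydisc then serves all points
  y of the sphere at once, and the C_n come out bounded.\<close>

definition regular_op where
 "regular_op s c D d \<longleftrightarrow> (\<forall>\<rho>>0. \<forall>M. \<exists>\<rho>'>0. \<exists>M'. \<forall>H h. sep_hol s c \<rho> M H \<longrightarrow> real_agree s c \<rho> H h \<longrightarrow>
   sep_hol s c \<rho>' M' (D H) \<and> real_agree s c \<rho>' (D H) (d h))"

lemma regular_op_id: "regular_op s c (\<lambda>H. H) (\<lambda>h. h)"
 unfolding regular_op_def by blast

lemma regular_op_compose:
 assumes "regular_op s c D d" "regular_op s c E e" shows "regular_op s c (\<lambda>H. D (E H)) (\<lambda>h. d (e h))"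
 unfolding regular_op_def
proof (intro allI impI)
 fix \<rho> M :: real assume "\<rho> > 0"
 then obtain \<rho>1 M1 where 1: "\<rho>1 > 0" "\<And>H h. sep_hol s c \<rho> M H \<Longrightarrow> real_agree s c \<rho> H h \<Longrightarrow>
   sep_hol s c \<rho>1 M1 (E H) \<and> real_agree s c \<rho>1 (E H) (e h)" using assms(2) unfolding regular_op_def by metis
 obtain \<rho>2 M2 where 2: "\<rho>2 > 0" "\<And>H h. sep_hol s c \<rho>1 M1 H \<Longrightarrow> real_agree s c \<rho>1 H h \<Longrightarrow>
   sep_hol s c \<rho>2 M2 (D H) \<and> real_agree s c \<rho>2 (D H) (d h)" using assms(1) 1(1) unfolding regular_op_def by metis
 show "\<exists>\<rho>'>0. \<exists>M'. \<forall>H h. sep_hol s c \<rho> M H \<longrightarrow> real_agree s c \<rho> H h \<longrightarrow>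
   sep_hol s c \<rho>' M' (D (E H)) \<and> real_agree s c \<rho>' (D (E H)) (d (e h))" using 1 2 by blast
qed

lemma regular_op_cpd: assumes "j \<in> {1..s}" shows "regular_op s c (cpd j) (\<lambda>h. pdiff h j)"
 unfolding regular_op_def
proof (intro allI impI)
 fix \<rho> M :: real assume "\<rho> > 0"
 then show "\<exists>\<rho>'>0. \<exists>M'. \<forall>H h. sep_hol s c \<rho> M H \<longrightarrow> real_agree s c \<rho> H h \<longrightarrow>
   sep_hol s c \<rho>' M' (cpd j H) \<and> real_agree s c \<rho>' (cpd j H) (pdiff h j)"
  using sep_hol_cpd[OF _ _ assms] real_agree_cpd[OF _ _ _ assms] half_gt_zero by blast
qed

lemma regular_op_funpow: "regular_op s c D d \<Longrightarrow> regular_op s c (\<lambda>H. (D ^^ k) H) (\<lambda>h. (d ^^ k) h)"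
proof (induction k)
 case 0
 then show ?case by (simp add: regular_op_id)
next
 case (Suc k)
 then show ?case using regular_op_compose[of s c D d "\<lambda>H. (D ^^ k) H" "\<lambda>h. (d ^^ k) h"] by simp
qed

lemma regular_op_cmpd: "set js \<subseteq> {1..s} \<Longrightarrow> regular_op s c (cmpd js n) (\<lambda>h. foldr (\<lambda>i G. ((\<lambda>H. pdiff H i) ^^ n i) G) js h)"
proof (induction js)
 case Nil
 then show ?case using regular_op_id by (simp add: cmpd_def)
next
 case (Cons j js)
 have "regular_op s c (\<lambda>H. (cpd j ^^ n j) (cmpd js n H))
   (\<lambda>h. ((\<lambda>H. pdiff H j) ^^ n j) (foldr (\<lambda>i G. ((\<lambda>H. pdiff H i) ^^ n i) G) js h))"
  using regular_op_compose[OF regular_op_funpow[OF regular_op_cpd]] Cons by auto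
 then show ?case by (simp add: cmpd_def)
qed

section \<open>Absorption\<close>

lemma tendsto_zero_squeeze:
 fixes a b :: "nat \<Rightarrow> real"
 assumes "b \<longlonglongrightarrow> 0" "\<And>n. 0 \<le> a n" "\<And>n. a n \<le> b n" shows "a \<longlonglongrightarrow> 0"
 by (rule Lim_null_comparison[OF _ assms(1)]) (simp add: assms)

lemma setdist_bounds:
 assumes "u \<in> RS" "K \<subseteq> RS" "K \<noteq> {}"
 shows "infdist u K \<le> setdist u K" "setdist u K \<le> 3 * infdist u K"
proof -
 have bdd: "bdd_below ((\<lambda>v. sdist u v) ` K)"
 proof (rule bdd_belowI[of _ 0])
  fix t assume "t \<in> (\<lambda>v. sdist u v) ` K"
  then obtain v where v: "v \<in> K" "t = sdist u v" by blast
  then have "dist u v \<le> t" using sdist_bounds(1)[OF assms(1)] assms(2) by blast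
  then show "0 \<le> t" using zero_le_dist[of u v] by linarith
 qed
 show "infdist u K \<le> setdist u K"
  unfolding setdist_def
 proof (rule cINF_greatest[OF assms(3)])
  fix v assume v: "v \<in> K"
  have "infdist u K \<le> dist u v" using v by (rule infdist_le)
  also have "\<dots> \<le> sdist u v" using sdist_bounds(1)[OF assms(1)] v assms(2) by blast
  finally show "infdist u K \<le> sdist u v" .
 qed
 have "setdist u K / 3 \<le> dist u v" if v: "v \<in> K" for v
 proof -
  have "setdist u K \<le> sdist u v" unfolding setdist_def by (rule cINF_lower[OF bdd v])
  also have "\<dots> \<le> 3 * dist u v" using sdist_bounds(2)[OF assms(1)] v assms(2) by blast
  finally show ?thesis by simp
 qed
 then have "setdist u K / 3 \<le> infdist u K" unfolding infdist_notempty[OF assms(3)] by (rule cINF_greatest[OF assms(3)])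
 then show "setdist u K \<le> 3 * infdist u K" by simp
qed

lemma fseq_Suc_shift: "fseq f (case_nat i \<omega>) (Suc n) x = fseq f \<omega> n (f i x)"
proof -
 have "map (case_nat i \<omega>) [0..<Suc n] = i # map \<omega> [0..<n]"
  by (subst upt_conv_Cons) (auto simp: map_Suc_upt[symmetric] simp del: upt_Suc)
 then show ?thesis by (simp add: fseq_def)
qed

context hyperbolic_system
begin

lemma minimal_forward: assumes "minimal_set s f K" "z \<in> K" "i \<in> idx s" shows "f i z \<in> K"
proof -
 have "f i \<in> semigrp s f" using semigrpI[of "[i]"] assms(3) by simp
 then have "f i z \<in> {g z | g. g \<in> semigrp s f}" by blast
 then have "f i z \<in> closure {g z | g. g \<in> semigrp s f}" by (rule subsetD[OF closure_subset])
 moreover have "K = closure {g z | g. g \<in> semigrp s f}" using assms(1,2) unfolding minimal_set_def by blast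
 ultimately show ?thesis by simp
qed

lemma minimal_forward_word: "minimal_set s f K \<Longrightarrow> z \<in> K \<Longrightarrow> word w \<Longrightarrow> wcomp f w z \<in> K"
 by (induction w arbitrary: z) (auto simp: minimal_forward)

lemma minimal_disjoint: assumes "minimal_set s f K" "minimal_set s f K'" "K \<noteq> K'" shows "K \<inter> K' = {}"
 using assms unfolding minimal_set_def by blast

text \<open>If an orbit point of v came close to some y in J, shadowing backwards would put a
  preimage of y, which lies in J, close to v.\<close>

lemma fatou_orbit_far:
 assumes v: "v \<in> F" shows "\<exists>\<eta>>0. \<forall>w. word w \<longrightarrow> \<eta> \<le> infdist (wcomp f w v) J"
proof -
 obtain r K where r: "r > 0" and K: "K > 0" and pre: "\<And>w y y'. word w \<Longrightarrow> y \<in> J \<Longrightarrow> y' \<in> RS \<Longrightarrow> dist y y' < r \<Longrightarrow>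
  weak_shadow K w y y'"
  using preimages_equicontinuous by metis
 have clJ: "closed J" by (rule compact_imp_closed[OF compact_J])
 have vR: "v \<in> RS" "v \<notin> J" using v F_RS by (auto simp: julia_def)
 define D where "D = infdist v J"
 have D: "D > 0" unfolding D_def by (rule infdist_pos_not_in_closed[OF clJ J_nonempty vR(2)])
 define \<eta> where "\<eta> = min (r / 2) (D / (2 * K))"
 have \<eta>: "\<eta> > 0" using r D K by (simp add: \<eta>_def)
 have "\<eta> \<le> infdist (wcomp f w v) J" if w: "word w" for w
 proof (rule ccontr)
  assume neg: "\<not> \<eta> \<le> infdist (wcomp f w v) J"
  obtain y where y: "y \<in> J" "infdist (wcomp f w v) J = dist (wcomp f w v) y"
   using infdist_attains_inf[OF clJ J_nonempty] by blast
  then have d: "dist y (wcomp f w v) < \<eta>" using neg by (simp add: dist_commute)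
  then have "dist y (wcomp f w v) < r" using r by (simp add: \<eta>_def)
  from pre[OF w y(1) wcomp_RS[OF w vR(1)] this, THEN conjunct2, rule_format, OF vR(1) refl]
  obtain x where x: "x \<in> RS" "wcomp f w x = y"
   "\<forall>j. odist j w x v \<le> K * dist y (wcomp f w v)" by blast
  have "x \<in> J" using J_backward[OF x(1) w] x(2) y(1) by simp
  then have "D \<le> dist v x" unfolding D_def by (rule infdist_le)
  also have "\<dots> \<le> K * dist y (wcomp f w v)" using x(3)[rule_format, of 0] by (simp add: dist_commute)
  also have "\<dots> < K * \<eta>" using d K by simp
  also have "\<dots> \<le> K * (D / (2 * K))" using K by (intro mult_left_mono) (auto simp: \<eta>_def)
  also have "\<dots> = D / 2" using K by simp
  finally show False using D by simp
 qed
 then show ?thesis using \<eta> by blast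
qed

lemma some_image_F: assumes "y \<in> RS" shows "\<exists>i\<in>idx s. f i y \<in> F"
proof -
 have 2: "1 \<in> idx s" "2 \<in> idx s" using s_pos by (auto simp: idx_def)
 then have "f 1 y \<notin> J \<or> f 2 y \<notin> J" using A2[OF 2 assms] by auto
 then show ?thesis using 2 f_RS J_iff by blast
qed

text \<open>By (A2) some letter sends a point of K into F. The orbit of that image stays away from J
  by \<open>fatou_orbit_far\<close>, and its closure is all of K.\<close>

lemma minimal_F: assumes K: "minimal_set s f K" shows "K \<subseteq> F"
proof -
 obtain v0 where v0: "v0 \<in> K" "K \<subseteq> RS" using K unfolding minimal_set_def by blast
 then obtain i where i: "i \<in> idx s" "f i v0 \<in> F" using some_image_F by blast
 define v where "v = f i v0"
 have v: "v \<in> K" "v \<in> F" using minimal_forward[OF K v0(1) i(1)] i(2) by (auto simp: v_def)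
 obtain \<eta> where \<eta>: "\<eta> > 0" "\<And>w. word w \<Longrightarrow> \<eta> \<le> infdist (wcomp f w v) J" using fatou_orbit_far[OF v(2)] by blast
 have "closed {x \<in> RS. \<eta> \<le> infdist x J}" using compact_far_from_J(1)[OF \<eta>(1)] by (rule compact_imp_closed)
 moreover have "{g v | g. g \<in> semigrp s f} \<subseteq> {x \<in> RS. \<eta> \<le> infdist x J}"
 proof
  fix x assume "x \<in> {g v | g. g \<in> semigrp s f}"
  then obtain w where w: "x = wcomp f w v" "word w" unfolding semigrp_def by blast
  have "v \<in> RS" using v(2) F_RS by blast
  then show "x \<in> {x \<in> RS. \<eta> \<le> infdist x J}" using \<eta>(2)[OF w(2)] wcomp_RS[OF w(2)] w(1) by simp
 qed
 ultimately have "closure {g v | g. g \<in> semigrp s f} \<subseteq> {x \<in> RS. \<eta> \<le> infdist x J}" by (rule closure_minimal[rotated])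
 moreover have "K = closure {g v | g. g \<in> semigrp s f}" using K v(1) unfolding minimal_set_def by blast
 ultimately show ?thesis using compact_far_from_J(2)[OF \<eta>(1)] by blast
qed

lemma fseq_RS: "(\<forall>n. \<omega> n \<in> idx s) \<Longrightarrow> y \<in> RS \<Longrightarrow> fseq f \<omega> n y \<in> RS"
 unfolding fseq_def by (rule wcomp_RS) auto

end

locale hyperbolic_minimal = hyperbolic_system +
 fixes L L' :: "(complex \<times> real) set" and p :: "nat \<Rightarrow> real"
 assumes L: "minimal_set s f L" and L': "minimal_set s f L'" "L' \<noteq> L"
  and p: "\<And>i. i \<in> {1..s} \<Longrightarrow> 0 < p i" "(\<Sum>i=1..s. p i) < 1"
begin

definition adm :: "(nat \<Rightarrow> nat) \<Rightarrow> bool" where "adm \<omega> \<longleftrightarrow> (\<forall>n. \<omega> n \<in> idx s)"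

definition conv :: "(nat \<Rightarrow> nat) \<Rightarrow> complex \<times> real \<Rightarrow> bool" where
 "conv \<omega> y \<longleftrightarrow> (\<lambda>n. setdist (fseq f \<omega> n y) L) \<longlonglongrightarrow> 0"

text \<open>Convergence is required, or excluded, for every admissible \<omega> and not only for
  almost every one. This makes both sets forward invariant and, by \<open>conv_near\<close>, open.
  The set \<open>A1\<close> is not the hypothesis (A1).\<close>

definition A1 where "A1 = {y \<in> F. \<forall>\<omega>. adm \<omega> \<longrightarrow> conv \<omega> y}"
definition A0 where "A0 = {y \<in> F. \<forall>\<omega>. adm \<omega> \<longrightarrow> \<not> conv \<omega> y}"

lemma L_props: "L \<noteq> {}" "compact L" "L \<subseteq> RS"
 using L unfolding minimal_set_def by auto

lemma conv_infdist: assumes "adm \<omega>" "y \<in> RS" shows "conv \<omega> y \<longleftrightarrow> (\<lambda>n. infdist (fseq f \<omega> n y) L) \<longlonglongrightarrow> 0"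
proof -
 have R: "fseq f \<omega> n y \<in> RS" for n using assms fseq_RS by (simp add: adm_def)
 show ?thesis
 proof
  assume "conv \<omega> y"
  then have "(\<lambda>n. setdist (fseq f \<omega> n y) L) \<longlonglongrightarrow> 0" by (simp add: conv_def)
  then show "(\<lambda>n. infdist (fseq f \<omega> n y) L) \<longlonglongrightarrow> 0"
   by (rule tendsto_zero_squeeze) (rule infdist_nonneg setdist_bounds(1)[OF R L_props(3,1)])+
 next
  assume "(\<lambda>n. infdist (fseq f \<omega> n y) L) \<longlonglongrightarrow> 0"
  then have "(\<lambda>n. 3 * infdist (fseq f \<omega> n y) L) \<longlonglongrightarrow> 3 * 0" by (intro tendsto_intros)
  then have "(\<lambda>n. 3 * infdist (fseq f \<omega> n y) L) \<longlonglongrightarrow> 0" by simp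
  moreover have "0 \<le> setdist (fseq f \<omega> n y) L" for n using setdist_bounds(1)[OF R L_props(3,1)] infdist_nonneg order_trans by blast
  ultimately show "conv \<omega> y" unfolding conv_def
   using setdist_bounds(2)[OF R L_props(3,1)] by (rule tendsto_zero_squeeze)
 qed
qed

lemma adm_case_nat: "i \<in> idx s \<Longrightarrow> adm \<omega> \<Longrightarrow> adm (case_nat i \<omega>)"
 by (auto simp: adm_def split: nat.split)

lemma conv_shift: "conv (case_nat i \<omega>) y \<longleftrightarrow> conv \<omega> (f i y)"
 unfolding conv_def using filterlim_sequentially_Suc[of "\<lambda>n. setdist (fseq f (case_nat i \<omega>) n y) L" "nhds 0"]
 by (simp add: fseq_Suc_shift)

lemma A_forward: assumes "i \<in> idx s" shows "y \<in> A1 \<Longrightarrow> f i y \<in> A1" "y \<in> A0 \<Longrightarrow> f i y \<in> A0"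
 using F_forward assms adm_case_nat conv_shift unfolding A1_def A0_def by blast+

lemma A_forward_word: assumes "word w" shows "y \<in> A1 \<Longrightarrow> wcomp f w y \<in> A1" "y \<in> A0 \<Longrightarrow> wcomp f w y \<in> A0"
 using assms by (induction w arbitrary: y) (auto simp: A_forward)

lemma adm_exists: "adm (\<lambda>_. 1)" using idx_nonempty by (simp add: adm_def)

lemma A_disjoint: "A1 \<inter> A0 = {}"
 using adm_exists unfolding A1_def A0_def by blast

lemma A_F: "A1 \<subseteq> F" "A0 \<subseteq> F" by (auto simp: A1_def A0_def)

text \<open>By \<open>fatou_contraction\<close> nearby Fatou points have asymptotic orbits, with one
  neighbourhood for all \<omega>.\<close>

lemma conv_near: assumes "y \<in> F"
 shows "\<exists>d>0. \<forall>y'\<in>RS. dist y y' < d \<longrightarrow> y' \<in> F \<and> (\<forall>\<omega>. adm \<omega> \<longrightarrow> (conv \<omega> y \<longleftrightarrow> conv \<omega> y'))"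
proof -
 obtain d1 where d1: "d1 > 0" "\<And>y' \<omega>. y' \<in> RS \<Longrightarrow> dist y y' < d1 \<Longrightarrow> adm \<omega> \<Longrightarrow> (\<lambda>n. dist (fseq f \<omega> n y) (fseq f \<omega> n y')) \<longlonglongrightarrow> 0"
  using fatou_contraction[OF assms] unfolding adm_def by blast
 obtain d2 where d2: "d2 > 0" "\<And>y'. y' \<in> RS \<Longrightarrow> dist y' y < d2 \<Longrightarrow> y' \<in> F"
  using openin_F assms unfolding openin_euclidean_subtopology_iff by blast
 have half: "conv \<omega> b" if c: "conv \<omega> a" and \<omega>: "adm \<omega>" and R: "a \<in> RS" "b \<in> RS"
  and lim: "(\<lambda>n. dist (fseq f \<omega> n a) (fseq f \<omega> n b)) \<longlonglongrightarrow> 0" for \<omega> a b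
 proof -
  have "(\<lambda>n. infdist (fseq f \<omega> n a) L + dist (fseq f \<omega> n a) (fseq f \<omega> n b)) \<longlonglongrightarrow> 0 + 0"
   using c lim conv_infdist[OF \<omega> R(1)] by (intro tendsto_add) auto
  then have "(\<lambda>n. infdist (fseq f \<omega> n a) L + dist (fseq f \<omega> n a) (fseq f \<omega> n b)) \<longlonglongrightarrow> 0" by simp
  moreover have "infdist (fseq f \<omega> n b) L \<le> infdist (fseq f \<omega> n a) L + dist (fseq f \<omega> n a) (fseq f \<omega> n b)" for n
   using infdist_triangle[of "fseq f \<omega> n b" L "fseq f \<omega> n a"] by (simp add: dist_commute)
  ultimately have "(\<lambda>n. infdist (fseq f \<omega> n b) L) \<longlonglongrightarrow> 0"
   by (intro tendsto_zero_squeeze[of _ "\<lambda>n. infdist (fseq f \<omega> n b) L"] infdist_nonneg)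
  then show ?thesis using conv_infdist[OF \<omega> R(2)] by simp
 qed
 have "y' \<in> F \<and> (\<forall>\<omega>. adm \<omega> \<longrightarrow> (conv \<omega> y \<longleftrightarrow> conv \<omega> y'))" if y': "y' \<in> RS" "dist y y' < min d1 d2" for y'
 proof (intro conjI allI impI)
  show "y' \<in> F" using d2(2) y' by (simp add: dist_commute)
  fix \<omega> assume \<omega>: "adm \<omega>"
  have yR: "y \<in> RS" using assms F_RS by blast
  have l: "(\<lambda>n. dist (fseq f \<omega> n y) (fseq f \<omega> n y')) \<longlonglongrightarrow> 0" using d1(2) y' \<omega> by simp
  then have l': "(\<lambda>n. dist (fseq f \<omega> n y') (fseq f \<omega> n y)) \<longlonglongrightarrow> 0" by (simp add: dist_commute)
  show "conv \<omega> y \<longleftrightarrow> conv \<omega> y'" using half[OF _ \<omega> yR y'(1) l] half[OF _ \<omega> y'(1) yR l'] by blast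
 qed
 then show ?thesis using d1(1) d2(1) by (intro exI[of _ "min d1 d2"]) auto
qed

text \<open>The same words lead both points into \<open>A1\<close>. The relation does not involve
  the weights, so at such points the approximations of T agree for all complex weights, and with
  them all derivatives.\<close>

definition same :: "complex \<times> real \<Rightarrow> complex \<times> real \<Rightarrow> bool" where
 "same y y' \<longleftrightarrow> (\<forall>w. word w \<longrightarrow> (wcomp f w y \<in> A1 \<longleftrightarrow> wcomp f w y' \<in> A1))"

lemma conv_word: assumes "word w" "adm \<omega>" shows "\<exists>\<omega>'. adm \<omega>' \<and> (\<forall>y. conv \<omega>' y \<longleftrightarrow> conv \<omega> (wcomp f w y))"
 using assms
proof (induction w)
 case (Cons i w)
 have iw: "i \<in> idx s" "word w" using Cons.prems by auto
 obtain \<omega>' where "adm \<omega>'" and c: "\<And>y. conv \<omega>' y \<longleftrightarrow> conv \<omega> (wcomp f w y)"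
  using Cons.IH[OF iw(2) Cons.prems(2)] by blast
 then show ?case using iw by (intro exI[of _ "case_nat i \<omega>'"]) (simp add: conv_shift adm_case_nat c del: split_paired_All)
qed auto

text \<open>This contains the local constancy of T and of all C_n on the Fatou set.\<close>

lemma same_near: assumes "y \<in> F" shows "\<exists>d>0. \<forall>y'\<in>RS. dist y y' < d \<longrightarrow> same y y'"
proof -
 obtain d where d: "d > 0" "\<And>y'. y' \<in> RS \<Longrightarrow> dist y y' < d \<Longrightarrow> y' \<in> F \<and> (\<forall>\<omega>. adm \<omega> \<longrightarrow> (conv \<omega> y \<longleftrightarrow> conv \<omega> y'))"
  using conv_near[OF assms] by blast
 have "same y y'" if "y' \<in> RS" "dist y y' < d" for y'
  unfolding same_def
 proof (intro allI impI)
  fix w assume w: "word w"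
  have "conv \<omega> (wcomp f w y) \<longleftrightarrow> conv \<omega> (wcomp f w y')" if \<omega>: "adm \<omega>" for \<omega>
   using conv_word[OF w \<omega>] d(2)[OF \<open>y' \<in> RS\<close> \<open>dist y y' < d\<close>] by blast
  moreover have "wcomp f w y \<in> F" "wcomp f w y' \<in> F" using F_forward_word w assms d(2)[OF that] by auto
  ultimately show "wcomp f w y \<in> A1 \<longleftrightarrow> wcomp f w y' \<in> A1" by (auto simp: A1_def)
 qed
 then show ?thesis using d(1) by blast
qed

lemma openin_A: "openin (top_of_set RS) A1" "openin (top_of_set RS) A0"
proof -
 show "openin (top_of_set RS) A1"
  unfolding openin_euclidean_subtopology_iff
 proof (intro conjI ballI)
  show "A1 \<subseteq> RS" using A_F F_RS by blast
  fix x assume x: "x \<in> A1"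
  then obtain d where d: "d > 0" "\<And>y'. y' \<in> RS \<Longrightarrow> dist x y' < d \<Longrightarrow> y' \<in> F \<and> (\<forall>\<omega>. adm \<omega> \<longrightarrow> (conv \<omega> x \<longleftrightarrow> conv \<omega> y'))"
   using conv_near[of x] A_F by blast
  show "\<exists>e>0. \<forall>x'\<in>RS. dist x' x < e \<longrightarrow> x' \<in> A1"
  proof (intro exI[of _ d] conjI ballI impI d(1))
   fix x' assume "x' \<in> RS" "dist x' x < d"
   then show "x' \<in> A1" using d(2)[of x'] x by (simp add: A1_def dist_commute)
  qed
 qed
 show "openin (top_of_set RS) A0"
  unfolding openin_euclidean_subtopology_iff
 proof (intro conjI ballI)
  show "A0 \<subseteq> RS" using A_F F_RS by blast
  fix x assume x: "x \<in> A0"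
  then obtain d where d: "d > 0" "\<And>y'. y' \<in> RS \<Longrightarrow> dist x y' < d \<Longrightarrow> y' \<in> F \<and> (\<forall>\<omega>. adm \<omega> \<longrightarrow> (conv \<omega> x \<longleftrightarrow> conv \<omega> y'))"
   using conv_near[of x] A_F by blast
  show "\<exists>e>0. \<forall>x'\<in>RS. dist x' x < e \<longrightarrow> x' \<in> A0"
  proof (intro exI[of _ d] conjI ballI impI d(1))
   fix x' assume "x' \<in> RS" "dist x' x < d"
   then show "x' \<in> A0" using d(2)[of x'] x by (simp add: A0_def dist_commute)
  qed
 qed
qed

lemma fseq_minimal: assumes "minimal_set s f K" "y \<in> K" "adm \<omega>" shows "fseq f \<omega> n y \<in> K"
 unfolding fseq_def using assms by (intro minimal_forward_word) (auto simp: adm_def)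

lemma L_A1: "L \<subseteq> A1"
proof
 fix y assume y: "y \<in> L"
 have yR: "y \<in> RS" using y L_props by blast
 have "conv \<omega> y" if \<omega>: "adm \<omega>" for \<omega>
  unfolding conv_infdist[OF \<omega> yR] using fseq_minimal[OF L y \<omega>] by simp
 then show "y \<in> A1" using y minimal_F[OF L] by (auto simp: A1_def)
qed

lemma L'_A0: "L' \<subseteq> A0"
proof
 fix y assume y: "y \<in> L'"
 have yR: "y \<in> RS" and cL': "closed L'" using y L' unfolding minimal_set_def by (auto intro: compact_imp_closed)
 have "L \<inter> L' = {}" using minimal_disjoint[OF L L'(1)] L'(2) by blast
 then obtain d where d: "d > 0" "\<And>x y. x \<in> L \<Longrightarrow> y \<in> L' \<Longrightarrow> d \<le> dist x y"
  using separate_compact_closed[OF L_props(2) cL'] by blast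
 have "\<not> conv \<omega> y" if \<omega>: "adm \<omega>" for \<omega>
 proof
  assume "conv \<omega> y"
  then have "(\<lambda>n. infdist (fseq f \<omega> n y) L) \<longlonglongrightarrow> 0" unfolding conv_infdist[OF \<omega> yR] .
  moreover have "d \<le> infdist (fseq f \<omega> n y) L" for n
   unfolding infdist_notempty[OF L_props(1)]
   using d(2) fseq_minimal[OF L'(1) y \<omega>] by (intro cINF_greatest[OF L_props(1)]) (simp add: dist_commute)
  ultimately have "d \<le> 0" using LIMSEQ_le_const by blast
  then show False using d(1) by simp
 qed
 then show "y \<in> A0" using y minimal_F[OF L'(1)] by (auto simp: A0_def)
qed

text \<open>\<open>A1\<close> is relatively open and contains the compact set L, hence a
  neighbourhood of it in the sphere.\<close>

lemma conv_enters: assumes "adm \<omega>" "y \<in> RS" "conv \<omega> y" shows "\<exists>n. fseq f \<omega> n y \<in> A1"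
proof -
 obtain U where U: "open U" "A1 = RS \<inter> U" using openin_A(1) by (auto simp: openin_open)
 obtain e where e: "e > 0" "{x. infdist x L \<le> e} \<subseteq> U"
  using compact_in_open_separated[OF L_props(1,2) U(1)] L_A1 U(2) by blast
 have "(\<lambda>n. infdist (fseq f \<omega> n y) L) \<longlonglongrightarrow> 0" using conv_infdist[OF assms(1,2)] assms(3) by simp
 then have "\<forall>\<^sub>F n in sequentially. infdist (fseq f \<omega> n y) L < e" using e(1) by (rule order_tendstoD(2))
 then obtain n where "infdist (fseq f \<omega> n y) L < e" unfolding eventually_sequentially by blast
 then have "fseq f \<omega> n y \<in> U" using e(2) by auto
 moreover have "fseq f \<omega> n y \<in> RS" using fseq_RS assms by (simp add: adm_def)
 ultimately show ?thesis using U(2) by blast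
qed

lemma A1_conv: assumes "adm \<omega>" "fseq f \<omega> n y \<in> A1" "y \<in> RS" shows "conv \<omega> y"
proof -
 define \<omega>' where "\<omega>' k = \<omega> (k + n)" for k
 have "adm \<omega>'" using assms(1) by (simp add: adm_def \<omega>'_def)
 then have "conv \<omega>' (fseq f \<omega> n y)" using assms(2) by (simp add: A1_def)
 moreover have "fseq f \<omega>' k (fseq f \<omega> n y) = fseq f \<omega> (k + n) y" for k
 proof -
  have "map \<omega>' [0..<k] = map \<omega> [n..<n + k]"
   by (rule nth_equalityI) (auto simp: \<omega>'_def add.commute)
  then show ?thesis using fseq_add[of \<omega> n k y] by (simp add: fseq_def add.commute)
 qed
 ultimately show ?thesis unfolding conv_def
  using LIMSEQ_offset[of "\<lambda>k. setdist (fseq f \<omega> k y) L" n 0] by (simp add: conv_def)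
qed

text \<open>If no word leads a Fatou point into \<open>A1\<close>, then by
  \<open>conv_enters\<close> no orbit from it converges to L, so it already lies in
  \<open>A0\<close>. Any other point is first sent to the Fatou set by one letter.\<close>

lemma reach: assumes "y \<in> RS" shows "\<exists>w. word w \<and> wcomp f w y \<in> A1 \<union> A0"
proof -
 have F: "\<exists>w. word w \<and> wcomp f w y \<in> A1 \<union> A0" if y: "y \<in> F" for y
 proof (cases "\<exists>w. word w \<and> wcomp f w y \<in> A1")
  case False
  have "\<not> conv \<omega> y" if \<omega>: "adm \<omega>" for \<omega>
  proof
   assume c: "conv \<omega> y"
   obtain n where "fseq f \<omega> n y \<in> A1" using conv_enters[OF \<omega> _ c] y F_RS by blast
   moreover have "word (map \<omega> [0..<n])" using \<omega> by (auto simp: adm_def)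
   ultimately show False using False unfolding fseq_def by blast
  qed
  then have "y \<in> A0" using y by (simp add: A0_def)
  then show ?thesis by (intro exI[of _ "[]"]) simp
 qed blast
 obtain i where i: "i \<in> idx s" "f i y \<in> F" using some_image_F[OF assms] by blast
 obtain w where "word w" "wcomp f w (f i y) \<in> A1 \<union> A0" using F[OF i(2)] by blast
 then show ?thesis using i(1) by (intro exI[of _ "i # w"]) auto
qed

lemma uniform_reach: "\<exists>n\<ge>1. \<forall>y\<in>RS. \<exists>w. word w \<and> length w = n \<and> wcomp f w y \<in> A1 \<union> A0"
proof -
 define V where "V w = {y \<in> RS. wcomp f w y \<in> A1 \<union> A0}" for w
 have op: "openin (top_of_set RS) (V w)" if w: "word w" for w
 proof -
  have "openin (top_of_set RS) (A1 \<union> A0)" using openin_A by (rule openin_Un)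
  then have "openin (top_of_set RS) (RS \<inter> wcomp f w -` (A1 \<union> A0))"
   using continuous_openin_preimage[OF continuous_wcomp[OF w]] wcomp_RS[OF w] by blast
  moreover have "RS \<inter> wcomp f w -` (A1 \<union> A0) = V w" by (auto simp: V_def)
  ultimately show ?thesis by simp
 qed
 have "RS \<subseteq> \<Union> (V ` {w. word w})"
 proof
  fix y assume y: "y \<in> RS"
  then obtain w where "word w" "wcomp f w y \<in> A1 \<union> A0" using reach by blast
  then show "y \<in> \<Union> (V ` {w. word w})" using y by (auto simp: V_def)
 qed
 moreover have "\<forall>c\<in>V ` {w. word w}. openin (top_of_set RS) c" using op by blast
 ultimately obtain \<D> where \<D>: "\<D> \<subseteq> V ` {w. word w}" "finite \<D>" "RS \<subseteq> \<Union> \<D>"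
  using compact_RS[unfolded compact_eq_openin_cover] by meson
 obtain W where W: "W \<subseteq> {w. word w}" "finite W" "\<D> = V ` W" using finite_subset_image[OF \<D>(2,1)] by blast
 define n where "n = Max (insert 1 (length ` W))"
 have n: "n \<ge> 1" "\<And>w. w \<in> W \<Longrightarrow> length w \<le> n" using W(2) by (auto simp: n_def)
 have "\<exists>w. word w \<and> length w = n \<and> wcomp f w y \<in> A1 \<union> A0" if y: "y \<in> RS" for y
 proof -
  obtain w where w: "w \<in> W" "y \<in> V w" using \<D>(3) W(3) y by blast
  \<comment> \<open>Padding gives all words the same length; it keeps the image in
    \<open>A1 \<union> A0\<close> because both sets are forward invariant.\<close>
  define w' where "w' = replicate (n - length w) (1 :: nat)"
  have w': "word w'" using idx_nonempty by (auto simp: w'_def)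
  have "wcomp f w y \<in> A1 \<union> A0" using w(2) by (simp add: V_def)
  then have "wcomp f w' (wcomp f w y) \<in> A1 \<union> A0" using A_forward_word[OF w'] by blast
  then have "wcomp f (w @ w') y \<in> A1 \<union> A0" by (simp only: wcomp_append)
  moreover have "length (w @ w') = n" using n(2)[OF w(1)] by (simp add: w'_def)
  moreover have "word (w @ w')" using w' W(1) w(1) by auto
  ultimately show ?thesis by blast
 qed
 then show ?thesis using n(1) by blast
qed

end

section \<open>Complex weights and the speed of absorption\<close>

definition cwt :: "nat \<Rightarrow> (nat \<Rightarrow> complex) \<Rightarrow> nat \<Rightarrow> complex" where
 "cwt s \<xi> i = (if i \<in> {1..s} then \<xi> i else if i = s + 1 then 1 - (\<Sum>j=1..s. \<xi> j) else 0)"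

lemma cwt_of_real: "cwt s (\<lambda>i. complex_of_real (x i)) i = complex_of_real (wt s x i)"
 by (simp add: cwt_def wt_def)

lemma idx_eq: "idx s = insert (s + 1) {1..s}" "s + 1 \<notin> {1..s}"
 by (auto simp: idx_def)

lemma sum_cwt: "(\<Sum>i\<in>idx s. cwt s \<xi> i) = 1"
proof -
 have "(\<Sum>i\<in>idx s. cwt s \<xi> i) = cwt s \<xi> (s + 1) + (\<Sum>i\<in>{1..s}. cwt s \<xi> i)"
  unfolding idx_eq(1) by (rule sum.insert) auto
 also have "(\<Sum>i\<in>{1..s}. cwt s \<xi> i) = (\<Sum>i\<in>{1..s}. \<xi> i)" by (rule sum.cong) (auto simp: cwt_def)
 finally show ?thesis by (simp add: cwt_def)
qed

lemma sum_wt: "(\<Sum>i\<in>idx s. wt s x i) = 1"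
proof -
 have "(\<Sum>i\<in>idx s. wt s x i) = wt s x (s + 1) + (\<Sum>i\<in>{1..s}. wt s x i)"
  unfolding idx_eq(1) by (rule sum.insert) auto
 also have "(\<Sum>i\<in>{1..s}. wt s x i) = (\<Sum>i\<in>{1..s}. x i)" by (rule sum.cong) (auto simp: wt_def)
 finally show ?thesis by (simp add: wt_def)
qed

lemma cwt_upd: assumes "j \<in> {1..s}"
 shows "cwt s (\<xi>(j := t)) i = cwt s \<xi> i + (if i \<in> {1..s} then if i = j then 1 else 0 else if i = s + 1 then -1 else 0) * (t - \<xi> j)"
proof -
 have "(\<Sum>k=1..s. (\<xi>(j := t)) k) = (\<Sum>k=1..s. \<xi> k) + (t - \<xi> j)"
 proof -
  have "(\<Sum>k=1..s. (\<xi>(j := t)) k) = t + (\<Sum>k\<in>{1..s}-{j}. (\<xi>(j := t)) k)" using assms by (subst sum.remove[of _ j]) auto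
  also have "(\<Sum>k\<in>{1..s}-{j}. (\<xi>(j := t)) k) = (\<Sum>k\<in>{1..s}-{j}. \<xi> k)" by (rule sum.cong) auto
  also have "\<dots> = (\<Sum>k=1..s. \<xi> k) - \<xi> j" using assms by (subst sum.remove[of _ j]) auto
  finally show ?thesis by simp
 qed
 then show ?thesis using assms by (auto simp: cwt_def)
qed

context hyperbolic_minimal
begin

definition pC :: "nat \<Rightarrow> complex" where "pC i = complex_of_real (p i)"

text \<open>For probability weights this is the probability of being in \<open>A1\<close> after n
  letters. As a polynomial in the weights it makes sense for complex ones.\<close>

primrec afun :: "nat \<Rightarrow> (nat \<Rightarrow> complex) \<Rightarrow> complex \<times> real \<Rightarrow> complex" where
 "afun 0 \<xi> y = of_bool (y \<in> A1)"
| "afun (Suc n) \<xi> y = (\<Sum>i\<in>idx s. cwt s \<xi> i * afun n \<xi> (f i y))"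

text \<open>The total weight of the words of length n that have not yet absorbed y. It is used for
  the weights p and for the moduli of complex weights.\<close>

primrec bfun :: "nat \<Rightarrow> (nat \<Rightarrow> real) \<Rightarrow> complex \<times> real \<Rightarrow> real" where
 "bfun 0 u y = of_bool (y \<notin> A1 \<union> A0)"
| "bfun (Suc n) u y = (\<Sum>i\<in>idx s. u i * bfun n u (f i y))"

lemma bfun_nonneg: "(\<And>i. i \<in> idx s \<Longrightarrow> 0 \<le> u i) \<Longrightarrow> 0 \<le> bfun n u y"
proof (induction n arbitrary: y)
 case (Suc n)
 show ?case unfolding bfun.simps by (intro sum_nonneg mult_nonneg_nonneg Suc)
qed simp

lemma bfun_absorbed: "y \<in> A1 \<union> A0 \<Longrightarrow> bfun n u y = 0"
proof (induction n arbitrary: y)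
 case (Suc n)
 have "bfun n u (f i y) = 0" if "i \<in> idx s" for i
  using Suc.IH[of "f i y"] Suc.prems A_forward[OF that] by blast
 then show ?case by simp
qed auto

lemma bfun_scale:
 assumes "\<And>i. i \<in> idx s \<Longrightarrow> 0 \<le> u i" "\<And>i. i \<in> idx s \<Longrightarrow> u i \<le> q * u' i" "\<And>i. i \<in> idx s \<Longrightarrow> 0 \<le> u' i" "q \<ge> 0"
 shows "bfun n u y \<le> q ^ n * bfun n u' y"
proof (induction n arbitrary: y)
 case (Suc n)
 have "u i * bfun n u (f i y) \<le> (q * u' i) * (q ^ n * bfun n u' (f i y))" if i: "i \<in> idx s" for i
  using Suc assms(1,2)[OF i] bfun_nonneg[of u n "f i y"] assms(1,3,4) i by (intro mult_mono) auto
 then have "bfun (Suc n) u y \<le> (\<Sum>i\<in>idx s. (q * u' i) * (q ^ n * bfun n u' (f i y)))" unfolding bfun.simps by (rule sum_mono)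
 also have "\<dots> = q ^ Suc n * bfun (Suc n) u' y" by (simp add: sum_distrib_left mult_ac)
 finally show ?case .
qed simp

text \<open>Absorbed points contribute nothing, so after m letters only the remaining mass is
  multiplied by the bound \<theta> for the next n letters.\<close>

lemma bfun_submult:
 assumes u: "\<And>i. i \<in> idx s \<Longrightarrow> 0 \<le> u i" and b: "\<And>y. y \<in> RS \<Longrightarrow> bfun n u y \<le> \<theta>"
 shows "y \<in> RS \<Longrightarrow> bfun (m + n) u y \<le> \<theta> * bfun m u y"
proof (induction m arbitrary: y)
 case 0
 then show ?case using b bfun_absorbed[of y n u] by (cases "y \<in> A1 \<union> A0") auto
next
 case (Suc m)
 have "u i * bfun (m + n) u (f i y) \<le> u i * (\<theta> * bfun m u (f i y))" if i: "i \<in> idx s" for i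
  using Suc.IH[OF f_RS[OF i]] u[OF i] by (intro mult_left_mono) auto
 then have "bfun (Suc m + n) u y \<le> (\<Sum>i\<in>idx s. u i * (\<theta> * bfun m u (f i y)))" unfolding add_Suc bfun.simps by (rule sum_mono)
 also have "\<dots> = \<theta> * bfun (Suc m) u y" by (simp add: sum_distrib_left mult_ac)
 finally show ?case .
qed

lemma wt_p_pos: "i \<in> idx s \<Longrightarrow> wt s p i > 0"
 using p by (auto simp: wt_def idx_def)

lemma bfun_p_le_1: "bfun n (wt s p) y \<le> 1"
proof (induction n arbitrary: y)
 case (Suc n)
 have "wt s p i * bfun n (wt s p) (f i y) \<le> wt s p i * 1" if "i \<in> idx s" for i
  using Suc wt_p_pos[OF that] by (intro mult_left_mono) auto
 then have "bfun (Suc n) (wt s p) y \<le> (\<Sum>i\<in>idx s. wt s p i * 1)" unfolding bfun.simps by (rule sum_mono)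
 then show ?case using sum_wt[of s p] by simp
qed simp

lemma wt_p_min: obtains m where "m > 0" "m < 1" "\<And>i. i \<in> idx s \<Longrightarrow> m \<le> wt s p i"
proof -
 define m where "m = Min (insert (1/2) (wt s p ` idx s))"
 have "m > 0" unfolding m_def using finite_idx wt_p_pos by (subst Min_gr_iff) auto
 moreover have "m \<le> 1/2" unfolding m_def using finite_idx by (intro Min_le) auto
 moreover have "m \<le> wt s p i" if "i \<in> idx s" for i unfolding m_def using finite_idx that by (intro Min_le) auto
 ultimately show ?thesis using that[of m] by auto
qed

text \<open>The given absorbing word alone carries at least the mass m^n, n being its length, and
  this mass is missing from \<open>bfun\<close>.\<close>

lemma bfun_word:
 assumes m: "m > 0" "m < 1" "\<And>i. i \<in> idx s \<Longrightarrow> m \<le> wt s p i"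
 shows "word w \<Longrightarrow> wcomp f w y \<in> A1 \<union> A0 \<Longrightarrow> bfun (length w) (wt s p) y \<le> 1 - m ^ length w"
proof (induction w arbitrary: y)
 case (Cons i w)
 have i: "i \<in> idx s" "word w" using Cons.prems by auto
 have b: "bfun (length w) (wt s p) (f i y) \<le> 1 - m ^ length w" using Cons by simp
 have "bfun (Suc (length w)) (wt s p) y = wt s p i * bfun (length w) (wt s p) (f i y) + (\<Sum>k\<in>idx s - {i}. wt s p k * bfun (length w) (wt s p) (f k y))"
  unfolding bfun.simps by (rule sum.remove[OF finite_idx i(1)])
 also have "\<dots> \<le> wt s p i * (1 - m ^ length w) + (\<Sum>k\<in>idx s - {i}. wt s p k * 1)"
  using b wt_p_pos i(1) bfun_p_le_1 by (intro add_mono sum_mono mult_left_mono) (auto intro: less_imp_le)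
 also have "\<dots> = (wt s p i + (\<Sum>k\<in>idx s - {i}. wt s p k)) - wt s p i * m ^ length w" by (simp add: algebra_simps)
 also have "wt s p i + (\<Sum>k\<in>idx s - {i}. wt s p k) = 1" using sum.remove[OF finite_idx i(1), of "wt s p"] sum_wt[of s p] by simp
 also have "1 - wt s p i * m ^ length w \<le> 1 - m * m ^ length w"
  using m(3)[OF i(1)] m(1) by (intro diff_left_mono mult_right_mono) auto
 finally show ?case by simp
qed auto

text \<open>The weights may be complex and need not be positive: absorption is exponentially fast for the
 moduli of all weights close to p.\<close>
lemma uniform_decay:
 "\<exists>\<rho>>0. \<exists>K>0. \<exists>\<theta>. 0 < \<theta> \<and> \<theta> < 1 \<and> (\<forall>\<xi>\<in>pdisc s pC \<rho>. (\<forall>i\<in>idx s. cmod (cwt s \<xi> i) \<le> 2 * wt s p i) \<and>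
   (\<forall>y\<in>RS. \<forall>n. bfun n (\<lambda>i. cmod (cwt s \<xi> i)) y \<le> K * \<theta> ^ n))"
proof -
 obtain m where m: "m > 0" "m < 1" "\<And>i. i \<in> idx s \<Longrightarrow> m \<le> wt s p i" using wt_p_min by blast
 obtain n1 where n1: "n1 \<ge> 1" "\<And>y. y \<in> RS \<Longrightarrow> \<exists>w. word w \<and> length w = n1 \<and> wcomp f w y \<in> A1 \<union> A0"
  using uniform_reach by blast
 define \<kappa> where "\<kappa> = m ^ n1"
 have \<kappa>: "0 < \<kappa>" "\<kappa> < 1" using m n1(1) by (auto simp: \<kappa>_def power_less_one_iff)
 have bp: "bfun n1 (wt s p) y \<le> 1 - \<kappa>" if y: "y \<in> RS" for y
 proof -
  obtain w where "word w" "length w = n1" "wcomp f w y \<in> A1 \<union> A0" using n1(2)[OF y] by blast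
  then show ?thesis using bfun_word[OF m, of w y] by (simp add: \<kappa>_def)
 qed
 \<comment> \<open>Continuity provides an \<epsilon> by which all weights may grow relatively
   without destroying the contraction over one block of n1 letters.\<close>
 have "isCont (\<lambda>t. (1 + t) ^ n1 * (1 - \<kappa>)) 0" by (intro continuous_intros)
 moreover have "\<kappa> / 2 > 0" using \<kappa> by simp
 ultimately obtain d where d: "d > 0" "\<And>t. dist t 0 < d \<Longrightarrow> dist ((1 + t) ^ n1 * (1 - \<kappa>)) ((1 + 0) ^ n1 * (1 - \<kappa>)) < \<kappa> / 2"
  unfolding continuous_at_eps_delta by (metis dist_commute)
 define \<epsilon> where "\<epsilon> = min (d / 2) 1"
 have \<epsilon>: "\<epsilon> > 0" "\<epsilon> \<le> 1" "\<epsilon> < d" using d by (auto simp: \<epsilon>_def)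
 define \<theta>1 where "\<theta>1 = 1 - \<kappa> / 2"
 have \<theta>1: "0 < \<theta>1" "\<theta>1 < 1" using \<kappa> by (auto simp: \<theta>1_def)
 have "dist ((1 + \<epsilon>) ^ n1 * (1 - \<kappa>)) (1 - \<kappa>) < \<kappa> / 2" using d(2)[of \<epsilon>] \<epsilon> by simp
 then have contr: "(1 + \<epsilon>) ^ n1 * (1 - \<kappa>) \<le> \<theta>1" unfolding dist_real_def \<theta>1_def by linarith
 \<comment> \<open>Divided by s because the last weight is 1 minus the sum of s parameters, and its
   error must stay below \<epsilon> * m too.\<close>
 define \<rho> where "\<rho> = \<epsilon> * m / real s"
 have \<rho>: "\<rho> > 0" using \<epsilon> m s_pos by (simp add: \<rho>_def)
 define \<theta> where "\<theta> = root n1 \<theta>1"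
 have \<theta>: "0 < \<theta>" "\<theta> < 1" "\<theta> ^ n1 = \<theta>1" unfolding \<theta>_def using n1(1) \<theta>1 by (auto simp: real_root_lt_1_iff)
 define K where "K = 2 ^ n1 / \<theta>1"
 have K: "K > 0" using \<theta>1 by (simp add: K_def)
 have main: "(\<forall>i\<in>idx s. cmod (cwt s \<xi> i) \<le> 2 * wt s p i) \<and> (\<forall>y\<in>RS. \<forall>n. bfun n (\<lambda>i. cmod (cwt s \<xi> i)) y \<le> K * \<theta> ^ n)"
  if \<xi>: "\<xi> \<in> pdisc s pC \<rho>" for \<xi>
 proof -
  define u where "u i = cmod (cwt s \<xi> i)" for i
  have \<xi>j: "cmod (\<xi> j - pC j) \<le> \<rho>" if "j \<in> {1..s}" for j
   using \<xi> that unfolding pdisc_def dist_norm by (force simp: norm_minus_commute)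
  have s\<rho>: "real s * \<rho> = \<epsilon> * m" "\<rho> \<le> \<epsilon> * m" using s_pos \<epsilon> m by (auto simp: \<rho>_def field_simps)
  have cl: "cmod (cwt s \<xi> i - complex_of_real (wt s p i)) \<le> \<epsilon> * m" if i: "i \<in> idx s" for i
  proof (cases "i \<in> {1..s}")
   case True
   then show ?thesis using \<xi>j[OF True] s\<rho>(2) by (simp add: cwt_def wt_def pC_def)
  next
   case False
   then have "i = s + 1" using i idx_eq by auto
   then have "cwt s \<xi> i - complex_of_real (wt s p i) = - (\<Sum>j=1..s. \<xi> j - pC j)"
    by (simp add: cwt_def wt_def pC_def sum_subtractf)
   then have "cmod (cwt s \<xi> i - complex_of_real (wt s p i)) = cmod (\<Sum>j=1..s. \<xi> j - pC j)" by simp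
   also have "\<dots> \<le> (\<Sum>j=1..s. \<rho>)" by (intro sum_norm_le \<xi>j) auto
   also have "\<dots> = \<epsilon> * m" using s\<rho>(1) by simp
   finally show ?thesis .
  qed
  have u1: "u i \<le> (1 + \<epsilon>) * wt s p i" if i: "i \<in> idx s" for i
  proof -
   have "u i \<le> cmod (complex_of_real (wt s p i)) + cmod (cwt s \<xi> i - complex_of_real (wt s p i))"
    unfolding u_def using norm_triangle_ineq[of "complex_of_real (wt s p i)" "cwt s \<xi> i - complex_of_real (wt s p i)"] by simp
   also have "\<dots> \<le> wt s p i + \<epsilon> * m" using cl[OF i] wt_p_pos[OF i] by simp
   also have "\<dots> \<le> wt s p i + \<epsilon> * wt s p i" using m(3)[OF i] \<epsilon> by (intro add_left_mono mult_left_mono) auto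
   finally show ?thesis by (simp add: algebra_simps)
  qed
  have u0: "0 \<le> u i" for i by (simp add: u_def)
  have wp: "\<And>i. i \<in> idx s \<Longrightarrow> 0 \<le> wt s p i" using wt_p_pos by (simp add: less_imp_le)
  have q: "bfun n u y \<le> (1 + \<epsilon>) ^ n * bfun n (wt s p) y" for n y
   using bfun_scale[of u "1 + \<epsilon>" "wt s p" n y] u0 u1 wp \<epsilon> by simp
  have bn1: "bfun n1 u y \<le> \<theta>1" if y: "y \<in> RS" for y
  proof -
   have "bfun n1 u y \<le> (1 + \<epsilon>) ^ n1 * (1 - \<kappa>)"
    using order_trans[OF q mult_left_mono[OF bp[OF y]]] \<epsilon> by simp
   then show ?thesis using contr by linarith
  qed
  have "bfun n u y \<le> K * \<theta> ^ n" if y: "y \<in> RS" for n y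
  proof (induction n rule: less_induct)
   case (less n)
   show ?case
   proof (cases "n < n1")
    case True
    have "bfun n u y \<le> (1 + \<epsilon>) ^ n * 1" using order_trans[OF q mult_left_mono[OF bfun_p_le_1]] \<epsilon> by simp
    also have "\<dots> \<le> 2 ^ n" using \<epsilon> by (simp add: power_mono)
    also have "\<dots> \<le> 2 ^ n1" using True by (intro power_increasing) auto
    also have "\<dots> = K * \<theta> ^ n1" using \<theta>1 by (simp add: K_def \<theta>(3))
    also have "\<dots> \<le> K * \<theta> ^ n" using True \<theta> K by (intro mult_left_mono power_decreasing) auto
    finally show ?thesis .
   next
    case False
    define k where "k = n - n1"
    have nk: "n = k + n1" "k < n" using False n1(1) by (auto simp: k_def)
    have "bfun n u y \<le> \<theta>1 * bfun k u y" unfolding nk(1) using bn1 u0 y by (intro bfun_submult) auto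
    also have "\<dots> \<le> \<theta>1 * (K * \<theta> ^ k)" using less.IH[OF nk(2)] \<theta>1 by (intro mult_left_mono) auto
    also have "\<dots> = K * \<theta> ^ n" by (simp add: nk(1) power_add \<theta>(3))
    finally show ?thesis .
   qed
  qed
  moreover have "u i \<le> 2 * wt s p i" if "i \<in> idx s" for i
  proof -
   have "(1 + \<epsilon>) * wt s p i \<le> 2 * wt s p i" using \<epsilon> wp[OF that] by (intro mult_right_mono) auto
   then show ?thesis using u1[OF that] by linarith
  qed
  ultimately show ?thesis unfolding u_def by blast
 qed
 show ?thesis using \<rho> K \<theta>(1,2) main by blast
qed

text \<open>One more letter changes the value only at points not yet absorbed, and there by at most
  the sum of the moduli of the weights, which is at most 2.\<close>

lemma afun_step:
 assumes "\<forall>i\<in>idx s. cmod (cwt s \<xi> i) \<le> 2 * wt s p i"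
 shows "cmod (afun (Suc n) \<xi> y - afun n \<xi> y) \<le> 2 * bfun n (\<lambda>i. cmod (cwt s \<xi> i)) y"
proof (induction n arbitrary: y)
 case 0
 have S: "(\<Sum>i\<in>idx s. cmod (cwt s \<xi> i)) \<le> 2"
 proof -
  have "(\<Sum>i\<in>idx s. cmod (cwt s \<xi> i)) \<le> (\<Sum>i\<in>idx s. 2 * wt s p i)" using assms by (intro sum_mono) auto
  then show ?thesis using sum_wt[of s p] by (simp add: sum_distrib_left[symmetric])
 qed
 consider "y \<in> A1" | "y \<in> A0" | "y \<notin> A1 \<union> A0" by blast
 then show ?case
 proof cases
  case 1
  have "afun (Suc 0) \<xi> y = (\<Sum>i\<in>idx s. cwt s \<xi> i)" using A_forward(1)[OF _ 1] by simp
  then show ?thesis using 1 sum_cwt by simp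
 next
  case 2
  have "f i y \<notin> A1" if "i \<in> idx s" for i using A_forward(2)[OF that 2] A_disjoint by blast
  then have "afun (Suc 0) \<xi> y = 0" by simp
  then show ?thesis using 2 A_disjoint by auto
 next
  case 3
  have "cmod (afun (Suc 0) \<xi> y) \<le> (\<Sum>i\<in>idx s. cmod (cwt s \<xi> i))"
   unfolding afun.simps by (intro sum_norm_le) (auto simp: norm_mult)
  then show ?thesis using 3 S by simp
 qed
next
 case (Suc n)
 have "afun (Suc (Suc n)) \<xi> y - afun (Suc n) \<xi> y = (\<Sum>i\<in>idx s. cwt s \<xi> i * (afun (Suc n) \<xi> (f i y) - afun n \<xi> (f i y)))"
  by (simp only: afun.simps(2)[of "Suc n"] afun.simps(2)[of n \<xi> y] sum_subtractf right_diff_distrib)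
 also have "cmod \<dots> \<le> (\<Sum>i\<in>idx s. cmod (cwt s \<xi> i) * (2 * bfun n (\<lambda>i. cmod (cwt s \<xi> i)) (f i y)))"
  using Suc by (intro sum_norm_le) (simp only: norm_mult, intro mult_left_mono, auto)
 also have "\<dots> = 2 * bfun (Suc n) (\<lambda>i. cmod (cwt s \<xi> i)) y" by (simp add: sum_distrib_left mult_ac)
 finally show ?case .
qed

definition Hlim :: "(nat \<Rightarrow> complex) \<Rightarrow> complex \<times> real \<Rightarrow> complex" where
 "Hlim \<xi> y = lim (\<lambda>n. afun n \<xi> y)"

lemma afun_holomorphic: "j \<in> {1..s} \<Longrightarrow> (\<lambda>t. afun n (\<xi>(j := t)) y) holomorphic_on S"
proof (induction n arbitrary: y)
 case (Suc n)
 show ?case unfolding afun.simps cwt_upd[OF Suc.prems] by (intro holomorphic_intros Suc.IH Suc.prems)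
qed (simp add: holomorphic_on_const)

text \<open>By \<open>uniform_decay\<close> the increments of \<open>afun\<close> are dominated by
  one geometric series, uniformly in the weights and in y. The Weierstrass test then makes the limit
  holomorphic in each weight.\<close>

lemma Hlim_sep_hol:
 "\<exists>\<rho>>0. \<exists>M. \<forall>y\<in>RS. sep_hol s pC \<rho> M (\<lambda>\<xi>. Hlim \<xi> y) \<and> (\<forall>\<xi>\<in>pdisc s pC \<rho>. (\<lambda>n. afun n \<xi> y) \<longlonglongrightarrow> Hlim \<xi> y)"
proof -
 obtain \<rho> K \<theta> where \<rho>: "\<rho> > 0" and K: "K > 0" and \<theta>: "0 < \<theta>" "\<theta> < 1"
  and w: "\<And>\<xi>. \<xi> \<in> pdisc s pC \<rho> \<Longrightarrow> \<forall>i\<in>idx s. cmod (cwt s \<xi> i) \<le> 2 * wt s p i"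
  and b: "\<And>\<xi> y n. \<xi> \<in> pdisc s pC \<rho> \<Longrightarrow> y \<in> RS \<Longrightarrow> bfun n (\<lambda>i. cmod (cwt s \<xi> i)) y \<le> K * \<theta> ^ n"
  using uniform_decay by metis
 define M where "M = 1 + 2 * K / (1 - \<theta>)"
 have sumg: "summable (\<lambda>n. 2 * K * \<theta> ^ n)" using \<theta> by (intro summable_mult) (simp add: summable_geometric)
 have suminfg: "(\<Sum>n. 2 * K * \<theta> ^ n) = 2 * K / (1 - \<theta>)"
  using \<theta> suminf_geometric[of \<theta>] by (subst suminf_mult) (auto simp: summable_geometric)
 have "sep_hol s pC \<rho> M (\<lambda>\<xi>. Hlim \<xi> y) \<and> (\<forall>\<xi>\<in>pdisc s pC \<rho>. (\<lambda>n. afun n \<xi> y) \<longlonglongrightarrow> Hlim \<xi> y)" if y: "y \<in> RS" for y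
 proof -
  have d: "cmod (afun (Suc n) \<xi> y - afun n \<xi> y) \<le> 2 * K * \<theta> ^ n" if "\<xi> \<in> pdisc s pC \<rho>" for n \<xi>
   using afun_step[OF w[OF that], of n y] b[OF that y, of n] by simp
  have ul: "uniform_limit (pdisc s pC \<rho>) (\<lambda>n \<xi>. \<Sum>k<n. afun (Suc k) \<xi> y - afun k \<xi> y)
    (\<lambda>\<xi>. \<Sum>k. afun (Suc k) \<xi> y - afun k \<xi> y) sequentially"
   using Weierstrass_m_test[of "pdisc s pC \<rho>" "\<lambda>k \<xi>. afun (Suc k) \<xi> y - afun k \<xi> y" "\<lambda>n. 2 * K * \<theta> ^ n"] d sumg by blast
  have tel: "(\<Sum>k<n. afun (Suc k) \<xi> y - afun k \<xi> y) = afun n \<xi> y - afun 0 \<xi> y" for n \<xi>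
   by (rule sum_lessThan_telescope)
  define S where "S \<xi> = (\<Sum>k. afun (Suc k) \<xi> y - afun k \<xi> y)" for \<xi>
  define a0 :: complex where "a0 = of_bool (y \<in> A1)"
  have "uniform_limit (pdisc s pC \<rho>) (\<lambda>n \<xi>. (afun n \<xi> y - a0) + a0) (\<lambda>\<xi>. S \<xi> + a0) sequentially"
   using ul unfolding tel S_def[symmetric] a0_def by (intro uniform_limit_intros) auto
  then have ul': "uniform_limit (pdisc s pC \<rho>) (\<lambda>n \<xi>. afun n \<xi> y) (\<lambda>\<xi>. S \<xi> + a0) sequentially" by simp
  have lim: "(\<lambda>n. afun n \<xi> y) \<longlonglongrightarrow> S \<xi> + a0" if "\<xi> \<in> pdisc s pC \<rho>" for \<xi>
   using tendsto_uniform_limitI[OF ul' that] .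
  then have H: "Hlim \<xi> y = S \<xi> + a0" if "\<xi> \<in> pdisc s pC \<rho>" for \<xi> using that unfolding Hlim_def by (blast intro: limI)
  have "sep_hol s pC \<rho> M (\<lambda>\<xi>. Hlim \<xi> y)"
   unfolding sep_hol_def
  proof (intro ballI conjI)
   fix \<xi> assume \<xi>: "\<xi> \<in> pdisc s pC \<rho>"
   have sm: "summable (\<lambda>k. cmod (afun (Suc k) \<xi> y - afun k \<xi> y))"
    using d[OF \<xi>] by (intro summable_comparison_test'[OF sumg]) auto
   have "cmod (S \<xi>) \<le> (\<Sum>k. cmod (afun (Suc k) \<xi> y - afun k \<xi> y))" unfolding S_def by (rule summable_norm[OF sm])
   also have "\<dots> \<le> (\<Sum>n. 2 * K * \<theta> ^ n)" using d[OF \<xi>] by (intro suminf_le sm sumg) auto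
   finally have "cmod (S \<xi>) \<le> 2 * K / (1 - \<theta>)" unfolding suminfg .
   moreover have "cmod a0 \<le> 1" by (simp add: a0_def)
   ultimately show "cmod (Hlim \<xi> y) \<le> M" unfolding H[OF \<xi>] M_def using norm_triangle_ineq[of "S \<xi>" a0] by linarith
   fix j assume j: "j \<in> {1..s}"
   have ulj: "uniform_limit (ball (pC j) \<rho>) (\<lambda>n t. afun n (\<xi>(j := t)) y) (\<lambda>t. Hlim (\<xi>(j := t)) y) sequentially"
    unfolding uniform_limit_iff
   proof (intro allI impI)
    fix e :: real assume "e > 0"
    then have "\<forall>\<^sub>F n in sequentially. \<forall>\<xi>\<in>pdisc s pC \<rho>. dist (afun n \<xi> y) (S \<xi> + a0) < e"
     using ul' unfolding uniform_limit_iff by blast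
    then show "\<forall>\<^sub>F n in sequentially. \<forall>t\<in>ball (pC j) \<rho>. dist (afun n (\<xi>(j := t)) y) (Hlim (\<xi>(j := t)) y) < e"
     by eventually_elim (use H pdisc_upd[OF \<xi>] in simp)
   qed
   show "(\<lambda>t. Hlim (\<xi>(j := t)) y) holomorphic_on ball (pC j) \<rho>"
   proof (rule holomorphic_uniform_sequence[OF open_ball afun_holomorphic[OF j]])
    fix t assume "t \<in> ball (pC j) \<rho>"
    then obtain e where e: "e > 0" "cball t e \<subseteq> ball (pC j) \<rho>" using open_contains_cball_eq[OF open_ball] by blast
    then show "\<exists>d>0. cball t d \<subseteq> ball (pC j) \<rho> \<and> uniform_limit (cball t d) (\<lambda>n t. afun n (\<xi>(j := t)) y) (\<lambda>t. Hlim (\<xi>(j := t)) y) sequentially"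
     using uniform_limit_on_subset[OF ulj] by blast
   qed
  qed
  then show ?thesis using lim H by simp
 qed
 then show ?thesis using \<rho> by blast
qed

lemma afun_same: "same y y' \<Longrightarrow> afun n \<xi> y = afun n \<xi> y'"
proof (induction n arbitrary: y y')
 case 0
 then have "wcomp f [] y \<in> A1 \<longleftrightarrow> wcomp f [] y' \<in> A1" unfolding same_def by (metis empty_subsetI list.set(1))
 then show ?case by simp
next
 case (Suc n)
 have "same (f i y) (f i y')" if "i \<in> idx s" for i
  unfolding same_def
 proof (intro allI impI)
  fix w assume "word w"
  then have "word (i # w)" using that by simp
  then have "wcomp f (i # w) y \<in> A1 \<longleftrightarrow> wcomp f (i # w) y' \<in> A1" using Suc.prems unfolding same_def by blast
  then show "wcomp f w (f i y) \<in> A1 \<longleftrightarrow> wcomp f w (f i y') \<in> A1" by simp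
 qed
 then show ?case unfolding afun.simps by (intro sum.cong refl arg_cong2[of _ _ _ _ "(*)"] Suc.IH)
qed

lemma Hlim_same: "same y y' \<Longrightarrow> Hlim \<xi> y = Hlim \<xi> y'"
 unfolding Hlim_def using afun_same[of y y'] by simp

lemma afun_absorbed: "y \<in> A1 \<Longrightarrow> afun n \<xi> y = 1" "y \<in> A0 \<Longrightarrow> afun n \<xi> y = 0"
proof -
 show "y \<in> A1 \<Longrightarrow> afun n \<xi> y = 1"
 proof (induction n arbitrary: y)
  case (Suc n)
  then have "afun (Suc n) \<xi> y = (\<Sum>i\<in>idx s. cwt s \<xi> i)" using A_forward(1) by simp
  then show ?case using sum_cwt by simp
 qed simp
 show "y \<in> A0 \<Longrightarrow> afun n \<xi> y = 0"
 proof (induction n arbitrary: y)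
  case 0 then show ?case using A_disjoint by auto
 next
  case (Suc n) then show ?case using A_forward(2) by simp
 qed
qed

end

section \<open>The product measure, T and its derivatives\<close>

lemma pmf_wpmf: assumes "\<And>i. i \<in> idx s \<Longrightarrow> 0 \<le> wt s x i" shows "pmf (wpmf s x) i = wt s x i"
proof -
 have z: "wt s x i = 0" if "i \<notin> idx s" for i using that by (auto simp: wt_def idx_def)
 have nn: "0 \<le> wt s x i" for i using assms z by (cases "i \<in> idx s") auto
 have "(\<integral>\<^sup>+i. ennreal (wt s x i) \<partial>count_space UNIV) = (\<Sum>i\<in>idx s. ennreal (wt s x i))"
  using z by (intro nn_integral_count_space') (auto simp: idx_def)
 also have "\<dots> = ennreal (\<Sum>i\<in>idx s. wt s x i)" using nn by (intro sum_ennreal) auto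
 finally have "(\<integral>\<^sup>+i. ennreal (wt s x i) \<partial>count_space UNIV) = 1" using sum_wt by simp
 then show ?thesis unfolding wpmf_def using nn by (intro pmf_embed_pmf) auto
qed

lemma pmf_wpmf_0: assumes "\<And>i. i \<in> idx s \<Longrightarrow> 0 \<le> wt s x i" "i \<notin> idx s" shows "pmf (wpmf s x) i = 0"
proof -
 have "pmf (wpmf s x) i = wt s x i" using pmf_wpmf assms(1) by blast
 then show ?thesis using assms(2) by (auto simp: wt_def idx_def)
qed

lemma sequence_space_seq: "sequence_space (measure_pmf M)"
 by unfold_locales

lemma seq_measure_space: "space (seq_measure s x) = UNIV"
 by (simp add: seq_measure_def space_PiM PiE_UNIV_domain)

lemma seq_component_event: "{\<omega>. \<omega> n \<in> A} \<in> sets (seq_measure s x)"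
proof -
 have "(\<lambda>\<omega>. \<omega> n) \<in> measurable (seq_measure s x) (measure_pmf (wpmf s x))" unfolding seq_measure_def by simp
 then have "(\<lambda>\<omega>. \<omega> n) -` A \<inter> space (seq_measure s x) \<in> sets (seq_measure s x)" by (rule measurable_sets) simp
 then show ?thesis by (simp add: seq_measure_space vimage_def)
qed

lemma seq_word_event: "{\<omega>. Q (map \<omega> [0..<n])} \<in> sets (seq_measure s x)"
proof (induction n arbitrary: Q)
 case 0
 show ?case using sets.top[of "seq_measure s x"] by (cases "Q []") (auto simp: seq_measure_space)
next
 case (Suc n)
 have "{\<omega>. Q (map \<omega> [0..<Suc n])} = (\<Union>i. {\<omega>. \<omega> n \<in> {i}} \<inter> {\<omega>. Q (map \<omega> [0..<n] @ [i])})" by auto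
 also have "\<dots> \<in> sets (seq_measure s x)"
  by (intro sets.countable_UN' sets.Int seq_component_event[of n "{_}"] Suc image_subsetI) auto
 finally show ?case .
qed

lemma seq_fseq_event: "{\<omega>. R (fseq f \<omega> n y)} \<in> sets (seq_measure s x)"
 using seq_word_event[of "\<lambda>w. R (wcomp f w y)"] by (simp add: fseq_def)

text \<open>Conditioning on the first letter: the product measure is the image of the pair (letter,
  remaining sequence) under \<open>case_nat\<close>.\<close>

lemma seq_measure_step:
 assumes x: "\<And>i. i \<in> idx s \<Longrightarrow> 0 \<le> wt s x i" and A: "A \<in> sets (seq_measure s x)"
 shows "measure (seq_measure s x) A = (\<Sum>i\<in>idx s. wt s x i * measure (seq_measure s x) {\<omega>. case_nat i \<omega> \<in> A})"
proof -
 let ?M = "measure_pmf (wpmf s x)" and ?S = "seq_measure s x"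
 interpret sequence_space ?M by (rule sequence_space_seq)
 interpret S: prob_space ?S unfolding seq_measure_def by (rule prob_space_PiM) (rule measure_pmf.prob_space_axioms)
 have g: "(\<lambda>(i, \<omega>). case_nat i \<omega>) \<in> measurable (?M \<Otimes>\<^sub>M ?S) ?S"
  unfolding seq_measure_def by measurable
 have "emeasure ?S A = emeasure (distr (?M \<Otimes>\<^sub>M ?S) ?S (\<lambda>(i, \<omega>). case_nat i \<omega>)) A"
  using PiM_iter unfolding seq_measure_def by simp
 also have "\<dots> = emeasure (?M \<Otimes>\<^sub>M ?S) ((\<lambda>(i, \<omega>). case_nat i \<omega>) -` A \<inter> space (?M \<Otimes>\<^sub>M ?S))"
  by (rule emeasure_distr[OF g A])
 also have "\<dots> = (\<integral>\<^sup>+i. emeasure ?S (Pair i -` ((\<lambda>(i, \<omega>). case_nat i \<omega>) -` A \<inter> space (?M \<Otimes>\<^sub>M ?S))) \<partial>?M)"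
  by (rule S.emeasure_pair_measure_alt) (rule measurable_sets[OF g A])
 also have "\<dots> = (\<integral>\<^sup>+i. emeasure ?S {\<omega>. case_nat i \<omega> \<in> A} \<partial>?M)"
  by (intro nn_integral_cong arg_cong[of _ _ "emeasure ?S"]) (auto simp: space_pair_measure seq_measure_space)
 also have "\<dots> = (\<Sum>i\<in>idx s. emeasure ?S {\<omega>. case_nat i \<omega> \<in> A} * pmf (wpmf s x) i)"
 proof (rule nn_integral_measure_pmf_support)
  fix i assume "i \<in> set_pmf (wpmf s x)" "i \<notin> idx s"
  then show "emeasure ?S {\<omega>. case_nat i \<omega> \<in> A} = 0"
   using pmf_wpmf_0[of s x i] x by (simp add: set_pmf_iff)
 qed (auto simp: idx_def)
 also have "\<dots> = (\<Sum>i\<in>idx s. ennreal (wt s x i * measure ?S {\<omega>. case_nat i \<omega> \<in> A}))"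
  by (intro sum.cong refl) (use x pmf_wpmf[of s x] in \<open>simp add: S.emeasure_eq_measure ennreal_mult'' mult.commute\<close>)
 also have "\<dots> = ennreal (\<Sum>i\<in>idx s. wt s x i * measure ?S {\<omega>. case_nat i \<omega> \<in> A})"
  using x by (intro sum_ennreal) auto
 finally show ?thesis unfolding S.emeasure_eq_measure using x by (subst (asm) ennreal_inj) (auto intro!: sum_nonneg)
qed

lemma seq_measure_AE_idx:
 assumes x: "\<And>i. i \<in> idx s \<Longrightarrow> 0 \<le> wt s x i"
 shows "AE \<omega> in seq_measure s x. \<forall>n. \<omega> n \<in> idx s"
 unfolding AE_all_countable seq_measure_def
proof (intro allI AE_PiM_component)
 show "AE i in measure_pmf (wpmf s x). i \<in> idx s"
  unfolding AE_measure_pmf_iff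
 proof (intro ballI)
  fix i assume "i \<in> set_pmf (wpmf s x)"
  then have "pmf (wpmf s x) i \<noteq> 0" by (simp add: set_pmf_iff)
  then show "i \<in> idx s" using pmf_wpmf_0[of s x i] x by blast
 qed
qed (auto intro: measure_pmf.prob_space_axioms)

context hyperbolic_minimal
begin

lemma conv_event: "{\<omega>. conv \<omega> y} \<in> sets (seq_measure s x)"
proof -
 have "conv \<omega> y \<longleftrightarrow> (\<forall>k. \<exists>N. \<forall>n\<in>{N..}. \<bar>setdist (fseq f \<omega> n y) L\<bar> < inverse (real (Suc k)))" for \<omega>
  unfolding conv_def LIMSEQ_def dist_real_def
 proof safe
  fix k assume "\<forall>r>0. \<exists>no. \<forall>n\<ge>no. \<bar>setdist (fseq f \<omega> n y) L - 0\<bar> < r"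
  then show "\<exists>N. \<forall>n\<in>{N..}. \<bar>setdist (fseq f \<omega> n y) L\<bar> < inverse (real (Suc k))" 
   by (auto simp del: of_nat_Suc dest!: spec[of _ "inverse (real (Suc k))"])
 next
  fix r :: real assume a: "\<forall>k. \<exists>N. \<forall>n\<in>{N..}. \<bar>setdist (fseq f \<omega> n y) L\<bar> < inverse (real (Suc k))" and r: "r > 0"
  obtain k where k: "inverse (real (Suc k)) < r" using reals_Archimedean[OF r] by blast
  obtain N where "\<forall>n\<in>{N..}. \<bar>setdist (fseq f \<omega> n y) L\<bar> < inverse (real (Suc k))" using a by blast
  then show "\<exists>no. \<forall>n\<ge>no. \<bar>setdist (fseq f \<omega> n y) L - 0\<bar> < r" using k by (intro exI[of _ N]) (auto dest!: bspec)
 qed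
 then have "{\<omega>. conv \<omega> y} = (\<Inter>k. \<Union>N. \<Inter>n\<in>{N..}. {\<omega>. \<bar>setdist (fseq f \<omega> n y) L\<bar> < inverse (real (Suc k))})"
  by (auto simp only: mem_Collect_eq INT_iff UN_iff UNIV_I ball_UNIV bex_UNIV)
 also have "\<dots> \<in> sets (seq_measure s x)"
 proof -
  have "(\<Inter>n\<in>{N..}. {\<omega>. \<bar>setdist (fseq f \<omega> n y) L\<bar> < inverse (real (Suc k))}) \<in> sets (seq_measure s x)" for N k :: nat
   using seq_fseq_event[of "\<lambda>z. \<bar>setdist z L\<bar> < inverse (real (Suc k))" f _ y s x] by (intro sets.countable_INT') auto
  then have "(\<Union>N. \<Inter>n\<in>{N..}. {\<omega>. \<bar>setdist (fseq f \<omega> n y) L\<bar> < inverse (real (Suc k))}) \<in> sets (seq_measure s x)" for k :: nat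
   by (intro sets.countable_UN) auto
  then show ?thesis by (intro sets.countable_INT) auto
 qed
 finally show ?thesis .
qed

lemma prob_enter:
 assumes x: "\<And>i. i \<in> idx s \<Longrightarrow> 0 \<le> wt s x i"
 shows "complex_of_real (measure (seq_measure s x) {\<omega>. fseq f \<omega> n y \<in> A1}) = afun n (\<lambda>i. complex_of_real (x i)) y"
proof (induction n arbitrary: y)
 case 0
 interpret S: prob_space "seq_measure s x" unfolding seq_measure_def by (rule prob_space_PiM) (rule measure_pmf.prob_space_axioms)
 show ?case using S.prob_space by (cases "y \<in> A1") (auto simp: fseq_def seq_measure_space)
next
 case (Suc n)
 have "measure (seq_measure s x) {\<omega>. fseq f \<omega> (Suc n) y \<in> A1} =
   (\<Sum>i\<in>idx s. wt s x i * measure (seq_measure s x) {\<omega>. fseq f \<omega> n (f i y) \<in> A1})"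
  using seq_measure_step[OF x seq_fseq_event[of "\<lambda>z. z \<in> A1" f "Suc n" y s x]] by (simp add: fseq_Suc_shift)
 then show ?case by (simp add: Suc cwt_of_real)
qed

text \<open>Forward invariance of \<open>A1\<close> makes the events of being in \<open>A1\<close>
  at time n increase along admissible sequences, and their union there is convergence to L. Almost
  every sequence is admissible.\<close>

lemma prob_conv:
 assumes x: "\<And>i. i \<in> idx s \<Longrightarrow> 0 \<le> wt s x i" and y: "y \<in> RS"
 shows "(\<lambda>n. measure (seq_measure s x) {\<omega>. fseq f \<omega> n y \<in> A1}) \<longlonglongrightarrow> Tfun s f L x y"
proof -
 let ?S = "seq_measure s x"
 interpret S: prob_space ?S unfolding seq_measure_def by (rule prob_space_PiM) (rule measure_pmf.prob_space_axioms)
 define D where "D = {\<omega>. adm \<omega>}"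
 define E where "E n = {\<omega>. fseq f \<omega> n y \<in> A1} \<inter> D" for n
 have "D = (\<Inter>n. {\<omega>. \<omega> n \<in> idx s})" by (auto simp: D_def adm_def)
 then have D: "D \<in> sets ?S" using seq_component_event by (auto intro!: sets.countable_INT'')
 have AE: "AE \<omega> in ?S. \<omega> \<in> D" using seq_measure_AE_idx[OF x] by (simp add: D_def adm_def)
 have E: "E n \<in> sets ?S" for n unfolding E_def using D seq_fseq_event by (intro sets.Int) auto
 have inc: "incseq E"
 proof (rule incseq_SucI)
  fix n show "E n \<le> E (Suc n)"
   unfolding E_def D_def using A_forward(1)[of "_ n" "fseq f _ n y"] by (auto simp: adm_def fseq_def wcomp_append)
 qed
 have "(\<lambda>n. measure ?S (E n)) \<longlonglongrightarrow> measure ?S (\<Union>n. E n)"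
  using E inc by (intro S.finite_Lim_measure_incseq) auto
 moreover have "measure ?S (E n) = measure ?S {\<omega>. fseq f \<omega> n y \<in> A1}" for n
  using AE E seq_fseq_event by (intro measure_eq_AE) (auto simp: E_def elim!: eventually_mono)
 moreover have "measure ?S (\<Union>n. E n) = measure ?S {\<omega>. conv \<omega> y}"
 proof (rule measure_eq_AE)
  show "AE \<omega> in ?S. (\<omega> \<in> (\<Union>n. E n)) = (\<omega> \<in> {\<omega>. conv \<omega> y})"
   using AE by eventually_elim (use conv_enters[OF _ y] A1_conv[OF _ _ y] in \<open>auto simp: E_def D_def\<close>)
 qed (use E conv_event in auto)
 moreover have "Tfun s f L x y = measure ?S {\<omega>. conv \<omega> y}" by (simp add: Tfun_def conv_def seq_measure_space)
 ultimately show ?thesis by simp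
qed

lemma wt_near_p: "\<exists>\<rho>>0. \<forall>x. (\<lambda>i. complex_of_real (x i)) \<in> pdisc s pC \<rho> \<longrightarrow> (\<forall>i\<in>idx s. 0 \<le> wt s x i)"
proof -
 obtain m where m: "m > 0" "m < 1" "\<And>i. i \<in> idx s \<Longrightarrow> m \<le> wt s p i" using wt_p_min by blast
 define \<rho> where "\<rho> = m / real s"
 have \<rho>: "\<rho> > 0" "\<rho> \<le> m" "real s * \<rho> = m" using m s_pos by (auto simp: \<rho>_def field_simps)
 have "0 \<le> wt s x i" if x: "(\<lambda>i. complex_of_real (x i)) \<in> pdisc s pC \<rho>" and i: "i \<in> idx s" for x i
 proof -
  have xp: "\<bar>x j - p j\<bar> < \<rho>" if "j \<in> {1..s}" for j
  proof -
   have "dist (complex_of_real (p j)) (complex_of_real (x j)) < \<rho>" using x that unfolding pdisc_def pC_def by blast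
   then show ?thesis unfolding dist_of_real by (simp add: dist_real_def abs_minus_commute)
  qed
  show ?thesis
  proof (cases "i \<in> {1..s}")
   case True
   then show ?thesis using xp[OF True] m(3)[OF i] \<rho>(2) unfolding wt_def by (auto simp: abs_less_iff)
  next
   case False
   then have "i = s + 1" using i idx_eq by auto
   then have "wt s x i - wt s p i = (\<Sum>j=1..s. p j - x j)" by (simp add: wt_def sum_subtractf)
   moreover have "(\<Sum>j=1..s. p j - x j) \<ge> (\<Sum>j=1..s. - \<rho>)" by (rule sum_mono) (use xp in \<open>force simp: abs_less_iff\<close>)
   ultimately show ?thesis using \<rho>(3) m(3)[OF i] by simp
  qed
 qed
 then show ?thesis using \<rho>(1) by blast
qed

text \<open>C_n(y) as an iterated complex derivative at p; \<open>Ccoef_cf\<close> identifies it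
  with the real one.\<close>

definition cf :: "(nat \<Rightarrow> nat) \<Rightarrow> complex \<times> real \<Rightarrow> complex" where
 "cf n y = cmpd [1..<s+1] n (\<lambda>\<xi>. Hlim \<xi> y) pC"

lemma Hlim_Tfun:
 "\<exists>\<rho>>0. \<exists>M. \<forall>y\<in>RS. sep_hol s pC \<rho> M (\<lambda>\<xi>. Hlim \<xi> y) \<and> real_agree s pC \<rho> (\<lambda>\<xi>. Hlim \<xi> y) (\<lambda>x. Tfun s f L x y)
   \<and> (\<forall>\<xi>\<in>pdisc s pC \<rho>. (\<lambda>n. afun n \<xi> y) \<longlonglongrightarrow> Hlim \<xi> y)"
proof -
 obtain \<rho>1 M where 1: "\<rho>1 > 0" "\<And>y. y \<in> RS \<Longrightarrow> sep_hol s pC \<rho>1 M (\<lambda>\<xi>. Hlim \<xi> y)"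
   "\<And>y \<xi>. y \<in> RS \<Longrightarrow> \<xi> \<in> pdisc s pC \<rho>1 \<Longrightarrow> (\<lambda>n. afun n \<xi> y) \<longlonglongrightarrow> Hlim \<xi> y" using Hlim_sep_hol by metis
 obtain \<rho>2 where 2: "\<rho>2 > 0" "\<And>x i. (\<lambda>i. complex_of_real (x i)) \<in> pdisc s pC \<rho>2 \<Longrightarrow> i \<in> idx s \<Longrightarrow> 0 \<le> wt s x i"
  using wt_near_p by metis
 define \<rho> where "\<rho> = min \<rho>1 \<rho>2"
 have \<rho>: "\<rho> > 0" "\<rho> \<le> \<rho>1" "\<rho> \<le> \<rho>2" using 1 2 by (auto simp: \<rho>_def)
 have "real_agree s pC \<rho> (\<lambda>\<xi>. Hlim \<xi> y) (\<lambda>x. Tfun s f L x y)" if y: "y \<in> RS" for y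
  unfolding real_agree_def
 proof (intro allI impI)
  fix x assume x: "(\<lambda>i. complex_of_real (x i)) \<in> pdisc s pC \<rho>"
  then have x1: "(\<lambda>i. complex_of_real (x i)) \<in> pdisc s pC \<rho>1" and x2: "(\<lambda>i. complex_of_real (x i)) \<in> pdisc s pC \<rho>2"
   using pdisc_mono[OF \<rho>(2)] pdisc_mono[OF \<rho>(3)] by blast+
  have "(\<lambda>n. complex_of_real (measure (seq_measure s x) {\<omega>. fseq f \<omega> n y \<in> A1})) \<longlonglongrightarrow> complex_of_real (Tfun s f L x y)"
   by (intro tendsto_of_real prob_conv[OF _ y]) (rule 2(2)[OF x2])
  then have "(\<lambda>n. afun n (\<lambda>i. complex_of_real (x i)) y) \<longlonglongrightarrow> complex_of_real (Tfun s f L x y)"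
   using prob_enter[OF 2(2)[OF x2]] by simp
  then show "Hlim (\<lambda>i. complex_of_real (x i)) y = complex_of_real (Tfun s f L x y)"
   using 1(3)[OF y x1] LIMSEQ_unique by blast
 qed
 moreover have "sep_hol s pC \<rho> M (\<lambda>\<xi>. Hlim \<xi> y)" if "y \<in> RS" for y using sep_hol_mono[OF 1(2)[OF that] \<rho>(2)] by simp
 ultimately show ?thesis using \<rho>(1) 1(3) pdisc_mono[OF \<rho>(2), of s pC] by blast
qed

lemma cmpd_Hlim: "\<exists>\<rho>>0. \<exists>M. \<forall>y\<in>RS. sep_hol s pC \<rho> M (cmpd [1..<s+1] n (\<lambda>\<xi>. Hlim \<xi> y)) \<and>
  real_agree s pC \<rho> (cmpd [1..<s+1] n (\<lambda>\<xi>. Hlim \<xi> y)) (mpdiff s n (\<lambda>x. Tfun s f L x y))"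
proof -
 obtain \<rho> M where 1: "\<rho> > 0" "\<And>y. y \<in> RS \<Longrightarrow> sep_hol s pC \<rho> M (\<lambda>\<xi>. Hlim \<xi> y)"
   "\<And>y. y \<in> RS \<Longrightarrow> real_agree s pC \<rho> (\<lambda>\<xi>. Hlim \<xi> y) (\<lambda>x. Tfun s f L x y)" using Hlim_Tfun by metis
 have "set [1..<s+1] \<subseteq> {1..s}" by auto
 then obtain \<rho>' M' where "\<rho>' > 0" "\<And>H h. sep_hol s pC \<rho> M H \<Longrightarrow> real_agree s pC \<rho> H h \<Longrightarrow>
   sep_hol s pC \<rho>' M' (cmpd [1..<s+1] n H) \<and> real_agree s pC \<rho>' (cmpd [1..<s+1] n H) (mpdiff s n h)"
  using regular_op_cmpd[of "[1..<s+1]" s pC n, unfolded regular_op_def, rule_format, OF _ 1(1), of M]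
  unfolding mpdiff_def by blast
 then show ?thesis using 1(2,3) by blast
qed

lemma Ccoef_cf: assumes y: "y \<in> RS" shows "complex_of_real (Ccoef s f L p n y) = cf n y"
proof -
 obtain \<rho> where \<rho>: "\<rho> > 0" "real_agree s pC \<rho> (cmpd [1..<s+1] n (\<lambda>\<xi>. Hlim \<xi> y)) (mpdiff s n (\<lambda>x. Tfun s f L x y))"
  using cmpd_Hlim[of n] y by blast
 have "pC \<in> pdisc s pC \<rho>" using \<rho>(1) by (simp add: pdisc_def)
 then show ?thesis using \<rho>(2) unfolding real_agree_def by (simp add: cf_def Ccoef_def pC_def[abs_def])
qed

lemma cf_bounded: "\<exists>M. \<forall>y\<in>RS. cmod (cf n y) \<le> M"
proof -
 obtain \<rho> M where \<rho>: "\<rho> > 0" "\<And>y. y \<in> RS \<Longrightarrow> sep_hol s pC \<rho> M (cmpd [1..<s+1] n (\<lambda>\<xi>. Hlim \<xi> y))"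
  using cmpd_Hlim[of n] by blast
 have "pC \<in> pdisc s pC \<rho>" using \<rho>(1) by (simp add: pdisc_def)
 then show ?thesis using \<rho>(2) unfolding sep_hol_def cf_def by blast
qed

end

section \<open>Increments of the derivatives\<close>

context hyperbolic_system
begin

lemma equi_of_images:
 assumes y: "y \<in> RS" "\<And>i. i \<in> idx s \<Longrightarrow> f i y \<in> F"
 shows "equi (semigrp s f) RS y"
 unfolding equi_def
proof (intro allI impI)
 fix e :: real assume e: "e > 0"
 have "\<exists>\<delta>>0. \<forall>x\<in>RS. dist (f i y) x < \<delta> \<longrightarrow> (\<forall>w. word w \<longrightarrow> dist (wcomp f w (f i y)) (wcomp f w x) < e)" if i: "i \<in> idx s" for i
  using uniform_equi[of "{f i y}" e] y(2)[OF i] e by auto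
 then obtain D where D: "\<And>i. i \<in> idx s \<Longrightarrow> D i > 0" "\<And>i x w. i \<in> idx s \<Longrightarrow> x \<in> RS \<Longrightarrow> dist (f i y) x < D i \<Longrightarrow> word w \<Longrightarrow>
   dist (wcomp f w (f i y)) (wcomp f w x) < e" by metis
 have "\<exists>d>0. \<forall>i\<in>idx s. \<forall>x\<in>RS. dist y x < d \<longrightarrow> dist (f i y) (f i x) < D i"
 proof (rule finite_uniform_bound[OF finite_idx])
  fix i assume i: "i \<in> idx s"
  obtain d where d: "d > 0" "\<forall>k\<in>idx s. \<forall>x\<in>RS. \<forall>x'\<in>RS. dist x x' < d \<longrightarrow> dist (f k x) (f k x') < D i"
   using uniform_continuity[OF D(1)[OF i]] by blast
  show "\<exists>d>0. \<forall>d'. 0 < d' \<longrightarrow> d' \<le> d \<longrightarrow> (\<forall>x\<in>RS. dist y x < d' \<longrightarrow> dist (f i y) (f i x) < D i)"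
   using d y(1) i by (intro exI[of _ d]) (meson order_less_le_trans)
 qed
 then obtain d where d: "d > 0" "\<And>i x. i \<in> idx s \<Longrightarrow> x \<in> RS \<Longrightarrow> dist y x < d \<Longrightarrow> dist (f i y) (f i x) < D i" by blast
 have "dist (h y) (h x) < e" if x: "x \<in> RS" "dist y x < d" and h: "h \<in> semigrp s f" for x h
 proof -
  obtain v where v: "h = wcomp f v" "v \<noteq> []" "word v" using h unfolding semigrp_def by blast
  then obtain i w where iw: "v = i # w" by (cases v) auto
  then have w: "h = wcomp f (i # w)" "i \<in> idx s" "word w" using v by auto
  show ?thesis using D(2)[OF w(2) f_RS[OF w(2)] d(2)[OF w(2) x] w(3)] w(1) by simp
 qed
 then show "\<exists>\<delta>>0. \<forall>x\<in>RS. dist y x < \<delta> \<longrightarrow> (\<forall>h\<in>semigrp s f. dist (h y) (h x) < e)" using d(1) by blast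
qed

text \<open>If every letter sent x into the open set F, the same would hold for all points near x.
  By \<open>equi_of_images\<close> the semigroup would be equicontinuous at each of them, and x
  would be a Fatou point.\<close>

lemma J_forward: assumes x: "x \<in> J" shows "\<exists>i\<in>idx s. f i x \<in> J"
proof (rule ccontr)
 assume neg: "\<not> ?thesis"
 have xRS: "x \<in> RS" using x J_RS by auto
 have fx: "f i x \<in> F" if "i \<in> idx s" for i
  using neg that J_iff[OF f_RS[OF that]] by blast
 have "\<exists>d>0. \<forall>i\<in>idx s. \<forall>y\<in>RS. dist x y < d \<longrightarrow> f i y \<in> F"
 proof (rule finite_uniform_bound[OF finite_idx])
  fix i assume i: "i \<in> idx s"
  obtain e where e: "e > 0" "\<And>y. y \<in> RS \<Longrightarrow> dist y (f i x) < e \<Longrightarrow> y \<in> F"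
   using openin_F fx[OF i] unfolding openin_euclidean_subtopology_iff by blast
  obtain d where d: "d > 0" "\<forall>i\<in>idx s. \<forall>x\<in>RS. \<forall>x'\<in>RS. dist x x' < d \<longrightarrow> dist (f i x) (f i x') < e"
   using uniform_continuity[OF e(1)] by blast
  show "\<exists>d>0. \<forall>d'. 0 < d' \<longrightarrow> d' \<le> d \<longrightarrow> (\<forall>y\<in>RS. dist x y < d' \<longrightarrow> f i y \<in> F)"
  proof (intro exI[of _ d] conjI d(1) allI impI ballI)
   fix d' y assume "d' \<le> d" "y \<in> RS" "dist x y < d'"
   then have "dist (f i y) (f i x) < e" using d(2) i xRS by (subst dist_commute) auto
   then show "f i y \<in> F" using e(2) f_RS[OF i] \<open>y \<in> RS\<close> by blast
  qed
 qed
 then obtain d where d: "d > 0" "\<And>i y. i \<in> idx s \<Longrightarrow> y \<in> RS \<Longrightarrow> dist x y < d \<Longrightarrow> f i y \<in> F" by blast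
 have "equi (semigrp s f) RS y" if "y \<in> RS" "dist x y < d" for y using equi_of_images[OF that(1)] d(2) that by blast
 then have "x \<in> F" unfolding F_iff using xRS d(1) by blast
 then show False using x J_iff[OF xRS] by blast
qed

lemma J_forward_word: assumes x: "x \<in> J" shows "\<exists>w. word w \<and> length w = n \<and> wcomp f w x \<in> J"
proof (induction n)
 case 0
 show ?case using x by (intro exI[of _ "[]"]) simp
next
 case (Suc n)
 then obtain w where w: "word w" "length w = n" "wcomp f w x \<in> J" by blast
 obtain i where "i \<in> idx s" "f i (wcomp f w x) \<in> J" using J_forward[OF w(3)] by blast
 then show ?case using w by (intro exI[of _ "w @ [i]"]) (simp add: wcomp_append)
qed

text \<open>The words may be taken arbitrarily long: first follow an orbit of z inside the Julia set.\<close>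
lemma backward_orbit_dense:
 assumes z: "z \<in> J" and r: "r > 0" and y: "y \<in> J"
 shows "\<exists>x w. x \<in> RS \<and> dist z x < r \<and> word w \<and> k \<le> length w \<and> wcomp f w x = y"
proof -
 obtain r1 C \<theta> where c: "r1 > 0" "C > 0" "0 < \<theta>" "\<theta> < 1" 
  and pre: "\<forall>w y y'. word w \<longrightarrow> y \<in> J \<longrightarrow> y' \<in> RS \<longrightarrow> dist y y' < r1 \<longrightarrow> shadow C \<theta> w y y'"
  using preimages_contract by blast
 have Cth: "C * \<theta> ^ n * t \<le> C * t" if "t \<ge> 0" for n t
 proof -
  have "\<theta> ^ n \<le> 1" using c by (intro power_le_one) auto
  then show ?thesis using c that by (intro mult_right_mono) (auto simp: mult_le_cancel_left1)
 qed
 have zRS: "z \<in> RS" using z J_RS by auto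
 obtain u where u: "word u" "length u = k" "wcomp f u z \<in> J" using J_forward_word[OF z] by blast
 \<comment> \<open>Two pull-backs, each costing a factor C: along w from within e of y to within
   \<rho> / 2 of x2, and along u from within \<rho> of f_u(z) to within r of z.\<close>
 define \<rho> where "\<rho> = min r1 (r / C)"
 have \<rho>: "\<rho> > 0" "\<rho> \<le> r1" "C * \<rho> \<le> r" using c r by (auto simp: \<rho>_def min_def field_simps)
 define e where "e = min r1 (\<rho> / (2 * C))"
 have e: "e > 0" "e \<le> r1" "C * e \<le> \<rho> / 2" using c \<rho> by (auto simp: e_def min_def field_simps)
 have "\<rho> / 2 > 0" "y \<in> RS" using \<rho> y J_RS by auto
 then obtain w x2 where w: "word w" "x2 \<in> RS" "dist (wcomp f u z) x2 < \<rho> / 2" "wcomp f w x2 \<in> ball y e"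
  using J_dense_images[OF u(3), of "\<rho> / 2" "ball y e" y] e by auto
 obtain x3 where x3: "x3 \<in> RS" "wcomp f w x3 = y"
   "\<forall>j\<le>length w. dist (wcomp f (take j w) x3) (wcomp f (take j w) x2) \<le> C * \<theta> ^ (length w - j) * dist y (wcomp f w x2)"
 proof -
  have "dist y (wcomp f w x2) < r1" using w(4) e(2) by simp
  from pre[rule_format, OF w(1) y wcomp_RS[OF w(1,2)] this, THEN conjunct2, THEN bspec, OF w(2), THEN mp, OF refl] that
  show ?thesis by blast
 qed
 have "dist x3 x2 \<le> C * \<theta> ^ length w * dist y (wcomp f w x2)" using x3(3) by (auto dest: spec[of _ 0])
 also have "\<dots> \<le> C * dist y (wcomp f w x2)" by (rule Cth) simp
 also have "\<dots> < C * e" using w(4) c by simp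
 finally have "dist x3 x2 < \<rho> / 2" using e by linarith
 then have d3: "dist (wcomp f u z) x3 < \<rho>" using w(3) dist_triangle[of "wcomp f u z" x3 x2] by (simp add: dist_commute)
 obtain x where x: "x \<in> RS" "wcomp f u x = x3"
   "\<forall>j\<le>length u. odist j u z x \<le> C * \<theta> ^ (length u - j) * dist (wcomp f u z) x3"
 proof -
  have "dist (wcomp f u z) x3 < r1" using d3 \<rho>(2) by simp
  from pre[rule_format, OF u(1,3) x3(1) this, THEN conjunct1, THEN bspec, OF zRS, THEN mp, OF refl] that
  show ?thesis by blast
 qed
 have "dist z x \<le> C * \<theta> ^ length u * dist (wcomp f u z) x3" using x(3) by (auto dest: spec[of _ 0])
 also have "\<dots> \<le> C * dist (wcomp f u z) x3" by (rule Cth) simp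
 also have "\<dots> < C * \<rho>" using d3 c by simp
 finally have "dist z x < r" using \<rho> by linarith
 then show ?thesis using x x3(2) u(1,2) w(1) by (intro exI[of _ x] exI[of _ "u @ w"]) (simp add: wcomp_append)
qed

end

context hyperbolic_minimal
begin

text \<open>The partial derivative of the weight of letter i in direction l. It is -1 for the last
  letter, whose weight is 1 minus the sum of the others.\<close>

definition vv :: "nat \<Rightarrow> nat \<Rightarrow> complex" where
 "vv i l = (if i \<in> {1..s} then if i = l then 1 else 0 else if i = s + 1 then -1 else 0)"

lemma norm_vv: "cmod (vv i l) \<le> 1" by (simp add: vv_def)

lemma affine_cwt: assumes i: "i \<in> idx s" shows "affine_fun s pC (vv i) (\<lambda>\<xi>. cwt s \<xi> i)"
 unfolding affine_fun_def
proof (intro conjI ballI allI)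
 show "reg s pC (\<lambda>\<xi>. cwt s \<xi> i)"
 proof (cases "i \<in> {1..s}")
  case True
  then show ?thesis using reg_var[OF True, of pC] by (simp add: cwt_def)
 next
  case False
  then have "i = s + 1" using i idx_eq by auto
  then have "(\<lambda>\<xi>. cwt s \<xi> i) = (\<lambda>\<xi>. 1 + (\<Sum>l\<in>{1..s}. - 1 * \<xi> l))" by (auto simp: cwt_def sum_negf)
  then show ?thesis using reg_add[OF reg_const reg_sum[of "{1..s}" s pC "\<lambda>l \<xi>. \<xi> l" "\<lambda>_. -1"], of 1] reg_var[of _ s pC] by simp
 qed
qed (simp only: cwt_upd vv_def eq_commute)

lemma Hlim_rec: "\<exists>\<rho>>0. \<forall>y\<in>RS. \<forall>\<xi>\<in>pdisc s pC \<rho>. Hlim \<xi> y = (\<Sum>i\<in>idx s. cwt s \<xi> i * Hlim \<xi> (f i y))"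
proof -
 obtain \<rho> where 1: "\<rho> > 0" "\<And>y \<xi>. y \<in> RS \<Longrightarrow> \<xi> \<in> pdisc s pC \<rho> \<Longrightarrow> (\<lambda>n. afun n \<xi> y) \<longlonglongrightarrow> Hlim \<xi> y" using Hlim_Tfun by metis
 have "Hlim \<xi> y = (\<Sum>i\<in>idx s. cwt s \<xi> i * Hlim \<xi> (f i y))" if y: "y \<in> RS" "\<xi> \<in> pdisc s pC \<rho>" for y \<xi>
 proof (rule LIMSEQ_unique)
  show "(\<lambda>n. afun (Suc n) \<xi> y) \<longlonglongrightarrow> Hlim \<xi> y" using 1(2)[OF y] by (rule LIMSEQ_Suc)
  show "(\<lambda>n. afun (Suc n) \<xi> y) \<longlonglongrightarrow> (\<Sum>i\<in>idx s. cwt s \<xi> i * Hlim \<xi> (f i y))"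
   unfolding afun.simps by (intro tendsto_sum tendsto_mult tendsto_const 1(2) f_RS y)
 qed
 then show ?thesis using 1(1) by blast
qed

lemma reg_Hlim: "y \<in> RS \<Longrightarrow> reg s pC (\<lambda>\<xi>. Hlim \<xi> y)"
 unfolding reg_def using Hlim_Tfun by blast

lemma cf_same: "same y y' \<Longrightarrow> cf n y = cf n y'"
 unfolding cf_def using Hlim_same[of y y'] by simp

text \<open>In the increment of T the letters other than i cancel, because their images are related
  by \<open>same\<close>. What remains is an affine function of the parameters times another
  increment, to which \<open>leibniz_affine\<close> applies.\<close>

lemma cf_rec_diff:
 assumes yz: "y \<in> RS" "z \<in> RS" and i: "i \<in> idx s" and sm: "\<And>j. j \<in> idx s \<Longrightarrow> j \<noteq> i \<Longrightarrow> same (f j y) (f j z)"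
 shows "cf n y - cf n z = complex_of_real (wt s p i) * (cf n (f i y) - cf n (f i z)) +
  (\<Sum>l\<in>{1..s}. of_nat (n l) * vv i l * (cf (n(l := n l - 1)) (f i y) - cf (n(l := n l - 1)) (f i z)))"
proof -
 define js where "js = [1..<s+1]"
 have js: "distinct js" "set js \<subseteq> {1..s}" "set js = {1..s}" by (auto simp: js_def)
 define D where "D \<xi> = 1 * Hlim \<xi> y + -1 * Hlim \<xi> z" for \<xi>
 define D' where "D' \<xi> = 1 * Hlim \<xi> (f i y) + -1 * Hlim \<xi> (f i z)" for \<xi>
 have fi: "f i y \<in> RS" "f i z \<in> RS" using f_RS[OF i] yz by auto
 have regD': "reg s pC D'" unfolding D'_def by (intro reg_add reg_mult reg_const reg_Hlim fi)
 have g1: "germ_eq s pC D (\<lambda>\<xi>. cwt s \<xi> i * D' \<xi>)"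
 proof -
  obtain \<rho> where \<rho>: "\<rho> > 0" "\<And>y \<xi>. y \<in> RS \<Longrightarrow> \<xi> \<in> pdisc s pC \<rho> \<Longrightarrow> Hlim \<xi> y = (\<Sum>i\<in>idx s. cwt s \<xi> i * Hlim \<xi> (f i y))"
   using Hlim_rec by metis
  have "D \<xi> = cwt s \<xi> i * D' \<xi>" if "\<xi> \<in> pdisc s pC \<rho>" for \<xi>
  proof -
   have "D \<xi> = (\<Sum>j\<in>idx s. cwt s \<xi> j * (Hlim \<xi> (f j y) - Hlim \<xi> (f j z)))"
    unfolding D_def using \<rho>(2)[OF yz(1) that] \<rho>(2)[OF yz(2) that] by (simp add: right_diff_distrib sum_subtractf)
   also have "\<dots> = cwt s \<xi> i * (Hlim \<xi> (f i y) - Hlim \<xi> (f i z)) + (\<Sum>j\<in>idx s - {i}. cwt s \<xi> j * (Hlim \<xi> (f j y) - Hlim \<xi> (f j z)))"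
    by (rule sum.remove[OF finite_idx i])
   also have "(\<Sum>j\<in>idx s - {i}. cwt s \<xi> j * (Hlim \<xi> (f j y) - Hlim \<xi> (f j z))) = 0"
    using Hlim_same[OF sm] by (intro sum.neutral) auto
   finally show ?thesis by (simp add: D'_def)
  qed
  then show ?thesis unfolding germ_eq_def using \<rho>(1) by blast
 qed
 have lin: "cmpd js m (\<lambda>\<xi>. 1 * Hlim \<xi> a + -1 * Hlim \<xi> b) pC = cf m a - cf m b" if "a \<in> RS" "b \<in> RS" for m a b
  using germ_eq_at[OF linop_lin[OF linop_cmpd[OF js(2)] reg_Hlim[OF that(1)] reg_Hlim[OF that(2)], of m 1 "-1"]]
  unfolding cf_def js_def by simp
 have "germ_eq s pC (cmpd js n D) (\<lambda>\<xi>. cwt s \<xi> i * cmpd js n D' \<xi> + (\<Sum>l\<in>set js. (of_nat (n l) * vv i l) * cmpd js (n(l := n l - 1)) D' \<xi>))"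
  using germ_eq_trans[OF linop_germ[OF linop_cmpd[OF js(2)] g1] leibniz_affine[OF affine_cwt[OF i] regD' js(1,2)]] .
 from germ_eq_at[OF this]
 have "cmpd js n D pC = cwt s pC i * cmpd js n D' pC + (\<Sum>l\<in>{1..s}. (of_nat (n l) * vv i l) * cmpd js (n(l := n l - 1)) D' pC)"
  unfolding js(3) .
 moreover have "cwt s pC i = complex_of_real (wt s p i)" using cwt_of_real[of s p i] by (simp add: pC_def[abs_def])
 ultimately show ?thesis unfolding D_def[abs_def] D'_def[abs_def] lin[OF yz] lin[OF fi] by simp
qed

text \<open>The compact set of points that f i maps into J is sent by every other letter into a
  compact part of the Fatou set. There \<open>same\<close> holds on balls of a uniform radius, a
  Lebesgue number.\<close>

lemma separation:
 "\<exists>\<eta>>0. \<forall>i\<in>idx s. \<forall>j\<in>idx s. \<forall>z\<in>RS. \<forall>y\<in>RS. f i z \<in> J \<longrightarrow> j \<noteq> i \<longrightarrow> dist y z < \<eta> \<longrightarrow> same (f j y) (f j z)"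
proof -
 have "\<exists>\<eta>>0. \<forall>ij\<in>idx s \<times> idx s. \<forall>z\<in>RS. \<forall>y\<in>RS. f (fst ij) z \<in> J \<longrightarrow> snd ij \<noteq> fst ij \<longrightarrow> dist y z < \<eta> \<longrightarrow> same (f (snd ij) y) (f (snd ij) z)"
 proof (rule finite_uniform_bound)
  show "finite (idx s \<times> idx s)" using finite_idx by simp
  fix ij assume "ij \<in> idx s \<times> idx s"
  then obtain i j where ij: "ij = (i, j)" "i \<in> idx s" "j \<in> idx s" by blast
  have "\<exists>\<eta>>0. \<forall>z\<in>RS. \<forall>y\<in>RS. f i z \<in> J \<longrightarrow> j \<noteq> i \<longrightarrow> dist y z < \<eta> \<longrightarrow> same (f j y) (f j z)"
  proof (cases "j = i")
   case True
   then show ?thesis by (intro exI[of _ 1]) simp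
  next
   case False
   define C where "C = f j ` {x \<in> RS. f i x \<in> J}"
   have "C \<subseteq> F"
   proof
    fix u assume "u \<in> C"
    then obtain x where "x \<in> RS" "f i x \<in> J" "u = f j x" by (auto simp: C_def)
    then show "u \<in> F" using A2[OF ij(2,3)] False J_iff[OF f_RS[OF ij(3)]] by metis
   qed
   have "continuous_on {x \<in> RS. f i x \<in> J} (f j)" using continuous_f[OF ij(3)] by (rule continuous_on_subset) auto
   then have C: "compact C" unfolding C_def by (intro compact_continuous_image compact_preimage_J[OF ij(2)])
   obtain d where d: "\<And>u. u \<in> C \<Longrightarrow> d u > 0" "\<And>u u'. u \<in> C \<Longrightarrow> u' \<in> RS \<Longrightarrow> dist u u' < d u \<Longrightarrow> same u u'"
   proof -
    have "\<forall>u\<in>C. \<exists>d>0. \<forall>u'\<in>RS. dist u u' < d \<longrightarrow> same u u'" using same_near \<open>C \<subseteq> F\<close> by blast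
    from bchoice[OF this] that show ?thesis by blast
   qed
   have "C \<subseteq> \<Union>((\<lambda>u. ball u (d u)) ` C)" using d(1) by force
   moreover have "\<And>B. B \<in> (\<lambda>u. ball u (d u)) ` C \<Longrightarrow> open B" by auto
   ultimately obtain e where e: "e > 0" "\<And>u. u \<in> C \<Longrightarrow> \<exists>B\<in>(\<lambda>u. ball u (d u)) ` C. ball u e \<subseteq> B"
    using Heine_Borel_lemma[OF C, of "(\<lambda>u. ball u (d u)) ` C"] by blast
   have near: "same u' u" if u: "u \<in> C" "u' \<in> RS" "dist u u' < e" for u u'
   proof -
    obtain v where v: "v \<in> C" "ball u e \<subseteq> ball v (d v)" using e(2)[OF u(1)] by blast
    have "u \<in> RS" using u(1) \<open>C \<subseteq> F\<close> F_RS by blast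
    moreover have "u \<in> ball u e" "u' \<in> ball u e" using e(1) u by auto
    ultimately have "same v u" "same v u'" using d(2)[OF v(1)] v(2) u(2) by (meson mem_ball subsetD)+
    then show ?thesis unfolding same_def by simp
   qed
   obtain \<eta> where \<eta>: "\<eta> > 0" "\<forall>i\<in>idx s. \<forall>x\<in>RS. \<forall>y\<in>RS. dist x y < \<eta> \<longrightarrow> dist (f i x) (f i y) < e"
    using uniform_continuity[OF e(1)] by blast
   have "same (f j y) (f j z)" if "z \<in> RS" "y \<in> RS" "f i z \<in> J" "dist y z < \<eta>" for z y
   proof (rule near)
    show "f j z \<in> C" using that by (auto simp: C_def)
    show "f j y \<in> RS" using f_RS[OF ij(3)] that by blast
    show "dist (f j z) (f j y) < e" using \<eta>(2) ij(3) that by (simp add: dist_commute)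
   qed
   then show ?thesis using \<eta>(1) by blast
  qed
  then obtain \<eta> where \<eta>: "\<eta> > 0" "\<And>z y. z \<in> RS \<Longrightarrow> y \<in> RS \<Longrightarrow> f i z \<in> J \<Longrightarrow> j \<noteq> i \<Longrightarrow> dist y z < \<eta> \<Longrightarrow> same (f j y) (f j z)" by blast
  show "\<exists>d>0. \<forall>d'. 0 < d' \<longrightarrow> d' \<le> d \<longrightarrow> (\<forall>z\<in>RS. \<forall>y\<in>RS. f (fst ij) z \<in> J \<longrightarrow> snd ij \<noteq> fst ij \<longrightarrow> dist y z < d' \<longrightarrow> same (f (snd ij) y) (f (snd ij) z))"
   unfolding ij(1) fst_conv snd_conv
  proof (intro exI[of _ \<eta>] conjI \<eta>(1) allI impI ballI)
   fix d' z y assume "d' \<le> \<eta>" "z \<in> RS" "y \<in> RS" "f i z \<in> J" "j \<noteq> i" "dist y z < d'"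
   then show "same (f j y) (f j z)" by (intro \<eta>(2)) auto
  qed
 qed
 then show ?thesis by auto
qed

end

context hyperbolic_minimal
begin

section \<open>Transport of coefficients along words\<close>

definition deg :: "(nat \<Rightarrow> nat) \<Rightarrow> nat" where "deg n = (\<Sum>i=1..s. n i)"

definition Lam :: "nat \<Rightarrow> (nat \<Rightarrow> nat) set" where
 "Lam N = {n. (\<forall>i. i \<notin> {1..s} \<longrightarrow> n i = 0) \<and> deg n \<le> N}"

definition supp :: "nat \<Rightarrow> ((nat \<Rightarrow> nat) \<Rightarrow> complex) \<Rightarrow> bool" where
 "supp N \<beta> \<longleftrightarrow> (\<forall>n. n \<notin> Lam N \<longrightarrow> \<beta> n = 0)"

text \<open>One step of the dynamics along the letter i, dual to the recursion of the derivatives.\<close>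
definition up :: "nat \<Rightarrow> ((nat \<Rightarrow> nat) \<Rightarrow> complex) \<Rightarrow> (nat \<Rightarrow> nat) \<Rightarrow> complex" where
 "up i \<beta> m = \<beta> m + (\<Sum>l\<in>{1..s}. vv i l * of_nat (m l + 1) * \<beta> (m(l := m l + 1))) / complex_of_real (wt s p i)"

primrec upw :: "nat list \<Rightarrow> ((nat \<Rightarrow> nat) \<Rightarrow> complex) \<Rightarrow> (nat \<Rightarrow> nat) \<Rightarrow> complex" where
 "upw [] \<beta> = \<beta>"
| "upw (i # w) \<beta> = upw w (up i \<beta>)"

primrec pw :: "nat list \<Rightarrow> real" where
 "pw [] = 1"
| "pw (i # w) = wt s p i * pw w"

definition Df :: "nat \<Rightarrow> ((nat \<Rightarrow> nat) \<Rightarrow> complex) \<Rightarrow> complex \<times> real \<Rightarrow> complex \<times> real \<Rightarrow> complex" where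
 "Df N \<beta> y z = (\<Sum>n\<in>Lam N. \<beta> n * (cf n y - cf n z))"

lemma finite_Lam: "finite (Lam N)"
proof (rule finite_subset)
 show "Lam N \<subseteq> {n. \<forall>i. (i \<in> {1..s} \<longrightarrow> n i \<in> {..N}) \<and> (i \<notin> {1..s} \<longrightarrow> n i = 0)}"
 proof safe
  fix n i assume n: "n \<in> Lam N" and i: "i \<in> {1..s}"
  have "n i \<le> deg n" unfolding deg_def using i by (intro member_le_sum) auto
  then show "n i \<le> N" using n by (simp add: Lam_def)
 qed (auto simp: Lam_def)
 show "finite {n. \<forall>i. (i \<in> {1..s} \<longrightarrow> n i \<in> {..N}) \<and> (i \<notin> {1..s} \<longrightarrow> n i = (0::nat))}"
  by (rule finite_set_of_finite_funs) auto
qed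

lemma deg_upd: "l \<in> {1..s} \<Longrightarrow> deg (n(l := k)) + n l = deg n + k"
proof -
 assume l: "l \<in> {1..s}"
 have "deg (n(l := k)) = k + (\<Sum>i\<in>{1..s} - {l}. (n(l := k)) i)" unfolding deg_def using l by (subst sum.remove[of _ l]) auto
 also have "(\<Sum>i\<in>{1..s} - {l}. (n(l := k)) i) = (\<Sum>i\<in>{1..s} - {l}. n i)" by (intro sum.cong) auto
 moreover have "deg n = n l + (\<Sum>i\<in>{1..s} - {l}. n i)" unfolding deg_def using l by (subst sum.remove[of _ l]) auto
 ultimately show ?thesis by simp
qed

lemma Lam_upd: "n \<in> Lam N \<Longrightarrow> l \<in> {1..s} \<Longrightarrow> n(l := k) \<in> Lam N \<longleftrightarrow> deg (n(l := k)) \<le> N"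
 by (auto simp: Lam_def)

lemma supp_raise: "supp N \<beta> \<Longrightarrow> l \<in> {1..s} \<Longrightarrow> N \<le> deg m \<Longrightarrow> \<beta> (m(l := m l + 1)) = 0"
 using deg_upd[of l m "m l + 1"] unfolding supp_def Lam_def by (auto dest!: spec[of _ "m(l := m l + 1)"])

lemma supp_mono: "supp N \<beta> \<Longrightarrow> N \<le> N' \<Longrightarrow> supp N' \<beta>"
 unfolding supp_def Lam_def by auto

lemma supp_up: assumes "supp N \<beta>" shows "supp N (up i \<beta>)"
 unfolding supp_def
proof (intro allI impI)
 fix m assume m: "m \<notin> Lam N"
 have "\<beta> (m(l := m l + 1)) = 0" if l: "l \<in> {1..s}" for l
 proof (cases "N \<le> deg m")
  case True
  then show ?thesis using supp_raise[OF assms l] by simp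
 next
  case False
  then have "\<not> (\<forall>i. i \<notin> {1..s} \<longrightarrow> m i = 0)" using m unfolding Lam_def by simp
  then obtain i where i: "i \<notin> {1..s}" "m i \<noteq> 0" by blast
  have "m(l := m l + 1) \<notin> Lam N"
  proof
   assume "m(l := m l + 1) \<in> Lam N"
   then have "\<forall>k. k \<notin> {1..s} \<longrightarrow> (m(l := m l + 1)) k = 0" unfolding Lam_def mem_Collect_eq by (rule conjunct1)
   from this[THEN spec, THEN mp, OF i(1)] show False using i(2) by (simp split: if_splits)
  qed
  then show ?thesis using assms unfolding supp_def by blast
 qed
 then have "(\<Sum>l\<in>{1..s}. vv i l * of_nat (m l + 1) * \<beta> (m(l := m l + 1))) = 0" by (intro sum.neutral) auto
 then show "up i \<beta> m = 0" using assms m unfolding up_def supp_def by simp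
qed

lemma supp_upw: "supp N \<beta> \<Longrightarrow> supp N (upw w \<beta>)"
 by (induction w arbitrary: \<beta>) (auto simp: supp_up)

text \<open>\<open>up\<close> adds to a coefficient only multiples of coefficients of degree one
  higher, so those of top degree do not change. This is why a non-trivial combination cannot
  degenerate along an orbit.\<close>

lemma up_top: assumes "supp d \<beta>" "d \<le> deg m" shows "up i \<beta> m = \<beta> m"
proof -
 have "(\<Sum>l\<in>{1..s}. vv i l * of_nat (m l + 1) * \<beta> (m(l := m l + 1))) = 0"
  using supp_raise[OF assms(1) _ assms(2)] by (intro sum.neutral) auto
 then show ?thesis by (simp add: up_def)
qed

lemma upw_top: "supp d \<beta> \<Longrightarrow> d \<le> deg m \<Longrightarrow> upw w \<beta> m = \<beta> m"
 by (induction w arbitrary: \<beta>) (auto simp: supp_up up_top)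

lemma upw_append: "upw (u @ w) \<beta> = upw w (upw u \<beta>)"
 by (induction u arbitrary: \<beta>) auto

text \<open>For i \<le> s the weight of letter i depends on x_i alone, so one step adds n_i
  \<beta>_n / p_i to the coefficient at n - e_i. The coefficient \<beta>_n has top degree and is
  unchanged, so k steps add k times this amount.\<close>

lemma upw_replicate: assumes \<beta>: "supp d \<beta>" and i: "i \<in> {1..s}" and n: "deg n = d" "n i \<ge> 1"
 shows "upw (replicate k i) \<beta> (n(i := n i - 1)) = \<beta> (n(i := n i - 1)) + of_nat k * (of_nat (n i) * \<beta> n / complex_of_real (wt s p i))"
 using \<beta>
proof (induction k arbitrary: \<beta>)
 case (Suc k)
 let ?m = "n(i := n i - 1)"
 have m: "?m(i := ?m i + 1) = n" "?m i + 1 = n i" using n by (auto simp: fun_eq_iff)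
 have "(\<Sum>l\<in>{1..s}. vv i l * of_nat (?m l + 1) * \<beta> (?m(l := ?m l + 1))) = (\<Sum>l\<in>{1..s}. if l = i then of_nat (n i) * \<beta> n else 0)"
 proof (intro sum.cong refl)
  fix l assume "l \<in> {1..s}"
  show "vv i l * of_nat (?m l + 1) * \<beta> (?m(l := ?m l + 1)) = (if l = i then of_nat (n i) * \<beta> n else 0)"
  proof (cases "l = i")
   case True
   show ?thesis unfolding True m using i by (simp add: vv_def)
  next
   case False
   then show ?thesis using i by (simp add: vv_def)
  qed
 qed
 also have "\<dots> = of_nat (n i) * \<beta> n" using i by (simp add: sum.delta)
 finally have u: "up i \<beta> ?m = \<beta> ?m + of_nat (n i) * \<beta> n / complex_of_real (wt s p i)" unfolding up_def by simp
 have t: "up i \<beta> n = \<beta> n" using up_top[OF Suc.prems] n(1) by simp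
 show ?case using Suc.IH[OF supp_up[OF Suc.prems, of i]] unfolding replicate_Suc upw.simps u t
  by (simp add: algebra_simps add_divide_distrib del: fun_upd_apply)
qed simp

lemma pw_pos: "word w \<Longrightarrow> 0 < pw w"
 by (induction w) (auto simp: wt_p_pos)

text \<open>The substitution m = n - e_l moves the lowering of the index from the increments to the
  coefficients. Terms with n l = 0 drop out through the factor n l.\<close>

lemma sum_shift:
 assumes \<beta>: "supp N \<beta>" and l: "l \<in> {1..s}"
 shows "(\<Sum>n\<in>Lam N. \<beta> n * (of_nat (n l) * v * d (n(l := n l - 1)))) = (\<Sum>m\<in>Lam N. (v * of_nat (m l + 1) * \<beta> (m(l := m l + 1))) * d m)"
proof -
 define g where "g n = \<beta> n * (of_nat (n l) * v * d (n(l := n l - 1)))" for n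
 define h where "h m = (v * of_nat (m l + 1) * \<beta> (m(l := m l + 1))) * d m" for m
 have "sum g (Lam N) = sum g {n \<in> Lam N. n l \<noteq> 0}" by (rule sum.mono_neutral_right) (auto simp: finite_Lam g_def)
 also have "\<dots> = sum h {m \<in> Lam N. m(l := m l + 1) \<in> Lam N}"
 proof (rule sum.reindex_bij_witness[where i = "\<lambda>m. m(l := m l + 1)" and j = "\<lambda>n. n(l := n l - 1)"])
  fix n assume n: "n \<in> {n \<in> Lam N. n l \<noteq> 0}"
  then show e: "(n(l := n l - 1))(l := (n(l := n l - 1)) l + 1) = n" by auto
  have "n(l := n l - 1) \<in> Lam N" using n l deg_upd[OF l, of n "n l - 1"] by (subst Lam_upd) (auto simp: Lam_def)
  then show "n(l := n l - 1) \<in> {m \<in> Lam N. m(l := m l + 1) \<in> Lam N}" using e n by auto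
  show "h (n(l := n l - 1)) = g n" unfolding g_def h_def e using n by simp
 qed auto
 also have "\<dots> = sum h (Lam N)" using \<beta> by (intro sum.mono_neutral_left) (auto simp: finite_Lam h_def supp_def)
 finally show ?thesis unfolding g_def h_def .
qed

lemma Df_step:
 assumes \<beta>: "supp N \<beta>" and yz: "y \<in> RS" "z \<in> RS" and i: "i \<in> idx s" and sm: "\<And>j. j \<in> idx s \<Longrightarrow> j \<noteq> i \<Longrightarrow> same (f j y) (f j z)"
 shows "Df N \<beta> y z = complex_of_real (wt s p i) * Df N (up i \<beta>) (f i y) (f i z)"
proof -
 define P where "P = complex_of_real (wt s p i)"
 have P: "P \<noteq> 0" using wt_p_pos[OF i] by (simp add: P_def)
 define d where "d n = cf n (f i y) - cf n (f i z)" for n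
 define S where "S m = (\<Sum>l\<in>{1..s}. vv i l * of_nat (m l + 1) * \<beta> (m(l := m l + 1)))" for m
 have "Df N \<beta> y z = (\<Sum>n\<in>Lam N. \<beta> n * (P * d n + (\<Sum>l\<in>{1..s}. of_nat (n l) * vv i l * d (n(l := n l - 1)))))"
  unfolding Df_def d_def P_def by (intro sum.cong refl arg_cong2[of _ _ _ _ "(*)"] cf_rec_diff[OF yz i sm])
 also have "\<dots> = (\<Sum>n\<in>Lam N. P * (\<beta> n * d n)) + (\<Sum>n\<in>Lam N. \<Sum>l\<in>{1..s}. \<beta> n * (of_nat (n l) * vv i l * d (n(l := n l - 1))))"
  by (simp only: distrib_left sum.distrib sum_distrib_left) (simp add: mult_ac)
 also have "(\<Sum>n\<in>Lam N. \<Sum>l\<in>{1..s}. \<beta> n * (of_nat (n l) * vv i l * d (n(l := n l - 1)))) =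
   (\<Sum>l\<in>{1..s}. \<Sum>m\<in>Lam N. (vv i l * of_nat (m l + 1) * \<beta> (m(l := m l + 1))) * d m)"
  by (subst sum.swap) (intro sum.cong refl sum_shift[OF \<beta>])
 also have "\<dots> = (\<Sum>m\<in>Lam N. S m * d m)" unfolding S_def sum_distrib_right by (rule sum.swap)
 finally have "Df N \<beta> y z = (\<Sum>n\<in>Lam N. P * (\<beta> n * d n)) + (\<Sum>m\<in>Lam N. S m * d m)" .
 also have "\<dots> = P * (\<Sum>n\<in>Lam N. (\<beta> n + S n / P) * d n)"
  using P by (simp add: sum_distrib_left distrib_right distrib_left sum.distrib mult_ac)
 finally show ?thesis unfolding Df_def d_def up_def S_def P_def .
qed

definition sepc :: "real \<Rightarrow> bool" where
 "sepc \<eta> \<longleftrightarrow> \<eta> > 0 \<and> (\<forall>i\<in>idx s. \<forall>j\<in>idx s. \<forall>z\<in>RS. \<forall>y\<in>RS. f i z \<in> J \<longrightarrow> j \<noteq> i \<longrightarrow> dist y z < \<eta> \<longrightarrow> same (f j y) (f j z))"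

lemma Df_word:
 assumes \<eta>: "sepc \<eta>"
 shows "supp N \<beta> \<Longrightarrow> word w \<Longrightarrow> y \<in> RS \<Longrightarrow> z \<in> RS \<Longrightarrow> wcomp f w z \<in> J \<Longrightarrow>
  (\<And>j. j < length w \<Longrightarrow> odist j w y z < \<eta>) \<Longrightarrow>
  Df N \<beta> y z = complex_of_real (pw w) * Df N (upw w \<beta>) (wcomp f w y) (wcomp f w z)"
proof (induction w arbitrary: y z \<beta>)
 case (Cons i w)
 have i: "i \<in> idx s" "word w" "wcomp f w (f i z) \<in> J" using Cons.prems by auto
 have fz: "f i z \<in> J" using J_backward[OF f_RS[OF i(1)] i(2,3)] .
 have "dist y z < \<eta>" using Cons.prems(6)[of 0] by simp
 then have sm: "same (f j y) (f j z)" if "j \<in> idx s" "j \<noteq> i" for j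
  using \<eta> i(1) that Cons.prems(3,4) fz unfolding sepc_def by blast
 have "Df N (up i \<beta>) (f i y) (f i z) = complex_of_real (pw w) * Df N (upw w (up i \<beta>)) (wcomp f w (f i y)) (wcomp f w (f i z))"
 proof (rule Cons.IH)
  fix j assume "j < length w"
  then show "dist (wcomp f (take j w) (f i y)) (wcomp f (take j w) (f i z)) < \<eta>" using Cons.prems(6)[of "Suc j"] by simp
 qed (use Cons.prems i f_RS[OF i(1)] supp_up in auto)
 then show ?case using Df_step[OF Cons.prems(1,3,4) i(1) sm] by (simp add: mult_ac)
qed simp

text \<open>The weights kappa to the degree absorb the lower order terms of the recursion, so that only a factor
 (1 + eps) is lost in each step.\<close>
lemma diff_growth:
 assumes \<eta>: "sepc \<eta>" and \<epsilon>: "\<epsilon> > 0"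
 shows "\<exists>K\<ge>0. \<forall>n\<in>Lam N. \<forall>w y z. word w \<longrightarrow> y \<in> RS \<longrightarrow> z \<in> RS \<longrightarrow> wcomp f w z \<in> J \<longrightarrow>
  (\<forall>j<length w. odist j w y z < \<eta>) \<longrightarrow> cmod (cf n y - cf n z) \<le> K * ((1 + \<epsilon>) ^ length w * pw w)"
proof -
 obtain m where m: "m > 0" "m < 1" "\<And>i. i \<in> idx s \<Longrightarrow> m \<le> wt s p i" using wt_p_min by blast
 \<comment> \<open>Lower order terms carry a weight smaller by the factor \<kappa> and their
   multiplicities add up to at most N. By this choice together they contribute at most \<epsilon> *
   m, and so at most \<epsilon> times the weight of the letter.\<close>
 define \<kappa> where "\<kappa> = max 1 (real N / (\<epsilon> * m))"
 have \<kappa>: "\<kappa> \<ge> 1" "real N / \<kappa> \<le> \<epsilon> * m" using m \<epsilon> by (auto simp: \<kappa>_def max_def field_simps)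
 obtain B where B: "\<And>n y. y \<in> RS \<Longrightarrow> cmod (cf n y) \<le> B n" using cf_bounded by metis
 have B0: "B n \<ge> 0" for n using B[of _ n] idx_nonempty L_props order_trans[OF norm_ge_zero] by blast
 define M where "M = 2 * (\<Sum>n\<in>Lam N. B n)"
 have M: "M \<ge> 0" using B0 by (simp add: M_def sum_nonneg)
 have base: "cmod (cf n y - cf n z) \<le> M" if "n \<in> Lam N" "y \<in> RS" "z \<in> RS" for n y z
 proof -
  have "cmod (cf n y - cf n z) \<le> B n + B n" using norm_triangle_ineq4[of "cf n y" "cf n z"] B[OF that(2), of n] B[OF that(3), of n] by linarith
  also have "B n \<le> (\<Sum>n\<in>Lam N. B n)" using that(1) B0 finite_Lam by (intro member_le_sum) auto
  finally show ?thesis by (simp add: M_def)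
 qed
 have main: "word w \<Longrightarrow> y \<in> RS \<Longrightarrow> z \<in> RS \<Longrightarrow> wcomp f w z \<in> J \<Longrightarrow>
  (\<forall>j<length w. odist j w y z < \<eta>) \<Longrightarrow> n \<in> Lam N \<Longrightarrow>
   cmod (cf n y - cf n z) \<le> M * \<kappa> ^ deg n * ((1 + \<epsilon>) ^ length w * pw w)" for n w y z
 proof (induction w arbitrary: y z n)
  case Nil
  have "M * 1 \<le> M * \<kappa> ^ deg n" using \<kappa> M by (intro mult_left_mono) auto
  then show ?case using base[OF Nil(6,2,3)] by simp
 next
  case (Cons i w)
  have i: "i \<in> idx s" "word w" "wcomp f w (f i z) \<in> J" using Cons.prems by auto
  have fz: "f i z \<in> J" using J_backward[OF f_RS[OF i(1)] i(2,3)] .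
  have "dist y z < \<eta>" using Cons.prems(5) by (auto dest: spec[of _ 0])
  then have sm: "same (f j y) (f j z)" if "j \<in> idx s" "j \<noteq> i" for j
   using \<eta> i(1) that Cons.prems(2,3) fz unfolding sepc_def by blast
  have tr: "\<forall>j<length w. dist (wcomp f (take j w) (f i y)) (wcomp f (take j w) (f i z)) < \<eta>"
  proof (intro allI impI)
   fix j assume "j < length w"
   then show "dist (wcomp f (take j w) (f i y)) (wcomp f (take j w) (f i z)) < \<eta>" using Cons.prems(5) by (auto dest: spec[of _ "Suc j"])
  qed
  define E where "E = (1 + \<epsilon>) ^ length w * pw w"
  have E: "E \<ge> 0" using \<epsilon> pw_pos[OF i(2)] by (simp add: E_def)
  define d where "d n = cf n (f i y) - cf n (f i z)" for n
  have IH: "cmod (d n) \<le> M * \<kappa> ^ deg n * E" if "n \<in> Lam N" for n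
   unfolding d_def E_def using Cons.IH[OF i(2) f_RS[OF i(1)] f_RS[OF i(1)] i(3) tr that] .
  have wpos: "wt s p i > 0" by (rule wt_p_pos[OF i(1)])
  have T: "cmod (of_nat (n l) * vv i l * d (n(l := n l - 1))) \<le> real (n l) * (M * \<kappa> ^ deg n * E / \<kappa>)" if l: "l \<in> {1..s}" for l
  proof (cases "n l = 0")
   case False
   have dg: "deg (n(l := n l - 1)) + 1 = deg n" using deg_upd[OF l, of n "n l - 1"] False by simp
   then have "n(l := n l - 1) \<in> Lam N" using Lam_upd[OF Cons.prems(6) l] Cons.prems(6) by (simp add: Lam_def)
   then have "cmod (d (n(l := n l - 1))) \<le> M * \<kappa> ^ deg (n(l := n l - 1)) * E" by (rule IH)
   also have "\<dots> = M * \<kappa> ^ deg n * E / \<kappa>" unfolding dg[symmetric] using \<kappa> by (simp del: fun_upd_apply)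
   finally have "cmod (vv i l) * cmod (d (n(l := n l - 1))) \<le> 1 * (M * \<kappa> ^ deg n * E / \<kappa>)"
    using norm_vv by (intro mult_mono) auto
   then have "real (n l) * (cmod (vv i l) * cmod (d (n(l := n l - 1)))) \<le> real (n l) * (M * \<kappa> ^ deg n * E / \<kappa>)"
    by (intro mult_left_mono) auto
   then show ?thesis by (simp only: norm_mult norm_of_nat mult.assoc)
  qed simp
  have "cf n y - cf n z = complex_of_real (wt s p i) * d n + (\<Sum>l\<in>{1..s}. of_nat (n l) * vv i l * d (n(l := n l - 1)))"
   unfolding d_def by (rule cf_rec_diff[OF Cons.prems(2,3) i(1) sm])
  then have "cmod (cf n y - cf n z) \<le> cmod (complex_of_real (wt s p i) * d n) + (\<Sum>l\<in>{1..s}. cmod (of_nat (n l) * vv i l * d (n(l := n l - 1))))"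
   using order_trans[OF norm_triangle_ineq add_left_mono[OF norm_sum]] by simp
  also have "\<dots> \<le> wt s p i * (M * \<kappa> ^ deg n * E) + (\<Sum>l\<in>{1..s}. real (n l) * (M * \<kappa> ^ deg n * E / \<kappa>))"
  proof (intro add_mono sum_mono T)
   show "cmod (complex_of_real (wt s p i) * d n) \<le> wt s p i * (M * \<kappa> ^ deg n * E)"
    unfolding norm_mult norm_of_real abs_of_pos[OF wpos] using wpos IH[OF Cons.prems(6)] by (intro mult_left_mono) auto
  qed
  also have "(\<Sum>l\<in>{1..s}. real (n l) * (M * \<kappa> ^ deg n * E / \<kappa>)) = real (deg n) / \<kappa> * (M * \<kappa> ^ deg n * E)"
   unfolding sum_distrib_right[symmetric] by (simp add: deg_def)
  also have "\<dots> \<le> (\<epsilon> * wt s p i) * (M * \<kappa> ^ deg n * E)"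
  proof (rule mult_right_mono)
   have "real (deg n) / \<kappa> \<le> real N / \<kappa>" using Cons.prems(6) \<kappa> by (intro divide_right_mono) (auto simp: Lam_def)
   also have "\<dots> \<le> \<epsilon> * m" by (rule \<kappa>)
   also have "\<dots> \<le> \<epsilon> * wt s p i" using m(3)[OF i(1)] \<epsilon> by simp
   finally show "real (deg n) / \<kappa> \<le> \<epsilon> * wt s p i" .
   show "0 \<le> M * \<kappa> ^ deg n * E" using M \<kappa> E by simp
  qed
  finally have "cmod (cf n y - cf n z) \<le> wt s p i * (M * \<kappa> ^ deg n * E) + \<epsilon> * wt s p i * (M * \<kappa> ^ deg n * E)" by simp
  also have "\<dots> = M * \<kappa> ^ deg n * ((1 + \<epsilon>) ^ length (i # w) * pw (i # w))" by (simp add: E_def algebra_simps)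
  finally show ?case .
 qed
 show ?thesis
 proof (intro exI[of _ "M * \<kappa> ^ N"] conjI ballI allI impI)
  show "0 \<le> M * \<kappa> ^ N" using M \<kappa> by simp
  fix n w y z assume n: "n \<in> Lam N" and w: "word w" and a: "y \<in> RS" "z \<in> RS" "wcomp f w z \<in> J"
   "\<forall>j<length w. odist j w y z < \<eta>"
  have "cmod (cf n y - cf n z) \<le> M * \<kappa> ^ deg n * ((1 + \<epsilon>) ^ length w * pw w)" by (rule main[OF w a n])
  also have "\<dots> \<le> M * \<kappa> ^ N * ((1 + \<epsilon>) ^ length w * pw w)"
  proof (intro mult_right_mono mult_left_mono M power_increasing \<kappa>)
   show "deg n \<le> N" using n by (simp add: Lam_def)
   show "0 \<le> (1 + \<epsilon>) ^ length w * pw w" using \<epsilon> pw_pos[OF w] by simp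
  qed
  finally show "cmod (cf n y - cf n z) \<le> M * \<kappa> ^ N * ((1 + \<epsilon>) ^ length w * pw w)" .
 qed
qed

end

section \<open>Linear independence of the derivatives\<close>

lemma bounded_sequences_diagonal:
 fixes g :: "nat \<Rightarrow> 'a \<Rightarrow> complex"
 assumes "finite S" "\<And>n. n \<in> S \<Longrightarrow> bounded (range (\<lambda>k. g k n))"
 shows "\<exists>l r. strict_mono (r :: nat \<Rightarrow> nat) \<and> (\<forall>n\<in>S. (\<lambda>k. g (r k) n) \<longlonglongrightarrow> l n)"
 using assms
proof (induction S rule: finite_induct)
 case empty
 show ?case using strict_mono_id by auto
next
 case (insert a S)
 obtain l r where r: "strict_mono (r :: nat \<Rightarrow> nat)" "\<forall>n\<in>S. (\<lambda>k. g (r k) n) \<longlonglongrightarrow> l n" using insert by auto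
 have "bounded (range (\<lambda>k. g (r k) a))" by (rule bounded_subset[OF insert.prems[of a]]) auto
 then obtain L r' where r': "strict_mono (r' :: nat \<Rightarrow> nat)" "((\<lambda>k. g (r k) a) \<circ> r') \<longlonglongrightarrow> L" using bounded_imp_convergent_subsequence by blast
 have "(\<lambda>k. g ((r \<circ> r') k) n) \<longlonglongrightarrow> (l(a := L)) n" if "n \<in> insert a S" for n
 proof (cases "n = a")
  case True
  then show ?thesis using r'(2) by (simp add: o_def)
 next
  case False
  then have "(\<lambda>k. g (r k) n) \<longlonglongrightarrow> l n" using r(2) that by blast
  from LIMSEQ_subseq_LIMSEQ[OF this r'(1)] show ?thesis using False by (simp add: o_def)
 qed
 then show ?case using strict_mono_o[OF r(1) r'(1)] by blast
qed

lemma connected_locally_constant: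
 fixes g :: "'a::metric_space \<Rightarrow> 'b"
 assumes S: "connected S" and loc: "\<And>x. x \<in> S \<Longrightarrow> \<exists>r>0. \<forall>y\<in>S. dist y x < r \<longrightarrow> g y = g x"
  and "a \<in> S" "b \<in> S"
 shows "g a = g b"
proof -
 have "openin (top_of_set S) {x \<in> S. g x = c}" for c
  unfolding openin_euclidean_subtopology_iff using loc by fastforce
 then have 1: "openin (top_of_set S) {x \<in> S. g x = g a}" by blast
 have "openin (top_of_set S) (\<Union>c\<in>-{g a}. {x \<in> S. g x = c})"
  using \<open>\<And>c. openin (top_of_set S) {x \<in> S. g x = c}\<close> by blast
 moreover have "(\<Union>c\<in>-{g a}. {x \<in> S. g x = c}) = {x \<in> S. g x \<noteq> g a}" by blast
 ultimately have 2: "openin (top_of_set S) {x \<in> S. g x \<noteq> g a}" by simp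
 have "S \<subseteq> {x \<in> S. g x = g a} \<union> {x \<in> S. g x \<noteq> g a}" "{x \<in> S. g x = g a} \<inter> {x \<in> S. g x \<noteq> g a} = {}" by blast+
 then have "{x \<in> S. g x = g a} = {} \<or> {x \<in> S. g x \<noteq> g a} = {}"
  using S 1 2 unfolding connected_openin by blast
 then have "b \<notin> {x \<in> S. g x \<noteq> g a}" using assms(3) by auto
 then show ?thesis using assms(4) by auto
qed

context hyperbolic_minimal
begin

text \<open>A linear relation among the C_n, up to an additive constant, on the ball of radius r
  about z.\<close>

definition kill :: "nat \<Rightarrow> real \<Rightarrow> complex \<times> real \<Rightarrow> ((nat \<Rightarrow> nat) \<Rightarrow> complex) \<Rightarrow> bool" where
 "kill N r z \<beta> \<longleftrightarrow> (\<forall>y\<in>RS. dist y z < r \<longrightarrow> Df N \<beta> y z = 0)"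

lemma Df_diff: "Df N \<beta> y z = Df N \<beta> y x - Df N \<beta> z x"
 unfolding Df_def by (simp add: sum_subtractf[symmetric] right_diff_distrib)

lemma cf_zero: "cf (\<lambda>_. 0) y = Hlim pC y"
proof -
 have "cmpd js (\<lambda>_. 0) H = H" for js H by (induction js) auto
 then show ?thesis by (simp add: cf_def)
qed

lemma cf_zero_minimal: "y \<in> L \<Longrightarrow> cf (\<lambda>_. 0) y = 1" "y \<in> L' \<Longrightarrow> cf (\<lambda>_. 0) y = 0"
proof -
 show "y \<in> L \<Longrightarrow> cf (\<lambda>_. 0) y = 1" using L_A1 afun_absorbed(1)[of y _ pC] unfolding cf_zero Hlim_def by auto
 show "y \<in> L' \<Longrightarrow> cf (\<lambda>_. 0) y = 0" using L'_A0 afun_absorbed(2)[of y _ pC] unfolding cf_zero Hlim_def by auto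
qed

text \<open>At the scale r0 every point near an orbit in the Julia set is shadowed within the separation constant eta.\<close>
definition scale :: "real \<Rightarrow> real \<Rightarrow> real \<Rightarrow> real \<Rightarrow> bool" where
 "scale \<eta> r0 C \<theta> \<longleftrightarrow> r0 > 0 \<and> C > 0 \<and> 0 < \<theta> \<and> \<theta> < 1 \<and> (\<forall>w z y'. word w \<longrightarrow> z \<in> RS \<longrightarrow> wcomp f w z \<in> J \<longrightarrow> y' \<in> RS \<longrightarrow> dist y' (wcomp f w z) < r0 \<longrightarrow>
   (\<exists>y\<in>RS. wcomp f w y = y' \<and> dist y z \<le> C * \<theta> ^ length w \<and> (\<forall>j\<le>length w. odist j w y z < \<eta>)))"

lemma good_scale:
 assumes \<eta>: "\<eta> > 0"
 shows "\<exists>r0 C \<theta>. scale \<eta> r0 C \<theta>"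
proof -
 obtain r1 C \<theta> where c: "r1 > 0" "C > 0" "0 < \<theta>" "\<theta> < 1"
  and pre: "\<forall>w y y'. word w \<longrightarrow> y \<in> J \<longrightarrow> y' \<in> RS \<longrightarrow> dist y y' < r1 \<longrightarrow> shadow C \<theta> w y y'"
  using preimages_contract by blast
 \<comment> \<open>The entries give the range of shadowing, the bound C * \<theta>^k without a
   further factor, and orbits that stay within C * r0 \<le> \<eta>.\<close>
 define r0 where "r0 = min r1 (min 1 (\<eta> / C))"
 have "r0 > 0" "r0 \<le> r1" "r0 \<le> 1" "r0 \<le> \<eta> / C" using c \<eta> by (auto simp: r0_def)
 then have r0: "r0 > 0" "r0 \<le> r1" "r0 \<le> 1" "C * r0 \<le> \<eta>" using c by (auto simp: field_simps)
 have "\<exists>y\<in>RS. wcomp f w y = y' \<and> dist y z \<le> C * \<theta> ^ length w \<and> (\<forall>j\<le>length w. odist j w y z < \<eta>)"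
  if w: "word w" and z: "z \<in> RS" "wcomp f w z \<in> J" and y': "y' \<in> RS" "dist y' (wcomp f w z) < r0" for w z y'
 proof -
  define t where "t = dist y' (wcomp f w z)"
  have t: "0 \<le> t" "t < r0" using y' by (auto simp: t_def)
  have "dist y' (wcomp f w z) < r1" using y' r0 by simp
  then have "dist (wcomp f w z) y' < r1" by (simp add: dist_commute)
  from pre[rule_format, OF w z(2) y'(1) this, THEN conjunct1, THEN bspec, OF z(1), THEN mp, OF refl]
  obtain y where "y \<in> RS" "wcomp f w y = y'" "\<forall>j\<le>length w. odist j w z y \<le> C * \<theta> ^ (length w - j) * dist (wcomp f w z) y'" by blast
  then have y: "y \<in> RS" "wcomp f w y = y'" "\<And>j. j \<le> length w \<Longrightarrow> odist j w y z \<le> C * \<theta> ^ (length w - j) * t"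
   by (auto simp: t_def dist_commute)
  have "C * \<theta> ^ length w * t \<le> C * \<theta> ^ length w * 1" using t r0 c by (intro mult_left_mono) auto
  then have "dist y z \<le> C * \<theta> ^ length w" using y(3)[of 0] by simp
  moreover have "odist j w y z < \<eta>" if "j \<le> length w" for j
  proof -
   have "\<theta> ^ (length w - j) \<le> 1" using c by (intro power_le_one) auto
   then have "C * \<theta> ^ (length w - j) * t \<le> C * 1 * t" using c t by (intro mult_right_mono mult_left_mono) auto
   also have "\<dots> < C * r0" using c t by simp
   finally show ?thesis using y(3)[OF that] r0 by linarith
  qed
  ultimately show ?thesis using y(1,2) by blast
 qed
 then have "scale \<eta> r0 C \<theta>" unfolding scale_def using r0(1) c by blast
 then show ?thesis by blast
qed

lemma scaleD:
 assumes "scale \<eta> r0 C \<theta>" "word w" "z \<in> RS" "wcomp f w z \<in> J" "y' \<in> RS" "dist y' (wcomp f w z) < r0"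
 obtains y where "y \<in> RS" "wcomp f w y = y'" "dist y z \<le> C * \<theta> ^ length w" "\<And>j. j \<le> length w \<Longrightarrow> odist j w y z < \<eta>"
 using assms unfolding scale_def by meson

text \<open>A ball of the universal radius r0 about f_w(z) pulls back along a long word into the
  ball of radius r about z, and the factor \<open>pw w\<close> is positive. A relation at any small
  scale thus becomes a relation at scale r0.\<close>

lemma kill_forward:
 assumes \<eta>: "sepc \<eta>" and sc: "scale \<eta> r0 C \<theta>" and \<beta>: "supp N \<beta>" and r: "r > 0"
 shows "\<exists>k. \<forall>z w. kill N r z \<beta> \<longrightarrow> k \<le> length w \<longrightarrow> word w \<longrightarrow> z \<in> RS \<longrightarrow> wcomp f w z \<in> J \<longrightarrow> kill N r0 (wcomp f w z) (upw w \<beta>)"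
proof -
 have c: "C > 0" "0 < \<theta>" "\<theta> < 1" using sc by (auto simp: scale_def)
 obtain k where k: "\<theta> ^ k < r / C" using real_arch_pow_inv[of "r / C" \<theta>] r c by auto
 have "kill N r0 (wcomp f w z) (upw w \<beta>)"
  if kl: "kill N r z \<beta>" and w: "k \<le> length w" "word w" and z: "z \<in> RS" "wcomp f w z \<in> J" for z w
  unfolding kill_def
 proof (intro ballI impI)
  fix y' assume y': "y' \<in> RS" "dist y' (wcomp f w z) < r0"
  obtain y where y: "y \<in> RS" "wcomp f w y = y'" "dist y z \<le> C * \<theta> ^ length w" "\<And>j. j \<le> length w \<Longrightarrow> odist j w y z < \<eta>"
   using scaleD[OF sc w(2) z y'] by blast
  have "C * \<theta> ^ length w \<le> C * \<theta> ^ k" using c w(1) by (intro mult_left_mono power_decreasing) auto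
  also have "\<dots> < r" using k c by (simp add: field_simps)
  finally have "Df N \<beta> y z = 0" using kl y(1,3) unfolding kill_def by force
  moreover have "Df N \<beta> y z = complex_of_real (pw w) * Df N (upw w \<beta>) (wcomp f w y) (wcomp f w z)"
   by (rule Df_word[OF \<eta> \<beta> w(2) y(1) z]) (use y(4) in auto)
  ultimately show "Df N (upw w \<beta>) y' (wcomp f w z) = 0" using pw_pos[OF w(2)] y(2) by simp
 qed
 then show ?thesis by blast
qed

text \<open>In degree 0 the combination is a non-zero multiple of T. It is locally constant near J
  by assumption and near F by \<open>same_near\<close>, hence constant on the connected sphere,
  whereas T is 1 on L and 0 on L'.\<close>

lemma no_kill_0: assumes b: "\<beta> (\<lambda>_. 0) \<noteq> 0" and \<beta>: "supp 0 \<beta>" and k: "\<And>y. y \<in> J \<Longrightarrow> kill N r0 y \<beta>" and r0: "r0 > 0"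
 shows False
proof -
 have D: "Df N \<beta> y z = \<beta> (\<lambda>_. 0) * (cf (\<lambda>_. 0) y - cf (\<lambda>_. 0) z)" for y z
 proof -
  have z: "(\<lambda>_. 0) \<in> Lam N" by (simp add: Lam_def deg_def)
  have "\<beta> n = 0" if "n \<noteq> (\<lambda>_. 0)" for n
  proof -
   have "n \<notin> Lam 0"
   proof
    assume "n \<in> Lam 0"
    then have "n i = 0" for i by (cases "i \<in> {1..s}") (auto simp: Lam_def deg_def)
    then show False using that by auto
   qed
   then show ?thesis using \<beta> unfolding supp_def by blast
  qed
  then have "(\<Sum>n\<in>Lam N - {\<lambda>_. 0}. \<beta> n * (cf n y - cf n z)) = 0" by (intro sum.neutral) auto
  then show ?thesis unfolding Df_def using sum.remove[OF finite_Lam z, of "\<lambda>n. \<beta> n * (cf n y - cf n z)"] by simp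
 qed
 have "\<exists>r>0. \<forall>y\<in>RS. dist y x < r \<longrightarrow> cf (\<lambda>_. 0) y = cf (\<lambda>_. 0) x" if x: "x \<in> RS" for x
 proof (cases "x \<in> J")
  case True
  show ?thesis using k[OF True] r0 b unfolding kill_def D by (intro exI[of _ r0]) auto
 next
  case False
  then have "x \<in> F" using J_iff[OF x] by blast
  then obtain d where "d > 0" "\<forall>y\<in>RS. dist x y < d \<longrightarrow> same x y" using same_near by blast
  then show ?thesis using cf_same by (metis dist_commute)
 qed
 moreover obtain a a' where a: "a \<in> L" "a' \<in> L'" using L L' unfolding minimal_set_def by blast
 moreover have "a \<in> RS" "a' \<in> RS" using L L' a unfolding minimal_set_def by blast+
 ultimately have "cf (\<lambda>_. 0) a = cf (\<lambda>_. 0) a'" using connected_locally_constant[OF connected_RS, of "cf (\<lambda>_. 0)" a a'] by blast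
 then show False using cf_zero_minimal a by auto
qed

text \<open>Iterating one letter i adds a fixed nonzero amount to a coefficient of submaximal degree, while recurrence of the
 backward orbit makes two of the iterates kill on a common ball; their difference has smaller degree.\<close>
lemma independence:
 assumes \<eta>: "sepc \<eta>" and sc: "scale \<eta> r0 C \<theta>"
 shows "d \<le> N \<Longrightarrow> supp d \<beta> \<Longrightarrow> z \<in> J \<Longrightarrow> r > 0 \<Longrightarrow> kill N r z \<beta> \<Longrightarrow> \<beta> = (\<lambda>_. 0)"
proof (induction d arbitrary: \<beta> z r rule: less_induct)
 case (less d)
 have r0: "r0 > 0" using sc by (simp add: scale_def)
 have dN: "d - 1 \<le> N" using less.prems(1) by linarith
 have suppN: "supp N \<beta>" using supp_mono[OF less.prems(2,1)] .
 show ?case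
 proof (rule ccontr)
  assume nz: "\<beta> \<noteq> (\<lambda>_. 0)"
  \<comment> \<open>Without a coefficient of degree exactly d the induction hypothesis for d - 1
    applies; for d = 0 there would be no non-zero coefficient at all.\<close>
  have ex: "\<exists>n\<in>Lam d. deg n = d \<and> \<beta> n \<noteq> 0"
  proof (rule ccontr)
   assume neg: "\<not> ?thesis"
   show False
   proof (cases "d = 0")
    case True
    have "\<beta> n = 0" for n
    proof (cases "n \<in> Lam d")
     case True
     then have "deg n = d" using \<open>d = 0\<close> by (simp add: Lam_def)
     then show ?thesis using neg True by blast
    next
     case False
     then show ?thesis using less.prems(2) unfolding supp_def by blast
    qed
    then show False using nz by auto
   next
    case False
    have "supp (d - 1) \<beta>"
     unfolding supp_def
    proof (intro allI impI)
     fix n assume n: "n \<notin> Lam (d - 1)"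
     show "\<beta> n = 0"
     proof (cases "n \<in> Lam d")
      case True
      then have "deg n = d" using n by (auto simp: Lam_def)
      then show ?thesis using neg True by blast
     next
      case False
      then show ?thesis using less.prems(2) unfolding supp_def by blast
     qed
    qed
    then show False using less.IH[OF _ dN _ less.prems(3,4,5)] False nz by auto
   qed
  qed
  have half: "kill N (r / 2) x \<beta>" if "x \<in> RS" "dist z x < r / 2" for x
   unfolding kill_def
  proof (intro ballI impI)
   fix y assume y: "y \<in> RS" "dist y x < r / 2"
   have "dist x z < r" using that less.prems(4) by (simp add: dist_commute)
   moreover have "dist y z < r" using dist_triangle[of y z x] y that by (simp add: dist_commute)
   ultimately show "Df N \<beta> y x = 0" using less.prems(5) that(1) y(1) Df_diff[of N \<beta> y x z] unfolding kill_def by simp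
  qed
  have r2: "r / 2 > 0" using less.prems by simp
  obtain k where k: "\<And>z w. kill N (r / 2) z \<beta> \<Longrightarrow> k \<le> length w \<Longrightarrow> word w \<Longrightarrow> z \<in> RS \<Longrightarrow> wcomp f w z \<in> J \<Longrightarrow>
    kill N r0 (wcomp f w z) (upw w \<beta>)"
   using kill_forward[OF \<eta> sc suppN r2] by blast
  have reach: "\<exists>w x. word w \<and> wcomp f w x = y \<and> x \<in> RS \<and> kill N (r / 2) x \<beta> \<and> k \<le> length w" if y: "y \<in> J" for y
  proof -
   obtain x w where "x \<in> RS" "dist z x < r / 2" "word w" "k \<le> length w" "wcomp f w x = y"
    using backward_orbit_dense[OF less.prems(3) r2 y] by blast
   then show ?thesis using half by blast
  qed
  show False
  proof (cases "d = 0")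
   case True
   have "kill N r0 y \<beta>" if y: "y \<in> J" for y
   proof -
    obtain w x where w: "word w" "wcomp f w x = y" "x \<in> RS" "kill N (r / 2) x \<beta>" "k \<le> length w" using reach[OF y] by blast
    have "upw w \<beta> = \<beta>" using upw_top[OF less.prems(2)] True by auto
    then show ?thesis using k[OF w(4,5,1,3)] w(2) y by simp
   qed
   moreover obtain n where n: "n \<in> Lam 0" "\<beta> n \<noteq> 0" using ex unfolding True by blast
   moreover have "n = (\<lambda>_. 0)"
   proof
    fix i show "n i = 0" using n(1) by (cases "i \<in> {1..s}") (auto simp: Lam_def deg_def)
   qed
   ultimately show False using no_kill_0[of \<beta> N r0] less.prems(2) True r0 by auto
  next
   case False
   obtain n where n: "n \<in> Lam d" "deg n = d" "\<beta> n \<noteq> 0" using ex by blast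
   obtain i where i: "i \<in> {1..s}" "n i \<ge> 1"
   proof -
    have "(\<Sum>i=1..s. n i) \<noteq> 0" using n(2) False by (simp add: deg_def)
    then obtain i where "i \<in> {1..s}" "n i \<noteq> 0" by (meson sum.neutral)
    then show ?thesis using that by auto
   qed
   have ii: "i \<in> idx s" using i by (auto simp: idx_def)
   have step: "\<exists>x'\<in>J. f i x' = x" if "x \<in> J" for x
   proof -
    have "x \<in> f i ` RS" unfolding onto_f[OF ii] using that J_RS by (rule subsetD[rotated])
    then obtain x' where x': "x' \<in> RS" "f i x' = x" by blast
    have "x' \<in> J" by (rule J_backward[OF x'(1), of "[i]"]) (use ii that x'(2) in simp_all)
    then show ?thesis using x'(2) by blast
   qed
   then obtain g where g: "\<And>x. x \<in> J \<Longrightarrow> g x \<in> J" "\<And>x. x \<in> J \<Longrightarrow> f i (g x) = x"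
   proof -
    have "\<forall>x\<in>J. \<exists>x'. x' \<in> J \<and> f i x' = x" using step by blast
    from bchoice[OF this] that show ?thesis by blast
   qed
   define X where "X a = (g ^^ a) z" for a
   have XJ: "X a \<in> J" for a by (induction a) (auto simp: X_def less.prems(3) g(1))
   have XR: "X a \<in> RS" for a using XJ J_RS by blast
   have Xf: "f i (X (Suc a)) = X a" for a using g(2)[OF XJ[of a]] by (simp add: X_def)
   have Xw: "wcomp f (replicate k i) (X (a + k)) = X a" for a k
    by (induction k) (auto simp: Xf)
   \<comment> \<open>Recurrence: compactness of J provides two points of the backward orbit that are
     closer than r0 / 2.\<close>
   obtain lim \<phi> where \<phi>: "strict_mono (\<phi> :: nat \<Rightarrow> nat)" "(X \<circ> \<phi>) \<longlonglongrightarrow> lim"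
    using compact_J[unfolded compact_eq_seq_compact_metric seq_compact_def, rule_format, of X] XJ by blast
   have "Cauchy (X \<circ> \<phi>)" using \<phi>(2) by (rule LIMSEQ_imp_Cauchy)
   then obtain M where "\<forall>m\<ge>M. \<forall>n\<ge>M. dist ((X \<circ> \<phi>) m) ((X \<circ> \<phi>) n) < r0 / 2" unfolding Cauchy_def using r0 by (meson half_gt_zero)
   then have dX: "dist (X (\<phi> (Suc M))) (X (\<phi> M)) < r0 / 2" by simp
   define a b where "a = \<phi> M" and "b = \<phi> (Suc M)"
   have ab: "a < b" using \<phi>(1) by (simp add: a_def b_def strict_mono_def)
   obtain w x where w: "word w" "wcomp f w x = X b" "x \<in> RS" "kill N (r / 2) x \<beta>" "k \<le> length w" using reach[OF XJ] by blast
   define \<gamma> where "\<gamma> = upw w \<beta>"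
   have \<gamma>: "supp d \<gamma>" "\<gamma> n = \<beta> n" unfolding \<gamma>_def using supp_upw[OF less.prems(2)] upw_top[OF less.prems(2), of n w] n(2) by auto
   have kk: "kill N r0 (X (b - t)) (upw (replicate t i) \<gamma>)" if t: "t \<le> b" for t
   proof -
    have e: "wcomp f (w @ replicate t i) x = X (b - t)" using w(2) Xw[of t "b - t"] t by (simp add: wcomp_append)
    have "word (w @ replicate t i)" using w(1) ii by auto
    moreover have "k \<le> length (w @ replicate t i)" using w(5) by simp
    moreover have "wcomp f (w @ replicate t i) x \<in> J" unfolding e by (rule XJ)
    ultimately show ?thesis using k[OF w(4) _ _ w(3), of "w @ replicate t i"] unfolding e upw_append \<gamma>_def by blast
   qed
   \<comment> \<open>\<gamma> kills about X b, and its transport by b - a letters i, which lead from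
     X b to X a, kills about X a. As these points are close, the difference kills about X a as well.
     Its coefficients of degree d cancel, while the one at n - e_i is (b - a) n_i \<beta>_n /
     p_i.\<close>
   define \<delta> where "\<delta> m = upw (replicate (b - a) i) \<gamma> m - \<gamma> m" for m
   have ka: "kill N r0 (X a) (upw (replicate (b - a) i) \<gamma>)" using kk[of "b - a"] ab by simp
   have kb: "kill N r0 (X b) \<gamma>" using kk[of 0] by simp
   have kd: "kill N (r0 / 2) (X a) \<delta>"
    unfolding kill_def
   proof (intro ballI impI)
    fix y assume y: "y \<in> RS" "dist y (X a) < r0 / 2"
    have d1: "dist (X a) (X b) < r0 / 2" using dX by (simp add: a_def b_def dist_commute)
    have "dist y (X b) < r0" using dist_triangle[of y "X b" "X a"] d1 y by simp
    then have "Df N \<gamma> y (X b) = 0" using kb y(1) unfolding kill_def by blast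
    moreover have "Df N \<gamma> (X a) (X b) = 0" using kb XR[of a] d1 r0 unfolding kill_def by simp
    ultimately have "Df N \<gamma> y (X a) = 0" using Df_diff[of N \<gamma> y "X a" "X b"] by simp
    moreover have "Df N (upw (replicate (b - a) i) \<gamma>) y (X a) = 0" using ka y r0 unfolding kill_def by simp
    moreover have "Df N \<delta> y (X a) = Df N (upw (replicate (b - a) i) \<gamma>) y (X a) - Df N \<gamma> y (X a)"
     unfolding Df_def \<delta>_def by (simp add: left_diff_distrib sum_subtractf)
    ultimately show "Df N \<delta> y (X a) = 0" by simp
   qed
   have sd: "supp (d - 1) \<delta>"
    unfolding supp_def
   proof (intro allI impI)
    fix m assume m: "m \<notin> Lam (d - 1)"
    show "\<delta> m = 0"
    proof (cases "m \<in> Lam d")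
     case True
     then have "deg m = d" using m by (auto simp: Lam_def)
     then show ?thesis using upw_top[OF \<gamma>(1)] by (simp add: \<delta>_def)
    next
     case False
     then show ?thesis using \<gamma>(1) supp_upw[OF \<gamma>(1)] unfolding supp_def \<delta>_def by simp
    qed
   qed
   have "\<delta> = (\<lambda>_. 0)" using less.IH[OF _ dN sd XJ _ kd] False r0 by auto
   moreover have "\<delta> (n(i := n i - 1)) = of_nat (b - a) * (of_nat (n i) * \<gamma> n / complex_of_real (wt s p i))"
    unfolding \<delta>_def using upw_replicate[OF \<gamma>(1) i(1) n(2) i(2)] by simp
   ultimately show False using ab i(2) n(3) \<gamma>(2) wt_p_pos[OF ii] by auto
  qed
 qed
qed

end

section \<open>Orbits in the Julia set of the skew product\<close>

context rational_system
begin

lemma set_map_idx: "\<forall>n. \<omega> n \<in> idx s \<Longrightarrow> word (map \<omega> ns)" by auto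

lemma continuous_fseq: assumes "\<forall>n. \<omega> n \<in> idx s" shows "continuous_on RS (fseq f \<omega> n)"
 unfolding fseq_def by (rule continuous_wcomp[OF set_map_idx[OF assms]])

lemma fseq_into_RS: assumes "\<forall>n. \<omega> n \<in> idx s" "x \<in> RS" shows "fseq f \<omega> n x \<in> RS"
 unfolding fseq_def by (rule wcomp_RS[OF set_map_idx[OF assms(1)] assms(2)])

lemma fseq_continuity:
 assumes w: "\<forall>n. \<omega> n \<in> idx s" and x: "x \<in> RS" and e: "e > 0"
 shows "\<exists>d>0. \<forall>y\<in>RS. dist x y < d \<longrightarrow> dist (fseq f \<omega> n x) (fseq f \<omega> n y) < e"
 using continuous_fseq[OF w] x e unfolding continuous_on_iff by (metis dist_commute)

lemma equi_fseq:
 assumes w: "\<forall>n. \<omega> n \<in> idx s" and x: "x \<in> RS" and F: "fseq f \<omega> k x \<in> F"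
 shows "equi (range (fseq f \<omega>)) RS x"
 unfolding equi_def
proof (intro allI impI)
 fix e :: real assume e: "e > 0"
 obtain d1 where d1: "d1 > 0" "\<And>y v. y \<in> RS \<Longrightarrow> dist (fseq f \<omega> k x) y < d1 \<Longrightarrow> word v \<Longrightarrow> dist (wcomp f v (fseq f \<omega> k x)) (wcomp f v y) < e"
  using uniform_equi[of "{fseq f \<omega> k x}" e] F e by auto
 obtain d2 where d2: "d2 > 0" "\<And>y. y \<in> RS \<Longrightarrow> dist x y < d2 \<Longrightarrow> dist (fseq f \<omega> k x) (fseq f \<omega> k y) < d1"
  using fseq_continuity[OF w x d1(1)] by blast
 have "\<exists>d>0. \<forall>j\<in>{..<k}. \<forall>y\<in>RS. dist x y < d \<longrightarrow> dist (fseq f \<omega> j x) (fseq f \<omega> j y) < e"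
 proof (rule finite_uniform_bound)
  fix j
  obtain d where d: "d > 0" "\<forall>y\<in>RS. dist x y < d \<longrightarrow> dist (fseq f \<omega> j x) (fseq f \<omega> j y) < e" using fseq_continuity[OF w x e] by blast
  then show "\<exists>d>0. \<forall>d'. 0 < d' \<longrightarrow> d' \<le> d \<longrightarrow> (\<forall>y\<in>RS. dist x y < d' \<longrightarrow> dist (fseq f \<omega> j x) (fseq f \<omega> j y) < e)"
   by (intro exI[of _ d]) (meson order_less_le_trans)
 qed simp
 then obtain d3 where d3: "d3 > 0" "\<And>j y. j < k \<Longrightarrow> y \<in> RS \<Longrightarrow> dist x y < d3 \<Longrightarrow> dist (fseq f \<omega> j x) (fseq f \<omega> j y) < e" by blast
 have "dist (fseq f \<omega> n x) (fseq f \<omega> n y) < e" if y: "y \<in> RS" "dist x y < min d2 d3" for n y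
 proof (cases "n < k")
  case True
  then show ?thesis using d3(2) y by simp
 next
  case False
  define m where "m = n - k"
  have n: "n = k + m" using False by (simp add: m_def)
  have "dist (fseq f \<omega> k x) (fseq f \<omega> k y) < d1" using d2(2) y by simp
  then show ?thesis unfolding n fseq_add by (intro d1(2) fseq_into_RS[OF w] y set_map_idx[OF w])
 qed
 then show "\<exists>\<delta>>0. \<forall>y\<in>RS. dist x y < \<delta> \<longrightarrow> (\<forall>h\<in>range (fseq f \<omega>). dist (h x) (h y) < e)"
  using d2(1) d3(1) by (intro exI[of _ "min d2 d3"]) auto
qed

text \<open>If the orbit enters the Fatou set of G at time k, all later maps are equicontinuous
  there and the finitely many earlier ones are continuous. This persists near z, so z would belong
  to F_\<omega>.\<close>

lemma julia_seq_orbit: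
 assumes w: "\<forall>n. \<omega> n \<in> idx s" and z: "z \<in> julia_seq f \<omega>"
 shows "z \<in> RS" "fseq f \<omega> k z \<in> J"
proof -
 show zRS: "z \<in> RS" using z by (simp add: julia_seq_def)
 show "fseq f \<omega> k z \<in> J"
 proof (rule ccontr)
  assume "fseq f \<omega> k z \<notin> J"
  then have "fseq f \<omega> k z \<in> F" using J_iff fseq_into_RS[OF w zRS] by blast
  then obtain e where e: "e > 0" "\<And>u. u \<in> RS \<Longrightarrow> dist u (fseq f \<omega> k z) < e \<Longrightarrow> u \<in> F"
   using openin_F unfolding openin_euclidean_subtopology_iff by blast
  obtain d where d: "d > 0" "\<And>x. x \<in> RS \<Longrightarrow> dist z x < d \<Longrightarrow> dist (fseq f \<omega> k z) (fseq f \<omega> k x) < e"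
   using fseq_continuity[OF w zRS e(1)] by blast
  have "equi (range (fseq f \<omega>)) RS x" if "x \<in> RS" "dist z x < d" for x
   by (rule equi_fseq[OF w that(1), of k]) (use e(2)[OF fseq_into_RS[OF w that(1)], of k] d(2)[OF that] in \<open>simp add: dist_commute\<close>)
  moreover have "fatou (range (fseq f \<omega>)) = fatou_seq f \<omega>" by (simp add: fatou_def fatou_seq_def)
  ultimately have "z \<in> fatou_seq f \<omega>"
   using fatou_iff_equi[of "range (fseq f \<omega>)" z] fseq_into_RS[OF w] zRS d(1) by blast
  then show False using z by (simp add: julia_seq_def)
 qed
qed

lemma open_coordinate: "open {\<omega>' :: nat \<Rightarrow> nat. \<omega>' j = c}"
proof -
 have "open ((\<lambda>\<omega>' :: nat \<Rightarrow> nat. \<omega>' j) -` {c})"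
  by (intro open_vimage continuous_on_product_coordinates Topological_Spaces.open_discrete)
 then show ?thesis by (simp add: vimage_def)
qed

text \<open>Lying in J at time k is a closed condition that involves only k letters, so it passes to
  the closure in the product topology, where nearby sequences share these letters.\<close>

lemma julia_skew_orbit:
 assumes wz: "(\<omega>, z) \<in> julia_skew s f"
 shows "\<forall>n. \<omega> n \<in> idx s" "z \<in> RS" "fseq f \<omega> k z \<in> J"
proof -
 have near: "\<exists>\<omega>' z'. (\<forall>n. \<omega>' n \<in> idx s) \<and> z' \<in> julia_seq f \<omega>' \<and> (\<forall>j\<le>k. \<omega>' j = \<omega> j) \<and> dist z z' < e" if e: "e > 0" for k e
 proof -
  define V where "V = (\<Inter>j\<in>{..k}. {\<omega>'. \<omega>' j = \<omega> j})"
  have "open V" unfolding V_def by (intro open_INT ballI open_coordinate) auto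
  then have "open (V \<times> ball z e)" by (intro open_Times) auto
  moreover have "(\<omega>, z) \<in> V \<times> ball z e" using e by (auto simp: V_def)
  ultimately have "V \<times> ball z e \<inter> {(\<omega>, z). (\<forall>n. \<omega> n \<in> idx s) \<and> z \<in> julia_seq f \<omega>} \<noteq> {}"
   using wz open_Int_closure_eq_empty[of "V \<times> ball z e" "{(\<omega>, z). (\<forall>n. \<omega> n \<in> idx s) \<and> z \<in> julia_seq f \<omega>}"]
   unfolding julia_skew_def by blast
  then obtain \<omega>' z' where "\<omega>' \<in> V" "z' \<in> ball z e" "\<forall>n. \<omega>' n \<in> idx s" "z' \<in> julia_seq f \<omega>'" by blast
  then show ?thesis by (intro exI[of _ \<omega>'] exI[of _ z']) (auto simp: V_def)
 qed
 show w: "\<forall>n. \<omega> n \<in> idx s"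
 proof
  fix n show "\<omega> n \<in> idx s" using near[of 1 n] by (metis order_refl zero_less_one)
 qed
 have "z \<in> closure RS"
  unfolding closure_approachable
 proof (intro allI impI)
  fix e :: real assume "e > 0"
  then obtain \<omega>' z' where o: "\<forall>n. \<omega>' n \<in> idx s" "z' \<in> julia_seq f \<omega>'" "dist z z' < e" using near[of e 0] by blast
  then show "\<exists>y\<in>RS. dist y z < e" using julia_seq_orbit(1)[OF o(1,2)] by (auto simp: dist_commute)
 qed
 then show zRS: "z \<in> RS" using compact_RS compact_imp_closed closure_closed by blast
 have "fseq f \<omega> k z \<in> closure J"
  unfolding closure_approachable
 proof (intro allI impI)
  fix e :: real assume "e > 0"
  then obtain d where d: "d > 0" "\<And>y. y \<in> RS \<Longrightarrow> dist z y < d \<Longrightarrow> dist (fseq f \<omega> k z) (fseq f \<omega> k y) < e"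
   using fseq_continuity[OF w zRS] by blast
  obtain \<omega>' z' where o: "\<forall>n. \<omega>' n \<in> idx s" "z' \<in> julia_seq f \<omega>'" "\<forall>j\<le>k. \<omega>' j = \<omega> j" "dist z z' < d" using near[OF d(1), of k] by blast
  have "map \<omega>' [0..<k] = map \<omega> [0..<k]" using o(3) by auto
  then have "fseq f \<omega> k z' = fseq f \<omega>' k z'" by (simp only: fseq_def)
  then have "fseq f \<omega> k z' \<in> J" using julia_seq_orbit(2)[OF o(1,2)] by simp
  moreover have "dist (fseq f \<omega> k z') (fseq f \<omega> k z) < e" using d(2)[OF julia_seq_orbit(1)[OF o(1,2)] o(4)] by (simp add: dist_commute)
  ultimately show "\<exists>y\<in>J. dist y (fseq f \<omega> k z) < e" by blast
 qed
 then show "fseq f \<omega> k z \<in> J" using compact_J compact_imp_closed closure_closed by blast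
qed

end

context hyperbolic_minimal
begin

text \<open>The uniform version of \<open>independence\<close>. Coefficients of a sequence of
  counterexamples are normalised to sum of moduli 1; in the limit they give a relation about a point
  of J, which must be trivial. The bound is in terms of any single coefficient because the one used
  later has top degree and is constant along words.\<close>

lemma Df_lower_bound:
 assumes \<eta>: "sepc \<eta>" and sc: "scale \<eta> r0 C \<theta>" and r: "r > 0"
 shows "\<exists>c>0. \<forall>y\<in>J. \<forall>\<gamma> n. supp N \<gamma> \<longrightarrow> (\<exists>y'\<in>RS. dist y' y < r \<and> c * cmod (\<gamma> n) \<le> cmod (Df N \<gamma> y' y))"
proof (rule ccontr)
 assume neg: "\<not> ?thesis"
 have "\<exists>y \<gamma> n. y \<in> J \<and> supp N \<gamma> \<and> (\<forall>y'\<in>RS. dist y' y < r \<longrightarrow> cmod (Df N \<gamma> y' y) < inverse (real (Suc k)) * cmod (\<gamma> n))" for k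
 proof -
  have "inverse (real (Suc k)) > 0" by simp
  then show ?thesis using neg by (meson not_le)
 qed
 then obtain Y \<Gamma> \<nu> where Y: "\<And>k. Y k \<in> J" and \<Gamma>: "\<And>k. supp N (\<Gamma> k)"
  and small: "\<And>k y'. y' \<in> RS \<Longrightarrow> dist y' (Y k) < r \<Longrightarrow> cmod (Df N (\<Gamma> k) y' (Y k)) < inverse (real (Suc k)) * cmod (\<Gamma> k (\<nu> k))"
  by metis
 have YR: "Y k \<in> RS" for k using Y J_RS by blast
 define M where "M k = (\<Sum>n\<in>Lam N. cmod (\<Gamma> k n))" for k
 have nz: "cmod (\<Gamma> k (\<nu> k)) > 0" for k
 proof -
  have "0 < inverse (real (Suc k)) * cmod (\<Gamma> k (\<nu> k))" using small[of "Y k" k] YR r norm_ge_zero order_le_less_trans by (metis dist_self)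
  then show ?thesis by (simp add: zero_less_mult_iff)
 qed
 have Mge: "cmod (\<Gamma> k n) \<le> M k" for k n
 proof (cases "n \<in> Lam N")
  case True
  then show ?thesis unfolding M_def by (intro member_le_sum finite_Lam) auto
 next
  case False
  then show ?thesis using \<Gamma>[of k] unfolding supp_def M_def by (simp add: sum_nonneg)
 qed
 have Mpos: "M k > 0" for k using Mge[of k "\<nu> k"] nz[of k] by linarith
 define g where "g k n = \<Gamma> k n / complex_of_real (M k)" for k n
 have gn: "cmod (g k n) = cmod (\<Gamma> k n) / M k" for k n using Mpos[of k] by (simp add: g_def norm_divide)
 have g1: "cmod (g k n) \<le> 1" for k n unfolding gn using Mpos Mge by (simp add: field_simps)
 have gsum: "(\<Sum>n\<in>Lam N. cmod (g k n)) = 1" for k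
  unfolding gn sum_divide_distrib[symmetric] using Mpos[of k] by (simp add: M_def[symmetric])
 have gsmall: "cmod (Df N (g k) y' (Y k)) \<le> inverse (real (Suc k))" if "y' \<in> RS" "dist y' (Y k) < r" for k y'
 proof -
  have "Df N (g k) y' (Y k) = Df N (\<Gamma> k) y' (Y k) / complex_of_real (M k)"
   unfolding Df_def g_def sum_divide_distrib by simp
  then have "cmod (Df N (g k) y' (Y k)) = cmod (Df N (\<Gamma> k) y' (Y k)) / M k" using Mpos[of k] by (simp add: norm_divide)
  also have "\<dots> \<le> inverse (real (Suc k)) * M k / M k"
  proof (rule divide_right_mono)
   have "cmod (Df N (\<Gamma> k) y' (Y k)) \<le> inverse (real (Suc k)) * cmod (\<Gamma> k (\<nu> k))" using small[OF that] by simp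
   also have "\<dots> \<le> inverse (real (Suc k)) * M k" using Mge by (intro mult_left_mono) auto
   finally show "cmod (Df N (\<Gamma> k) y' (Y k)) \<le> inverse (real (Suc k)) * M k" .
  qed (use Mpos[of k] in simp)
  finally show ?thesis using Mpos[of k] by simp
 qed
 obtain y \<phi> where y: "y \<in> J" "strict_mono (\<phi> :: nat \<Rightarrow> nat)" "(Y \<circ> \<phi>) \<longlonglongrightarrow> y"
  using compact_J[unfolded compact_eq_seq_compact_metric seq_compact_def, rule_format, of Y] Y by blast
 have yR: "y \<in> RS" using y(1) J_RS by blast
 have "bounded (range (\<lambda>k. g (\<phi> k) n))" for n unfolding bounded_iff using g1 by blast
 then obtain l \<psi> where \<psi>: "strict_mono (\<psi> :: nat \<Rightarrow> nat)" "\<And>n. n \<in> Lam N \<Longrightarrow> (\<lambda>k. g (\<phi> (\<psi> k)) n) \<longlonglongrightarrow> l n"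
  using bounded_sequences_diagonal[OF finite_Lam, of N "\<lambda>k. g (\<phi> k)"] by blast
 define h where "h k = \<phi> (\<psi> k)" for k
 have hmono: "strict_mono h" using strict_mono_o[OF y(2) \<psi>(1)] by (simp add: h_def[abs_def] o_def)
 have Yh: "(\<lambda>k. Y (h k)) \<longlonglongrightarrow> y" using LIMSEQ_subseq_LIMSEQ[OF y(3) \<psi>(1)] by (simp add: h_def o_def)
 have gh: "(\<lambda>k. g (h k) n) \<longlonglongrightarrow> l n" if "n \<in> Lam N" for n using \<psi>(2)[OF that] by (simp add: h_def)
 define \<gamma> where "\<gamma> n = (if n \<in> Lam N then l n else 0)" for n
 have s\<gamma>: "supp N \<gamma>" by (simp add: supp_def \<gamma>_def)
 have "(\<lambda>k. \<Sum>n\<in>Lam N. cmod (g (h k) n)) \<longlonglongrightarrow> (\<Sum>n\<in>Lam N. cmod (l n))" by (intro tendsto_sum tendsto_norm gh)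
 then have l1: "(\<Sum>n\<in>Lam N. cmod (l n)) = 1" unfolding gsum by (simp add: LIMSEQ_const_iff)
 have "kill N (r / 2) y \<gamma>"
  unfolding kill_def
 proof (intro ballI impI)
  fix y' assume y': "y' \<in> RS" "dist y' y < r / 2"
  have Dg: "(\<lambda>k. Df N (g (h k)) y' y) \<longlonglongrightarrow> Df N \<gamma> y' y"
  proof -
   have "(\<lambda>k. Df N (g (h k)) y' y) \<longlonglongrightarrow> (\<Sum>n\<in>Lam N. l n * (cf n y' - cf n y))"
    unfolding Df_def by (intro tendsto_sum tendsto_mult tendsto_const gh)
   also have "(\<Sum>n\<in>Lam N. l n * (cf n y' - cf n y)) = Df N \<gamma> y' y" unfolding Df_def \<gamma>_def by (intro sum.cong) auto
   finally show ?thesis .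
  qed
  have "\<forall>\<^sub>F k in sequentially. dist (Y (h k)) y < r / 2" using tendstoD[OF Yh, of "r / 2"] r by simp
  then have ev: "\<forall>\<^sub>F k in sequentially. cmod (Df N (g (h k)) y' y) \<le> 2 * inverse (real (Suc k))"
  proof eventually_elim
   case (elim k)
   have "dist y' (Y (h k)) < r" using dist_triangle[of y' "Y (h k)" y] y'(2) elim by (simp add: dist_commute)
   then have 1: "cmod (Df N (g (h k)) y' (Y (h k))) \<le> inverse (real (Suc (h k)))" using gsmall[OF y'(1)] by blast
   have "dist y (Y (h k)) < r" using elim r by (simp add: dist_commute)
   then have 2: "cmod (Df N (g (h k)) y (Y (h k))) \<le> inverse (real (Suc (h k)))" using gsmall[OF yR] by blast
   have "k \<le> h k" using hmono by (rule seq_suble)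
   then have "inverse (real (Suc (h k))) \<le> inverse (real (Suc k))" by (intro le_imp_inverse_le) auto
   then show ?case
    unfolding Df_diff[of N "g (h k)" y' y "Y (h k)"]
    using 1 2 norm_triangle_ineq4[of "Df N (g (h k)) y' (Y (h k))" "Df N (g (h k)) y (Y (h k))"] by linarith
  qed
  have "(\<lambda>k. 2 * inverse (real (Suc k))) \<longlonglongrightarrow> 2 * 0" by (intro tendsto_mult tendsto_const LIMSEQ_inverse_real_of_nat)
  then have "(\<lambda>k. Df N (g (h k)) y' y) \<longlonglongrightarrow> 0" using Lim_null_comparison[OF ev] by simp
  then show "Df N \<gamma> y' y = 0" using LIMSEQ_unique[OF Dg] by blast
 qed
 then have "\<gamma> = (\<lambda>_. 0)" using independence[OF \<eta> sc order_refl s\<gamma> y(1) half_gt_zero[OF r]] by blast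
 then have "(\<Sum>n\<in>Lam N. cmod (l n)) = 0" unfolding \<gamma>_def by (intro sum.neutral) (metis norm_zero)
 then show False using l1 by simp
qed

end

section \<open>The Hoelder exponent\<close>

lemma power_powr_swap: "x > 0 \<Longrightarrow> (x ^ k) powr a = (x powr a) ^ k" for x :: real
 by (induction k) (auto simp: powr_mult)

text \<open>\<tau>^2 = \<Lambda>^t splits the margin t in two. One \<tau> pays for the distortion
  through q powr a \<le> \<tau>; the other pays for (1 + \<epsilon>)^k in the lower bound and beats
  an arbitrary constant in the upper bound. The exponent 1 / (a + 1) also covers a = 0.\<close>

lemma contraction_rate:
 fixes \<Lambda> a t :: real
 assumes "\<Lambda> > 1" "a \<ge> 0" "t > 0"
 obtains \<tau> q where "\<tau> > 1" "\<tau> * \<tau> = \<Lambda> powr t" "q > 1" "q < \<Lambda>" "q powr a \<le> \<tau>"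
proof -
 define \<tau> where "\<tau> = \<Lambda> powr (t / 2)"
 define q where "q = min ((1 + \<Lambda>) / 2) (\<tau> powr (1 / (a + 1)))"
 have \<tau>: "\<tau> > 1" unfolding \<tau>_def using assms by (intro gr_one_powr) auto
 have "\<tau> powr (1 / (a + 1)) > 1" using \<tau> assms by (intro gr_one_powr) auto
 then have q: "q > 1" "q < \<Lambda>" using assms by (auto simp: q_def min_def)
 have "q powr a \<le> (\<tau> powr (1 / (a + 1))) powr a" using q assms by (intro powr_mono2) (auto simp: q_def)
 also have "\<dots> = \<tau> powr (a / (a + 1))" by (simp add: powr_powr)
 also have "\<dots> \<le> \<tau> powr 1" using \<tau> assms by (intro powr_mono) (auto simp: field_simps)
 finally have "q powr a \<le> \<tau>" using \<tau> by simp
 moreover have "\<tau> * \<tau> = \<Lambda> powr t" by (simp add: \<tau>_def powr_add[symmetric])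
 ultimately show ?thesis using that \<tau> q by blast
qed

context hyperbolic_minimal
begin

lemma pw_append: "pw (u @ v) = pw u * pw v"
 by (induction u) auto

lemma Spsi_pw: assumes w: "\<forall>n. \<omega> n \<in> idx s" shows "Spsi s p k \<omega> = ln (pw (map \<omega> [0..<k]))"
proof (induction k)
 case (Suc k)
 have "pw (map \<omega> [0..<k]) > 0" using pw_pos[OF set_map_idx[OF w]] .
 moreover have "wt s p (\<omega> k) > 0" using wt_p_pos w by blast
 ultimately show ?case using Suc by (simp add: Spsi_def pw_append ln_mult)
qed (simp add: Spsi_def)

lemma Sphi_wder:
 assumes w: "\<forall>n. \<omega> n \<in> idx s" and z: "z \<in> RS" and orb: "\<And>k. fseq f \<omega> k z \<in> J"
 shows "Sphi f k \<omega> z = - ln (wder (map \<omega> [0..<k]) z)"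
proof (induction k)
 case (Suc k)
 have 1: "wder (map \<omega> [0..<k]) z > 0" using wder_pos[OF set_map_idx[OF w] z] orb[of k] by (simp add: fseq_def)
 have "f (\<omega> k) (fseq f \<omega> k z) \<in> J" using orb[of "Suc k"] by (simp add: fseq_def wcomp_append)
 then have 2: "sph_dnorm (f (\<omega> k)) (fseq f \<omega> k z) > 0" using sph_dnorm_pos[of "\<omega> k"] w fseq_into_RS[OF w z] by blast
 have "wder (map \<omega> [0..<Suc k]) z = wder (map \<omega> [0..<k]) z * sph_dnorm (f (\<omega> k)) (fseq f \<omega> k z)"
  by (simp add: wder_append fseq_def)
 then show ?case using Suc 1 2 by (simp add: Sphi_def ln_mult)
qed (simp add: Sphi_def)

lemma wcomp_take_map: "j \<le> k \<Longrightarrow> wcomp f (take j (map \<omega> [0..<k])) x = fseq f \<omega> j x"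
 by (simp add: fseq_def take_map)

lemma sepc_exists: assumes "\<delta> > 0" obtains \<eta> where "sepc \<eta>" "\<eta> > 0" "\<eta> \<le> \<delta>"
proof -
 obtain e where e: "e > 0" "\<forall>i\<in>idx s. \<forall>j\<in>idx s. \<forall>z\<in>RS. \<forall>y\<in>RS. f i z \<in> J \<longrightarrow> j \<noteq> i \<longrightarrow> dist y z < e \<longrightarrow> same (f j y) (f j z)"
  using separation by blast
 have "sepc (min e \<delta>)" unfolding sepc_def using e assms by auto
 then show ?thesis using that[of "min e \<delta>"] e assms by simp
qed

text \<open>As long as the orbits stay \<eta>-close, \<open>track\<close> forces their distance to
  grow like (\<Lambda> / q)^k. The first time at which it reaches \<eta> is the scale that belongs
  to y.\<close>

lemma first_exit:
 assumes w: "\<forall>n. \<omega> n \<in> idx s" and z: "z \<in> RS" and orb: "\<And>k. fseq f \<omega> k z \<in> J"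
  and D: "distortion q \<delta>" and q: "1 < q" "q < \<Lambda>" and g: "c > 0" "\<And>k. c * \<Lambda> ^ k \<le> wder (map \<omega> [0..<k]) z"
  and \<eta>: "\<eta> \<le> \<delta>" and y: "y \<in> RS" "y \<noteq> z"
 shows "\<exists>k. \<eta> \<le> dist (fseq f \<omega> k z) (fseq f \<omega> k y) \<and> (\<forall>j<k. dist (fseq f \<omega> j z) (fseq f \<omega> j y) < \<eta>)"
proof -
 have "\<exists>k. \<eta> \<le> dist (fseq f \<omega> k z) (fseq f \<omega> k y)"
 proof (rule ccontr)
  assume "\<not> ?thesis"
  then have lt: "dist (fseq f \<omega> k z) (fseq f \<omega> k y) < \<eta>" for k by (simp add: not_le)
  have d: "dist z y > 0" using y by auto
  have "(\<Lambda> / q) ^ k * (c * dist z y) \<le> \<eta>" for k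
  proof -
   have "wder (map \<omega> [0..<k]) z / q ^ k * dist z y \<le> dist (fseq f \<omega> k z) (fseq f \<omega> k y)"
   proof -
    have "wcomp f (map \<omega> [0..<k]) z \<in> J" using orb[of k] by (simp add: fseq_def)
    moreover have "dist (wcomp f (take j (map \<omega> [0..<k])) z) (wcomp f (take j (map \<omega> [0..<k])) y) < \<delta>" if "j < length (map \<omega> [0..<k])" for j
     using that lt[of j] \<eta> by (simp only: wcomp_take_map length_map length_upt)
    ultimately show ?thesis using track[OF D q(1) set_map_idx[OF w] z y(1), of "[0..<k]"] by (simp add: fseq_def)
   qed
   moreover have "c * \<Lambda> ^ k / q ^ k * dist z y \<le> wder (map \<omega> [0..<k]) z / q ^ k * dist z y"
    using g(2)[of k] q by (intro mult_right_mono divide_right_mono) auto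
   ultimately have "c * \<Lambda> ^ k / q ^ k * dist z y \<le> \<eta>" using lt[of k] by linarith
   then show ?thesis by (simp add: power_divide mult_ac)
  qed
  moreover obtain k where "\<eta> / (c * dist z y) < (\<Lambda> / q) ^ k" using real_arch_pow[of "\<Lambda> / q"] q by auto
  then have "\<eta> < (\<Lambda> / q) ^ k * (c * dist z y)" using g(1) d by (simp only: pos_divide_less_eq mult_pos_pos)
  ultimately show False by (meson not_le)
 qed
 then show ?thesis using exists_least_iff[of "\<lambda>k. \<eta> \<le> dist (fseq f \<omega> k z) (fseq f \<omega> k y)"] by (auto simp: not_le)
qed

text \<open>With k the first exit time, l the derivative norm, P the weight of the word and d = dist
  y z: \<eta> \<le> l q^k d, while the increment is at most K1 \<tau>^k P and P \<le> K0 l^(-a-t).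
  The factor l^(-t) \<le> c^(-t) \<Lambda>^(-t k) absorbs \<tau>^(2k).\<close>

lemma hoelder_lower:
 assumes w: "\<forall>n. \<omega> n \<in> idx s" and z: "z \<in> RS" and orb: "\<And>k. fseq f \<omega> k z \<in> J"
  and at: "a \<ge> 0" "t > 0" and K0: "K0 > 0" "\<And>k. pw (map \<omega> [0..<k]) \<le> K0 * wder (map \<omega> [0..<k]) z powr (- (a + t))"
 shows "\<exists>K. \<forall>y\<in>RS. y \<noteq> z \<longrightarrow> cmod (Df N \<beta> y z) \<le> K * dist y z powr a"
proof -
 obtain c \<Lambda> where g: "c > 0" "\<Lambda> > 1" "\<forall>w x. word w \<longrightarrow> x \<in> RS \<longrightarrow> wcomp f w x \<in> J \<longrightarrow> c * \<Lambda> ^ length w \<le> wder w x"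
  using wder_growth by blast
 obtain \<tau> q where \<tau>: "\<tau> > 1" "\<tau> * \<tau> = \<Lambda> powr t" and q: "q > 1" "q < \<Lambda>" "q powr a \<le> \<tau>"
  using contraction_rate[OF g(2) at] by blast
 obtain \<delta> where \<delta>: "\<delta> > 0" "distortion q \<delta>" using distortion_exists[OF q(1)] by blast
 obtain \<eta> where \<eta>: "sepc \<eta>" "\<eta> > 0" "\<eta> \<le> \<delta>" using sepc_exists[OF \<delta>(1)] by blast
 have "\<tau> - 1 > 0" using \<tau> by simp
 then obtain K where K: "K \<ge> 0" "\<forall>n\<in>Lam N. \<forall>w y z. word w \<longrightarrow> y \<in> RS \<longrightarrow> z \<in> RS \<longrightarrow> wcomp f w z \<in> J \<longrightarrow>
  (\<forall>j<length w. odist j w y z < \<eta>) \<longrightarrow> cmod (cf n y - cf n z) \<le> K * ((1 + (\<tau> - 1)) ^ length w * pw w)"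
  using diff_growth[OF \<eta>(1), of "\<tau> - 1" N] by blast
 define l where "l k = wder (map \<omega> [0..<k]) z" for k
 define P where "P k = pw (map \<omega> [0..<k])" for k
 have wJ: "wcomp f (map \<omega> [0..<k]) z \<in> J" for k using orb[of k] by (simp add: fseq_def)
 have lg: "c * \<Lambda> ^ k \<le> l k" for k using g(3)[rule_format, OF set_map_idx[OF w] z wJ[of k]] by (simp add: l_def)
 have l0: "l k > 0" for k using lg[of k] g by (smt (verit) zero_less_mult_iff zero_less_power)
 have P0: "P k > 0" for k unfolding P_def by (rule pw_pos[OF set_map_idx[OF w]])
 define K1 where "K1 = (\<Sum>n\<in>Lam N. cmod (\<beta> n)) * K"
 have K1: "K1 \<ge> 0" using K(1) by (simp add: K1_def sum_nonneg)
 have "cmod (Df N \<beta> y z) \<le> (K1 * K0 * c powr (- t) / \<eta> powr a) * dist y z powr a" if y: "y \<in> RS" "y \<noteq> z" for y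
 proof -
  obtain k where k: "\<eta> \<le> dist (fseq f \<omega> k z) (fseq f \<omega> k y)" "\<And>j. j < k \<Longrightarrow> dist (fseq f \<omega> j z) (fseq f \<omega> j y) < \<eta>"
   using first_exit[OF w z orb \<delta>(2) q(1,2) g(1) lg[unfolded l_def] \<eta>(3) y] by blast
  define d where "d = dist y z"
  have d: "d > 0" using y by (simp add: d_def)
  have near: "dist (wcomp f (take j (map \<omega> [0..<k])) y) (wcomp f (take j (map \<omega> [0..<k])) z) < \<eta>" if "j < length (map \<omega> [0..<k])" for j
   using that k(2)[of j] by (simp add: wcomp_take_map dist_commute del: take_map)
  have near\<delta>: "dist (wcomp f (take j (map \<omega> [0..<k])) z) (wcomp f (take j (map \<omega> [0..<k])) y) < \<delta>" if "j < length (map \<omega> [0..<k])" for j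
   using near[OF that] \<eta>(3) by (simp add: dist_commute)
  have "dist (fseq f \<omega> k z) (fseq f \<omega> k y) \<le> l k * q ^ k * dist z y"
   using track[OF \<delta>(2) q(1) set_map_idx[OF w] z y(1) wJ near\<delta>] by (simp add: l_def fseq_def)
  then have "\<eta> \<le> l k * q ^ k * d" using k(1) by (simp add: d_def dist_commute)
  then have "\<eta> powr a \<le> (l k * q ^ k * d) powr a" using at \<eta>(2) by (intro powr_mono2) auto
  also have "\<dots> = l k powr a * (q powr a) ^ k * d powr a"
   using l0[of k] q(1) d by (simp add: powr_mult power_powr_swap)
  also have "\<dots> \<le> l k powr a * \<tau> ^ k * d powr a" using q(3) by (intro mult_right_mono mult_left_mono power_mono) auto
  finally have e1: "\<eta> powr a \<le> l k powr a * \<tau> ^ k * d powr a" .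
  have e2: "cmod (Df N \<beta> y z) \<le> K1 * (\<tau> ^ k * P k)"
  proof -
   have "cmod (Df N \<beta> y z) \<le> (\<Sum>n\<in>Lam N. cmod (\<beta> n) * (K * (\<tau> ^ k * P k)))"
    unfolding Df_def
   proof (intro sum_norm_le)
    fix n assume n: "n \<in> Lam N"
    have "cmod (cf n y - cf n z) \<le> K * (\<tau> ^ k * P k)"
     using K(2)[rule_format, OF n set_map_idx[OF w] y(1) z wJ near] by (simp add: P_def)
    then show "cmod (\<beta> n * (cf n y - cf n z)) \<le> cmod (\<beta> n) * (K * (\<tau> ^ k * P k))"
     unfolding norm_mult by (intro mult_left_mono) auto
   qed
   then show ?thesis by (simp add: K1_def sum_distrib_right[symmetric] mult.assoc)
  qed
  have e3: "P k * l k powr a \<le> K0 * l k powr (- t)"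
  proof -
   have "P k * l k powr a \<le> K0 * l k powr (- (a + t)) * l k powr a"
    using K0(2)[of k] by (intro mult_right_mono) (auto simp: P_def l_def)
   then show ?thesis by (simp add: powr_add[symmetric] mult.assoc)
  qed
  have e4: "\<tau> ^ k * \<tau> ^ k * l k powr (- t) \<le> c powr (- t)"
  proof -
   have "l k powr (- t) \<le> (c * \<Lambda> ^ k) powr (- t)" using lg[of k] g at by (intro powr_mono2') auto
   also have "\<dots> = c powr (- t) * (\<Lambda> powr (- t)) ^ k" using g by (simp add: powr_mult power_powr_swap)
   finally have "\<tau> ^ k * \<tau> ^ k * l k powr (- t) \<le> (\<tau> * \<tau>) ^ k * (c powr (- t) * (\<Lambda> powr (- t)) ^ k)"
    unfolding power_mult_distrib using \<tau>(1) by (intro mult_left_mono) auto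
   also have "\<dots> = c powr (- t) * (\<Lambda> powr t * \<Lambda> powr (- t)) ^ k" unfolding \<tau>(2) by (simp add: power_mult_distrib)
   also have "\<Lambda> powr t * \<Lambda> powr (- t) = 1" using g(2) by (simp add: powr_add[symmetric])
   finally show ?thesis by simp
  qed
  have "cmod (Df N \<beta> y z) * \<eta> powr a \<le> (K1 * (\<tau> ^ k * P k)) * (l k powr a * \<tau> ^ k * d powr a)"
   using e1 e2 K1 \<tau>(1) P0[of k] by (intro mult_mono) auto
  also have "\<dots> = (K1 * \<tau> ^ k * \<tau> ^ k * d powr a) * (P k * l k powr a)" by (simp add: mult_ac)
  also have "\<dots> \<le> (K1 * \<tau> ^ k * \<tau> ^ k * d powr a) * (K0 * l k powr (- t))"
   using e3 K1 \<tau>(1) by (intro mult_left_mono) auto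
  also have "\<dots> = (K1 * K0 * d powr a) * (\<tau> ^ k * \<tau> ^ k * l k powr (- t))" by (simp add: mult_ac)
  also have "\<dots> \<le> (K1 * K0 * d powr a) * c powr (- t)" using e4 K1 K0(1) by (intro mult_left_mono) auto
  finally have "cmod (Df N \<beta> y z) * \<eta> powr a \<le> (K1 * K0 * d powr a) * c powr (- t)" .
  moreover have "\<eta> powr a > 0" using \<eta>(2) by simp
  ultimately show ?thesis by (simp add: d_def field_simps)
 qed
 then show ?thesis by blast
qed

text \<open>At a time k with P large, \<open>Df_lower_bound\<close> gives a point y' near f_v(z)
  where the transported combination has an increment bounded below, since its coefficient at n0 is
  still \<beta> n0. Pulled back to y, this becomes an increment of size P at distance at most r0 q^k
  / l from z.\<close>

lemma hoelder_upper:
 assumes w: "\<forall>n. \<omega> n \<in> idx s" and z: "z \<in> RS" and orb: "\<And>k. fseq f \<omega> k z \<in> J"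
  and at: "a \<ge> 0" "t > 0" and fr: "\<exists>\<^sub>F k in sequentially. wder (map \<omega> [0..<k]) z powr (- (a - t)) < pw (map \<omega> [0..<k])"
  and \<beta>: "supp N \<beta>" "deg n0 = N" "\<beta> n0 \<noteq> 0" and K: "K > 0" and d0: "d0 > 0"
 shows "\<exists>y\<in>RS. y \<noteq> z \<and> dist y z < d0 \<and> K * dist y z powr a < cmod (Df N \<beta> y z)"
proof -
 obtain c \<Lambda> where g: "c > 0" "\<Lambda> > 1" "\<forall>w x. word w \<longrightarrow> x \<in> RS \<longrightarrow> wcomp f w x \<in> J \<longrightarrow> c * \<Lambda> ^ length w \<le> wder w x"
  using wder_growth by blast
 obtain \<tau> q where \<tau>: "\<tau> > 1" "\<tau> * \<tau> = \<Lambda> powr t" and q: "q > 1" "q < \<Lambda>" "q powr a \<le> \<tau>"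
  using contraction_rate[OF g(2) at] by blast
 obtain \<delta> where \<delta>: "\<delta> > 0" "distortion q \<delta>" using distortion_exists[OF q(1)] by blast
 obtain \<eta> where \<eta>: "sepc \<eta>" "\<eta> > 0" "\<eta> \<le> \<delta>" using sepc_exists[OF \<delta>(1)] by blast
 obtain r0 C \<theta> where sc: "scale \<eta> r0 C \<theta>" using good_scale[OF \<eta>(2)] by blast
 then have r0: "r0 > 0" "C > 0" "0 < \<theta>" "\<theta> < 1" by (auto simp: scale_def)
 obtain c2 where c2: "c2 > 0" "\<forall>y\<in>J. \<forall>\<gamma> n. supp N \<gamma> \<longrightarrow> (\<exists>y'\<in>RS. dist y' y < r0 \<and> c2 * cmod (\<gamma> n) \<le> cmod (Df N \<gamma> y' y))"
  using Df_lower_bound[OF \<eta>(1) sc r0(1)] by blast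
 define c3 where "c3 = c2 * cmod (\<beta> n0)"
 have c3: "c3 > 0" using c2 \<beta> by (simp add: c3_def)
 define l where "l k = wder (map \<omega> [0..<k]) z" for k
 define P where "P k = pw (map \<omega> [0..<k])" for k
 have wJ: "wcomp f (map \<omega> [0..<k]) z \<in> J" for k using orb[of k] by (simp add: fseq_def)
 have lg: "c * \<Lambda> ^ k \<le> l k" for k using g(3)[rule_format, OF set_map_idx[OF w] z wJ[of k]] by (simp add: l_def)
 have l0: "l k > 0" for k using lg[of k] g by (smt (verit) zero_less_mult_iff zero_less_power)
 have P0: "P k > 0" for k unfolding P_def by (rule pw_pos[OF set_map_idx[OF w]])
 have ev1: "\<forall>\<^sub>F k in sequentially. C * \<theta> ^ k < d0"
 proof -
  have "(\<lambda>k. C * \<theta> ^ k) \<longlonglongrightarrow> C * 0" using r0 by (intro tendsto_mult tendsto_const LIMSEQ_realpow_zero) auto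
  then show ?thesis using d0 by (auto intro: order_tendstoD(2))
 qed
 \<comment> \<open>The second factor \<tau>^k eventually exceeds any constant, so K may be
   arbitrary.\<close>
 have ev2: "\<forall>\<^sub>F k in sequentially. K * r0 powr a < c3 * c powr t * \<tau> ^ k"
 proof -
  obtain m where m: "K * r0 powr a / (c3 * c powr t) < \<tau> ^ m" using real_arch_pow[OF \<tau>(1)] by blast
  have "K * r0 powr a < c3 * c powr t * \<tau> ^ k" if "k \<ge> m" for k
  proof -
   have "\<tau> ^ m \<le> \<tau> ^ k" using \<tau>(1) that by (intro power_increasing) auto
   then have "K * r0 powr a / (c3 * c powr t) < \<tau> ^ k" using m by linarith
   then show ?thesis using c3 g(1) by (simp add: field_simps)
  qed
  then show ?thesis unfolding eventually_sequentially by blast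
 qed
 have "\<exists>\<^sub>F k in sequentially. l k powr (- (a - t)) < P k \<and> C * \<theta> ^ k < d0 \<and> K * r0 powr a < c3 * c powr t * \<tau> ^ k"
  using frequently_eventually_frequently[OF fr eventually_conj[OF ev1 ev2]] unfolding l_def P_def .
 then obtain k where k: "l k powr (- (a - t)) < P k" "C * \<theta> ^ k < d0" "K * r0 powr a < c3 * c powr t * \<tau> ^ k"
  using frequently_ex by blast
 define v where "v = map \<omega> [0..<k]"
 have v: "word v" "length v = k" "wcomp f v z \<in> J" unfolding v_def using set_map_idx[OF w, of "[0..<k]"] wJ[of k] by simp_all
 have lv: "l k = wder v z" "P k = pw v" by (simp_all add: l_def P_def v_def)
 define \<gamma> where "\<gamma> = upw v \<beta>"
 have \<gamma>: "supp N \<gamma>" "\<gamma> n0 = \<beta> n0" unfolding \<gamma>_def using supp_upw[OF \<beta>(1)] upw_top[OF \<beta>(1)] \<beta>(2) by auto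
 obtain y' where y': "y' \<in> RS" "dist y' (wcomp f v z) < r0" "c2 * cmod (\<gamma> n0) \<le> cmod (Df N \<gamma> y' (wcomp f v z))"
  using c2(2)[rule_format, OF v(3) \<gamma>(1), of n0] by blast
 obtain y where y: "y \<in> RS" "wcomp f v y = y'" "dist y z \<le> C * \<theta> ^ length v" "\<And>j. j \<le> length v \<Longrightarrow> odist j v y z < \<eta>"
  using scaleD[OF sc v(1) z v(3) y'(1,2)] by blast
 have "Df N \<beta> y z = complex_of_real (pw v) * Df N (upw v \<beta>) (wcomp f v y) (wcomp f v z)"
  by (rule Df_word[OF \<eta>(1) \<beta>(1) v(1) y(1) z v(3)]) (use y(4) in auto)
 then have "cmod (Df N \<beta> y z) = P k * cmod (Df N \<gamma> y' (wcomp f v z))" using P0[of k] y(2) by (simp add: norm_mult lv \<gamma>_def)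
 moreover have "P k * c3 \<le> P k * cmod (Df N \<gamma> y' (wcomp f v z))" using y'(3) P0[of k] by (intro mult_left_mono) (auto simp: c3_def \<gamma>(2))
 ultimately have low: "P k * c3 \<le> cmod (Df N \<beta> y z)" by simp
 have "P k * c3 > 0" using P0 c3 by simp
 then have yz: "y \<noteq> z" using low by (auto simp: Df_def)
 define d where "d = dist y z"
 have d: "d > 0" using yz by (simp add: d_def)
 have "odist j v z y < \<delta>" if "j < length v" for j
  using y(4)[of j] that \<eta>(3) by (simp add: dist_commute)
 then have "wder v z / q ^ length v * dist z y \<le> dist (wcomp f v z) (wcomp f v y)"
  using track[OF \<delta>(2) q(1) v(1) z y(1) v(3)] by blast
 then have "l k / q ^ k * d \<le> r0" using y'(2) y(2) by (simp add: lv v(2) d_def dist_commute)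
 then have "l k * d \<le> r0 * q ^ k" using q(1) by (simp add: field_simps)
 then have "(l k * d) powr a \<le> (r0 * q ^ k) powr a" using at l0[of k] d by (intro powr_mono2) auto
 then have "l k powr a * d powr a \<le> r0 powr a * (q powr a) ^ k" using l0[of k] d r0 q(1) by (simp add: powr_mult power_powr_swap)
 also have "\<dots> \<le> r0 powr a * \<tau> ^ k" using q(3) by (intro mult_left_mono power_mono) auto
 finally have e1: "l k powr a * d powr a \<le> r0 powr a * \<tau> ^ k" .
 have e2: "c powr t * (\<tau> ^ k * \<tau> ^ k) \<le> l k powr t"
 proof -
  have "(c * \<Lambda> ^ k) powr t \<le> l k powr t" using lg[of k] g(1,2) at by (intro powr_mono2) auto
  moreover have "(c * \<Lambda> ^ k) powr t = c powr t * (\<tau> * \<tau>) ^ k" unfolding \<tau>(2) using g(1,2) by (simp add: powr_mult power_powr_swap)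
  ultimately show ?thesis by (simp add: power_mult_distrib)
 qed
 have "l k powr a * (K * d powr a) = K * (l k powr a * d powr a)" by simp
 also have "\<dots> \<le> K * (r0 powr a * \<tau> ^ k)" using e1 K by (intro mult_left_mono) auto
 also have "\<dots> = (K * r0 powr a) * \<tau> ^ k" by simp
 also have "\<dots> < (c3 * c powr t * \<tau> ^ k) * \<tau> ^ k" using k(3) \<tau>(1) by (intro mult_strict_right_mono) auto
 also have "\<dots> = c3 * (c powr t * (\<tau> ^ k * \<tau> ^ k))" by simp
 also have "\<dots> \<le> c3 * l k powr t" using e2 c3 by (intro mult_left_mono) auto
 also have "l k powr t = l k powr a * l k powr (- (a - t))" by (simp add: powr_add[symmetric])
 also have "c3 * (l k powr a * l k powr (- (a - t))) \<le> c3 * (l k powr a * P k)"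
  using k(1) c3 by (intro mult_left_mono) auto
 also have "\<dots> = l k powr a * (P k * c3)" by simp
 finally have "K * d powr a < P k * c3" using l0[of k] by (simp add: mult_less_cancel_left_pos)
 then have "K * dist y z powr a < cmod (Df N \<beta> y z)" using low by (simp add: d_def)
 moreover have "dist y z < d0" using y(3) k(2) v(2) by simp
 ultimately show ?thesis using y(1) yz by blast
qed

text \<open>With the zero coefficients dropped, N is the exact degree and some coefficient n0 of top
  degree is non-zero, as \<open>hoelder_upper\<close> requires.\<close>

lemma Ccoef_combination:
 assumes B: "finite B" "\<forall>n\<in>B. \<forall>i. i \<notin> {1..s} \<longrightarrow> n i = 0" and nt: "\<exists>n\<in>B. \<beta> n \<noteq> 0"
 shows "\<exists>N \<beta>' n0. supp N \<beta>' \<and> deg n0 = N \<and> \<beta>' n0 \<noteq> 0 \<and> (\<forall>y\<in>RS. \<forall>z\<in>RS.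
  (\<Sum>n\<in>B. \<beta> n * complex_of_real (Ccoef s f L p n y)) - (\<Sum>n\<in>B. \<beta> n * complex_of_real (Ccoef s f L p n z)) = Df N \<beta>' y z)"
proof -
 define S where "S = {n \<in> B. \<beta> n \<noteq> 0}"
 have S: "finite S" "S \<noteq> {}" using B(1) nt by (auto simp: S_def)
 define N where "N = Max (deg ` S)"
 define \<beta>' where "\<beta>' n = (if n \<in> S then \<beta> n else 0)" for n
 have "N \<in> deg ` S" unfolding N_def using S by (intro Max_in) auto
 then obtain n0 where n0: "n0 \<in> S" "deg n0 = N" by auto
 have SL: "S \<subseteq> Lam N"
 proof
  fix n assume n: "n \<in> S"
  have "deg n \<le> N" unfolding N_def using S n by (intro Max_ge) auto
  then show "n \<in> Lam N" using n B(2) unfolding Lam_def S_def by blast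
 qed
 have eq: "(\<Sum>n\<in>B. \<beta> n * complex_of_real (Ccoef s f L p n y)) = (\<Sum>n\<in>Lam N. \<beta>' n * cf n y)" if y: "y \<in> RS" for y
 proof -
  have "(\<Sum>n\<in>B. \<beta> n * complex_of_real (Ccoef s f L p n y)) = (\<Sum>n\<in>B. \<beta> n * cf n y)" using Ccoef_cf[OF y] by simp
  also have "\<dots> = (\<Sum>n\<in>S. \<beta> n * cf n y)" using B(1) by (intro sum.mono_neutral_right) (auto simp: S_def)
  also have "\<dots> = (\<Sum>n\<in>S. \<beta>' n * cf n y)" by (intro sum.cong) (auto simp: \<beta>'_def)
  also have "\<dots> = (\<Sum>n\<in>Lam N. \<beta>' n * cf n y)" using SL finite_Lam by (intro sum.mono_neutral_left) (auto simp: \<beta>'_def)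
  finally show ?thesis .
 qed
 have "supp N \<beta>'" using SL unfolding supp_def \<beta>'_def by auto
 moreover have "\<beta>' n0 \<noteq> 0" using n0(1) by (simp add: \<beta>'_def S_def)
 moreover have "\<forall>y\<in>RS. \<forall>z\<in>RS. (\<Sum>n\<in>B. \<beta> n * complex_of_real (Ccoef s f L p n y)) - (\<Sum>n\<in>B. \<beta> n * complex_of_real (Ccoef s f L p n z)) = Df N \<beta>' y z"
 proof (intro ballI)
  fix y z assume yz: "y \<in> RS" "z \<in> RS"
  show "(\<Sum>n\<in>B. \<beta> n * complex_of_real (Ccoef s f L p n y)) - (\<Sum>n\<in>B. \<beta> n * complex_of_real (Ccoef s f L p n z)) = Df N \<beta>' y z"
   unfolding eq[OF yz(1)] eq[OF yz(2)] Df_def by (simp add: right_diff_distrib sum_subtractf)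
 qed
 ultimately show ?thesis using n0(2) by blast
qed

text \<open>\<open>low\<close> puts every non-negative a below the liminf into the set defining the
  exponent, and \<open>upp\<close> keeps every a above the liminf out of it. The margin t fits
  because there is room between a and the liminf.\<close>

lemma hoelder_exp_Liminf:
 fixes \<rho> :: "nat \<Rightarrow> real"
 assumes z: "z \<in> RS" and bdd: "\<And>y. y \<in> RS \<Longrightarrow> cmod (C y - C z) \<le> M"
  and low: "\<And>a t. a \<ge> 0 \<Longrightarrow> t > 0 \<Longrightarrow> \<forall>\<^sub>F k in sequentially. a + t < \<rho> k \<Longrightarrow> \<exists>K. \<forall>y\<in>RS. y \<noteq> z \<longrightarrow> cmod (C y - C z) \<le> K * dist y z powr a"
  and upp: "\<And>a t K d. a \<ge> 0 \<Longrightarrow> t > 0 \<Longrightarrow> \<exists>\<^sub>F k in sequentially. \<rho> k < a - t \<Longrightarrow> K > 0 \<Longrightarrow> d > 0 \<Longrightarrow>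
   \<exists>y\<in>RS. y \<noteq> z \<and> dist y z < d \<and> K * dist y z powr a < cmod (C y - C z)"
 shows "hoelder_exp C z = Liminf sequentially (\<lambda>k. ereal (\<rho> k))"
proof -
 let ?l = "Liminf sequentially (\<lambda>k. ereal (\<rho> k))"
 let ?q = "\<lambda>a y. ereal (cmod (C y - C z) / (sdist y z) powr a)"
 let ?S = "{ereal \<alpha> | \<alpha>. \<alpha> \<ge> 0 \<and> Limsup (at z within RS) (?q \<alpha>) < \<infinity>}"
 have in_S: "ereal a \<in> ?S" if a: "a \<ge> 0" and K: "\<forall>y\<in>RS. y \<noteq> z \<longrightarrow> cmod (C y - C z) \<le> K * dist y z powr a" for a K
 proof -
  have "\<forall>\<^sub>F y in at z within RS. ?q a y \<le> ereal \<bar>K\<bar>"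
   unfolding eventually_at
  proof (intro exI[of _ 1] conjI ballI impI)
   fix y assume y: "y \<in> RS" "y \<noteq> z \<and> dist y z < 1"
   have d: "dist y z > 0" "dist y z \<le> sdist y z" using y sdist_bounds(1)[OF y(1) z] by auto
   have "cmod (C y - C z) \<le> K * dist y z powr a" using K y by blast
   also have "\<dots> \<le> \<bar>K\<bar> * sdist y z powr a" using d a by (intro mult_mono powr_mono2) auto
   finally show "?q a y \<le> ereal \<bar>K\<bar>" using d by (simp add: divide_le_eq)
  qed simp
  then have "Limsup (at z within RS) (?q a) \<le> ereal \<bar>K\<bar>" by (rule Limsup_bounded)
  then have "Limsup (at z within RS) (?q a) < \<infinity>" using order_le_less_trans by fastforce
  then show ?thesis using a by blast
 qed
 \<comment> \<open>Boundedness puts 0 into the set, which bounds the supremum below when it is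
   compared with negative numbers.\<close>
 have zero: "ereal 0 \<in> ?S"
 proof (rule in_S[of 0 M])
  show "\<forall>y\<in>RS. y \<noteq> z \<longrightarrow> cmod (C y - C z) \<le> M * dist y z powr 0" using bdd by simp
 qed simp
 have "?l \<le> Sup ?S"
 proof (rule dense_le)
  fix x assume x: "x < ?l"
  show "x \<le> Sup ?S"
  proof (cases "x < 0")
   case True
   then have "x \<le> ereal 0" by (simp add: zero_ereal_def)
   then show ?thesis using Sup_upper[OF zero] order_trans by blast
  next
   case False
   obtain b where b: "x < ereal b" "ereal b < ?l" using ereal_dense2[OF x] by blast
   then obtain a where a: "x = ereal a" using False by (cases x) (auto simp: zero_ereal_def)
   have "a \<ge> 0" "b - a > 0" using False a b by (auto simp: zero_ereal_def)
   moreover have "\<forall>\<^sub>F k in sequentially. a + (b - a) < \<rho> k" using less_LiminfD[OF b(2)] by simp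
   ultimately obtain K where "\<forall>y\<in>RS. y \<noteq> z \<longrightarrow> cmod (C y - C z) \<le> K * dist y z powr a" using low by blast
   then have "ereal a \<in> ?S" using in_S \<open>a \<ge> 0\<close> by blast
   then show ?thesis unfolding a by (rule Sup_upper)
  qed
 qed
 moreover have "Sup ?S \<le> ?l"
 proof (rule Sup_least)
  fix x assume "x \<in> ?S"
  then obtain a where a: "x = ereal a" "a \<ge> 0" "Limsup (at z within RS) (?q a) < \<infinity>" by blast
  show "x \<le> ?l"
  proof (rule ccontr)
   assume "\<not> x \<le> ?l"
   then have "?l < ereal a" using a by simp
   then obtain b where b: "?l < ereal b" "ereal b < ereal a" using ereal_dense2 by blast
   have "\<exists>\<^sub>F k in sequentially. \<rho> k < a - (a - b)"
   proof (rule ccontr)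
    assume "\<not> ?thesis"
    then have "\<forall>\<^sub>F k in sequentially. ereal b \<le> ereal (\<rho> k)" by (simp add: not_frequently not_less)
    then have "ereal b \<le> ?l" by (rule Liminf_bounded)
    then show False using b(1) by simp
   qed
   obtain K where K: "Limsup (at z within RS) (?q a) < ereal K" using ereal_dense2[OF a(3)] by blast
   have "\<forall>\<^sub>F y in at z within RS. ?q a y < ereal K" using Limsup_lessD[OF K] .
   then obtain d where d: "d > 0" "\<And>y. y \<in> RS \<Longrightarrow> y \<noteq> z \<Longrightarrow> dist y z < d \<Longrightarrow> ?q a y < ereal K" unfolding eventually_at by blast
   \<comment> \<open>The factor 3 powr a pays for the passage from \<open>dist\<close> to
     \<open>sdist\<close>.\<close>
   have "(\<bar>K\<bar> + 1) * 3 powr a > 0" by (intro mult_pos_pos) auto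
   moreover have "a - b > 0" using b(2) by simp
   ultimately obtain y where y: "y \<in> RS" "y \<noteq> z" "dist y z < d" "(\<bar>K\<bar> + 1) * 3 powr a * dist y z powr a < cmod (C y - C z)"
    using upp[OF a(2) _ \<open>\<exists>\<^sub>F k in sequentially. \<rho> k < a - (a - b)\<close> _ d(1)] by blast
   have s: "dist y z > 0" "dist y z \<le> sdist y z" "sdist y z \<le> 3 * dist y z" using y sdist_bounds[OF y(1) z] by auto
   have "cmod (C y - C z) / (sdist y z) powr a < K" using d(2)[OF y(1,2,3)] by simp
   then have "cmod (C y - C z) < K * sdist y z powr a" using s by (simp add: pos_divide_less_eq)
   also have "\<dots> \<le> (\<bar>K\<bar> + 1) * (3 * dist y z) powr a" using s a(2) by (intro mult_mono powr_mono2) auto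
   also have "\<dots> = (\<bar>K\<bar> + 1) * 3 powr a * dist y z powr a" using s by (simp add: powr_mult)
   finally show False using y(4) by simp
  qed
 qed
 ultimately show ?thesis unfolding hoelder_exp_def by (rule antisym[rotated])
qed

lemma hoelder_exp_Ccoef:
 assumes B: "finite B" "\<forall>n\<in>B. \<forall>i. i \<notin> {1..s} \<longrightarrow> n i = 0" and nt: "\<exists>n\<in>B. \<beta> n \<noteq> 0" and wz: "(\<omega>, z) \<in> julia_skew s f"
 shows "hoelder_exp (\<lambda>y. \<Sum>n\<in>B. \<beta> n * complex_of_real (Ccoef s f L p n y)) z
  = Liminf sequentially (\<lambda>k. ereal (Spsi s p k \<omega> / Sphi f k \<omega> z))"
proof -
 have w: "\<forall>n. \<omega> n \<in> idx s" and z: "z \<in> RS" and orb: "\<And>k. fseq f \<omega> k z \<in> J" using julia_skew_orbit[OF wz] by auto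
 define C where "C y = (\<Sum>n\<in>B. \<beta> n * complex_of_real (Ccoef s f L p n y))" for y
 obtain N \<beta>' n0 where \<beta>': "supp N \<beta>'" "deg n0 = N" "\<beta>' n0 \<noteq> 0" and CD: "\<And>y. y \<in> RS \<Longrightarrow> C y - C z = Df N \<beta>' y z"
  using Ccoef_combination[OF B nt] z unfolding C_def by blast
 define l where "l k = wder (map \<omega> [0..<k]) z" for k
 define P where "P k = pw (map \<omega> [0..<k])" for k
 have wJ: "wcomp f (map \<omega> [0..<k]) z \<in> J" for k using orb[of k] by (simp add: fseq_def)
 obtain c \<Lambda> where g: "c > 0" "\<Lambda> > 1" "\<forall>w x. word w \<longrightarrow> x \<in> RS \<longrightarrow> wcomp f w x \<in> J \<longrightarrow> c * \<Lambda> ^ length w \<le> wder w x"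
  using wder_growth by blast
 have lg: "c * \<Lambda> ^ k \<le> l k" for k using g(3)[rule_format, OF set_map_idx[OF w] z wJ[of k]] by (simp add: l_def)
 have l0: "l k > 0" for k unfolding l_def by (rule wder_pos[OF set_map_idx[OF w] z wJ])
 have P0: "P k > 0" for k unfolding P_def by (rule pw_pos[OF set_map_idx[OF w]])
 \<comment> \<open>For small k the denominator ln (l k) may be negative or 0; at k = 0 the quotient
   is 0 / 0, which is 0. The comparisons below need l k > 1, which holds eventually and thus
   suffices for a liminf.\<close>
 have l1: "\<forall>\<^sub>F k in sequentially. l k > 1"
 proof -
  obtain m where m: "1 / c < \<Lambda> ^ m" using real_arch_pow[OF g(2)] by blast
  have "l k > 1" if "k \<ge> m" for k
  proof -
   have "\<Lambda> ^ m \<le> \<Lambda> ^ k" using g(2) that by (intro power_increasing) auto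
   then have "1 / c < \<Lambda> ^ k" using m by linarith
   then have "1 < c * \<Lambda> ^ k" using g(1) by (simp add: field_simps)
   then show ?thesis using lg[of k] by linarith
  qed
  then show ?thesis unfolding eventually_sequentially by blast
 qed
 define \<rho> where "\<rho> k = Spsi s p k \<omega> / Sphi f k \<omega> z" for k
 have \<rho>: "\<rho> k = - ln (P k) / ln (l k)" for k
  unfolding \<rho>_def Spsi_pw[OF w] Sphi_wder[OF w z orb] P_def l_def by simp
 have less: "b < \<rho> k \<longleftrightarrow> P k < l k powr (- b)" and gr: "\<rho> k < b \<longleftrightarrow> l k powr (- b) < P k" if "l k > 1" for k b
 proof -
  have "ln (l k) > 0" using that by simp
  moreover have "ln (l k powr (- b)) = - (b * ln (l k))" using that by (simp add: ln_powr)
  moreover have "P k < l k powr (- b) \<longleftrightarrow> ln (P k) < ln (l k powr (- b))" using P0[of k] that by (intro ln_less_cancel_iff[symmetric]) auto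
  moreover have "l k powr (- b) < P k \<longleftrightarrow> ln (l k powr (- b)) < ln (P k)" using P0[of k] that by (intro ln_less_cancel_iff[symmetric]) auto
  ultimately show "b < \<rho> k \<longleftrightarrow> P k < l k powr (- b)" "\<rho> k < b \<longleftrightarrow> l k powr (- b) < P k" unfolding \<rho> by (auto simp: field_simps)
 qed
 have "hoelder_exp C z = Liminf sequentially (\<lambda>k. ereal (\<rho> k))"
 proof (rule hoelder_exp_Liminf[OF z])
  fix y assume y: "y \<in> RS"
  show "cmod (C y - C z) \<le> (\<Sum>n\<in>Lam N. cmod (\<beta>' n) * (2 * (SOME b. \<forall>y\<in>RS. cmod (cf n y) \<le> b)))"
   unfolding CD[OF y] Df_def
  proof (rule sum_norm_le)
   fix n
   have b: "\<forall>y\<in>RS. cmod (cf n y) \<le> (SOME b. \<forall>y\<in>RS. cmod (cf n y) \<le> b)" using someI_ex[OF cf_bounded[of n]] .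
   have "cmod (cf n y - cf n z) \<le> 2 * (SOME b. \<forall>y\<in>RS. cmod (cf n y) \<le> b)"
    using norm_triangle_ineq4[of "cf n y" "cf n z"] bspec[OF b y] bspec[OF b z] by linarith
   then show "cmod (\<beta>' n * (cf n y - cf n z)) \<le> cmod (\<beta>' n) * (2 * (SOME b. \<forall>y\<in>RS. cmod (cf n y) \<le> b))"
    unfolding norm_mult by (intro mult_left_mono) auto
  qed
 next
  fix a t :: real assume at: "a \<ge> 0" "t > 0" and ev: "\<forall>\<^sub>F k in sequentially. a + t < \<rho> k"
  have "\<forall>\<^sub>F k in sequentially. P k < l k powr (- (a + t))" using ev l1 by eventually_elim (use less in blast)
  then obtain m where m: "\<And>k. k \<ge> m \<Longrightarrow> P k < l k powr (- (a + t))" unfolding eventually_sequentially by blast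
  \<comment> \<open>The summand 1 serves the times k \<ge> m, the sum serves the finitely many
    earlier ones.\<close>
  define K0 where "K0 = 1 + (\<Sum>k<m. P k / l k powr (- (a + t)))"
  have q0: "0 \<le> P k / l k powr (- (a + t))" for k using P0[of k] by simp
  have S0: "0 \<le> (\<Sum>k<m. P k / l k powr (- (a + t)))" by (intro sum_nonneg q0)
  have K0: "K0 > 0" unfolding K0_def using S0 by linarith
  have "P k \<le> K0 * l k powr (- (a + t))" for k
  proof -
   have "P k / l k powr (- (a + t)) \<le> K0"
   proof (cases "k < m")
    case True
    then have "P k / l k powr (- (a + t)) \<le> (\<Sum>k<m. P k / l k powr (- (a + t)))" using q0 by (intro member_le_sum) auto
    then show ?thesis by (simp add: K0_def)
   next
    case False
    then have "P k / l k powr (- (a + t)) \<le> 1" using m[of k] l0[of k] by (simp add: divide_le_eq)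
    then show ?thesis unfolding K0_def using S0 by linarith
   qed
   then show ?thesis using l0[of k] by (simp add: divide_le_eq)
  qed
  then obtain K where "\<forall>y\<in>RS. y \<noteq> z \<longrightarrow> cmod (Df N \<beta>' y z) \<le> K * dist y z powr a"
   using hoelder_lower[OF w z orb at K0, of N \<beta>'] unfolding l_def P_def by blast
  then show "\<exists>K. \<forall>y\<in>RS. y \<noteq> z \<longrightarrow> cmod (C y - C z) \<le> K * dist y z powr a" using CD by auto
 next
  fix a t K d :: real assume at: "a \<ge> 0" "t > 0" and fr: "\<exists>\<^sub>F k in sequentially. \<rho> k < a - t" and K: "K > 0" "d > 0"
  have "\<exists>\<^sub>F k in sequentially. l k powr (- (a - t)) < P k"
   using frequently_eventually_frequently[OF fr l1] by (rule frequently_elim1) (use gr in blast)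
  then obtain y where "y \<in> RS" "y \<noteq> z" "dist y z < d" "K * dist y z powr a < cmod (Df N \<beta>' y z)"
   using hoelder_upper[OF w z orb at _ \<beta>' K] unfolding l_def P_def by blast
  then show "\<exists>y\<in>RS. y \<noteq> z \<and> dist y z < d \<and> K * dist y z powr a < cmod (C y - C z)" using CD by auto
 qed
 then show ?thesis unfolding C_def \<rho>_def .
qed

end

theorem theorem1p1:
  fixes s :: nat
    and P Q :: "nat \<Rightarrow> complex poly"
    and f :: "nat \<Rightarrow> (complex \<times> real \<Rightarrow> complex \<times> real)"
    and L :: "(complex \<times> real) set"
    and p :: "nat \<Rightarrow> real"
    and B :: "(nat \<Rightarrow> nat) set"
    and \<beta> :: "(nat \<Rightarrow> nat) \<Rightarrow> complex"
    and \<omega> :: "nat \<Rightarrow> nat"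
    and z :: "complex \<times> real"
  assumes s: "s \<ge> 1"
    and rat: "\<forall>i\<in>idx s. rat_pair (P i) (Q i) \<and> rat_deg (P i) (Q i) \<ge> 2 \<and> f i = rat_sph (P i) (Q i)"
    and A1: "postcrit s f \<subseteq> fatou (semigrp s f)"
    and A2: "\<forall>i\<in>idx s. \<forall>j\<in>idx s. i \<noteq> j \<longrightarrow>
               {u \<in> RS. f i u \<in> julia (semigrp s f)} \<inter> {u \<in> RS. f j u \<in> julia (semigrp s f)} = {}"
    and A3: "\<exists>K1 K2. minimal_set s f K1 \<and> minimal_set s f K2 \<and> K1 \<noteq> K2"
    and L: "minimal_set s f L"
    and p: "\<forall>i\<in>{1..s}. 0 < p i \<and> p i < 1" "(\<Sum>i=1..s. p i) < 1"
    and B: "finite B" "\<forall>n\<in>B. \<forall>i. i \<notin> {1..s} \<longrightarrow> n i = 0"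
    and nontriv: "\<exists>n\<in>B. \<beta> n \<noteq> 0"
    and J: "(\<omega>, z) \<in> julia_skew s f"
  shows "hoelder_exp (\<lambda>y. \<Sum>n\<in>B. \<beta> n * complex_of_real (Ccoef s f L p n y)) z
         = Liminf sequentially (\<lambda>k. ereal (Spsi s p k \<omega> / Sphi f k \<omega> z))"
proof -
 obtain L' where L': "minimal_set s f L'" "L' \<noteq> L" using A3 by metis
 interpret R: rational_system s f
 proof
  show "\<exists>p q. rat_pair p q \<and> rat_deg p q \<ge> 2 \<and> f i = rat_sph p q" if "i \<in> idx s" for i using rat that by blast
 qed (rule s)
 have "fseq f \<omega> 0 z \<in> julia (semigrp s f)" using R.julia_skew_orbit(3)[OF J] .
 then have ne: "julia (semigrp s f) \<noteq> {}" by blast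
 interpret hyperbolic_minimal s f L L' p
 proof
  fix i j x assume "i \<in> idx s" "j \<in> idx s" "x \<in> RS" "f i x \<in> julia (semigrp s f)" "f j x \<in> julia (semigrp s f)"
  then show "i = j" using A2 by blast
 qed (use A1 ne L L' p in auto)
 show ?thesis by (rule hoelder_exp_Ccoef[OF B nontriv J])
qed

end
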